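(* Let $n\ge2$, let $\theta$ be a limit ordinal with $0<\theta<\omega^\omega$, and let $\alpha$ be a nonzero limit ordinal. Then $\mathfrak T_\alpha^n$ is elementarily equivalent to $\mathfrak T_{\omega^\omega+\theta}^n$ if and only if $\alpha=\alpha_0+\theta$ for some ordinal $\alpha_0$ with $\alpha_0\equiv\omega^\omega$ and $\operatorname{cf}(\alpha_0)=\omega$.
   Context: For a nonzero limit ordinal $\alpha$, $\mathfrak T_\alpha^n=(n^{<\alpha},\subseteq,S_0,\dots,S_{n-1})$, where $n^{<\alpha}$ is the set of all functions $s:\beta\to n=\{0,\dots,n-1\}$ with $\beta<\alpha$, $\subseteq$ is the initial-segment (inclusion) order, and $S_i(s)$ is $s$ extended by one further entry $i$. For an ordinal $\alpha_0$, $\alpha_0\equiv\omega^\omega$ means that $(\alpha_0,<)$ and $(\omega^\omega,<)$ are elementarily equivalent as linear orders. $\operatorname{cf}$ denotes cofinality. *)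

theory Defs
  imports Main "HOL-Library.FuncSet" "HOL-Library.Multiset_Order"
begin

unbundle cardinal_syntax

datatype fo_term = TVar nat | TFun nat fo_term

datatype fo_form =
    FEq fo_term fo_term
  | FRel fo_term fo_term
  | FNeg fo_form
  | FConj fo_form fo_form
  | FEx nat fo_form

primrec term_vars :: "fo_term \<Rightarrow> nat set" where
  "term_vars (TVar x) = {x}"
| "term_vars (TFun i t) = term_vars t"

primrec term_funs :: "fo_term \<Rightarrow> nat set" where
  "term_funs (TVar x) = {}"
| "term_funs (TFun i t) = insert i (term_funs t)"

primrec free_vars :: "fo_form \<Rightarrow> nat set" where
  "free_vars (FEq t u) = term_vars t \<union> term_vars u"
| "free_vars (FRel t u) = term_vars t \<union> term_vars u"
| "free_vars (FNeg \<phi>) = free_vars \<phi>"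
| "free_vars (FConj \<phi> \<psi>) = free_vars \<phi> \<union> free_vars \<psi>"
| "free_vars (FEx x \<phi>) = free_vars \<phi> - {x}"

primrec form_funs :: "fo_form \<Rightarrow> nat set" where
  "form_funs (FEq t u) = term_funs t \<union> term_funs u"
| "form_funs (FRel t u) = term_funs t \<union> term_funs u"
| "form_funs (FNeg \<phi>) = form_funs \<phi>"
| "form_funs (FConj \<phi> \<psi>) = form_funs \<phi> \<union> form_funs \<psi>"
| "form_funs (FEx x \<phi>) = form_funs \<phi>"

text \<open>The language of signature \<open>n\<close> has the binary relation symbol and the function symbols
  \<open>0, \<dots>, n - 1\<close>; signature \<open>0\<close> is the language of linear orders.\<close>

definition fo_sentence :: "nat \<Rightarrow> fo_form \<Rightarrow> bool" where
  "fo_sentence n \<phi> \<longleftrightarrow> free_vars \<phi> = {} \<and> form_funs \<phi> \<subseteq> {..<n}"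

record 'a fo_struct =
  univ :: "'a set"
  brel :: "'a \<Rightarrow> 'a \<Rightarrow> bool"
  ufun :: "nat \<Rightarrow> 'a \<Rightarrow> 'a"

primrec term_val :: "'a fo_struct \<Rightarrow> (nat \<Rightarrow> 'a) \<Rightarrow> fo_term \<Rightarrow> 'a" where
  "term_val M e (TVar x) = e x"
| "term_val M e (TFun i t) = ufun M i (term_val M e t)"

primrec sat :: "'a fo_struct \<Rightarrow> (nat \<Rightarrow> 'a) \<Rightarrow> fo_form \<Rightarrow> bool" where
  "sat M e (FEq t u) \<longleftrightarrow> term_val M e t = term_val M e u"
| "sat M e (FRel t u) \<longleftrightarrow> brel M (term_val M e t) (term_val M e u)"
| "sat M e (FNeg \<phi>) \<longleftrightarrow> \<not> sat M e \<phi>"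
| "sat M e (FConj \<phi> \<psi>) \<longleftrightarrow> sat M e \<phi> \<and> sat M e \<psi>"
| "sat M e (FEx x \<phi>) \<longleftrightarrow> (\<exists>a\<in>univ M. sat M (e(x := a)) \<phi>)"

text \<open>Only sentences are evaluated below, and their truth value does not depend on the
  assignment; so assignments need not be restricted to the universe.\<close>

definition models :: "'a fo_struct \<Rightarrow> fo_form \<Rightarrow> bool" where
  "models M \<phi> \<longleftrightarrow> (\<forall>e. sat M e \<phi>)"

lemma term_val_cong:
  "(\<And>x. x \<in> term_vars t \<Longrightarrow> e x = e' x) \<Longrightarrow> term_val M e t = term_val M e' t"
  by (induction t) auto

lemma sat_cong:
  "\<forall>x\<in>free_vars \<phi>. e x = e' x \<Longrightarrow> sat M e \<phi> \<longleftrightarrow> sat M e' \<phi>"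
proof (induction \<phi> arbitrary: e e')
  case (FEq t u)
  have "term_val M e t = term_val M e' t" "term_val M e u = term_val M e' u"
    by (rule term_val_cong, use FEq in simp)+
  then show ?case by simp
next
  case (FRel t u)
  have "term_val M e t = term_val M e' t" "term_val M e u = term_val M e' u"
    by (rule term_val_cong, use FRel in simp)+
  then show ?case by simp
next
  case (FNeg \<phi>)
  have "sat M e \<phi> \<longleftrightarrow> sat M e' \<phi>"
    by (rule FNeg.IH) (use FNeg.prems in simp)
  then show ?case by simp
next
  case (FConj \<phi> \<psi>)
  have "sat M e \<phi> \<longleftrightarrow> sat M e' \<phi>"
    by (rule FConj.IH(1)) (use FConj.prems in simp)
  moreover have "sat M e \<psi> \<longleftrightarrow> sat M e' \<psi>"
    by (rule FConj.IH(2)) (use FConj.prems in simp)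
  ultimately show ?case by simp
next
  case (FEx x \<phi>)
  have "sat M (e(x := a)) \<phi> \<longleftrightarrow> sat M (e'(x := a)) \<phi>" for a
    by (rule FEx.IH) (use FEx.prems in simp)
  then show ?case by simp
qed

lemma models_sentence: "fo_sentence n \<phi> \<Longrightarrow> models M \<phi> \<longleftrightarrow> sat M e \<phi>"
  unfolding models_def fo_sentence_def using sat_cong[of \<phi>] by (metis empty_iff)

definition elem_equiv :: "nat \<Rightarrow> 'a fo_struct \<Rightarrow> 'b fo_struct \<Rightarrow> bool" where
  "elem_equiv n M N \<longleftrightarrow> (\<forall>\<phi>. fo_sentence n \<phi> \<longrightarrow> (models M \<phi> \<longleftrightarrow> models N \<phi>))"

text \<open>An ordinal is given by a reflexive well-order on its field, up to isomorphism \<open>=o\<close>;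
  \<open><o\<close> compares ordinals, and \<open>natLeq\<close> represents \<open>\<omega>\<close>.\<close>

definition nonzero_limit :: "'a rel \<Rightarrow> bool" where
  "nonzero_limit r \<longleftrightarrow>
     Well_order r \<and> Field r \<noteq> {} \<and> (\<forall>a\<in>Field r. \<exists>b\<in>Field r. a \<noteq> b \<and> (a, b) \<in> r)"

definition ord_sum :: "'a rel \<Rightarrow> 'b rel \<Rightarrow> ('a + 'b) rel" (infixl \<open>+ord\<close> 65) where
  "r +ord s =
     {(Inl a, Inl a') | a a'. (a, a') \<in> r} \<union>
     {(Inl a, Inr b) | a b. a \<in> Field r \<and> b \<in> Field s} \<union>
     {(Inr b, Inr b') | b b'. (b, b') \<in> s}"

text \<open>Ordinal exponentiation: functions from the exponent to the base that are nonzero (not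
  least in the base) at finitely many places, compared at the largest place where they differ.\<close>

definition ord_pow :: "'a rel \<Rightarrow> 'b rel \<Rightarrow> ('b \<Rightarrow> 'a) rel" (infixr \<open>^ord\<close> 80) where
  "r ^ord s =
     (let F = {f \<in> Field s \<rightarrow>\<^sub>E Field r. finite {x \<in> Field s. underS r (f x) \<noteq> {}}}
      in {(f, g). f \<in> F \<and> g \<in> F \<and>
            (f = g \<or> (\<exists>z\<in>Field s. f z \<noteq> g z \<and> (f z, g z) \<in> r \<and>
                        (\<forall>x\<in>Field s. (z, x) \<in> s \<and> z \<noteq> x \<longrightarrow> f x = g x)))})"

definition omega_omega :: "(nat \<Rightarrow> nat) rel" where
  "omega_omega = natLeq ^ord natLeq"

text \<open>\<open>has_cofinality r s\<close>: the least order type of a cofinal subset of \<open>r\<close> is \<open>s\<close>. The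
  library's \<^const>\<open>cofinal\<close> requires strict bounds, which is not suitable for successor ordinals.\<close>

definition cofinal_subset :: "'a rel \<Rightarrow> 'a set \<Rightarrow> bool" where
  "cofinal_subset r K \<longleftrightarrow> K \<subseteq> Field r \<and> (\<forall>a\<in>Field r. \<exists>b\<in>K. (a, b) \<in> r)"

definition has_cofinality :: "'a rel \<Rightarrow> 'b rel \<Rightarrow> bool" where
  "has_cofinality r s \<longleftrightarrow>
     (\<exists>K. cofinal_subset r K \<and> Restr r K =o s) \<and>
     (\<forall>K. cofinal_subset r K \<longrightarrow> s \<le>o Restr r K)"

definition order_struct :: "'a rel \<Rightarrow> 'a fo_struct" where
  "order_struct r =
     \<lparr> univ = Field r, brel = (\<lambda>a b. (a, b) \<in> r \<and> a \<noteq> b), ufun = (\<lambda>_ a. a) \<rparr>"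

text \<open>An ordinal \<open>\<beta> < \<alpha>\<close> is the set of predecessors \<^term>\<open>underS r b\<close> of an element \<open>b\<close> of a
  well-order \<open>r\<close> of type \<open>\<alpha>\<close>, so a function \<open>\<beta> \<rightarrow> n\<close> is a partial map with this domain.\<close>

definition tree_nodes :: "nat \<Rightarrow> 'a rel \<Rightarrow> ('a \<rightharpoonup> nat) set" where
  "tree_nodes n r = {s. (\<exists>b\<in>Field r. dom s = underS r b) \<and> ran s \<subseteq> {..<n}}"

definition tree_succ :: "'a rel \<Rightarrow> nat \<Rightarrow> ('a \<rightharpoonup> nat) \<Rightarrow> ('a \<rightharpoonup> nat)" where
  "tree_succ r i s = s((THE b. b \<in> Field r \<and> dom s = underS r b) \<mapsto> i)"

definition tree_struct :: "nat \<Rightarrow> 'a rel \<Rightarrow> ('a \<rightharpoonup> nat) fo_struct" where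
  "tree_struct n r = \<lparr> univ = tree_nodes n r, brel = (\<subseteq>\<^sub>m), ufun = tree_succ r \<rparr>"

lemma ord_sum_iff [simp]:
  "(Inl a, Inl a') \<in> r +ord s \<longleftrightarrow> (a, a') \<in> r"
  "(Inl a, Inr b) \<in> r +ord s \<longleftrightarrow> a \<in> Field r \<and> b \<in> Field s"
  "(Inr b, Inl a) \<in> r +ord s \<longleftrightarrow> False"
  "(Inr b, Inr b') \<in> r +ord s \<longleftrightarrow> (b, b') \<in> s"
  by (auto simp: ord_sum_def)

lemma Field_ord_sum:
  fixes r :: "'c rel" and s :: "'d rel"
  shows "Field (r +ord s) = Inl ` Field r \<union> Inr ` Field s"
proof
  show "Field (r +ord s) \<subseteq> Inl ` Field r \<union> Inr ` Field s"
    by (auto simp: ord_sum_def Field_def)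
  have "Inl a \<in> Field (r +ord s)" if "(a, a') \<in> r \<or> (a', a) \<in> r" for a a'
    using that ord_sum_iff(1) by (metis FieldI1 FieldI2)
  moreover have "Inr b \<in> Field (r +ord s)" if "(b, b') \<in> s \<or> (b', b) \<in> s" for b b'
    using that ord_sum_iff(4) by (metis FieldI1 FieldI2)
  moreover have "x \<in> Field t \<Longrightarrow> \<exists>y. (x, y) \<in> t \<or> (y, x) \<in> t" for x :: 'c and t
    by (auto simp: Field_def)
  moreover have "x \<in> Field t \<Longrightarrow> \<exists>y. (x, y) \<in> t \<or> (y, x) \<in> t" for x :: 'd and t
    by (auto simp: Field_def)
  ultimately show "Inl ` Field r \<union> Inr ` Field s \<subseteq> Field (r +ord s)"
    by blast
qed

lemma Well_orderD:
  assumes "Well_order r"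
  shows "wf (r - Id)" "\<And>a b c. (a, b) \<in> r \<Longrightarrow> (b, c) \<in> r \<Longrightarrow> (a, c) \<in> r"
    "\<And>a b. (a, b) \<in> r \<Longrightarrow> (b, a) \<in> r \<Longrightarrow> a = b"
    "\<And>a. a \<in> Field r \<Longrightarrow> (a, a) \<in> r"
    "\<And>a b. a \<in> Field r \<Longrightarrow> b \<in> Field r \<Longrightarrow> (a, b) \<in> r \<or> (b, a) \<in> r"
proof -
  show "wf (r - Id)" using assms by (simp add: well_order_on_def)
  show "(a, c) \<in> r" if "(a, b) \<in> r" "(b, c) \<in> r" for a b c
    using assms that by (meson well_order_on_def linear_order_on_def partial_order_on_def
        preorder_on_def transD)
  show "a = b" if "(a, b) \<in> r" "(b, a) \<in> r" for a b
    using assms that by (meson well_order_on_def linear_order_on_def partial_order_on_def antisymD)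
  show R: "(a, a) \<in> r" if "a \<in> Field r" for a
    using assms that by (meson well_order_on_def linear_order_on_def partial_order_on_def
        preorder_on_def refl_onD)
  show "(a, b) \<in> r \<or> (b, a) \<in> r" if "a \<in> Field r" "b \<in> Field r" for a b
    using assms that R by (metis well_order_on_def linear_order_on_def total_on_def)
qed

lemma Well_orderI:
  assumes "wf (r - Id)" "trans r" "antisym r" "\<And>a. a \<in> Field r \<Longrightarrow> (a, a) \<in> r"
    "\<And>a b. a \<in> Field r \<Longrightarrow> b \<in> Field r \<Longrightarrow> (a, b) \<in> r \<or> (b, a) \<in> r"
  shows "Well_order r"
proof -
  have "refl_on (Field r) r" using assms(4) by (rule refl_onI)
  moreover have "total_on (Field r) r" using assms(5) by (simp add: total_on_def)
  moreover have "r \<subseteq> Field r \<times> Field r" by (auto simp: Field_def)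
  ultimately show ?thesis
    using assms(1-3)
    by (simp add: well_order_on_def linear_order_on_def partial_order_on_def preorder_on_def)
qed

lemma Well_order_ord_sum:
  assumes r: "Well_order r" and s: "Well_order s"
  shows "Well_order (r +ord s)"
proof (rule Well_orderI)
  show "wf (r +ord s - Id)"
  proof (rule wfI_min)
    fix x Q assume x: "x \<in> (Q :: ('a + 'b) set)"
    show "\<exists>z\<in>Q. \<forall>y. (y, z) \<in> r +ord s - Id \<longrightarrow> y \<notin> Q"
    proof (cases "\<exists>a. Inl a \<in> Q")
      case True
      then obtain a where "a \<in> {a. Inl a \<in> Q}" by blast
      then obtain z where "z \<in> {a. Inl a \<in> Q}"
          "\<And>y. (y, z) \<in> r - Id \<Longrightarrow> y \<notin> {a. Inl a \<in> Q}"
        by (rule wfE_min[OF Well_orderD(1)[OF r]]) blast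
      then have z: "Inl z \<in> Q" "\<And>y. (y, z) \<in> r - Id \<Longrightarrow> Inl y \<notin> Q" by simp_all
      have "y \<notin> Q" if "(y, Inl z) \<in> r +ord s - Id" for y
        using that z by (cases y) auto
      then show ?thesis using z(1) by blast
    next
      case False
      with x obtain b where "b \<in> {b. Inr b \<in> Q}" by (cases x) auto
      then obtain z where "z \<in> {a. Inr a \<in> Q}"
          "\<And>y. (y, z) \<in> s - Id \<Longrightarrow> y \<notin> {a. Inr a \<in> Q}"
        by (rule wfE_min[OF Well_orderD(1)[OF s]]) blast
      then have z: "Inr z \<in> Q" "\<And>y. (y, z) \<in> s - Id \<Longrightarrow> Inr y \<notin> Q" by simp_all
      have "y \<notin> Q" if "(y, Inr z) \<in> r +ord s - Id" for y
        using that z False by (cases y) auto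
      then show ?thesis using z(1) by blast
    qed
  qed
  show "trans (r +ord s)"
  proof (rule transI)
    fix x y z assume "(x, y) \<in> r +ord s" "(y, z) \<in> r +ord s"
    then show "(x, z) \<in> r +ord s"
      by (cases x; cases y; cases z; simp;
          metis FieldI1 FieldI2 Well_orderD(2)[OF r] Well_orderD(2)[OF s])
  qed
  show "antisym (r +ord s)"
  proof (rule antisymI)
    fix x y assume "(x, y) \<in> r +ord s" "(y, x) \<in> r +ord s"
    then show "x = y"
      by (cases x; cases y; simp; metis Well_orderD(3)[OF r] Well_orderD(3)[OF s])
  qed
  show "(x, x) \<in> r +ord s" if "x \<in> Field (r +ord s)" for x
    using that Well_orderD(4)[OF r] Well_orderD(4)[OF s] unfolding Field_ord_sum by auto
  show "(x, y) \<in> r +ord s \<or> (y, x) \<in> r +ord s"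
    if "x \<in> Field (r +ord s)" "y \<in> Field (r +ord s)" for x y
  proof (cases x; cases y)
    fix a b assume "x = Inl a" "y = Inl b"
    then show ?thesis using that Well_orderD(5)[OF r, of a b] by (auto simp: Field_ord_sum)
  next
    fix a b assume "x = Inr a" "y = Inr b"
    then show ?thesis using that Well_orderD(5)[OF s, of a b] by (auto simp: Field_ord_sum)
  qed (use that in \<open>auto simp: Field_ord_sum\<close>)
qed

text \<open>A finitely supported \<open>f\<close> stands for \<open>\<Sum>k. \<omega>\<^sup>k \<cdot> f k\<close>, summed from the largest \<open>k\<close> down.\<close>

lemma omega_omega_iff:
  "(f, g) \<in> omega_omega \<longleftrightarrow> finite {k. f k \<noteq> 0} \<and> finite {k. g k \<noteq> 0} \<and>
     (f = g \<or> (\<exists>z. f z < g z \<and> (\<forall>x>z. f x = g x)))"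
proof -
  have le: "(m, k) \<in> natLeq \<longleftrightarrow> m \<le> k" for m k by (simp add: natLeq_def)
  have "underS natLeq m = {..<m}" for m
    by (auto simp: underS_def le)
  then have u: "(underS natLeq m \<noteq> {}) \<longleftrightarrow> m \<noteq> 0" for m by (auto simp: lessThan_empty_iff)
  have z: "(f z \<noteq> g z \<and> f z \<le> g z \<and> (\<forall>x. z \<le> x \<and> z \<noteq> x \<longrightarrow> f x = g x)) \<longleftrightarrow>
      (f z < g z \<and> (\<forall>x>z. f x = g x))" for z
    by (metis less_le)
  have "(f, g) \<in> omega_omega \<longleftrightarrow> finite {k. f k \<noteq> 0} \<and> finite {k. g k \<noteq> 0} \<and>
     (f = g \<or> (\<exists>z. f z \<noteq> g z \<and> f z \<le> g z \<and> (\<forall>x. z \<le> x \<and> z \<noteq> x \<longrightarrow> f x = g x)))"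
    unfolding omega_omega_def ord_pow_def Let_def Field_natLeq u le
    by (simp add: PiE_UNIV_domain)
  then show ?thesis unfolding z .
qed

lemma omega_omega_multiset:
  "omega_omega =
     {(f, g). finite {k. f k \<noteq> 0} \<and> finite {k. g k \<noteq> 0} \<and> Abs_multiset f \<le> Abs_multiset g}"
proof -
  have "(f, g) \<in> omega_omega \<longleftrightarrow> Abs_multiset f \<le> Abs_multiset g"
    if fin: "finite {k. f k \<noteq> 0}" "finite {k. g k \<noteq> 0}" for f g :: "nat \<Rightarrow> nat"
  proof -
    have c [simp]: "count (Abs_multiset f) = f" "count (Abs_multiset g) = g"
      using fin by (simp_all add: count_Abs_multiset)
    have "Abs_multiset f < Abs_multiset g \<longleftrightarrow> (\<exists>z. f z < g z \<and> (\<forall>x>z. f x = g x))"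
    proof
      assume L: "Abs_multiset f < Abs_multiset g"
      define D where "D = {x. f x \<noteq> g x}"
      have "D \<subseteq> {k. f k \<noteq> 0} \<union> {k. g k \<noteq> 0}" by (auto simp: D_def)
      then have D: "finite D" using fin finite_subset by blast
      have "f \<noteq> g" using L by blast
      then have "D \<noteq> {}" by (auto simp: D_def)
      with D have M: "Max D \<in> D" by (rule Max_in)
      have gt: "f x = g x" if "x > Max D" for x
        using Max_ge[OF D, of x] that unfolding D_def mem_Collect_eq by linarith
      have "\<forall>y. g y < f y \<longrightarrow> (\<exists>x>y. f x < g x)"
        using L unfolding less_multiset\<^sub>H\<^sub>O c by blast
      then have "\<not> g (Max D) < f (Max D)" using gt by (metis less_irrefl)
      moreover have "f (Max D) \<noteq> g (Max D)" using M by (simp add: D_def)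
      ultimately have "f (Max D) < g (Max D)" by linarith
      then show "\<exists>z. f z < g z \<and> (\<forall>x>z. f x = g x)"
        using gt by blast
    next
      assume "\<exists>z. f z < g z \<and> (\<forall>x>z. f x = g x)"
      then obtain z where z: "f z < g z" "\<And>x. x > z \<Longrightarrow> f x = g x" by blast
      have "\<exists>x>y. f x < g x" if "g y < f y" for y
        using z that by (metis less_irrefl less_asym linorder_neqE_nat)
      moreover have "Abs_multiset f \<noteq> Abs_multiset g" using z(1) c by (metis less_irrefl)
      ultimately show "Abs_multiset f < Abs_multiset g"
        unfolding less_multiset\<^sub>H\<^sub>O c by blast
    qed
    moreover have "Abs_multiset f = Abs_multiset g \<longleftrightarrow> f = g" using c by metis
    ultimately show ?thesis using fin unfolding omega_omega_iff le_less by blast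
  qed
  then have "(f, g) \<in> omega_omega \<longleftrightarrow> finite {k. f k \<noteq> 0} \<and> finite {k. g k \<noteq> 0} \<and>
      Abs_multiset f \<le> Abs_multiset g" for f g
    using omega_omega_iff[of f g] by blast
  then show ?thesis by auto
qed

lemma Field_omega_omega: "Field omega_omega = {f. finite {k. f k \<noteq> 0}}"
proof -
  have "(f, f) \<in> omega_omega" if "finite {k. f k \<noteq> 0}" for f
    using that by (simp add: omega_omega_iff)
  moreover have "finite {k. f k \<noteq> 0} \<and> finite {k. g k \<noteq> 0}" if "(f, g) \<in> omega_omega" for f g
    using that unfolding omega_omega_iff by blast
  ultimately show ?thesis unfolding Field_def by blast
qed

lemma Well_order_omega_omega: "Well_order omega_omega"
proof (rule Well_orderI)
  have inj: "f = g" if "Abs_multiset f = Abs_multiset g" "finite {k. f k \<noteq> 0}"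
      "finite {k. g k \<noteq> 0}" for f g :: "nat \<Rightarrow> nat"
  proof -
    have "count (Abs_multiset f) = f" "count (Abs_multiset g) = g"
      using that(2,3) by (simp_all add: count_Abs_multiset)
    with that(1) show ?thesis by metis
  qed
  have iff: "(f, g) \<in> omega_omega \<longleftrightarrow> finite {k. f k \<noteq> 0} \<and> finite {k. g k \<noteq> 0} \<and>
      Abs_multiset f \<le> Abs_multiset g" for f g
    by (subst omega_omega_multiset) simp
  have "(f, g) \<in> inv_image {(M, N). M < N} Abs_multiset" if "(f, g) \<in> omega_omega - Id" for f g
  proof -
    have "f \<noteq> g" "(f, g) \<in> omega_omega" using that by blast+
    then have "Abs_multiset f < Abs_multiset g" using inj iff by (metis le_less)
    then show ?thesis by (simp add: in_inv_image)
  qed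
  then have "omega_omega - Id \<subseteq> inv_image {(M, N). M < N} Abs_multiset"
    by (rule subrelI)
  then show "wf (omega_omega - Id)"
    by (rule wf_subset[OF wf_inv_image[OF wf]])
  show "trans omega_omega"
    by (rule transI, unfold iff) (metis order_trans)
  show "antisym omega_omega"
    by (rule antisymI, unfold iff) (metis inj order_antisym)
  show "(f, f) \<in> omega_omega" if "f \<in> Field omega_omega" for f
    using that by (simp add: omega_omega_iff Field_omega_omega)
  show "(f, g) \<in> omega_omega \<or> (g, f) \<in> omega_omega"
    if "f \<in> Field omega_omega" "g \<in> Field omega_omega" for f g
    using that linear[of "Abs_multiset f" "Abs_multiset g"]
    unfolding iff Field_omega_omega by blast
qed

lemma underS_inj:
  assumes "Well_order r" "a \<in> Field r" "b \<in> Field r" "underS r a = underS r b"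
  shows "a = b"
  using Well_orderD(5)[OF assms(1-3)] assms(4) unfolding underS_def by blast

lemma tree_succ_eq:
  assumes "Well_order r" "b \<in> Field r" "dom s = underS r b"
  shows "tree_succ r i s = s(b \<mapsto> i)"
proof -
  have "(THE c. c \<in> Field r \<and> dom s = underS r c) = b"
    using assms underS_inj[OF assms(1)] by (intro the_equality) auto
  then show ?thesis by (simp add: tree_succ_def)
qed

lemma tree_succ_in_nodes:
  assumes r: "nonzero_limit r" and s: "s \<in> tree_nodes n r" and i: "i < n"
  shows "tree_succ r i s \<in> tree_nodes n r"
proof -
  have W: "Well_order r" using r by (simp add: nonzero_limit_def)
  note rs = Well_orderD[OF W]
  obtain b where b: "b \<in> Field r" "dom s = underS r b" using s by (auto simp: tree_nodes_def)
  define A where "A = {c \<in> Field r. b \<noteq> c \<and> (b, c) \<in> r}"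
  obtain c0 where "c0 \<in> A" using r b(1) by (auto simp: nonzero_limit_def A_def)
  then obtain c where c: "c \<in> A" "\<And>y. (y, c) \<in> r - Id \<Longrightarrow> y \<notin> A"
    by (rule wfE_min[OF rs(1)]) blast
  have F: "\<And>x y. (x, y) \<in> r \<Longrightarrow> x \<in> Field r" by (auto simp: Field_def)
  have "insert b (underS r b) \<subseteq> underS r c"
    using c(1) rs(2,3) by (auto simp: A_def underS_def)
  moreover have "underS r c \<subseteq> insert b (underS r b)"
  proof
    fix x assume "x \<in> underS r c"
    then have x: "(x, c) \<in> r - Id" by (auto simp: underS_def)
    then have "x \<in> Field r" "x \<notin> A" using F c(2) by blast+
    then show "x \<in> insert b (underS r b)"
      using rs(4,5) b(1) by (auto simp: A_def underS_def)
  qed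
  ultimately have "insert b (dom s) = underS r c" using b by blast
  moreover have "ran (s(b \<mapsto> i)) \<subseteq> {..<n}"
    using s i by (auto simp: tree_nodes_def ran_def split: if_splits)
  ultimately show ?thesis
    using c(1) by (auto simp: tree_succ_eq[OF W b] tree_nodes_def A_def)
qed

end

theory Submission
  imports Defs "HOL-Library.Ramsey" "HOL-Library.Nat_Bijection"
begin

text \<open>Write \<open>x + \<omega>\<^sup>k\<close> for the point that lies \<open>\<omega>\<^sup>k\<close> above \<open>x\<close>. The relation \<open>climb k R A x y\<close> expresses
\<open>y = x + \<omega>\<^sup>k\<close> inside \<open>A\<close> and is first-order in the order. In \<open>\<omega>\<^sup>\<omega>\<close> it is total for every \<open>k\<close>, hence it
is total in every \<open>\<alpha>\<^sub>0 \<equiv> \<omega>\<^sup>\<omega>\<close>; this totality and the countable cofinality are the properties of the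
front part \<open>\<alpha>\<^sub>0\<close> of \<open>\<alpha>\<^sub>0 + \<theta>\<close> from which the equivalence of the trees is derived.

From right to left, the proof is an Ehrenfeucht game on the two trees. A finite family of nodes is recorded
by words: the word of the node \<open>x\<^sub>i\<close> has as positions the ordinals up to the length of \<open>x\<^sub>i\<close>, and the colour of
a position \<open>c\<close> consists of the letter of \<open>x\<^sub>i\<close> at \<open>c\<close>, of the set of all \<open>j\<close> for which \<open>x\<^sub>j\<close> agrees with
\<open>x\<^sub>i\<close> up to \<open>c\<close>, and of the place of \<open>c\<close> inside \<open>\<theta>\<close>, if it is there. Two families are in a good position
if corresponding words are \<open>m\<close>-equivalent (\<open>position\<close>). A new node leaves the family at a point \<open>u\<close> of some
\<open>x\<^sub>i\<close>; a reply \<open>u'\<close> to \<open>u\<close> exists in the word of the partner of \<open>x\<^sub>i\<close>, and what remains is to copy the rest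
of the new node, a word on an interval that begins at \<open>u\<close>, to an interval that begins at \<open>u'\<close>
(\<open>stretch_exists\<close>). Inside \<open>\<theta>\<close> this is a literal copy. In the front part, either the interval ends there
or it contains a whole tail of the front part. So two facts are needed: every word on a well-order is
\<open>m\<close>-equivalent to a word on some interval beginning at a given point (\<open>short_real\<close>), and every word on a tail
of one front part is \<open>m\<close>-equivalent to a word on any given tail of the other (\<open>tail_equiv\<close>).

Both facts come from the algebra of \<open>m\<close>-types. These are finitely many, they multiply under concatenation,
and there is an \<open>\<omega>\<close>-product. Every type of a word on a well-order is generated from letters by binary
products and \<open>\<omega>\<close>-products (\<open>G_tp\<close>; uncountable cofinalities are removed by \<open>reflection\<close>), and \<open>k\<close> rounds
of generation can be realised between \<open>x\<close> and \<open>x + \<omega>\<^sup>k\<close> (\<open>gen_real\<close>). For tails, Ramsey's theorem writes the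
type as \<open>z \<cdot> g\<^sup>\<omega>\<close>. The types are aperiodic, and therefore every type of a word of length \<open>\<omega>\<^sup>K\<close> with large
\<open>K\<close> has a factor \<open>e\<close> with \<open>e = e \<cdot> e = e\<^sup>\<omega>\<close> (\<open>pump\<close>). Such an \<open>e\<close> is also the type of arbitrarily long
words, so the blocks \<open>g\<close> can be stretched until they are cofinal in the other front part (\<open>tail_real\<close>).

From left to right, \<open>\<theta>\<close> has to be recognised. By the Cantor normal form,
\<open>\<theta> = \<omega>\<^bsup>k\<^sub>1\<^esup> + \<dots> + \<omega>\<^bsup>k\<^sub>l\<^esup> + \<omega>\<^bsup>j+1\<^esup>\<close>; this is expressed by climbs (\<open>ends\<close>) and determines \<open>\<theta>\<close> up to
isomorphism (\<open>ends_iso\<close>). In \<open>\<omega>\<^sup>\<omega> + \<theta>\<close> the least point whose tail satisfies this description is the first point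
of \<open>\<theta>\<close> (\<open>least_end_sum\<close>). The tree interprets the order: the ordinals below a node \<open>s\<close> are its initial
segments and the ordinals from \<open>s\<close> on are its extensions by zeros. So the tree of \<open>\<alpha>\<close> knows that \<open>\<alpha>\<close> has such
a least point, which splits \<open>\<alpha>\<close> as \<open>\<alpha>\<^sub>0 + \<theta>\<close>, and it knows the first-order theory of \<open>\<alpha>\<^sub>0\<close>. Finally \<open>cf \<alpha>\<^sub>0 = \<omega>\<close>
is witnessed by a single node of length \<open>\<alpha>\<^sub>0\<close>: its letters \<open>1\<close> form a cofinal set in which every nonempty part
below a point has a largest element.\<close>

section \<open>Back-and-forth equivalence of coloured orders\<close>

text \<open>Duplicator survives \<open>m\<close> rounds of the Ehrenfeucht game on two coloured orders. In a linear order a move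
splits the game into independent games to the left and to the right of the chosen points, which gives a
recursion over suborders in place of partial isomorphisms.\<close>

primrec eqv :: "nat \<Rightarrow> ('x \<Rightarrow> 'x \<Rightarrow> bool) \<Rightarrow> 'x set \<Rightarrow> ('x \<Rightarrow> 'c) \<Rightarrow>
    ('y \<Rightarrow> 'y \<Rightarrow> bool) \<Rightarrow> 'y set \<Rightarrow> ('y \<Rightarrow> 'c) \<Rightarrow> bool" where
  "eqv 0 R X c S Y d \<longleftrightarrow> True"
| "eqv (Suc m) R X c S Y d \<longleftrightarrow>
    (\<forall>x\<in>X. \<exists>y\<in>Y. c x = d y \<and> eqv m R {z \<in> X. R z x} c S {z \<in> Y. S z y} d
                         \<and> eqv m R {z \<in> X. R x z} c S {z \<in> Y. S y z} d) \<and>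
    (\<forall>y\<in>Y. \<exists>x\<in>X. c x = d y \<and> eqv m R {z \<in> X. R z x} c S {z \<in> Y. S z y} d
                         \<and> eqv m R {z \<in> X. R x z} c S {z \<in> Y. S y z} d)"

definition reply :: "nat \<Rightarrow> ('x \<Rightarrow> 'x \<Rightarrow> bool) \<Rightarrow> 'x set \<Rightarrow> ('x \<Rightarrow> 'c) \<Rightarrow>
    ('y \<Rightarrow> 'y \<Rightarrow> bool) \<Rightarrow> 'y set \<Rightarrow> ('y \<Rightarrow> 'c) \<Rightarrow> 'x \<Rightarrow> 'y \<Rightarrow> bool" where
  "reply m R X c S Y d x y \<longleftrightarrow> c x = d y \<and> eqv m R {z \<in> X. R z x} c S {z \<in> Y. S z y} d
                         \<and> eqv m R {z \<in> X. R x z} c S {z \<in> Y. S y z} d"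

lemma eqv_Suc_iff: "eqv (Suc m) R X c S Y d \<longleftrightarrow>
    (\<forall>x\<in>X. \<exists>y\<in>Y. reply m R X c S Y d x y) \<and> (\<forall>y\<in>Y. \<exists>x\<in>X. reply m R X c S Y d x y)"
  by (simp add: reply_def)

declare eqv.simps(2) [simp del]

lemma replyI: "c x = d y \<Longrightarrow> eqv m R {z \<in> X. R z x} c S {z \<in> Y. S z y} d \<Longrightarrow>
    eqv m R {z \<in> X. R x z} c S {z \<in> Y. S y z} d \<Longrightarrow> reply m R X c S Y d x y"
  by (simp add: reply_def)

lemma replyD: assumes "reply m R X c S Y d x y"
  shows "c x = d y" "eqv m R {z \<in> X. R z x} c S {z \<in> Y. S z y} d"
    "eqv m R {z \<in> X. R x z} c S {z \<in> Y. S y z} d"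
  using assms by (simp_all add: reply_def)

lemma eqv_sym: "eqv m R X c S Y d \<Longrightarrow> eqv m S Y d R X c"
proof (induction m arbitrary: X Y)
  case (Suc m)
  have "reply m S Y d R X c y x" if "reply m R X c S Y d x y" for x y
    using replyD[OF that] Suc.IH by (intro replyI) auto
  then show ?case using Suc.prems unfolding eqv_Suc_iff by blast
qed simp

lemma eqv_iso:
  assumes "bij_betw f X Y" "\<And>x x'. x \<in> X \<Longrightarrow> x' \<in> X \<Longrightarrow> S (f x) (f x') \<longleftrightarrow> R x x'"
    "\<And>x. x \<in> X \<Longrightarrow> d (f x) = c x"
  shows "eqv m R X c S Y d"
  using assms
proof (induction m arbitrary: X Y)
  case (Suc m)
  have Y: "Y = f ` X" and inj: "inj_on f X" using Suc.prems(1) by (auto simp: bij_betw_def)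
  have *: "reply m R X c S Y d x (f x)" if "x \<in> X" for x
  proof (intro replyI Suc.IH)
    show "bij_betw f {z \<in> X. R z x} {z \<in> Y. S z (f x)}"
      "bij_betw f {z \<in> X. R x z} {z \<in> Y. S (f x) z}"
      using that inj Suc.prems(2) unfolding bij_betw_def Y by (auto simp: inj_on_def)
  qed (use Suc.prems that in auto)
  then show ?case unfolding eqv_Suc_iff Y by blast
qed simp

lemma eqv_refl: "eqv m R X c R X c"
  by (rule eqv_iso[where f = id]) auto

lemma eqv_cong:
  assumes "\<And>x. x \<in> X \<Longrightarrow> c x = c' x"
  shows "eqv m R X c R X c'"
  by (rule eqv_iso[where f = id]) (use assms in auto)

lemma eqv_trans: "eqv m R X c S Y d \<Longrightarrow> eqv m S Y d T Z e \<Longrightarrow> eqv m R X c T Z e"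
proof (induction m arbitrary: X Y Z)
  case (Suc m)
  have *: "reply m R X c T Z e x z" if "reply m R X c S Y d x y" "reply m S Y d T Z e y z" for x y z
    using replyD[OF that(1)] replyD[OF that(2)] by (auto intro!: replyI intro: Suc.IH)
  show ?case unfolding eqv_Suc_iff
  proof (intro conjI ballI)
    fix x assume "x \<in> X"
    then obtain y where "y \<in> Y" "reply m R X c S Y d x y"
      using Suc.prems(1) unfolding eqv_Suc_iff by blast
    moreover from this obtain z where "z \<in> Z" "reply m S Y d T Z e y z"
      using Suc.prems(2) unfolding eqv_Suc_iff by blast
    ultimately show "\<exists>z\<in>Z. reply m R X c T Z e x z" using * by blast
  next
    fix z assume "z \<in> Z"
    then obtain y where "y \<in> Y" "reply m S Y d T Z e y z"
      using Suc.prems(2) unfolding eqv_Suc_iff by blast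
    moreover from this obtain x where "x \<in> X" "reply m R X c S Y d x y"
      using Suc.prems(1) unfolding eqv_Suc_iff by blast
    ultimately show "\<exists>x\<in>X. reply m R X c T Z e x z" using * by blast
  qed
qed simp

lemma eqv_reply_mono:
  assumes "eqv (Suc m) R X c S Y d"
    "\<And>x y. x \<in> X \<Longrightarrow> y \<in> Y \<Longrightarrow> reply m R X c S Y d x y \<Longrightarrow> reply k R X c' S Y d' x y"
  shows "eqv (Suc k) R X c' S Y d'"
  using assms unfolding eqv_Suc_iff by meson

lemma eqv_Suc: "eqv (Suc m) R X c S Y d \<Longrightarrow> eqv m R X c S Y d"
proof (induction m arbitrary: X Y)
  case (Suc m)
  show ?case
  proof (rule eqv_reply_mono[OF Suc.prems])
    fix x y assume r: "reply (Suc m) R X c S Y d x y"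
    show "reply m R X c S Y d x y"
      using replyD(1)[OF r] Suc.IH[OF replyD(2)[OF r]] Suc.IH[OF replyD(3)[OF r]] by (rule replyI)
  qed
qed simp

lemma eqv_le: "m \<le> k \<Longrightarrow> eqv k R X c S Y d \<Longrightarrow> eqv m R X c S Y d"
  by (induction k rule: dec_induct) (auto dest: eqv_Suc)

lemma eqv_recolor:
  "eqv m R X c S Y d \<Longrightarrow> eqv m R X (\<lambda>x. g (c x)) S Y (\<lambda>y. g (d y))"
proof (induction m arbitrary: X Y)
  case (Suc m)
  show ?case
  proof (rule eqv_reply_mono[OF Suc.prems])
    fix x y assume r: "reply m R X c S Y d x y"
    show "reply m R X (\<lambda>x. g (c x)) S Y (\<lambda>y. g (d y)) x y"
      using arg_cong[OF replyD(1)[OF r], of g] Suc.IH[OF replyD(2)[OF r]] Suc.IH[OF replyD(3)[OF r]]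
      by (rule replyI)
  qed
qed simp

lemma eqv_restrict:
  "eqv m R X c S Y d \<Longrightarrow> eqv m R {x \<in> X. P (c x)} c S {y \<in> Y. P (d y)} d"
proof (induction m arbitrary: X Y)
  case (Suc m)
  have 1: "{z \<in> {x \<in> X. P (c x)}. Q z} = {x \<in> {x \<in> X. Q x}. P (c x)}" for Q by blast
  have 2: "{z \<in> {x \<in> Y. P (d x)}. Q z} = {x \<in> {x \<in> Y. Q x}. P (d x)}" for Q by blast
  have "reply m R {x \<in> X. P (c x)} c S {y \<in> Y. P (d y)} d x y" if "reply m R X c S Y d x y" for x y
    using replyD(1)[OF that] Suc.IH[OF replyD(2)[OF that]] Suc.IH[OF replyD(3)[OF that]]
    unfolding 1[symmetric] 2[symmetric] by (rule replyI)
  moreover have "P (c x) = P (d y)" if "reply m R X c S Y d x y" for x y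
    using replyD[OF that] by simp
  ultimately show ?case
    using Suc.prems unfolding eqv_Suc_iff by blast
qed simp

lemma eqv_single: "c x = d y \<Longrightarrow> R x x = S y y \<Longrightarrow> eqv m R {x} c S {y} d"
  by (rule eqv_iso[where f = "\<lambda>_. y"]) (auto simp: bij_betw_def)

definition before :: "('x \<Rightarrow> 'x \<Rightarrow> bool) \<Rightarrow> 'x set \<Rightarrow> 'x set \<Rightarrow> bool" where
  "before R A B \<longleftrightarrow> (\<forall>a\<in>A. \<forall>b\<in>B. R a b \<and> \<not> R b a)"

lemma before_mono: "before R A B \<Longrightarrow> A' \<subseteq> A \<Longrightarrow> B' \<subseteq> B \<Longrightarrow> before R A' B'"
  unfolding before_def by blast

lemma eqv_union:
  assumes "before R A B" "before S A' B'" "eqv m R A c S A' d" "eqv m R B c S B' d"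
  shows "eqv m R (A \<union> B) c S (A' \<union> B') d"
  using assms
proof (induction m arbitrary: A B A' B')
  case (Suc m)
  note bA = Suc.prems(1) and bB = Suc.prems(2)
  have eA0: "eqv m R A c S A' d" and eB0: "eqv m R B c S B' d"
    using Suc.prems(3,4) eqv_Suc by blast+
  have sA: "reply m R (A \<union> B) c S (A' \<union> B') d x y"
    if "x \<in> A" "y \<in> A'" and r: "reply m R A c S A' d x y" for x y
  proof -
    have 1: "{z \<in> A \<union> B. R z x} = {z \<in> A. R z x}" "{z \<in> A' \<union> B'. S z y} = {z \<in> A'. S z y}"
      "{z \<in> A \<union> B. R x z} = {z \<in> A. R x z} \<union> B" "{z \<in> A' \<union> B'. S y z} = {z \<in> A'. S y z} \<union> B'"
      using that(1,2) bA bB unfolding before_def by blast+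
    show ?thesis
      by (rule replyI; (unfold 1)?)
        (use replyD[OF r] Suc.IH[OF before_mono[OF bA] before_mono[OF bB] replyD(3)[OF r] eB0] in auto)
  qed
  have sB: "reply m R (A \<union> B) c S (A' \<union> B') d x y"
    if "x \<in> B" "y \<in> B'" and r: "reply m R B c S B' d x y" for x y
  proof -
    have 1: "{z \<in> A \<union> B. R z x} = A \<union> {z \<in> B. R z x}" "{z \<in> A' \<union> B'. S z y} = A' \<union> {z \<in> B'. S z y}"
      "{z \<in> A \<union> B. R x z} = {z \<in> B. R x z}" "{z \<in> A' \<union> B'. S y z} = {z \<in> B'. S y z}"
      using that(1,2) bA bB unfolding before_def by blast+
    show ?thesis
      by (rule replyI; (unfold 1)?)
        (use replyD[OF r] Suc.IH[OF before_mono[OF bA] before_mono[OF bB] eA0 replyD(2)[OF r]] in auto)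
  qed
  note eA = Suc.prems(3)[unfolded eqv_Suc_iff] and eB = Suc.prems(4)[unfolded eqv_Suc_iff]
  show ?case unfolding eqv_Suc_iff
  proof (intro conjI ballI)
    fix x assume "x \<in> A \<union> B"
    then show "\<exists>y\<in>A' \<union> B'. reply m R (A \<union> B) c S (A' \<union> B') d x y"
      by (elim UnE) (use eA eB sA sB in blast)+
  next
    fix y assume "y \<in> A' \<union> B'"
    then show "\<exists>x\<in>A \<union> B. reply m R (A \<union> B) c S (A' \<union> B') d x y"
      by (elim UnE) (use eA eB sA sB in blast)+
  qed
qed simp

text \<open>\<open>X\<close> is the sum over \<open>I\<close> of the fibres of \<open>p\<close>. Only points in different fibres are compared by \<open>Q\<close>, so
the fibres themselves may be arbitrary.\<close>

definition fibred :: "('x \<Rightarrow> 'x \<Rightarrow> bool) \<Rightarrow> 'x set \<Rightarrow> ('x \<Rightarrow> 'i) \<Rightarrow> ('i \<Rightarrow> 'i \<Rightarrow> bool) \<Rightarrow> 'i set \<Rightarrow> bool" where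
  "fibred R X p Q I \<longleftrightarrow> p ` X \<subseteq> I \<and> (\<forall>i\<in>I. \<not> Q i i) \<and>
     (\<forall>x\<in>X. \<forall>y\<in>X. p x \<noteq> p y \<longrightarrow> (R x y \<longleftrightarrow> Q (p x) (p y))) \<and>
     (\<forall>i\<in>I. \<forall>j\<in>I. Q i j \<longrightarrow> \<not> Q j i)"

lemma fibredD:
  assumes "fibred R X p Q I"
  shows "x \<in> X \<Longrightarrow> p x \<in> I" "i \<in> I \<Longrightarrow> \<not> Q i i"
    "x \<in> X \<Longrightarrow> y \<in> X \<Longrightarrow> p x \<noteq> p y \<Longrightarrow> R x y \<longleftrightarrow> Q (p x) (p y)"
    "i \<in> I \<Longrightarrow> j \<in> I \<Longrightarrow> Q i j \<Longrightarrow> \<not> Q j i"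
  using assms unfolding fibred_def by blast+

lemma fibred_sub:
  assumes "fibred R X p Q I" "J \<subseteq> I" shows "fibred R {x \<in> X. p x \<in> J} p Q J"
  using assms unfolding fibred_def by (auto simp: subset_iff)

lemma fibred_split:
  assumes f: "fibred R X p Q I" and x: "x \<in> X"
  shows "{z \<in> X. R z x} = {z \<in> X. p z \<in> {z \<in> I. Q z (p x)}} \<union> {z \<in> {z \<in> X. p z = p x}. R z x}"
    "{z \<in> X. R x z} = {z \<in> {z \<in> X. p z = p x}. R x z} \<union> {z \<in> X. p z \<in> {z \<in> I. Q (p x) z}}"
    "before R {z \<in> X. p z \<in> {z \<in> I. Q z (p x)}} {z \<in> {z \<in> X. p z = p x}. R z x}"
    "before R {z \<in> {z \<in> X. p z = p x}. R x z} {z \<in> X. p z \<in> {z \<in> I. Q (p x) z}}"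
proof -
  have a: "z \<in> X \<Longrightarrow> p z \<noteq> p x \<Longrightarrow> R z x \<longleftrightarrow> Q (p z) (p x)"
    "z \<in> X \<Longrightarrow> p z \<noteq> p x \<Longrightarrow> R x z \<longleftrightarrow> Q (p x) (p z)" "z \<in> X \<Longrightarrow> p z \<in> I" for z
    using fibredD[OF f] x by metis+
  have b: "\<not> Q (p x) (p x)" using fibredD[OF f] x by blast
  show "{z \<in> X. R z x} = {z \<in> X. p z \<in> {z \<in> I. Q z (p x)}} \<union> {z \<in> {z \<in> X. p z = p x}. R z x}"
    "{z \<in> X. R x z} = {z \<in> {z \<in> X. p z = p x}. R x z} \<union> {z \<in> X. p z \<in> {z \<in> I. Q (p x) z}}"
    using a b by (auto, metis+)
  have c: "R u v \<and> \<not> R v u" if "u \<in> X" "v \<in> X" "Q (p u) (p v)" for u v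
  proof -
    have "p u \<in> I" "p v \<in> I" using that fibredD(1)[OF f] by auto
    then have "\<not> Q (p v) (p u)" "p u \<noteq> p v" using that fibredD(2,4)[OF f] by metis+
    then show ?thesis using fibredD(3)[OF f] that by metis
  qed
  show "before R {z \<in> X. p z \<in> {z \<in> I. Q z (p x)}} {z \<in> {z \<in> X. p z = p x}. R z x}"
    "before R {z \<in> {z \<in> X. p z = p x}. R x z} {z \<in> X. p z \<in> {z \<in> I. Q (p x) z}}"
    unfolding before_def using c by auto
qed

text \<open>The composition theorem: \<open>X\<close> is an ordered sum of fibres over \<open>I\<close>. If the index orders, coloured by
labels, are equivalent and equal labels mean equivalent fibres, then the replies in the index order and in the
fibres combine to a reply in the sum.\<close>

lemma eqv_sum:
  assumes "fibred R X p Q I" "fibred S Y q P J"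
    "eqv m Q I l P J k"
    "\<And>i j. i \<in> I \<Longrightarrow> j \<in> J \<Longrightarrow> l i = k j \<Longrightarrow> eqv m R {x \<in> X. p x = i} c S {y \<in> Y. q y = j} d"
  shows "eqv m R X c S Y d"
  using assms
proof (induction m arbitrary: X Y I J)
  case (Suc m)
  note f1 = Suc.prems(1) and f2 = Suc.prems(2)
  have IHsub: "eqv m R {x \<in> X. p x \<in> I'} c S {y \<in> Y. q y \<in> J'} d"
    if "I' \<subseteq> I" "J' \<subseteq> J" "eqv m Q I' l P J' k" for I' J'
  proof (rule Suc.IH[OF _ _ that(3)])
    show "fibred R {x \<in> X. p x \<in> I'} p Q I'" "fibred S {y \<in> Y. q y \<in> J'} q P J'"
      using Suc.prems(1,2) that fibred_sub by blast+
    fix i j assume ij: "i \<in> I'" "j \<in> J'" "l i = k j"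
    then have 1: "{x \<in> {x \<in> X. p x \<in> I'}. p x = i} = {x \<in> X. p x = i}"
      "{y \<in> {y \<in> Y. q y \<in> J'}. q y = j} = {y \<in> Y. q y = j}" by auto
    have "i \<in> I" "j \<in> J" using ij that by auto
    from Suc.prems(4)[OF this ij(3), THEN eqv_Suc]
    show "eqv m R {x \<in> {x \<in> X. p x \<in> I'}. p x = i} c S {y \<in> {y \<in> Y. q y \<in> J'}. q y = j} d"
      unfolding 1 .
  qed
  have main: "reply m R X c S Y d x y"
    if x: "x \<in> X" and y: "y \<in> Y" and ij: "reply m Q I l P J k (p x) (q y)"
      and xy: "reply m R {z \<in> X. p z = p x} c S {z \<in> Y. q z = q y} d x y" for x y
  proof -
    note 1 = fibred_split[OF f1 x] and 2 = fibred_split[OF f2 y]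
    show ?thesis
    proof (rule replyI)
      show "c x = d y" using replyD(1)[OF xy] .
      show "eqv m R {z \<in> X. R z x} c S {z \<in> Y. S z y} d" unfolding 1(1) 2(1)
        by (rule eqv_union[OF 1(3) 2(3) IHsub[OF _ _ replyD(2)[OF ij]] replyD(2)[OF xy]]) auto
      show "eqv m R {z \<in> X. R x z} c S {z \<in> Y. S y z} d" unfolding 1(2) 2(2)
        by (rule eqv_union[OF 1(4) 2(4) replyD(3)[OF xy] IHsub[OF _ _ replyD(3)[OF ij]]]) auto
    qed
  qed
  note e = Suc.prems(3)[unfolded eqv_Suc_iff]
  have fib: "eqv (Suc m) R {z \<in> X. p z = i} c S {y \<in> Y. q y = j} d"
    if "reply m Q I l P J k i j" "i \<in> I" "j \<in> J" for i j
    using Suc.prems(4) that replyD(1)[OF that(1)] by blast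
  show ?case unfolding eqv_Suc_iff
  proof (intro conjI ballI)
    fix x assume x: "x \<in> X"
    then have "p x \<in> I" using fibredD(1)[OF f1] by blast
    then obtain j where j: "j \<in> J" "reply m Q I l P J k (p x) j" using e by blast
    obtain y where "y \<in> Y" "q y = j" "reply m R {z \<in> X. p z = p x} c S {y \<in> Y. q y = j} d x y"
      using fib[OF j(2) \<open>p x \<in> I\<close> j(1)] x unfolding eqv_Suc_iff by blast
    then show "\<exists>y\<in>Y. reply m R X c S Y d x y" using main[OF x] j by blast
  next
    fix y assume y: "y \<in> Y"
    then have "q y \<in> J" using fibredD(1)[OF f2] by blast
    then obtain i where i: "i \<in> I" "reply m Q I l P J k i (q y)" using e by blast
    obtain x where "x \<in> X" "p x = i" "reply m R {z \<in> X. p z = i} c S {z \<in> Y. q z = q y} d x y"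
      using fib[OF i(2) i(1) \<open>q y \<in> J\<close>] y unfolding eqv_Suc_iff by blast
    then show "\<exists>x\<in>X. reply m R X c S Y d x y" using main[OF _ y] i by blast
  qed
qed simp

section \<open>Types of words and their products\<close>

text \<open>A numerical code of the equivalence class, so that types of words on orders of different HOL types can be
compared and be themselves used as colours.\<close>

primrec tp :: "nat \<Rightarrow> ('x \<Rightarrow> 'x \<Rightarrow> bool) \<Rightarrow> 'x set \<Rightarrow> ('x \<Rightarrow> nat) \<Rightarrow> nat" where
  "tp 0 R X c = 0"
| "tp (Suc m) R X c = set_encode ((\<lambda>x. prod_encode (c x,
      prod_encode (tp m R {z \<in> X. R z x} c, tp m R {z \<in> X. R x z} c))) ` X)"

primrec codes :: "nat \<Rightarrow> nat \<Rightarrow> nat set" where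
  "codes n 0 = {0}"
| "codes n (Suc m) = set_encode ` Pow (prod_encode ` ({..<n} \<times> prod_encode ` (codes n m \<times> codes n m)))"

lemma finite_codes: "finite (codes n m)"
  by (induction m) auto

lemma tp_codes: "c ` X \<subseteq> {..<n} \<Longrightarrow> tp m R X c \<in> codes n m"
proof (induction m arbitrary: X)
  case (Suc m)
  have "tp m R {z \<in> X. Q z} c \<in> codes n m" for Q
    by (rule Suc.IH) (use Suc.prems in auto)
  then show ?case using Suc.prems by (auto intro!: imageI)
qed simp

lemma tp_eq_iff:
  assumes "c ` X \<subseteq> {..<n}" "d ` Y \<subseteq> {..<n}"
  shows "tp m R X c = tp m S Y d \<longleftrightarrow> eqv m R X c S Y d"
  using assms
proof (induction m arbitrary: X Y)
  case (Suc m)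
  define F where "F = (\<lambda>x. prod_encode (c x,
      prod_encode (tp m R {z \<in> X. R z x} c, tp m R {z \<in> X. R x z} c)))"
  define G where "G = (\<lambda>x. prod_encode (d x,
      prod_encode (tp m S {z \<in> Y. S z x} d, tp m S {z \<in> Y. S x z} d)))"
  have sub: "tp m R {z \<in> X. Q z} c \<in> codes n m" "tp m S {z \<in> Y. P z} d \<in> codes n m" for Q P
    by (rule tp_codes, use Suc.prems in auto)+
  have "F ` X \<subseteq> prod_encode ` ({..<n} \<times> prod_encode ` (codes n m \<times> codes n m))"
    "G ` Y \<subseteq> prod_encode ` ({..<n} \<times> prod_encode ` (codes n m \<times> codes n m))"
    using Suc.prems sub unfolding F_def G_def by (auto intro!: imageI)
  moreover have "finite (prod_encode ` ({..<n} \<times> prod_encode ` (codes n m \<times> codes n m)))"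
    by (intro finite_imageI finite_cartesian_product finite_codes finite_lessThan)
  ultimately have fin: "finite (F ` X)" "finite (G ` Y)"
    using finite_subset by blast+
  have r: "F x = G y \<longleftrightarrow> reply m R X c S Y d x y" for x y
  proof -
    have "tp m R {z \<in> X. R z x} c = tp m S {z \<in> Y. S z y} d \<longleftrightarrow>
        eqv m R {z \<in> X. R z x} c S {z \<in> Y. S z y} d"
      "tp m R {z \<in> X. R x z} c = tp m S {z \<in> Y. S y z} d \<longleftrightarrow>
        eqv m R {z \<in> X. R x z} c S {z \<in> Y. S y z} d"
      by (rule Suc.IH; use Suc.prems in auto)+
    then show ?thesis unfolding F_def G_def reply_def by simp
  qed
  have "tp (Suc m) R X c = tp (Suc m) S Y d \<longleftrightarrow> F ` X = G ` Y"
    unfolding tp.simps F_def[symmetric] G_def[symmetric] using set_encode_eq[OF fin] .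
  also have "\<dots> \<longleftrightarrow> eqv (Suc m) R X c S Y d"
    unfolding eqv_Suc_iff r[symmetric] set_eq_subset image_subset_iff image_iff by metis
  finally show ?case .
qed simp

lemma tp_empty [simp]: "tp m R {} c = 0"
  by (cases m) auto

lemma tp_cong: assumes "\<And>x. x \<in> X \<Longrightarrow> c x = c' x" shows "tp m R X c = tp m R X c'"
  using assms
proof (induction m arbitrary: X)
  case (Suc m)
  have "tp m R {z \<in> X. Q z} c = tp m R {z \<in> X. Q z} c'" for Q
    by (rule Suc.IH) (use Suc.prems in auto)
  then show ?case using Suc.prems by auto
qed simp

type_synonym word = "nat list \<Rightarrow> nat option"

text \<open>Types are represented by words on sets of lists: prefixing the lists of the \<open>i\<close>-th word by \<open>i\<close>
concatenates a sequence of words inside the same HOL type.\<close>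

abbreviation lx :: "nat list \<Rightarrow> nat list \<Rightarrow> bool" where
  "lx p q \<equiv> (p, q) \<in> lexord {(a, b). a < b}"

definition wtp :: "nat \<Rightarrow> word \<Rightarrow> nat" where
  "wtp m w = tp m lx (dom w) (\<lambda>p. the (w p))"

definition types :: "nat \<Rightarrow> nat \<Rightarrow> nat set" where
  "types n m = wtp m ` {w. ran w \<subseteq> {..<n}}"

text \<open>Outside \<open>types n m\<close> the value is some word in the alphabet; the products below are therefore total and
their laws hold for all numbers.\<close>

definition rep :: "nat \<Rightarrow> nat \<Rightarrow> nat \<Rightarrow> word" where
  "rep n m t = (SOME w. ran w \<subseteq> {..<n} \<and> (t \<in> types n m \<longrightarrow> wtp m w = t))"

definition join :: "(nat \<Rightarrow> word) \<Rightarrow> word" where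
  "join ws p = (case p of [] \<Rightarrow> None | i # q \<Rightarrow> ws i q)"

text \<open>The type of the concatenation of words with types \<open>t 0, t 1, \<dots>\<close>.\<close>

definition om :: "nat \<Rightarrow> nat \<Rightarrow> (nat \<Rightarrow> nat) \<Rightarrow> nat" where
  "om n m t = wtp m (join (\<lambda>i. rep n m (t i)))"

text \<open>A binary product is an \<open>\<omega>\<close>-product continued by empty words, whose type is \<open>0\<close>.\<close>

definition mul :: "nat \<Rightarrow> nat \<Rightarrow> nat \<Rightarrow> nat \<Rightarrow> nat" where
  "mul n m s t = om n m (\<lambda>i. if i = 0 then s else if i = 1 then t else 0)"

lemma zero_in_types: "0 \<in> types n m"
  by (auto simp: types_def wtp_def image_iff intro!: exI[of _ Map.empty])

lemma rep: "ran (rep n m t) \<subseteq> {..<n}" "t \<in> types n m \<Longrightarrow> wtp m (rep n m t) = t"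
proof -
  have "\<exists>w. ran w \<subseteq> {..<n} \<and> (t \<in> types n m \<longrightarrow> wtp m w = t)"
  proof (cases "t \<in> types n m")
    case False
    then show ?thesis by (intro exI[of _ Map.empty]) simp
  qed (auto simp: types_def)
  from someI_ex[OF this]
  show "ran (rep n m t) \<subseteq> {..<n}" "t \<in> types n m \<Longrightarrow> wtp m (rep n m t) = t"
    unfolding rep_def by blast+
qed

definition norm :: "nat \<Rightarrow> nat \<Rightarrow> nat \<Rightarrow> nat" where
  "norm n m t = wtp m (rep n m t)"

lemma norm_types: "norm n m t \<in> types n m"
  using rep(1) unfolding norm_def types_def by blast

lemma norm_id: "t \<in> types n m \<Longrightarrow> norm n m t = t"
  using rep(2) unfolding norm_def by blast

lemma ran_join: "(\<And>i. ran (ws i) \<subseteq> {..<n}) \<Longrightarrow> ran (join ws) \<subseteq> {..<n}"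
  unfolding join_def ran_def by (force split: list.splits)

lemma om_types: "om n m t \<in> types n m"
  unfolding om_def types_def by (intro imageI CollectI ran_join rep)

lemma mul_types: "mul n m s t \<in> types n m"
  unfolding mul_def by (rule om_types)

lemma word_colours: assumes "ran w \<subseteq> {..<n}" shows "(\<lambda>p. the (w p)) ` dom w \<subseteq> {..<n}"
  using assms by (auto intro: ranI)

lemma types_codes: "types n m \<subseteq> codes n m"
proof
  fix t assume "t \<in> types n m"
  then obtain w where w: "ran w \<subseteq> {..<n}" "t = wtp m w" by (auto simp: types_def)
  show "t \<in> codes n m" unfolding w(2) wtp_def by (rule tp_codes[OF word_colours[OF w(1)]])
qed

lemma fibred_join: "fibred lx (dom (join ws)) hd (<) UNIV"
  unfolding fibred_def by (auto simp: join_def split: list.splits)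

text \<open>The composition theorem in terms of types: the type of a sum depends only on the type of the index order
coloured by the types of the fibres.\<close>

lemma tp_sum:
  fixes c :: "'x \<Rightarrow> nat" and d :: "'y \<Rightarrow> nat"
  assumes f: "fibred R X p Q I" "fibred S Y q P J" and e: "eqv m Q I l P J k"
    and c: "c ` X \<subseteq> {..<n}" "d ` Y \<subseteq> {..<n}"
    and l: "\<And>i. i \<in> I \<Longrightarrow> l i = tp m R {x \<in> X. p x = i} c"
       "\<And>j. j \<in> J \<Longrightarrow> k j = tp m S {y \<in> Y. q y = j} d"
  shows "tp m R X c = tp m S Y d"
proof -
  have "eqv m R {x \<in> X. p x = i} c S {y \<in> Y. q y = j} d" if "i \<in> I" "j \<in> J" "l i = k j" for i j
  proof (subst tp_eq_iff[symmetric, where n = n])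
    show "tp m R {x \<in> X. p x = i} c = tp m S {y \<in> Y. q y = j} d" using that l by simp
  qed (use c in auto)
  then show ?thesis
    using eqv_sum[OF f e] tp_eq_iff[OF c] by blast
qed

lemma join_fibre:
  "tp m lx {x \<in> dom (join ws). hd x = i} (\<lambda>p. the (join ws p)) = wtp m (ws i)"
  if "ran (ws i) \<subseteq> {..<n}"
proof -
  have X: "{x \<in> dom (join ws). hd x = i} = (#) i ` dom (ws i)"
    by (auto simp: join_def image_iff split: list.splits)
  have "eqv m lx (dom (ws i)) (\<lambda>p. the (ws i p)) lx {x \<in> dom (join ws). hd x = i} (\<lambda>p. the (join ws p))"
    unfolding X by (rule eqv_iso[where f = "(#) i"]) (auto simp: bij_betw_def join_def)
  moreover note word_colours[OF that]
  moreover have "(\<lambda>p. the (join ws p)) ` {x \<in> dom (join ws). hd x = i} \<subseteq> {..<n}"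
    unfolding X using that by (auto simp: join_def ran_def)
  ultimately show ?thesis unfolding wtp_def by (rule tp_eq_iff[THEN iffD2, symmetric, rotated 2])
qed

lemma om_fibred:
  assumes f: "fibred R X p (<) (UNIV :: nat set)" and c: "c ` X \<subseteq> {..<n}"
    and t: "\<And>i. tp m R {x \<in> X. p x = i} c = norm n m (t i)"
  shows "tp m R X c = om n m t"
  unfolding om_def wtp_def
proof (rule tp_sum[OF f fibred_join eqv_refl[where c = "\<lambda>i. norm n m (t i)"] c])
  show "(\<lambda>p. the (join (\<lambda>i. rep n m (t i)) p)) ` dom (join (\<lambda>i. rep n m (t i))) \<subseteq> {..<n}"
    by (intro word_colours ran_join rep)
  fix j :: nat
  show "norm n m (t j) = tp m R {x \<in> X. p x = j} c" using t by simp
  show "norm n m (t j) = tp m lx {y \<in> dom (join (\<lambda>i. rep n m (t i))). hd y = j}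
      (\<lambda>p. the (join (\<lambda>i. rep n m (t i)) p))"
    unfolding norm_def by (rule join_fibre[OF rep(1), symmetric])
qed

section \<open>Laws of the products of types\<close>

text \<open>The product \<open>t i \<cdot> \<dots> \<cdot> t (i + l)\<close>, which has \<open>l + 1\<close> factors.\<close>

primrec seg :: "(nat \<Rightarrow> nat \<Rightarrow> nat) \<Rightarrow> (nat \<Rightarrow> nat) \<Rightarrow> nat \<Rightarrow> nat \<Rightarrow> nat" where
  "seg f t i 0 = t i"
| "seg f t i (Suc l) = f (seg f t i l) (t (i + Suc l))"

lemma tp_om:
  assumes b: "\<And>i j. i < j \<Longrightarrow> before R (A i) (A j)" and c: "c ` (\<Union>i. A i) \<subseteq> {..<n}"
    and t: "\<And>i. tp m R (A i) c \<in> types n m"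
  shows "tp m R (\<Union>i. A i) c = om n m (\<lambda>i. tp m R (A i) c)"
proof -
  define p where "p x = (LEAST i. x \<in> A i)" for x
  have p: "p x = i" if "x \<in> A i" for x i
  proof -
    have "x \<in> A (p x)" "p x \<le> i" unfolding p_def using that by (auto intro: LeastI Least_le)
    moreover have "\<not> p x < i" using b[of "p x" i] that \<open>x \<in> A (p x)\<close> unfolding before_def by blast
    ultimately show ?thesis by simp
  qed
  have A: "{x \<in> \<Union>i. A i. p x = i} = A i" for i using p by auto
  have "fibred R (\<Union>i. A i) p (<) UNIV"
    unfolding fibred_def
  proof (intro conjI ballI impI)
    fix x y assume xy: "x \<in> (\<Union>i. A i)" "y \<in> (\<Union>i. A i)" "p x \<noteq> p y"
    then have "x \<in> A (p x)" "y \<in> A (p y)" using p by auto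
    then show "R x y \<longleftrightarrow> p x < p y"
      using b[of "p x" "p y"] b[of "p y" "p x"] xy(3) unfolding before_def by (meson linorder_neqE_nat)
  qed auto
  then show ?thesis
    by (rule om_fibred[OF _ c]) (use t in \<open>simp only: A norm_id\<close>)
qed

lemma tp_mul:
  assumes b: "before R A B" and c: "c ` (A \<union> B) \<subseteq> {..<n}"
    and t: "tp m R A c \<in> types n m" "tp m R B c \<in> types n m"
  shows "tp m R (A \<union> B) c = mul n m (tp m R A c) (tp m R B c)"
proof -
  define F where "F i = (if i = 0 then A else if i = 1 then B else {})" for i :: nat
  have F: "(\<Union>i. F i) = A \<union> B" by (auto simp: F_def split: if_splits)
  have "tp m R (\<Union>i. F i) c = om n m (\<lambda>i. tp m R (F i) c)"
  proof (rule tp_om)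
    show "before R (F i) (F j)" if "i < j" for i j
      using b that by (auto simp: F_def before_def)
    show "tp m R (F i) c \<in> types n m" for i using t zero_in_types by (simp add: F_def)
  qed (use c F in auto)
  moreover have "(\<lambda>i. tp m R (F i) c) = (\<lambda>i. if i = 0 then tp m R A c else if i = 1 then tp m R B c else 0)"
    by (auto simp: F_def)
  ultimately show ?thesis unfolding F mul_def by simp
qed

lemma tp_seg:
  assumes b: "\<And>i j. i < j \<Longrightarrow> before R (A i) (A j)" and c: "c ` (\<Union>i. A i) \<subseteq> {..<n}"
    and t: "\<And>i. tp m R (A i) c \<in> types n m"
  shows "tp m R (\<Union>k\<in>{i..i+l}. A k) c = seg (mul n m) (\<lambda>k. tp m R (A k) c) i l \<and>
    tp m R (\<Union>k\<in>{i..i+l}. A k) c \<in> types n m"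
proof (induction l)
  case (Suc l)
  have 1: "(\<Union>k\<in>{i..i + Suc l}. A k) = (\<Union>k\<in>{i..i+l}. A k) \<union> A (i + Suc l)"
    by (simp add: atLeastAtMostSuc_conv Un_commute)
  have "tp m R (\<Union>k\<in>{i..i + Suc l}. A k) c =
      mul n m (tp m R (\<Union>k\<in>{i..i+l}. A k) c) (tp m R (A (i + Suc l)) c)"
    unfolding 1
  proof (rule tp_mul)
    show "before R (\<Union>k\<in>{i..i+l}. A k) (A (i + Suc l))"
      unfolding before_def
    proof (intro ballI)
      fix x y assume "x \<in> (\<Union>k\<in>{i..i+l}. A k)" and y: "y \<in> A (i + Suc l)"
      then have "\<exists>k < i + Suc l. x \<in> A k" by (auto simp: less_Suc_eq_le)
      then obtain k where k: "k < i + Suc l" "x \<in> A k" by blast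
      show "R x y \<and> \<not> R y x" using b[OF k(1)] k(2) y unfolding before_def by blast
    qed
  qed (use c Suc t in auto)
  then show ?case using Suc mul_types by simp
qed (use t in simp)

lemma tp_canonical: assumes "c ` X \<subseteq> {..<n}" shows "tp m lx X c \<in> types n m"
proof -
  define w where "w p = (if p \<in> X then Some (c p) else None)" for p
  have "ran w \<subseteq> {..<n}" "dom w = X" using assms by (auto simp: w_def ran_def split: if_splits)
  moreover have "tp m lx X c = tp m lx X (\<lambda>p. the (w p))" by (rule tp_cong) (simp add: w_def)
  ultimately show ?thesis unfolding types_def wtp_def by auto
qed

text \<open>Realising a sequence of types by disjoint consecutive words turns every law about products into a fact
about a single word that is cut in two ways.\<close>

lemma realise:
  fixes n m :: nat and t :: "nat \<Rightarrow> nat"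
  obtains A :: "nat \<Rightarrow> nat list set" and c where "\<And>i j. i < j \<Longrightarrow> before lx (A i) (A j)"
    "c ` (\<Union>i. A i) \<subseteq> {..<n}" "\<And>i. tp m lx (A i) c = norm n m (t i)"
proof
  define w where "w = join (\<lambda>i. rep n m (t i))"
  define A where "A i = {x \<in> dom w. hd x = i}" for i
  have w: "lx x y \<longleftrightarrow> hd x < hd y" if "x \<in> dom w" "y \<in> dom w" "hd x \<noteq> hd y" for x y
    using fibredD(3)[OF fibred_join] that unfolding w_def by blast
  show "before lx (A i) (A j)" if "i < j" for i j
    using that w unfolding before_def A_def by fastforce
  have "(\<lambda>p. the (w p)) ` dom w \<subseteq> {..<n}" unfolding w_def by (intro word_colours ran_join rep)
  then show "(\<lambda>p. the (w p)) ` (\<Union>i. A i) \<subseteq> {..<n}" by (auto simp: A_def)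
  show "tp m lx (A i) (\<lambda>p. the (w p)) = norm n m (t i)" for i
    unfolding A_def w_def norm_def by (rule join_fibre[OF rep(1)])
qed

lemma om_norm: "om n m (\<lambda>i. norm n m (t i)) = om n m t"
proof -
  obtain A c where A: "\<And>i j. i < j \<Longrightarrow> before lx (A i) (A j)"
    "c ` (\<Union>i. A i) \<subseteq> {..<n}" "\<And>i. tp m lx (A i) c = norm n m (t i)" using realise[of n m t] by blast
  have "fibred lx (dom (join (\<lambda>i. rep n m (t i)))) hd (<) UNIV" by (rule fibred_join)
  then have "om n m t = om n m (\<lambda>i. norm n m (t i))"
    unfolding om_def[of n m t] wtp_def
  proof (rule om_fibred)
    show "(\<lambda>p. the (join (\<lambda>i. rep n m (t i)) p)) ` dom (join (\<lambda>i. rep n m (t i))) \<subseteq> {..<n}"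
      by (intro word_colours ran_join rep)
    show "tp m lx {x \<in> dom (join (\<lambda>i. rep n m (t i))). hd x = i} (\<lambda>p. the (join (\<lambda>i. rep n m (t i)) p))
        = norm n m (norm n m (t i))" for i
      unfolding norm_id[OF norm_types] unfolding norm_def by (rule join_fibre[OF rep(1)])
  qed
  then show ?thesis by simp
qed

lemma mul_norm: "mul n m (norm n m s) (norm n m t) = mul n m s t"
proof -
  define f where "f = (\<lambda>i::nat. if i = 0 then s else if i = 1 then t else 0)"
  have "(\<lambda>i. norm n m (f i)) = (\<lambda>i::nat. if i = 0 then norm n m s else if i = 1 then norm n m t else 0)"
    by (auto simp: f_def norm_id zero_in_types)
  then show ?thesis using om_norm[of n m f] unfolding mul_def f_def by simp
qed

lemma norm_mul [simp]: "norm n m (mul n m s t) = mul n m s t"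
  by (simp add: norm_id mul_types)

lemma norm_om [simp]: "norm n m (om n m t) = om n m t"
  by (simp add: norm_id om_types)

lemma seg_norm: "seg (mul n m) (\<lambda>i. norm n m (t i)) i l = norm n m (seg (mul n m) t i l)"
proof (induction l)
  case (Suc l)
  then show ?case by (simp add: mul_norm)
qed simp

lemma mul_assoc: "mul n m (mul n m a b) d = mul n m a (mul n m b d)"
proof -
  define t where "t i = (if i = 0 then a else if i = 1 then b else d)" for i :: nat
  obtain A c where A: "\<And>i j. i < j \<Longrightarrow> before lx (A i) (A j)"
    "c ` (\<Union>i. A i) \<subseteq> {..<n}" "\<And>i. tp m lx (A i) c = norm n m (t i)" using realise[of n m t] by blast
  have ty: "tp m lx (A i) c \<in> types n m" for i unfolding A(3) by (rule norm_types)
  have c: "c ` A i \<subseteq> {..<n}" for i using A(2) by auto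
  have b: "before lx (A 0) (A 1)" "before lx (A 1) (A 2)" "before lx (A 0 \<union> A 1) (A 2)"
     "before lx (A 0) (A 1 \<union> A 2)"
    using A(1)[of 0 1] A(1)[of 1 2] A(1)[of 0 2] unfolding before_def by auto
  have 1: "tp m lx (A 0 \<union> A 1) c = mul n m a b" "tp m lx (A 1 \<union> A 2) c = mul n m b d"
    using tp_mul[OF b(1) _ ty ty] tp_mul[OF b(2) _ ty ty] c by (auto simp: A(3) t_def mul_norm simp del: One_nat_def)
  have "tp m lx ((A 0 \<union> A 1) \<union> A 2) c = mul n m (mul n m a b) (norm n m d)"
    by (subst tp_mul[OF b(3)]) (use c ty in \<open>auto simp: 1 mul_types norm_types A(3) t_def simp del: One_nat_def\<close>)
  moreover have "tp m lx (A 0 \<union> (A 1 \<union> A 2)) c = mul n m (norm n m a) (mul n m b d)"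
    by (subst tp_mul[OF b(4)]) (use c ty in \<open>auto simp: 1 mul_types norm_types A(3) t_def simp del: One_nat_def\<close>)
  ultimately have "mul n m (mul n m a b) (norm n m d) = mul n m (norm n m a) (mul n m b d)"
    by (simp add: Un_assoc)
  then show ?thesis
    using mul_norm[of n m "mul n m a b" d] mul_norm[of n m a "mul n m b d"] by simp
qed

lemma mul_zero: "mul n m x 0 = norm n m x" "mul n m 0 x = norm n m x"
proof -
  obtain A c where A: "\<And>i j. i < j \<Longrightarrow> before lx (A i) (A j)"
    "c ` (\<Union>i. A i) \<subseteq> {..<n}" "\<And>i::nat. tp m lx (A i) c = norm n m x" using realise[of n m "\<lambda>_. x"] by blast
  have b: "before lx (A 0) {}" "before lx {} (A 0)" and c: "c ` A 0 \<subseteq> {..<n}"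
    using A(2) by (auto simp: before_def)
  have "tp m lx (A 0 \<union> {}) c = mul n m (tp m lx (A 0) c) (tp m lx {} c)"
    by (rule tp_mul[OF b(1)]) (use c A(3) norm_types zero_in_types in simp_all)
  moreover have "tp m lx ({} \<union> A 0) c = mul n m (tp m lx {} c) (tp m lx (A 0) c)"
    by (rule tp_mul[OF b(2)]) (use c A(3) norm_types zero_in_types in simp_all)
  ultimately have "norm n m x = mul n m (norm n m x) (norm n m 0)" "norm n m x = mul n m (norm n m 0) (norm n m x)"
    by (simp_all add: A(3) norm_id[OF zero_in_types])
  then show "mul n m x 0 = norm n m x" "mul n m 0 x = norm n m x" by (metis mul_norm)+
qed

lemma om_unroll: "om n m t = mul n m (t 0) (om n m (\<lambda>i. t (Suc i)))"
proof -
  obtain A c where A: "\<And>i j. i < j \<Longrightarrow> before lx (A i) (A j)"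
    "c ` (\<Union>i. A i) \<subseteq> {..<n}" "\<And>i. tp m lx (A i) c = norm n m (t i)" using realise[of n m t] by blast
  have ty: "tp m lx (A i) c \<in> types n m" for i unfolding A(3) by (rule norm_types)
  have 1: "(\<Union>i. A i) = A 0 \<union> (\<Union>i. A (Suc i))"
  proof -
    have "x \<in> A i \<Longrightarrow> x \<in> A 0 \<or> (\<exists>j. x \<in> A (Suc j))" for x i by (cases i) auto
    then show ?thesis by blast
  qed
  have c: "c ` (\<Union>i. A (Suc i)) \<subseteq> {..<n}" using A(2) by auto
  have 2: "tp m lx (\<Union>i. A (Suc i)) c = om n m (\<lambda>i. t (Suc i))"
    by (subst tp_om[OF _ c]) (use A ty in \<open>auto simp: om_norm\<close>)
  have "tp m lx (\<Union>i. A i) c = mul n m (norm n m (t 0)) (om n m (\<lambda>i. t (Suc i)))"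
    unfolding 1
  proof (subst tp_mul)
    show "before lx (A 0) (\<Union>i. A (Suc i))" using A(1) unfolding before_def by blast
    show "c ` (A 0 \<union> (\<Union>i. A (Suc i))) \<subseteq> {..<n}" using A(2) by auto
  qed (use ty 2 om_types in \<open>auto simp: A(3)\<close>)
  moreover have "tp m lx (\<Union>i. A i) c = om n m t"
    by (subst tp_om[OF _ A(2)]) (use A ty in \<open>auto simp: om_norm\<close>)
  ultimately show ?thesis
    using mul_norm[of n m "t 0" "om n m (\<lambda>i. t (Suc i))"] by simp
qed

lemma om_regroup:
  assumes h: "strict_mono h"
  shows "om n m (\<lambda>i. t (h 0 + i)) = om n m (\<lambda>i. seg (mul n m) t (h i) (h (Suc i) - Suc (h i)))"
proof -
  obtain A c where A: "\<And>i j. i < j \<Longrightarrow> before lx (A i) (A j)"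
    "c ` (\<Union>i. A i) \<subseteq> {..<n}" "\<And>i. tp m lx (A i) c = norm n m (t i)" using realise[of n m t] by blast
  have ty: "tp m lx (A i) c \<in> types n m" for i unfolding A(3) by (rule norm_types)
  define B where "B i = (\<Union>k\<in>{h i..h i + (h (Suc i) - Suc (h i))}. A k)" for i
  have hS: "h i < h (Suc i)" for i using h by (simp add: strict_mono_Suc_iff)
  then have I: "{h i..h i + (h (Suc i) - Suc (h i))} = {h i..<h (Suc i)}" for i
    by (metis Suc_leI add_Suc le_add_diff_inverse atLeastLessThanSuc_atLeastAtMost)
  have ex: "\<exists>i. h i \<le> k \<and> k < h (Suc i)" if "h 0 \<le> k" for k
  proof -
    have "k < h (Suc k)" using strict_mono_imp_increasing[OF h, of "Suc k"] by simp
    then have "\<exists>i. k < h (Suc i)" by blast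
    then have L: "k < h (Suc (LEAST i. k < h (Suc i)))" by (rule LeastI_ex)
    show ?thesis
    proof (cases "LEAST i. k < h (Suc i)")
      case 0 then show ?thesis using L that by auto
    next
      case (Suc j)
      then have "\<not> k < h (Suc j)" using not_less_Least[of j "\<lambda>i. k < h (Suc i)"] by simp
      then show ?thesis using L Suc by (metis not_less)
    qed
  qed
  have U: "(\<Union>i. B i) = (\<Union>i. A (h 0 + i))"
  proof -
    have "h 0 \<le> h i" for i using h by (simp add: strict_mono_less_eq)
    moreover from this have "\<exists>i. k = h 0 + i" if "h j \<le> k" for j k
      using that by (metis le_add_diff_inverse order_trans)
    moreover have "\<exists>j. h j \<le> h 0 + i \<and> h 0 + i < h (Suc j)" for i by (rule ex) simp
    ultimately show ?thesis unfolding B_def I by fastforce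
  qed
  have c1: "c ` (\<Union>i. A (h 0 + i)) \<subseteq> {..<n}" using A(2) by auto
  then have c2: "c ` (\<Union>i. B i) \<subseteq> {..<n}" unfolding U .
  have Bt: "tp m lx (B i) c = norm n m (seg (mul n m) t (h i) (h (Suc i) - Suc (h i)))" for i
    unfolding B_def using tp_seg[OF A(1,2) ty] by (simp add: A(3) seg_norm)
  have "tp m lx (\<Union>i. A (h 0 + i)) c = om n m (\<lambda>i. t (h 0 + i))"
    by (subst tp_om[OF _ c1]) (use A ty in \<open>auto simp: om_norm\<close>)
  moreover have "tp m lx (\<Union>i. B i) c = om n m (\<lambda>i. seg (mul n m) t (h i) (h (Suc i) - Suc (h i)))"
  proof (subst tp_om[OF _ c2])
    fix i j :: nat assume "i < j"
    then have "h (Suc i) \<le> h j" using h by (simp add: strict_mono_less_eq)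
    then show "before lx (B i) (B j)" unfolding B_def I using A(1) unfolding before_def
      by (auto, meson le_less_trans less_le_trans, meson le_less_trans less_le_trans)
  qed (simp_all add: Bt norm_types om_norm)
  ultimately show ?thesis unfolding U by simp
qed

text \<open>Two finite chains that are long enough cannot be distinguished in \<open>m\<close> rounds: a move halves the length at
worst.\<close>

lemma eqv_chain:
  "k = l \<or> 2 ^ m \<le> Suc k \<and> 2 ^ m \<le> Suc l \<Longrightarrow>
   eqv m (<) {a..<a+k} (\<lambda>_. u) (<) {b..<b+l::nat} (\<lambda>_. u)" for a b k l :: nat
proof (induction m arbitrary: a b k l)
  case (Suc m)
  have R: "reply m (<) {a..<a+k} (\<lambda>_. u) (<) {b..<b+l} (\<lambda>_. u) (a + i) (b + j)"
    if "i < k" "j < l" "i = j \<or> 2 ^ m \<le> Suc i \<and> 2 ^ m \<le> Suc j"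
      "k - Suc i = l - Suc j \<or> 2 ^ m \<le> Suc (k - Suc i) \<and> 2 ^ m \<le> Suc (l - Suc j)" for i j k l a b
  proof -
    have 1: "{z \<in> {a..<a+k}. z < a + i} = {a..<a+i}" "{z \<in> {b..<b+l}. z < b + j} = {b..<b+j}"
       "{z \<in> {a..<a+k}. a + i < z} = {Suc (a + i)..<Suc (a+i) + (k - Suc i)}"
       "{z \<in> {b..<b+l}. b + j < z} = {Suc (b + j)..<Suc (b+j) + (l - Suc j)}"
      using that by auto
    show ?thesis
      by (rule replyI, simp) (unfold 1, (rule Suc.IH, use that in simp)+)
  qed
  have ex: "\<exists>j<l. (i = j \<or> 2 ^ m \<le> Suc i \<and> 2 ^ m \<le> Suc j) \<and>
      (k - Suc i = l - Suc j \<or> 2 ^ m \<le> Suc (k - Suc i) \<and> 2 ^ m \<le> Suc (l - Suc j))"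
    if "i < k" "k = l \<or> 2 ^ Suc m \<le> Suc k \<and> 2 ^ Suc m \<le> Suc l" for i k l :: nat
  proof (cases "k = l")
    case False
    then have g: "2 * 2 ^ m \<le> Suc k" "2 * 2 ^ m \<le> Suc l" using that(2) by auto
    define M :: nat where "M = 2 ^ m"
    have M: "M \<ge> 1" by (simp add: M_def)
    consider "Suc i < M" | "k - i < M" | "M \<le> Suc i" "M \<le> k - i" by linarith
    then show ?thesis
    proof cases
      case 1 then show ?thesis using g that(1) unfolding M_def[symmetric] by (intro exI[of _ i]) auto
    next
      case 2 then show ?thesis using g that(1) M unfolding M_def[symmetric]
        by (intro exI[of _ "l - (k - i)"]) auto
    next
      case 3 then show ?thesis using g that(1) M unfolding M_def[symmetric]
        by (intro exI[of _ "M - 1"]) auto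
    qed
  qed (use that in auto)
  show ?case unfolding eqv_Suc_iff
  proof (intro conjI ballI)
    fix x assume "x \<in> {a..<a+k}"
    then obtain i where i: "x = a + i" "i < k" by (metis atLeastLessThan_iff le_add_diff_inverse nat_add_left_cancel_less)
    from ex[OF i(2) Suc.prems] obtain j where "j < l" "i = j \<or> 2 ^ m \<le> Suc i \<and> 2 ^ m \<le> Suc j"
      "k - Suc i = l - Suc j \<or> 2 ^ m \<le> Suc (k - Suc i) \<and> 2 ^ m \<le> Suc (l - Suc j)" by blast
    from R[OF i(2) this, of a b] \<open>j < l\<close> i(1)
    show "\<exists>y\<in>{b..<b+l}. reply m (<) {a..<a+k} (\<lambda>_. u) (<) {b..<b+l} (\<lambda>_. u) x y" by auto
  next
    fix y assume "y \<in> {b..<b+l}"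
    then obtain j where j: "y = b + j" "j < l" by (metis atLeastLessThan_iff le_add_diff_inverse nat_add_left_cancel_less)
    have "l = k \<or> 2 ^ Suc m \<le> Suc l \<and> 2 ^ Suc m \<le> Suc k" using Suc.prems by auto
    from ex[OF j(2) this] obtain i where "i < k" "i = j \<or> 2 ^ m \<le> Suc i \<and> 2 ^ m \<le> Suc j"
      "k - Suc i = l - Suc j \<or> 2 ^ m \<le> Suc (k - Suc i) \<and> 2 ^ m \<le> Suc (l - Suc j)" by metis
    from R[OF this(1) j(2) this(2,3), of a b] \<open>i < k\<close> j(1)
    show "\<exists>x\<in>{a..<a+k}. reply m (<) {a..<a+k} (\<lambda>_. u) (<) {b..<b+l} (\<lambda>_. u) x y" by auto
  qed
qed simp

text \<open>Powers are sums over finite chains, so aperiodicity is inherited from \<open>eqv_chain\<close>.\<close>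

lemma seg_aperiodic: "seg (mul n m) (\<lambda>_. x) 0 (Suc (2 ^ m)) = seg (mul n m) (\<lambda>_. x) 0 (2 ^ m)"
proof -
  obtain A c where A: "\<And>i j. i < j \<Longrightarrow> before lx (A i) (A j)"
    "c ` (\<Union>i. A i) \<subseteq> {..<n}" "\<And>i::nat. tp m lx (A i) c = norm n m x" using realise[of n m "\<lambda>_. x"] by blast
  have ty: "tp m lx (A i) c \<in> types n m" for i unfolding A(3) by (rule norm_types)
  define p where "p x = (THE i. x \<in> A i)" for x
  have p: "p x = i" if "x \<in> A i" for x i unfolding p_def
  proof (rule the_equality[where P = "\<lambda>i. x \<in> A i", OF that])
    fix j assume "x \<in> A j" then show "j = i"
      using A(1)[of i j] A(1)[of j i] that unfolding before_def by (meson linorder_neqE_nat)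
  qed
  define X where "X q = (\<Union>k\<in>{0..0+q}. A k)" for q
  have fib: "{y \<in> X q. p y = i} = A i" if "i \<le> q" for i q using that p unfolding X_def by auto
  have f: "fibred lx (X q) p (<) {0..<0 + Suc q}" for q
    unfolding fibred_def
  proof (intro conjI ballI impI)
    fix x y assume xy: "x \<in> X q" "y \<in> X q" "p x \<noteq> p y"
    then have "x \<in> A (p x)" "y \<in> A (p y)" using p unfolding X_def by auto
    then show "lx x y \<longleftrightarrow> p x < p y"
      using A(1)[of "p x" "p y"] A(1)[of "p y" "p x"] xy(3) unfolding before_def by (meson linorder_neqE_nat)
  qed (auto simp: X_def p)
  have X: "tp m lx (X q) c = norm n m (seg (mul n m) (\<lambda>_. x) 0 q)" for q
    unfolding X_def using tp_seg[OF A(1,2) ty, of 0 q] by (simp add: A(3) seg_norm)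
  have cX: "c ` X q \<subseteq> {..<n}" for q using A(2) by (auto simp: X_def)
  have "tp m lx (X (Suc (2^m))) c = tp m lx (X (2^m)) c"
  proof (rule tp_sum[OF f f _ cX cX])
    show "eqv m (<) {0..<0 + Suc (Suc (2 ^ m))} (\<lambda>_. norm n m x) (<) {0..<0 + Suc (2 ^ m)} (\<lambda>_. norm n m x)"
      by (rule eqv_chain) simp
  qed (simp_all add: fib A(3))
  moreover have "norm n m (seg (mul n m) (\<lambda>_. x) 0 (Suc q)) = seg (mul n m) (\<lambda>_. x) 0 (Suc q)" for q
    by simp
  ultimately show ?thesis unfolding X
    by (metis norm_mul not0_implies_Suc power_not_zero seg.simps(2) zero_neq_numeral)
qed

section \<open>Finite aperiodic omega-algebras\<close>

text \<open>The abstract properties of the types of words: \<open>L\<close> are the types of single letters, \<open>unit\<close> is the type of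
the empty word and \<open>C\<close> is the finite set of all types.\<close>

locale omega_algebra =
  fixes mul :: "nat \<Rightarrow> nat \<Rightarrow> nat" (infixl "\<odot>" 70) and om :: "(nat \<Rightarrow> nat) \<Rightarrow> nat"
    and unit :: nat and C L :: "nat set"
  assumes assoc: "(a \<odot> b) \<odot> d = a \<odot> (b \<odot> d)"
    and unroll: "om t = t 0 \<odot> om (\<lambda>i. t (Suc i))"
    and regroup: "strict_mono h \<Longrightarrow>
      om (\<lambda>i. t (h 0 + i)) = om (\<lambda>i. seg (\<odot>) t (h i) (h (Suc i) - Suc (h i)))"
    and aperiodic: "\<exists>q. \<forall>x. seg (\<odot>) (\<lambda>_. x) 0 (Suc q) = seg (\<odot>) (\<lambda>_. x) 0 q"
    and finite_C: "finite C" and mul_C: "a \<odot> b \<in> C" and om_C: "om t \<in> C"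
    and L_C: "L \<subseteq> C" and unit_C: "unit \<in> C"
begin

abbreviation pw :: "nat \<Rightarrow> nat" where "pw e \<equiv> om (\<lambda>_. e)"

text \<open>The types generated in at most \<open>k\<close> rounds; the rank \<open>k\<close> bounds the length of a realisation by
\<open>\<omega>\<^sup>k\<close>.\<close>

inductive gen :: "nat \<Rightarrow> nat \<Rightarrow> bool" where
  gen_unit: "gen 0 unit"
| gen_letter: "a \<in> L \<Longrightarrow> gen 0 a"
| gen_mul: "gen k s \<Longrightarrow> gen k t \<Longrightarrow> gen (Suc k) (s \<odot> t)"
| gen_om: "(\<And>i. gen k (t i)) \<Longrightarrow> gen (Suc k) (om t)"
| gen_Suc: "gen k t \<Longrightarrow> gen (Suc k) t"

text \<open>The types of words of length \<open>\<omega>\<^sup>k\<close>.\<close>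

primrec S :: "nat \<Rightarrow> nat set" where
  "S 0 = L"
| "S (Suc k) = {om t | t. \<forall>i. t i \<in> S k}"

definition G :: "nat \<Rightarrow> bool" where "G t \<longleftrightarrow> (\<exists>k. gen k t)"

lemma gen_le: "k \<le> l \<Longrightarrow> gen k t \<Longrightarrow> gen l t"
  by (induction l rule: dec_induct) (auto intro: gen_Suc)

lemma G_mul: assumes "G s" "G t" shows "G (s \<odot> t)"
proof -
  obtain k l where "gen k s" "gen l t" using assms G_def by blast
  then have "gen (max k l) s" "gen (max k l) t"
    using gen_le[OF max.cobounded1] gen_le[OF max.cobounded2] by blast+
  then show ?thesis unfolding G_def using gen_mul by blast
qed

lemma G_pw: "G e \<Longrightarrow> G (pw e)"
  unfolding G_def using gen_om[of _ "\<lambda>_. e"] by blast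

lemma S_gen: "t \<in> S k \<Longrightarrow> gen k t"
proof (induction k arbitrary: t)
  case (Suc k) then show ?case by (auto intro: gen_om)
qed (simp add: gen_letter)

lemma S_G: "t \<in> S k \<Longrightarrow> G t"
  unfolding G_def using S_gen by blast

lemma S_C: "S k \<subseteq> C"
  by (cases k) (auto simp: L_C[THEN subsetD] om_C)

lemma gen_C: "gen k t \<Longrightarrow> t \<in> C"
  by (induction rule: gen.induct) (use unit_C L_C mul_C om_C in auto)

lemma seg_append: "seg (\<odot>) t i (l + Suc k) = seg (\<odot>) t i l \<odot> seg (\<odot>) t (i + Suc l) k"
  by (induction k) (simp_all add: assoc add.assoc)

lemma seg_Cons: "seg (\<odot>) t i (Suc k) = t i \<odot> seg (\<odot>) t (Suc i) k"
  using seg_append[of t i 0 k] by simp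

lemma seg_closed:
  assumes "\<And>a b. a \<in> P \<Longrightarrow> b \<in> P \<Longrightarrow> a \<odot> b \<in> P" "\<And>i. t i \<in> P"
  shows "seg (\<odot>) t i l \<in> P"
  by (induction l) (auto simp: assms)

lemma G_seg: "(\<And>i. G (t i)) \<Longrightarrow> G (seg (\<odot>) t i l)"
  using seg_closed[of "Collect G"] G_mul by blast

lemma om_split: "om t = seg (\<odot>) t 0 l \<odot> om (\<lambda>i. t (Suc l + i))"
proof (induction l)
  case 0 then show ?case using unroll[of t] by simp
next
  case (Suc l)
  show ?case unfolding Suc by (subst unroll) (simp add: assoc)
qed

text \<open>Ramsey's theorem, with a pair \<open>i < j\<close> coloured by the product of the factors from \<open>i\<close> to \<open>j - 1\<close>:
between the elements of a homogeneous set all products are the same idempotent.\<close>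

lemma om_ramsey:
  assumes t: "\<And>i. t i \<in> C"
  obtains l l' e where "om t = seg (\<odot>) t 0 l \<odot> pw e" "e \<odot> e = e" "e = seg (\<odot>) t (Suc l) l'"
    "pw e = om (\<lambda>i. t (Suc l + i))"
proof -
  define f where "f X = seg (\<odot>) t (Min X) (Max X - Suc (Min X))" for X :: "nat set"
  have "f X \<in> C" for X unfolding f_def by (rule seg_closed[OF mul_C t])
  then have fb: "f X < Suc (Max C)" for X using Max_ge[OF finite_C, of "f X"] by (simp add: less_Suc_eq_le)
  (* Starting at 1 keeps the prefix before the homogeneous set nonempty, as seg requires. *)
  have "infinite {1::nat..}" by (rule infinite_Ici)
  from Ramsey2[OF this, of f "Suc (Max C)"] fb
  obtain H e where H: "H \<subseteq> {1..}" "infinite H" "\<forall>x\<in>H. \<forall>y\<in>H. x \<noteq> y \<longrightarrow> f {x, y} = e" by blast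
  define h where "h = enumerate H"
  have h: "strict_mono h" "\<And>i. h i \<in> H"
    unfolding h_def using H(2) by (auto simp: strict_mono_enumerate enumerate_in_set)
  have e: "seg (\<odot>) t (h i) (h j - Suc (h i)) = e" if "i < j" for i j
  proof -
    have "h i < h j" using h(1) that by (simp add: strict_mono_less)
    then have "f {h i, h j} = seg (\<odot>) t (h i) (h j - Suc (h i))" unfolding f_def by simp
    then show ?thesis using H(3) h(2) \<open>h i < h j\<close> by (metis less_irrefl)
  qed
  obtain l where l: "h 0 = Suc l" using H(1) h(2)[of 0] by (cases "h 0") auto
  have 1: "pw e = om (\<lambda>i. t (Suc l + i))"
    using regroup[OF h(1), of t] e l by simp
  have lt: "h 0 < h 1" "h 1 < h 2" using h(1) by (simp_all add: strict_mono_less)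
  define x y where "x = h 1 - Suc (h 0)" and "y = h 2 - Suc (h 1)"
  have xy: "h 0 + Suc x = h 1" "h 2 - Suc (h 0) = x + Suc y" using lt unfolding x_def y_def by auto
  have "e = seg (\<odot>) t (h 0) (x + Suc y)" using e[of 0 2] xy by simp
  also have "\<dots> = seg (\<odot>) t (h 0) x \<odot> seg (\<odot>) t (h 1) y" unfolding seg_append xy ..
  also have "\<dots> = e \<odot> e" using e[of 0 1] e[of 1 2] unfolding x_def y_def by simp
  finally have 2: "e \<odot> e = e" by simp
  have 3: "e = seg (\<odot>) t (Suc l) x" using e[of 0 1] l x_def by simp
  show ?thesis using that[OF _ 2 3 1] om_split[of t l] 1 by simp
qed

text \<open>By Ramsey's theorem \<open>\<omega>\<close>-products reduce to binary products and \<open>\<omega>\<close>-powers.\<close>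

lemma om_closed:
  assumes P: "\<And>a b. a \<in> P \<Longrightarrow> b \<in> P \<Longrightarrow> a \<odot> b \<in> P" "\<And>e. e \<in> P \<Longrightarrow> pw e \<in> P" "P \<subseteq> C"
    and t: "\<And>i. t i \<in> P"
  shows "om t \<in> P"
proof -
  have "t i \<in> C" for i using P(3) t by blast
  from om_ramsey[of t, OF this] obtain l l' e where
    e: "om t = seg (\<odot>) t 0 l \<odot> pw e" "e = seg (\<odot>) t (Suc l) l'" by blast
  have "e \<in> P" unfolding e(2) by (rule seg_closed[OF P(1) t])
  then show ?thesis unfolding e(1) by (intro P seg_closed t)
qed

lemma pw_unroll: "e \<odot> pw e = pw e"
  using unroll[of "\<lambda>_. e"] by simp

lemma pw_rotate: "pw (x \<odot> y) = x \<odot> pw (y \<odot> x)"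
proof -
  have alt: "om (\<lambda>i. if even i then x else y) = pw (x \<odot> y)" for x y
  proof -
    have "strict_mono (\<lambda>i::nat. 2 * i)" by (simp add: strict_mono_def)
    from regroup[OF this, of "\<lambda>i. if even i then x else y"] show ?thesis by simp
  qed
  show ?thesis
  proof -
    have "(\<lambda>i. if even (Suc i) then x else y) = (\<lambda>i. if even i then y else x)" by auto
    then show ?thesis
      using unroll[of "\<lambda>i. if even i then x else y"] alt[of x y] alt[of y x] by simp
  qed
qed

lemma seg_const_comm: "x \<odot> seg (\<odot>) (\<lambda>_. x) 0 q = seg (\<odot>) (\<lambda>_. x) 0 (Suc q)"
proof (induction q)
  case (Suc q) then show ?case by (simp add: assoc[symmetric])
qed simp

text \<open>Iterating the equation gives \<open>f = w\<^sup>q \<cdot> f \<cdot> y\<^sup>q\<close>, and aperiodicity allows one more factor \<open>y\<close> on the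
right when \<open>q\<close> is large.\<close>

lemma absorb:
  assumes "f = w \<odot> (f \<odot> y)" shows "f \<odot> y = f"
proof -
  obtain q where q: "\<And>x. seg (\<odot>) (\<lambda>_. x) 0 (Suc q) = seg (\<odot>) (\<lambda>_. x) 0 q" using aperiodic by blast
  have 1: "f = seg (\<odot>) (\<lambda>_. w) 0 k \<odot> (f \<odot> seg (\<odot>) (\<lambda>_. y) 0 k)" for k
  proof (induction k)
    case (Suc k)
    have "f = seg (\<odot>) (\<lambda>_. w) 0 k \<odot> ((w \<odot> (f \<odot> y)) \<odot> seg (\<odot>) (\<lambda>_. y) 0 k)"
      using Suc assms by simp
    also have "\<dots> = (seg (\<odot>) (\<lambda>_. w) 0 k \<odot> w) \<odot> (f \<odot> (y \<odot> seg (\<odot>) (\<lambda>_. y) 0 k))"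
      by (simp only: assoc)
    finally show ?case unfolding seg_const_comm by simp
  qed (use assms in simp)
  have "f \<odot> y = seg (\<odot>) (\<lambda>_. w) 0 q \<odot> (f \<odot> seg (\<odot>) (\<lambda>_. y) 0 (Suc q))"
    by (subst 1[of q]) (simp add: assoc)
  also have "\<dots> = f" unfolding q using 1[of q] by simp
  finally show ?thesis .
qed

text \<open>With \<open>F k = (E k)\<^sup>\<omega>\<close>, the equation for \<open>E\<close> yields \<open>F (k + 1) = Z k \<cdot> F k \<cdot> F (k + 1)\<close>. Going once
around the cycle and applying \<open>absorb\<close>, the product of all \<open>F\<close> in a round is absorbed by each of them, and a
rotation shows that \<open>F (k + 1)\<close> also absorbs \<open>F (k + 2)\<close>. Then the product of a round, which is \<open>E (k + 1)\<close>,
collapses to \<open>F (k + 1)\<close>.\<close>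

lemma cycle:
  assumes per: "\<And>k. E (k + p) = E k" and p: "p > 0"
    and E: "\<And>k. E (Suc k) = Z k \<odot> pw (E k)"
  shows "pw (E k) = E k"
proof -
  define F where "F k = pw (E k)" for k
  (* Two rounds of the cycle, so that at least two factors are available when p = 1. *)
  obtain q where q: "2 * p = Suc (Suc q)" using p by (metis Suc_double_not_eq_double gr0_implies_Suc mult_2 add_Suc add_Suc_right)
  have perE: "E (k + Suc (Suc q)) = E k" for k
    unfolding q[symmetric] using per[of k] per[of "k + p"] by (simp add: mult_2 add.assoc)
  have F2: "F (Suc k) = Z k \<odot> (F k \<odot> F (Suc k))" for k
    using pw_unroll[of "E (Suc k)"] E[of k] unfolding F_def by (simp add: assoc)
  have F3: "\<exists>W. F (k + Suc l) = W \<odot> (F k \<odot> seg (\<odot>) F (Suc k) l)" for k l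
  proof (induction l)
    case 0 then show ?case using F2[of k] by auto
  next
    case (Suc l)
    then obtain W where "F (k + Suc l) = W \<odot> (F k \<odot> seg (\<odot>) F (Suc k) l)" by blast
    then have "F (k + Suc (Suc l)) = (Z (k + Suc l) \<odot> W) \<odot> (F k \<odot> seg (\<odot>) F (Suc k) (Suc l))"
      using F2[of "k + Suc l"] by (simp add: assoc)
    then show ?case by blast
  qed
  have F4: "F k \<odot> seg (\<odot>) F (Suc k) (Suc q) = F k" for k
  proof -
    have "F (k + Suc (Suc q)) = F k" unfolding F_def perE ..
    then show ?thesis using F3[of k "Suc q"] absorb by metis
  qed
  have E5: "E (Suc k) = seg (\<odot>) F (Suc k) (Suc q)" for k
  proof -
    have "E (Suc k) = Z k \<odot> (F k \<odot> seg (\<odot>) F (Suc k) (Suc q))" using E F4 unfolding F_def by simp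
    also have "\<dots> = (Z k \<odot> (F k \<odot> F (Suc k))) \<odot> seg (\<odot>) F (Suc (Suc k)) q"
      unfolding seg_Cons by (simp only: assoc)
    also have "\<dots> = seg (\<odot>) F (Suc k) (Suc q)" unfolding F2[symmetric] seg_Cons ..
    finally show ?thesis .
  qed
  have F6: "F (Suc k) = F (Suc k) \<odot> F (Suc (Suc k))" for k
  proof -
    have "F (Suc k) = F (k + Suc (Suc (Suc q)))" unfolding F_def using perE[of "Suc k"] by simp
    then have "seg (\<odot>) F (Suc (Suc k)) q \<odot> F (Suc k) = E (Suc (Suc k))"
      unfolding E5[of "Suc k"] by simp
    moreover have "E (Suc k) = F (Suc k) \<odot> seg (\<odot>) F (Suc (Suc k)) q"
      using E5[of k] unfolding seg_Cons .
    then have "F (Suc k) = pw (F (Suc k) \<odot> seg (\<odot>) F (Suc (Suc k)) q)"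
      using F_def[of "Suc k"] by simp
    ultimately show ?thesis
      using pw_rotate[of "F (Suc k)" "seg (\<odot>) F (Suc (Suc k)) q"] F_def[of "Suc (Suc k)"] by simp
  qed
  have F7: "seg (\<odot>) F (Suc k) l = F (Suc k) \<and> F (Suc k) \<odot> F (Suc (Suc k + l)) = F (Suc k)" for k l
  proof (induction l)
    case 0 show ?case using F6[of k] by simp
  next
    case (Suc l)
    have "F (Suc k) \<odot> F (Suc (Suc k + Suc l)) = (F (Suc k) \<odot> F (Suc (Suc k + l))) \<odot> F (Suc (Suc k + Suc l))"
      using Suc by simp
    also have "\<dots> = F (Suc k) \<odot> (F (Suc (Suc k + l)) \<odot> F (Suc (Suc (Suc k + l))))"
      unfolding assoc by simp
    also have "\<dots> = F (Suc k)" using Suc F6[of "Suc k + l"] by simp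
    finally show ?case using Suc by simp
  qed
  have "F (Suc k) = E (Suc k)" for k using E5[of k] F7[of k "Suc q"] by simp
  from this[of "k + Suc q"] show ?thesis using perE[of k] unfolding F_def by simp
qed

text \<open>A word of length \<open>\<omega>\<^bsup>K+1\<^esup>\<close> is an \<open>\<omega>\<close>-sequence of words of length \<open>\<omega>\<^sup>K\<close>. Ramsey's theorem
makes it \<open>z \<cdot> e\<^sup>\<omega>\<close> for an idempotent \<open>e\<close>, and \<open>e\<close> ends in one of the shorter words, to which the same applies.\<close>

lemma tower:
  "u \<in> S (Suc K) \<Longrightarrow> \<exists>e z. (\<forall>k\<le>K. e k \<odot> e k = e k \<and> pw (e k) \<in> S (Suc k) \<and> G (z k)) \<and>
     (\<forall>k<K. e (Suc k) = z k \<odot> pw (e k)) \<and> u = z K \<odot> pw (e K)"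
proof (induction K arbitrary: u)
  case 0
  then obtain t where t: "u = om t" "\<And>i. t i \<in> S 0" by auto
  then have "t i \<in> C" for i using S_C by blast
  from om_ramsey[of t, OF this] obtain l l' e where
    e: "om t = seg (\<odot>) t 0 l \<odot> pw e" "e \<odot> e = e" "e = seg (\<odot>) t (Suc l) l'"
    "pw e = om (\<lambda>i. t (Suc l + i))" by blast
  have "G (t i)" for i using S_G t(2) by blast
  then have "G (seg (\<odot>) t 0 l)" by (rule G_seg)
  moreover have "pw e \<in> S (Suc 0)"
    using e(4) t(2) by (auto intro!: exI[of _ "\<lambda>i. t (Suc l + i)"])
  ultimately show ?case using e(1,2) t(1) by (intro exI[of _ "\<lambda>_. e"] exI[of _ "\<lambda>_. seg (\<odot>) t 0 l"]) simp
next
  case (Suc K)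
  then obtain t where t: "u = om t" "\<And>i. t i \<in> S (Suc K)" by auto
  then have "t i \<in> C" for i using S_C by blast
  from om_ramsey[of t, OF this] obtain l l' e' where
    e: "om t = seg (\<odot>) t 0 l \<odot> pw e'" "e' \<odot> e' = e'" "e' = seg (\<odot>) t (Suc l) l'"
    "pw e' = om (\<lambda>i. t (Suc l + i))" by blast
  have "G (t i)" for i using S_G t(2) by blast
  then have gs: "G (seg (\<odot>) t i k)" for i k by (rule G_seg)
  have pe: "pw e' \<in> S (Suc (Suc K))"
    unfolding S.simps(2)[of "Suc K"] mem_Collect_eq using e(4) t(2) by blast
  obtain a j where a: "e' = a \<odot> t j" "G a"
  proof (cases l')
    case 0
    then have "e' = e' \<odot> t (Suc l)" using e(2,3) by simp
    then show ?thesis using that[of e' "Suc l"] gs[of "Suc l" l'] e(3) by simp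
  next
    case (Suc k) then show ?thesis using that[OF _ gs[of "Suc l" k]] e(3) by simp
  qed
  from Suc.IH[OF t(2)[of j]] obtain d z where
    d: "\<forall>k\<le>K. d k \<odot> d k = d k \<and> pw (d k) \<in> S (Suc k) \<and> G (z k)"
     "\<forall>k<K. d (Suc k) = z k \<odot> pw (d k)" "t j = z K \<odot> pw (d K)" by blast
  define D where "D = d(Suc K := e')"
  define Y where "Y = z(K := a \<odot> z K, Suc K := seg (\<odot>) t 0 l)"
  have "e' = (a \<odot> z K) \<odot> pw (d K)" using a(1) d(3) by (simp add: assoc)
  then have "\<forall>k<Suc K. D (Suc k) = Y k \<odot> pw (D k)"
    using d(2) by (auto simp: D_def Y_def less_Suc_eq)
  moreover have "\<forall>k\<le>Suc K. D k \<odot> D k = D k \<and> pw (D k) \<in> S (Suc k) \<and> G (Y k)"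
    using d(1) e(2) pe gs a(2) G_mul by (auto simp: D_def Y_def le_Suc_eq simp del: S.simps)
  moreover have "u = Y (Suc K) \<odot> pw (D (Suc K))" using t(1) e(1) by (simp add: D_def Y_def)
  ultimately show ?case by blast
qed

text \<open>In a tower that is higher than the number of types two idempotents coincide, and the tower between them is a
cycle; so the repeated idempotent equals its own \<open>\<omega>\<close>-power.\<close>

lemma pump:
  assumes u: "u \<in> S (Suc (card C))"
  obtains a b e j where "u = a \<odot> (e \<odot> b)" "e \<odot> e = e" "pw e = e" "e \<in> S j" "G a" "G b"
proof -
  define K where "K = card C"
  from tower u obtain e z where
    ez: "\<And>k. k \<le> K \<Longrightarrow> e k \<odot> e k = e k" "\<And>k. k \<le> K \<Longrightarrow> pw (e k) \<in> S (Suc k)" "\<And>k. k \<le> K \<Longrightarrow> G (z k)"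
     "\<And>k. k < K \<Longrightarrow> e (Suc k) = z k \<odot> pw (e k)" "u = z K \<odot> pw (e K)"
    unfolding K_def by blast
  have "e ` {..K} \<subseteq> C" using ez(1) mul_C by (metis atMost_iff image_subsetI)
  then have "card (e ` {..K}) \<le> K" unfolding K_def by (rule card_mono[OF finite_C])
  then have "\<not> inj_on e {..K}" using card_image[of e "{..K}"] by auto
  then obtain i j where ij: "i < j" "j \<le> K" "e i = e j"
    unfolding inj_on_def by (metis atMost_iff linorder_neqE_nat)
  define p where "p = j - i"
  have p: "p > 0" using ij p_def by simp
  have "pw (e (i + 0 mod p)) = e (i + 0 mod p)"
  proof (rule cycle[of "\<lambda>k. e (i + k mod p)" p "\<lambda>k. z (i + k mod p)"])
    fix k
    show "e (i + Suc k mod p) = z (i + k mod p) \<odot> pw (e (i + k mod p))"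
    proof (cases "Suc (k mod p) = p")
      case True
      then have "Suc k mod p = 0" by (simp add: mod_Suc)
      moreover have "Suc (i + k mod p) = j" using True ij p_def by simp
      ultimately show ?thesis using ez(4)[of "i + k mod p"] ij by simp
    next
      case False
      then have "Suc k mod p = Suc (k mod p)" by (simp add: mod_Suc)
      moreover have "i + k mod p < K" using p ij mod_less_divisor[OF p, of k] unfolding p_def by linarith
      ultimately show ?thesis using ez(4)[of "i + k mod p"] by simp
    qed
  qed (use p in auto)
  then have fx: "pw (e i) = e i" by simp
  (* Since pw (e (k + 1)) = e (k + 1) . pw (e (k + 1)) and e (k + 1) = z k . pw (e k), every
     pw (e k) of the tower is a factor of u. *)
  have "\<exists>a b. u = a \<odot> (pw (e (K - Suc d)) \<odot> b) \<and> G a \<and> G b" if "d < K" for d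
    using that
  proof (induction d)
    case 0
    define k where "k = K - 1"
    then have k: "Suc k = K" using 0 by simp
    have "pw (e K) = z k \<odot> (pw (e k) \<odot> pw (e K))"
      using pw_unroll[of "e K"] ez(4)[of k] k by (simp add: assoc)
    then have "u = (z K \<odot> z k) \<odot> (pw (e k) \<odot> pw (e K))" using ez(5) by (simp add: assoc)
    moreover have "G (z K \<odot> z k)" "G (pw (e K))" using ez(2,3) k by (auto intro: G_mul S_G simp del: S.simps)
    ultimately show ?case unfolding k_def by (metis One_nat_def)
  next
    case (Suc d)
    then obtain a b where ab: "u = a \<odot> (pw (e (K - Suc d)) \<odot> b)" "G a" "G b" by auto
    define k where "k = K - Suc (Suc d)"
    then have k: "Suc k = K - Suc d" "k < K" using Suc.prems by auto
    have "pw (e (Suc k)) = z k \<odot> (pw (e k) \<odot> pw (e (Suc k)))"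
      using pw_unroll[of "e (Suc k)"] ez(4)[of k] k by (simp add: assoc)
    then have "u = (a \<odot> z k) \<odot> (pw (e k) \<odot> (pw (e (Suc k)) \<odot> b))"
      using ab(1) k by (metis assoc)
    moreover have "G (a \<odot> z k)" "G (pw (e (Suc k)) \<odot> b)"
      using ez(2)[of "Suc k"] ez(3)[of k] k ab by (auto intro!: G_mul intro: S_G simp del: S.simps)
    ultimately show ?case unfolding k_def by blast
  qed
  from this[of "K - Suc i"] ij obtain a b where "u = a \<odot> (pw (e i) \<odot> b)" "G a" "G b"
    by (auto simp: Suc_diff_Suc)
  moreover have "e i \<in> S (Suc i)" using ez(2)[of i] fx ij by simp
  moreover have "e i \<odot> e i = e i" using ez(1)[of i] ij by simp
  ultimately show ?thesis using fx by (intro that[of a "e i" b "Suc i"]) simp_all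
qed

end

section \<open>Types of words on well-orders\<close>

definition wo :: "('i \<Rightarrow> 'i \<Rightarrow> bool) \<Rightarrow> 'i set \<Rightarrow> bool" where
  "wo R J \<longleftrightarrow> (\<forall>x\<in>J. \<not> R x x) \<and> (\<forall>x\<in>J. \<forall>y\<in>J. \<forall>z\<in>J. R x y \<longrightarrow> R y z \<longrightarrow> R x z) \<and>
     (\<forall>K\<subseteq>J. K \<noteq> {} \<longrightarrow> (\<exists>x\<in>K. \<forall>y\<in>K. x \<noteq> y \<longrightarrow> R x y))"

lemma woD:
  assumes "wo R J"
  shows "x \<in> J \<Longrightarrow> \<not> R x x" "x \<in> J \<Longrightarrow> y \<in> J \<Longrightarrow> z \<in> J \<Longrightarrow> R x y \<Longrightarrow> R y z \<Longrightarrow> R x z"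
    "K \<subseteq> J \<Longrightarrow> K \<noteq> {} \<Longrightarrow> \<exists>x\<in>K. \<forall>y\<in>K. x \<noteq> y \<longrightarrow> R x y"
    "x \<in> J \<Longrightarrow> y \<in> J \<Longrightarrow> x \<noteq> y \<Longrightarrow> R x y \<or> R y x"
    "x \<in> J \<Longrightarrow> y \<in> J \<Longrightarrow> R x y \<Longrightarrow> \<not> R y x"
proof -
  note w = assms[unfolded wo_def]
  show 1: "x \<in> J \<Longrightarrow> \<not> R x x" for x using w by blast
  show 2: "x \<in> J \<Longrightarrow> y \<in> J \<Longrightarrow> z \<in> J \<Longrightarrow> R x y \<Longrightarrow> R y z \<Longrightarrow> R x z" for x y z using w by blast
  show 3: "K \<subseteq> J \<Longrightarrow> K \<noteq> {} \<Longrightarrow> \<exists>x\<in>K. \<forall>y\<in>K. x \<noteq> y \<longrightarrow> R x y" for K using w by blast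
  show "x \<in> J \<Longrightarrow> y \<in> J \<Longrightarrow> x \<noteq> y \<Longrightarrow> R x y \<or> R y x" using 3[of "{x, y}"] by auto
  show "x \<in> J \<Longrightarrow> y \<in> J \<Longrightarrow> R x y \<Longrightarrow> \<not> R y x" using 1 2 by blast
qed

lemma wo_sub: "wo R J \<Longrightarrow> K \<subseteq> J \<Longrightarrow> wo R K"
  unfolding wo_def by (meson subsetD order_trans)

text \<open>If no sequence is cofinal in \<open>J\<close>, a closing-off argument as for the Loewenheim-Skolem theorem finds
a proper initial segment that is equivalent to \<open>J\<close>.\<close>

lemma reflection:
  fixes R :: "'i \<Rightarrow> 'i \<Rightarrow> bool" and l :: "'i \<Rightarrow> nat"
  assumes wo: "wo R J" and ne: "J \<noteq> {}" and l: "l ` J \<subseteq> {..<N}"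
    and unb: "\<And>s :: nat \<Rightarrow> 'i. range s \<subseteq> J \<Longrightarrow> \<exists>z\<in>J. \<forall>i. R (s i) z"
  shows "\<exists>z\<in>J. eqv m R {x \<in> J. R x z} l R J l"
proof -
  note w = woD[OF wo]
  define B where "B a b = {u \<in> J. R a u \<and> R u b}" for a b
  define A where "A a = {u \<in> J. R a u}" for a
  (* T a x is what a reply to the move x must reproduce in the game on the points above a. *)
  define T where "T a x = (tp m R (B a x) l, l x, tp m R (A x) l)" for a x
  have bnd: "\<exists>h\<in>J. R a h \<and> (\<forall>x\<in>K. R x h)" if "finite K" "K \<subseteq> J" "a \<in> J" for K a
    using that
  proof (induction K rule: finite_induct)
    case empty
    then show ?case using unb[of "\<lambda>_. a"] by auto
  next
    case (insert x K)
    then obtain h where h: "h \<in> J" "R a h" "\<forall>x\<in>K. R x h" by auto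
    have "range (\<lambda>i::nat. if i = 0 then h else x) \<subseteq> J" using h(1) insert.prems by auto
    from unb[OF this] obtain z where zz: "z \<in> J" "\<And>i::nat. R (if i = 0 then h else x) z" by blast
    have z: "z \<in> J" "R h z" "R x z" using zz(1) zz(2)[of 0] zz(2)[of 1] by auto
    have "R y z" if "y \<in> insert a K" for y
      using w(2)[of y h z] that h z insert.prems by auto
    then show ?case using z by auto
  qed
  have "\<exists>h\<in>J. R a h \<and> (\<forall>y\<in>A a. \<exists>x\<in>J. R a x \<and> R x h \<and> T a x = T a y)" if a: "a \<in> J" for a
  proof -
    have "T a y \<in> codes N m \<times> {..<N} \<times> codes N m" if "y \<in> A a" for y
      using that l unfolding T_def A_def B_def by (auto intro!: tp_codes)
    then have "finite (T a ` A a)"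
      using finite_subset[of "T a ` A a" "codes N m \<times> {..<N} \<times> codes N m"] finite_codes by auto
    then obtain K where K: "K \<subseteq> A a" "finite K" "T a ` A a = T a ` K"
      using finite_subset_image[of "T a ` A a" "T a" "A a"] by auto
    obtain h where h: "h \<in> J" "R a h" "\<forall>x\<in>K. R x h" using bnd[OF K(2) _ a] K(1) A_def by auto
    have "\<exists>x\<in>J. R a x \<and> R x h \<and> T a x = T a y" if "y \<in> A a" for y
    proof -
      have "T a y \<in> T a ` K" using that K(3) by blast
      then obtain x where "x \<in> K" "T a x = T a y" by auto
      then show ?thesis using K(1) h(3) unfolding A_def by blast
    qed
    then show ?thesis using h by blast
  qed
  (* H a is a bound below which every T a y is attained; the supremum z of the iterates of H has the
     property that no move beyond z is better than some move below z. *)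
  then obtain H where H: "\<And>a. a \<in> J \<Longrightarrow> H a \<in> J" "\<And>a. a \<in> J \<Longrightarrow> R a (H a)"
    "\<And>a y. a \<in> J \<Longrightarrow> y \<in> A a \<Longrightarrow> \<exists>x\<in>J. R a x \<and> R x (H a) \<and> T a x = T a y" by metis
  obtain a0 where a0: "a0 \<in> J" "\<And>y. y \<in> J \<Longrightarrow> a0 \<noteq> y \<Longrightarrow> R a0 y" using w(3)[of J] ne by blast
  define s where "s i = (H ^^ i) a0" for i
  have s: "s i \<in> J" for i by (induction i) (auto simp: s_def a0 H)
  have sS: "s (Suc i) = H (s i)" for i by (simp add: s_def)
  define U where "U = {z \<in> J. \<forall>i. R (s i) z}"
  have "U \<noteq> {}" using unb[of s] s unfolding U_def by auto
  then obtain z where z: "z \<in> U" "\<And>y. y \<in> U \<Longrightarrow> z \<noteq> y \<Longrightarrow> R z y" using w(3)[of U] U_def by blast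
  have zJ: "z \<in> J" and sz: "\<And>i. R (s i) z" using z(1) U_def by auto
  have cl: "eqv k R (B a z) l R (A a) l" if "k \<le> m" "a \<in> J" "R a z" for k a
    using that
  proof (induction k arbitrary: a)
    case (Suc k)
    have 1: "{u \<in> B a z. R u x} = B a x" "{u \<in> B a z. R x u} = B x z"
      if "x \<in> J" "R a x" "R x z" for x
    proof -
      have "R a u \<and> R u z \<and> R u x \<longleftrightarrow> R a u \<and> R u x" "R a u \<and> R u z \<and> R x u \<longleftrightarrow> R x u \<and> R u z"
        if "u \<in> J" for u
        using w(2)[of u x z] w(2)[of a x u] \<open>u \<in> J\<close> \<open>x \<in> J\<close> \<open>R a x\<close> \<open>R x z\<close> zJ Suc.prems by blast+
      then show "{u \<in> B a z. R u x} = B a x" "{u \<in> B a z. R x u} = B x z" unfolding B_def by blast+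
    qed
    have 2: "{u \<in> A a. R u y} = B a y" "{u \<in> A a. R y u} = A y" if "y \<in> J" "R a y" for y
    proof -
      have "R a u \<and> R y u \<longleftrightarrow> R y u" if "u \<in> J" for u
        using w(2)[of a y u] \<open>u \<in> J\<close> \<open>y \<in> J\<close> \<open>R a y\<close> Suc.prems by blast
      then show "{u \<in> A a. R u y} = B a y" "{u \<in> A a. R y u} = A y" unfolding A_def B_def by blast+
    qed
    have same: "reply k R (B a z) l R (A a) l x x" if "x \<in> J" "R a x" "R x z" for x
      by (rule replyI; (unfold 1[OF that] 2[OF that(1,2)])?)
        (use Suc.IH[of x] Suc.prems that eqv_refl in auto)
    have far: "\<exists>x\<in>B a z. reply k R (B a z) l R (A a) l x y" if y: "y \<in> A a" "\<not> R y z" for y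
    proof -
      have yJ: "y \<in> J" "R a y" using y A_def by auto
      have "a \<notin> U" using z(2)[of a] Suc.prems w(1)[of a] w(5)[of a z] zJ by blast
      then obtain i where i: "\<not> R (s i) a" using Suc.prems U_def by blast
      define b where "b = s (Suc i)"
      have b: "b \<in> J" "R b z" "R (s i) b" using s sz H(2)[OF s[of i]] unfolding b_def sS[symmetric] by auto
      have ab: "R a b"
      proof (cases "s i = a")
        case False
        then have "R a (s i)" using w(4)[of a "s i"] s Suc.prems i by blast
        then show ?thesis using w(2)[of a "s i" b] b s Suc.prems by blast
      qed (use b in simp)
      have zy: "z = y \<or> R z y" using w(4)[of z y] zJ yJ y by blast
      then have bly: "R b y" using w(2)[of b z y] b zJ yJ by auto
      obtain x where x: "x \<in> J" "R b x" "R x (H b)" "T b x = T b y"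
        using H(3)[OF b(1), of y] bly yJ A_def by auto
      have xz: "R x z" using w(2)[of x "H b" z] x(1,3) sz[of "Suc (Suc i)"] H(1)[OF b(1)] zJ
        unfolding b_def sS by simp
      have ax: "R a x" using w(2)[of a b x] ab x b Suc.prems by blast
      have BJ: "l ` B p q \<subseteq> {..<N}" "l ` A p \<subseteq> {..<N}" for p q using l unfolding B_def A_def by auto
      have t: "eqv m R (B b x) l R (B b y) l" "l x = l y" "eqv m R (A x) l R (A y) l"
        using x(4) unfolding T_def by (simp_all add: tp_eq_iff[OF BJ(1) BJ(1)] tp_eq_iff[OF BJ(2) BJ(2)])
      have "k \<le> m" using Suc.prems by simp
      have sp: "B a v = {u \<in> J. R a u \<and> (R u b \<or> u = b)} \<union> B b v"
          "before R {u \<in> J. R a u \<and> (R u b \<or> u = b)} (B b v)" if "v \<in> J" "R b v" for v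
      proof -
        show "B a v = {u \<in> J. R a u \<and> (R u b \<or> u = b)} \<union> B b v"
        proof -
          have "R a u \<and> R u v \<longleftrightarrow> R a u \<and> (R u b \<or> u = b) \<or> R b u \<and> R u v" if "u \<in> J" for u
            using w(4)[of u b] w(2)[of u b v] w(2)[of a b u] \<open>u \<in> J\<close> \<open>v \<in> J\<close> \<open>R b v\<close> ab b(1) Suc.prems by blast
          then show ?thesis unfolding B_def by blast
        qed
        show "before R {u \<in> J. R a u \<and> (R u b \<or> u = b)} (B b v)"
          unfolding before_def
        proof (intro ballI)
          fix p q assume "p \<in> {u \<in> J. R a u \<and> (R u b \<or> u = b)}" "q \<in> B b v"
          then have pq: "p \<in> J" "q \<in> J" "R b q" "R p b \<or> p = b" unfolding B_def by auto
          then have "R p q" using w(2)[of p b q] b by blast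
          then show "R p q \<and> \<not> R q p" using w(5)[of p q] pq by blast
        qed
      qed
      have "eqv k R (B a x) l R (B a y) l"
        unfolding sp(1)[OF x(1,2)] sp(1)[OF yJ(1) bly]
        by (rule eqv_union[OF sp(2)[OF x(1,2)] sp(2)[OF yJ(1) bly] eqv_refl eqv_le[OF \<open>k \<le> m\<close> t(1)]])
      moreover have "eqv k R (B x z) l R (A y) l"
        using eqv_trans[OF Suc.IH[OF \<open>k \<le> m\<close> x(1) xz] eqv_le[OF \<open>k \<le> m\<close> t(3)]] .
      ultimately have "reply k R (B a z) l R (A a) l x y"
        by (intro replyI; (unfold 1[OF x(1) ax xz] 2[OF yJ])?) (use t in auto)
      moreover have "x \<in> B a z" using x ax xz B_def by auto
      ultimately show ?thesis by blast
    qed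
    show ?case unfolding eqv_Suc_iff
    proof (intro conjI ballI)
      fix x assume x: "x \<in> B a z"
      then have "x \<in> A a" by (simp add: A_def B_def)
      moreover have "reply k R (B a z) l R (A a) l x x" by (rule same) (use x B_def in auto)
      ultimately show "\<exists>y\<in>A a. reply k R (B a z) l R (A a) l x y" by blast
    next
      fix y assume y: "y \<in> A a"
      show "\<exists>x\<in>B a z. reply k R (B a z) l R (A a) l x y"
      proof (cases "R y z")
        case True
        then have "y \<in> B a z" using y by (simp add: A_def B_def)
        moreover have "reply k R (B a z) l R (A a) l y y" by (rule same) (use True y A_def in auto)
        ultimately show ?thesis by blast
      qed (rule far[OF y])
    qed
  qed simp
  have a0z: "R a0 z" using sz[of 0] by (simp add: s_def)
  have "{x \<in> J. R x z} = {a0} \<union> B a0 z" "J = {a0} \<union> A a0"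
    using a0 a0z unfolding B_def A_def by blast+
  moreover have "eqv m R ({a0} \<union> B a0 z) l R ({a0} \<union> A a0) l"
    by (rule eqv_union[OF _ _ eqv_refl cl[OF order_refl a0(1) a0z]])
       (use w(5) a0(1) in \<open>auto simp: before_def B_def A_def\<close>)
  ultimately show ?thesis using zJ by metis
qed

definition letters :: "nat \<Rightarrow> nat \<Rightarrow> nat set" where
  "letters n m = (\<lambda>a. tp m lx {[]} (\<lambda>_. a)) ` {..<n}"

lemma tp_single:
  assumes "\<not> R x x" "c x < n" shows "tp m R {x} c = tp m lx {[]} (\<lambda>_. c x)" "tp m R {x} c \<in> letters n m"
proof -
  show 1: "tp m R {x} c = tp m lx {[]} (\<lambda>_. c x)"
    by (subst tp_eq_iff[where n = n]) (use assms in \<open>auto intro!: eqv_single\<close>)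
  show "tp m R {x} c \<in> letters n m" unfolding 1 letters_def using assms(2) by blast
qed

locale word_types = fixes n m :: nat
begin

sublocale W: omega_algebra "mul n m" "om n m" 0 "types n m" "letters n m"
proof
  show "finite (types n m)" using finite_subset[OF types_codes finite_codes] .
  show "letters n m \<subseteq> types n m" unfolding letters_def by (auto intro!: tp_canonical)
  show "\<exists>q. \<forall>x. seg (mul n m) (\<lambda>_. x) 0 (Suc q) = seg (mul n m) (\<lambda>_. x) 0 q"
    using seg_aperiodic by blast
qed (rule mul_assoc om_unroll om_regroup mul_types om_types zero_in_types; assumption?)+

text \<open>Induction along the index order. At a limit of cofinality \<open>\<omega>\<close> the sum is an \<open>\<omega>\<close>-product of shorter sums,
and at a limit of larger cofinality it has the type of a proper initial part, by reflection in the index order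
coloured by the types of the fibres.\<close>

lemma tp_wo_sum:
  fixes Q :: "'i \<Rightarrow> 'i \<Rightarrow> bool"
  assumes f: "fibred R X p Q I" and wo: "wo Q I" and c: "c ` X \<subseteq> {..<n}"
    and P: "0 \<in> P" "P \<subseteq> types n m" "\<And>a b. a \<in> P \<Longrightarrow> b \<in> P \<Longrightarrow> mul n m a b \<in> P" "\<And>e. e \<in> P \<Longrightarrow> W.pw e \<in> P"
    and fib: "\<And>i. i \<in> I \<Longrightarrow> tp m R {x \<in> X. p x = i} c \<in> P"
  shows "tp m R X c \<in> P"
proof -
  define Y where "Y J = {x \<in> X. p x \<in> J}" for J :: "'i set"
  have cY: "c ` Y J \<subseteq> {..<n}" for J using c Y_def by auto
  have bY: "before R (Y J) (Y K)" if "before Q J K" "J \<subseteq> I" "K \<subseteq> I" for J K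
    unfolding before_def
  proof (intro ballI)
    fix a b assume ab: "a \<in> Y J" "b \<in> Y K"
    then have q: "Q (p a) (p b)" "\<not> Q (p b) (p a)" using that(1) unfolding Y_def before_def by auto
    have "p a \<noteq> p b" using q by metis
    then show "R a b \<and> \<not> R b a" using fibredD(3)[OF f] ab q unfolding Y_def by (metis (no_types, lifting) mem_Collect_eq)
  qed
  have step: "tp m R (Y J) c \<in> P"
    if J: "J \<subseteq> I" and IH: "\<And>z K. z \<in> J \<Longrightarrow> K \<subseteq> {i \<in> J. Q i z} \<Longrightarrow> tp m R (Y K) c \<in> P" for J
  proof -
    note w = woD[OF wo_sub[OF wo J]]
    consider "J = {}" | z where "z \<in> J" "\<forall>i\<in>J. i \<noteq> z \<longrightarrow> Q i z"
      | s where "range s \<subseteq> J" "\<forall>z\<in>J. \<exists>i::nat. Q z (s i)"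
      | "J \<noteq> {}" "\<And>s :: nat \<Rightarrow> _. range s \<subseteq> J \<Longrightarrow> \<exists>z\<in>J. \<forall>i. Q (s i) z"
    proof -
      assume a: "J = {} \<Longrightarrow> thesis" "\<And>z. \<lbrakk>z \<in> J; \<forall>i\<in>J. i \<noteq> z \<longrightarrow> Q i z\<rbrakk> \<Longrightarrow> thesis"
        "\<And>s. \<lbrakk>range s \<subseteq> J; \<forall>z\<in>J. \<exists>i::nat. Q z (s i)\<rbrakk> \<Longrightarrow> thesis"
        "\<lbrakk>J \<noteq> {}; \<And>s :: nat \<Rightarrow> _. range s \<subseteq> J \<Longrightarrow> \<exists>z\<in>J. \<forall>i. Q (s i) z\<rbrakk> \<Longrightarrow> thesis"
      show thesis
      proof (cases "J = {} \<or> (\<exists>z\<in>J. \<forall>i\<in>J. i \<noteq> z \<longrightarrow> Q i z)")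
        case True then show ?thesis using a(1,2) by blast
      next
        case False
        then have nomax: "\<exists>i\<in>J. Q z i" if "z \<in> J" for z using that w(4) by metis
        show ?thesis
        proof (cases "\<forall>s :: nat \<Rightarrow> _. range s \<subseteq> J \<longrightarrow> (\<exists>z\<in>J. \<forall>i. Q (s i) z)")
          case True then show ?thesis using a(4) False by blast
        next
          case F2: False
          then obtain s :: "nat \<Rightarrow> _" where s: "range s \<subseteq> J" "\<And>z. z \<in> J \<Longrightarrow> \<exists>i. \<not> Q (s i) z" by blast
          have "\<exists>i. Q z (s i)" if z: "z \<in> J" for z
          proof -
            obtain y where y: "y \<in> J" "Q z y" using nomax z by blast
            obtain i where i: "\<not> Q (s i) y" using s(2) y by blast
            have "s i \<in> J" using s(1) by blast
            then have "y = s i \<or> Q y (s i)" using w(4) i y by blast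
            then show ?thesis using w(2)[of z y "s i"] y z \<open>s i \<in> J\<close> by blast
          qed
          then show ?thesis using a(3) s(1) by blast
        qed
      qed
    qed
    then show ?thesis
    proof cases
      case 1
      then show ?thesis using P(1) by (simp add: Y_def)
    next
      case (2 z)
      define K where "K = {i \<in> J. Q i z}"
      have JK: "Y J = Y K \<union> Y {z}" using 2 unfolding Y_def K_def by auto
      have "before Q K {z}" using w(5) 2 unfolding before_def K_def by auto
      then have b: "before R (Y K) (Y {z})" by (rule bY) (use J 2 in \<open>auto simp: K_def\<close>)
      have "tp m R (Y K) c \<in> P" by (rule IH[OF 2(1)]) (simp add: K_def)
      moreover have "tp m R (Y {z}) c \<in> P" using fib[of z] J 2 unfolding Y_def by auto
      ultimately show ?thesis unfolding JK
        by (subst tp_mul[OF b]) (use cY[of K] cY[of "{z}"] P in auto)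
    next
      case (3 s)
      (* The block of indices that lie below s i but not below an earlier s k. *)
      define A where "A i = {j \<in> J. Q j (s i) \<and> (\<forall>k<i. \<not> Q j (s k))}" for i
      have sJ: "s i \<in> J" for i using 3 by blast
      have bA: "before Q (A i) (A j)" if "i < j" for i j
        unfolding before_def
      proof (intro ballI)
        fix a b assume ab: "a \<in> A i" "b \<in> A j"
        then have "Q a (s i)" "\<not> Q b (s i)" "a \<in> J" "b \<in> J" using that unfolding A_def by auto
        then have "Q a b" using w(2)[of a "s i" b] w(4)[of b "s i"] sJ by blast
        then show "Q a b \<and> \<not> Q b a" using w(5) \<open>a \<in> J\<close> \<open>b \<in> J\<close> by blast
      qed
      have "\<exists>i. j \<in> A i" if "j \<in> J" for j
      proof -
        have "\<exists>i. Q j (s i)" using 3 that by blast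
        then obtain i where "Q j (s i)" "\<forall>k<i. \<not> Q j (s k)" using exists_least_iff[of "\<lambda>i. Q j (s i)"] by blast
        then show ?thesis using that A_def by blast
      qed
      then have U: "Y J = (\<Union>i. Y (A i))" unfolding Y_def A_def by blast
      have AJ: "A i \<subseteq> I" for i using J A_def by auto
      have tA: "tp m R (Y (A i)) c \<in> P" for i by (rule IH[OF sJ[of i]]) (auto simp: A_def)
      have "tp m R (\<Union>i. Y (A i)) c = om n m (\<lambda>i. tp m R (Y (A i)) c)"
      proof (rule tp_om)
        show "before R (Y (A i)) (Y (A j))" if "i < j" for i j by (rule bY[OF bA[OF that] AJ AJ])
        show "c ` (\<Union>i. Y (A i)) \<subseteq> {..<n}" using cY[of J] U by simp
        show "tp m R (Y (A i)) c \<in> types n m" for i using tA P(2) by blast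
      qed
      also have "\<dots> \<in> P" using W.om_closed[OF P(3,4,2) tA] .
      finally show ?thesis unfolding U .
    next
      case 4
      define l where "l i = tp m R {x \<in> X. p x = i} c" for i
      have "l i \<in> codes n m" for i unfolding l_def by (rule tp_codes) (use c in auto)
      then have "l ` J \<subseteq> {..<Suc (Max (codes n m))}"
        using Max_ge[OF finite_codes] by (auto simp: less_Suc_eq_le)
      from reflection[OF wo_sub[OF wo J] 4(1) this 4(2)] obtain z where
        z: "z \<in> J" "eqv m Q {x \<in> J. Q x z} l Q J l" by blast
      have "tp m R (Y {x \<in> J. Q x z}) c = tp m R (Y J) c"
      proof (rule tp_sum[OF _ _ z(2) cY cY])
        show "fibred R (Y {x \<in> J. Q x z}) p Q {x \<in> J. Q x z}" "fibred R (Y J) p Q J"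
          unfolding Y_def by (rule fibred_sub[OF f]; use J in auto)+
        show "l i = tp m R {x \<in> Y K. p x = i} c" if "i \<in> K" for i K
        proof -
          have "{x \<in> Y K. p x = i} = {x \<in> X. p x = i}" using that Y_def by auto
          then show ?thesis unfolding l_def by simp
        qed
        then show "l i = tp m R {x \<in> Y J. p x = i} c" if "i \<in> J" for i using that by blast
      qed
      then show ?thesis using IH[OF z(1), of "{x \<in> J. Q x z}"] by simp
    qed
  qed
  have init: "\<forall>K \<subseteq> {i \<in> I. Q i z}. tp m R (Y K) c \<in> P" if "z \<in> I" for z
  proof (rule ccontr)
    define Bad where "Bad = {z \<in> I. \<not> (\<forall>K \<subseteq> {i \<in> I. Q i z}. tp m R (Y K) c \<in> P)}"
    assume "\<not> (\<forall>K \<subseteq> {i \<in> I. Q i z}. tp m R (Y K) c \<in> P)"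
    then have "Bad \<noteq> {}" using that Bad_def by blast
    then obtain y where y: "y \<in> Bad" "\<And>x. x \<in> Bad \<Longrightarrow> y \<noteq> x \<Longrightarrow> Q y x"
      using woD(3)[OF wo, of Bad] Bad_def by blast
    then obtain K where K: "K \<subseteq> {i \<in> I. Q i y}" "tp m R (Y K) c \<notin> P" "y \<in> I" unfolding Bad_def by blast
    have "tp m R (Y K) c \<in> P"
    proof (rule step)
      fix x K' assume x: "x \<in> K" "K' \<subseteq> {i \<in> K. Q i x}"
      then have "x \<in> I" "Q x y" using K by auto
      then have "x \<notin> Bad" using y(2) woD(1,5)[OF wo] K(3) by metis
      then show "tp m R (Y K') c \<in> P" using x K(1) \<open>x \<in> I\<close> unfolding Bad_def by blast
    qed (use K in auto)
    then show False using K by blast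
  qed
  have "tp m R (Y I) c \<in> P" by (rule step) (use init in auto)
  moreover have "Y I = X" using fibredD(1)[OF f] Y_def by auto
  ultimately show ?thesis by simp
qed

text \<open>The previous lemma for fibres that are single points and \<open>P\<close> the set of generated types.\<close>

lemma G_tp: assumes "wo R X" "c ` X \<subseteq> {..<n}" shows "W.G (tp m R X c)"
proof -
  have "fibred R X (\<lambda>x. x) R X"
    using woD(1)[OF assms(1)] woD(5)[OF assms(1)] unfolding fibred_def by simp
  then have "tp m R X c \<in> Collect W.G"
  proof (rule tp_wo_sum[OF _ assms])
    show "Collect W.G \<subseteq> types n m" using W.gen_C W.G_def by blast
    fix x assume x: "x \<in> X"
    then have "{y \<in> X. y = x} = {x}" by auto
    moreover have "c x < n" using x assms(2) by auto
    then have "tp m R {x} c \<in> letters n m"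
      by (intro tp_single(2) woD(1)[OF assms(1) x])
    then have "W.G (tp m R {x} c)" unfolding W.G_def by (blast intro: W.gen_letter)
    ultimately show "tp m R {y \<in> X. y = x} c \<in> Collect W.G" by simp
  next
    show "0 \<in> Collect W.G" using W.gen_unit W.G_def by blast
    show "a \<in> Collect W.G \<Longrightarrow> b \<in> Collect W.G \<Longrightarrow> mul n m a b \<in> Collect W.G" for a b
      using W.G_mul by simp
    show "e \<in> Collect W.G \<Longrightarrow> W.pw e \<in> Collect W.G" for e using W.G_pw by simp
  qed
  then show ?thesis by simp
qed

lemma tp_types: "wo R X \<Longrightarrow> c ` X \<subseteq> {..<n} \<Longrightarrow> tp m R X c \<in> types n m"
  using G_tp W.gen_C unfolding W.G_def by blast

text \<open>A type with \<open>e = e \<cdot> e = e\<^sup>\<omega>\<close> is unchanged by sums of any nonzero length. The first index is treated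
separately because the empty sum has type \<open>0\<close>.\<close>

lemma tp_power:
  assumes f: "fibred R X p Q I" and wo: "wo Q I" and c: "c ` X \<subseteq> {..<n}" and ne: "I \<noteq> {}"
    and e: "mul n m e e = e" "W.pw e = e" and fib: "\<And>i. i \<in> I \<Longrightarrow> tp m R {x \<in> X. p x = i} c = e"
  shows "tp m R X c = e"
proof -
  note w = woD[OF wo]
  obtain i where i: "i \<in> I" "\<And>j. j \<in> I \<Longrightarrow> i \<noteq> j \<Longrightarrow> Q i j" using w(3)[of I] ne by blast
  have et: "e \<in> types n m" using e(1) mul_types by metis
  define J where "J = I - {i}"
  define Y where "Y = {x \<in> X. p x \<in> J}"
  have "fibred R Y p Q J" unfolding Y_def by (rule fibred_sub[OF f]) (auto simp: J_def)
  then have "tp m R Y c \<in> {0, e}"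
  proof (rule tp_wo_sum)
    show "wo Q J" by (rule wo_sub[OF wo]) (auto simp: J_def)
    fix j assume j: "j \<in> J"
    then have "{x \<in> Y. p x = j} = {x \<in> X. p x = j}" by (auto simp: Y_def)
    then show "tp m R {x \<in> Y. p x = j} c \<in> {0, e}" using fib[of j] j by (simp add: J_def)
  next
    fix x assume "x \<in> {0, e}"
    moreover have "W.pw 0 = 0"
      using tp_om[where A = "\<lambda>_. {}" and R = lx and n = n and m = m and c = "\<lambda>_. 0"] zero_in_types by (simp add: before_def)
    ultimately show "W.pw x \<in> {0, e}" using e by auto
  next
    show "c ` Y \<subseteq> {..<n}" using c by (auto simp: Y_def)
    show "{0, e} \<subseteq> types n m" using et zero_in_types by blast
    show "mul n m a b \<in> {0, e}" if "a \<in> {0, e}" "b \<in> {0, e}" for a b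
      using that e(1) mul_zero(1)[of n m e] mul_zero[of n m 0] mul_zero(2)[of n m e]
        norm_id[OF et] norm_id[OF zero_in_types, of n m] by auto
  qed simp
  then have Y: "tp m R Y c \<in> types n m" "mul n m e (tp m R Y c) = e"
    using et e zero_in_types mul_zero[of n m e] norm_id by auto
  have X: "X = {x \<in> X. p x = i} \<union> Y" using fibredD(1)[OF f] by (auto simp: Y_def J_def)
  have b: "before R {x \<in> X. p x = i} Y"
    unfolding before_def
  proof (intro ballI)
    fix a b assume a: "a \<in> {x \<in> X. p x = i}" "b \<in> Y"
    then have b: "p b \<in> I" "p b \<noteq> i" by (auto simp: Y_def J_def)
    then have "Q i (p b)" using i by metis
    then have "\<not> Q (p b) i" using w(5) i b by blast
    then show "R a b \<and> \<not> R b a" using fibredD(3)[OF f] a b \<open>Q i (p b)\<close> by (auto simp: Y_def)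
  qed
  have "tp m R ({x \<in> X. p x = i} \<union> Y) c = mul n m (tp m R {x \<in> X. p x = i} c) (tp m R Y c)"
    by (rule tp_mul[OF b]) (use X c Y et fib[OF i(1)] in auto)
  then show ?thesis using X Y(2) fib[OF i(1)] by simp
qed

end

section \<open>Realising types on intervals and on tails\<close>

text \<open>\<open>y = x + \<omega>\<^sup>k\<close> within \<open>A\<close>: the successor for \<open>k = 0\<close>, and for \<open>k + 1\<close> the least \<open>y\<close> above \<open>x\<close> such
that adding \<open>\<omega>\<^sup>k\<close> does not lead from \<open>[x, y)\<close> to \<open>y\<close> or beyond. In this form it is a first-order formula.\<close>

primrec climb :: "nat \<Rightarrow> ('a \<Rightarrow> 'a \<Rightarrow> bool) \<Rightarrow> 'a set \<Rightarrow> 'a \<Rightarrow> 'a \<Rightarrow> bool" where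
  "climb 0 R A x y \<longleftrightarrow> x \<in> A \<and> y \<in> A \<and> R x y \<and> \<not> (\<exists>z\<in>A. R x z \<and> R z y)"
| "climb (Suc k) R A x y \<longleftrightarrow> x \<in> A \<and> y \<in> A \<and> R x y \<and>
     (\<forall>z\<in>A. (z = x \<or> R x z) \<and> R z y \<longrightarrow> (\<exists>w\<in>A. R w y \<and> climb k R A z w)) \<and>
     \<not> (\<exists>y'\<in>A. R x y' \<and> R y' y \<and>
          (\<forall>z\<in>A. (z = x \<or> R x z) \<and> R z y' \<longrightarrow> (\<exists>w\<in>A. R w y' \<and> climb k R A z w)))"

lemma climbD: assumes "climb k R A x y" shows "x \<in> A" "y \<in> A" "R x y"
  using assms by (cases k; simp)+

lemma climb_unique:
  assumes w: "wo R A" and "climb k R A x y" "climb k R A x y'" shows "y = y'"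
proof -
  have "\<not> R y y'" if "climb k R A x y" "climb k R A x y'" for y y'
  proof
    assume "R y y'"
    then show False using that climbD[OF that(1)] climbD[OF that(2)]
      by (cases k; simp only: climb.simps) blast+
  qed
  then show ?thesis using woD(4)[OF w] climbD[OF assms(2)] climbD[OF assms(3)] assms(2,3) by blast
qed

text \<open>An order in which every \<open>x + \<omega>\<^sup>k\<close> exists and some sequence is cofinal; the front parts of the two
ordinals are of this kind.\<close>

locale ladder = word_types n m for n m :: nat +
  fixes lt :: "'a \<Rightarrow> 'a \<Rightarrow> bool" and A :: "'a set"
  assumes wo: "wo lt A" and climb_ex: "x \<in> A \<Longrightarrow> \<exists>y. climb k lt A x y" and n: "n > 0"
    and cofinal: "\<exists>s :: nat \<Rightarrow> 'a. range s \<subseteq> A \<and> (\<forall>a\<in>A. \<exists>i. a = s i \<or> lt a (s i))"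
begin

abbreviation le :: "'a \<Rightarrow> 'a \<Rightarrow> bool" where "le x y \<equiv> x = y \<or> lt x y"

lemmas w = woD[OF wo]

lemma le_lt: "x \<in> A \<Longrightarrow> y \<in> A \<Longrightarrow> z \<in> A \<Longrightarrow> le x y \<Longrightarrow> lt y z \<Longrightarrow> lt x z"
  and lt_le: "x \<in> A \<Longrightarrow> y \<in> A \<Longrightarrow> z \<in> A \<Longrightarrow> lt x y \<Longrightarrow> le y z \<Longrightarrow> lt x z"
  and le_le: "x \<in> A \<Longrightarrow> y \<in> A \<Longrightarrow> z \<in> A \<Longrightarrow> le x y \<Longrightarrow> le y z \<Longrightarrow> le x z"
  and not_lt: "x \<in> A \<Longrightarrow> y \<in> A \<Longrightarrow> \<not> lt x y \<longleftrightarrow> le y x"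
  and not_le: "x \<in> A \<Longrightarrow> y \<in> A \<Longrightarrow> \<not> le x y \<longleftrightarrow> lt y x"
  using w(1,2,4,5) by blast+

definition nx :: "nat \<Rightarrow> 'a \<Rightarrow> 'a" where "nx k x = (SOME y. climb k lt A x y)"

lemma climb_nx: "x \<in> A \<Longrightarrow> climb k lt A x (nx k x)"
  unfolding nx_def by (rule someI_ex[OF climb_ex])

lemma climb_iff: "x \<in> A \<Longrightarrow> climb k lt A x y \<longleftrightarrow> y = nx k x"
  using climb_nx climb_unique[OF wo] by blast

lemma nx_A [simp]: "x \<in> A \<Longrightarrow> nx k x \<in> A" and lt_nx [simp]: "x \<in> A \<Longrightarrow> lt x (nx k x)"
  using climbD[OF climb_nx] by blast+

lemma nx_0: "x \<in> A \<Longrightarrow> z \<in> A \<Longrightarrow> lt x z \<Longrightarrow> le (nx 0 x) z"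
  using climb_nx[of x 0] not_lt[of z "nx 0 x"] by auto

lemma nx_Suc_iff:
  assumes "x \<in> A"
  shows "y = nx (Suc k) x \<longleftrightarrow> y \<in> A \<and> lt x y \<and>
     (\<forall>z\<in>A. le x z \<and> lt z y \<longrightarrow> lt (nx k z) y) \<and>
     \<not> (\<exists>y'\<in>A. lt x y' \<and> lt y' y \<and> (\<forall>z\<in>A. le x z \<and> lt z y' \<longrightarrow> lt (nx k z) y'))"
proof -
  have 1: "(\<exists>w\<in>A. lt w y \<and> climb k lt A z w) \<longleftrightarrow> lt (nx k z) y" if "z \<in> A" for z y
    using climb_iff[OF that] nx_A[OF that] by auto
  have 2: "(\<forall>z\<in>A. (z = x \<or> lt x z) \<and> lt z y \<longrightarrow> (\<exists>w\<in>A. lt w y \<and> climb k lt A z w)) \<longleftrightarrow>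
       (\<forall>z\<in>A. le x z \<and> lt z y \<longrightarrow> lt (nx k z) y)" for y
    using 1 by metis
  show ?thesis unfolding climb_iff[OF assms, symmetric] climb.simps(2) 2 using assms by blast
qed

lemma nx_closed: "x \<in> A \<Longrightarrow> z \<in> A \<Longrightarrow> le x z \<Longrightarrow> lt z (nx (Suc k) x) \<Longrightarrow> lt (nx k z) (nx (Suc k) x)"
  using nx_Suc_iff[of x "nx (Suc k) x" k] by blast

lemma nx_least:
  assumes "x \<in> A" "y \<in> A" "lt x y" "\<And>z. z \<in> A \<Longrightarrow> le x z \<Longrightarrow> lt z y \<Longrightarrow> lt (nx k z) y"
  shows "le (nx (Suc k) x) y"
proof -
  have "\<not> lt y (nx (Suc k) x)" using nx_Suc_iff[of x "nx (Suc k) x" k] assms by blast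
  then show ?thesis using not_lt assms nx_A by blast
qed

text \<open>Ordinal absorption: \<open>z + \<omega>\<^sup>k = x + \<omega>\<^sup>k\<close> for \<open>x \<le> z < x + \<omega>\<^sup>k\<close>.\<close>

lemma nx_absorb:
  "x \<in> A \<Longrightarrow> z \<in> A \<Longrightarrow> le x z \<Longrightarrow> lt z (nx k x) \<Longrightarrow> nx k z = nx k x"
proof (induction k arbitrary: x z)
  case 0
  have "\<not> lt x z"
  proof
    assume "lt x z"
    then have "le (nx 0 x) z" using nx_0 0 by blast
    then show False using 0 w(5) not_lt nx_A by blast
  qed
  then show ?case using 0 by blast
next
  case (Suc k)
  define y where "y = nx (Suc k) x"
  define y' where "y' = nx (Suc k) z"
  have yA: "y \<in> A" "y' \<in> A" "lt z y" "lt z y'" using Suc.prems by (auto simp: y_def y'_def)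
  have "le y' y" unfolding y'_def
  proof (rule nx_least)
    fix v assume "v \<in> A" "le z v" "lt v y"
    then show "lt (nx k v) y" using nx_closed Suc.prems le_le unfolding y_def by blast
  qed (use Suc.prems yA in auto)
  moreover have "le y y'" unfolding y_def
  proof (rule nx_least)
    fix v assume v: "v \<in> A" "le x v" "lt v y'"
    show "lt (nx k v) y'"
    proof (cases "le z v")
      case True
      then show ?thesis using nx_closed v Suc.prems unfolding y'_def by blast
    next
      case False
      then have vz: "lt v z" using not_le v Suc.prems by blast
      show ?thesis
      proof (cases "lt z (nx k v)")
        case True
        then have "nx k z = nx k v" using Suc.IH v vz Suc.prems by blast
        then show ?thesis using nx_closed[of z z k] Suc.prems yA unfolding y'_def by auto
      next
        case False
        then have "le (nx k v) z" using not_lt v Suc.prems nx_A by blast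
        then show ?thesis using le_lt[of "nx k v" z y'] v Suc.prems yA by simp
      qed
    qed
  qed (use Suc.prems yA le_lt[of x z y'] in auto)
  ultimately show ?case using w(5)[of y y'] yA unfolding y_def y'_def by metis
qed

lemma nx_mono: assumes "x \<in> A" "y \<in> A" "le x y" shows "le (nx k x) (nx k y)"
proof (cases "lt y (nx k x)")
  case True then show ?thesis using nx_absorb[OF assms] by simp
next
  case False
  then have "le (nx k x) y" using not_lt assms nx_A by blast
  then show ?thesis using le_lt[of "nx k x" y "nx k y"] assms by simp
qed

lemma nx_nx: assumes "x \<in> A" shows "lt (nx k x) (nx (Suc k) x)" "lt (nx k (nx k x)) (nx (Suc k) x)"
proof -
  show 1: "lt (nx k x) (nx (Suc k) x)" by (rule nx_closed) (use assms in auto)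
  show "lt (nx k (nx k x)) (nx (Suc k) x)" by (rule nx_closed) (use assms 1 in auto)
qed

definition iv :: "'a \<Rightarrow> 'a \<Rightarrow> 'a set" where "iv x y = {z \<in> A. le x z \<and> lt z y}"
definition tail :: "'a \<Rightarrow> 'a set" where "tail x = {z \<in> A. le x z}"

lemma iv_sub: "iv x y \<subseteq> A" "tail x \<subseteq> A" unfolding iv_def tail_def by auto

lemma mono_seq:
  assumes "\<And>i. y i \<in> A" "\<And>i. le (y i) (y (Suc i))" "i \<le> j" shows "le (y i) (y j)"
  using assms(3)
proof (induction j rule: dec_induct)
  case (step j)
  have "le (y j) (y (Suc j))" by (rule assms(2))
  then show ?case using step(3) le_le[OF assms(1) assms(1) assms(1)] by blast
qed simp

definition upto :: "(nat \<Rightarrow> 'a) \<Rightarrow> 'a set" where "upto y = {z \<in> A. le (y 0) z \<and> (\<exists>i. lt z (y i))}"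

lemma pieces:
  assumes y: "\<And>i. y i \<in> A" "\<And>i. le (y i) (y (Suc i))"
  shows "upto y = (\<Union>i. iv (y i) (y (Suc i)))"
    and "i < j \<Longrightarrow> before lt (iv (y i) (y (Suc i))) (iv (y j) (y (Suc j)))"
proof -
  show "upto y = (\<Union>i. iv (y i) (y (Suc i)))"
  proof
    show "(\<Union>i. iv (y i) (y (Suc i))) \<subseteq> upto y"
    proof
      fix z assume "z \<in> (\<Union>i. iv (y i) (y (Suc i)))"
      then obtain i where z: "z \<in> A" "le (y i) z" "lt z (y (Suc i))" unfolding iv_def by auto
      have "le (y 0) (y i)" by (rule mono_seq[where y = y, OF y]) simp
      then have "le (y 0) z" using le_le[OF y(1) y(1) z(1)] z(2) by blast
      then show "z \<in> upto y" unfolding upto_def using z by blast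
    qed
    show "upto y \<subseteq> (\<Union>i. iv (y i) (y (Suc i)))"
    proof
      fix z assume "z \<in> upto y"
      then have z: "z \<in> A" "le (y 0) z" "\<exists>i. lt z (y i)" unfolding upto_def by auto
      define i where "i = (LEAST i. lt z (y i))"
      have i: "lt z (y i)" unfolding i_def by (rule LeastI_ex[OF z(3)])
      then have "i \<noteq> 0" using z(2) w(5)[OF z(1) y(1)] w(1)[OF z(1)] by (cases "i = 0") auto
      then obtain j where j: "i = Suc j" using not0_implies_Suc by blast
      then have "\<not> lt z (y j)" using not_less_Least[of j "\<lambda>i. lt z (y i)"] unfolding i_def by simp
      then have "le (y j) z" using not_lt[OF z(1) y(1)] by blast
      then show "z \<in> (\<Union>i. iv (y i) (y (Suc i)))" using i j z(1) unfolding iv_def by blast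
    qed
  qed
  assume ij: "i < j"
  show "before lt (iv (y i) (y (Suc i))) (iv (y j) (y (Suc j)))"
    unfolding before_def
  proof (intro ballI)
    fix a b assume "a \<in> iv (y i) (y (Suc i))" "b \<in> iv (y j) (y (Suc j))"
    then have ab: "a \<in> A" "b \<in> A" "lt a (y (Suc i))" "le (y j) b" unfolding iv_def by auto
    have "le (y (Suc i)) (y j)" by (rule mono_seq[where y = y, OF y]) (use ij in simp)
    then have "le (y (Suc i)) b" using le_le[OF y(1) y(1) ab(2)] ab(4) by blast
    then have "lt a b" using lt_le[OF ab(1) y(1) ab(2) ab(3)] by blast
    then show "lt a b \<and> \<not> lt b a" using w(5)[OF ab(1,2)] by blast
  qed
qed

lemma iv_wo: "wo lt (iv x y)" "wo lt (tail x)" "wo lt (upto s)"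
  by (rule wo_sub[OF wo], auto simp: iv_def tail_def upto_def)+

lemma iv_split:
  assumes "x \<in> A" "y \<in> A" "le x y"
  shows "z \<in> A \<Longrightarrow> le y z \<Longrightarrow> iv x z = iv x y \<union> iv y z" "tail x = iv x y \<union> tail y"
    "before lt (iv x y) (iv y z)" "before lt (iv x y) (tail y)"
proof -
  have a: "le x v \<longleftrightarrow> le x v \<and> lt v y \<or> le y v" if "v \<in> A" for v
    using not_lt[OF that assms(2)] le_le[OF assms(1,2) that] assms(3) by blast
  show "tail x = iv x y \<union> tail y" unfolding tail_def iv_def using a by blast
  show "iv x z = iv x y \<union> iv y z" if "z \<in> A" "le y z"
  proof -
    have "lt v z" if "v \<in> A" "lt v y" for v using lt_le[OF that(1) assms(2) \<open>z \<in> A\<close> that(2)] \<open>le y z\<close> by blast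
    then show ?thesis unfolding iv_def using a by blast
  qed
  show b: "before lt (iv x y) (tail y)" unfolding before_def
  proof (intro ballI)
    fix a b assume "a \<in> iv x y" "b \<in> tail y"
    then have ab: "a \<in> A" "b \<in> A" "lt a y" "le y b" unfolding iv_def tail_def by auto
    then have "lt a b" using lt_le[OF ab(1) assms(2) ab(2,3,4)] by blast
    then show "lt a b \<and> \<not> lt b a" using w(5)[OF ab(1,2)] by blast
  qed
  show "before lt (iv x y) (iv y z)" by (rule before_mono[OF b]) (auto simp: iv_def tail_def)
qed

lemma nx_upto:
  assumes x: "x \<in> A"
  shows "iv x (nx (Suc k) x) = upto (\<lambda>i. (nx k ^^ i) x)" "(nx k ^^ i) x \<in> A"
    "le ((nx k ^^ i) x) ((nx k ^^ Suc i) x)"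
proof -
  define y where "y i = (nx k ^^ i) x" for i
  define N where "N = nx (Suc k) x"
  have N: "N \<in> A" "lt x N" using x by (auto simp: N_def)
  have y0: "y 0 = x" and yS: "y (Suc i) = nx k (y i)" for i by (auto simp: y_def)
  have yA: "y i \<in> A" for i by (induction i) (auto simp: y0 yS x)
  have yl: "lt (y i) (y (Suc i))" for i unfolding yS using yA by simp
  then have yle: "le (y i) (y (Suc i))" for i by blast
  have yx: "le x (y i)" for i using mono_seq[where y = y, OF yA yle, of 0 i] y0 by simp
  have yN: "lt (y i) N" for i
  proof (induction i)
    case (Suc i)
    then show ?case unfolding yS N_def using nx_closed[OF x yA yx] by (simp add: N_def)
  qed (use N y0 in simp)
  have ex: "\<exists>i. lt z (y i)" if z: "z \<in> A" "lt z N" for z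
  proof (rule ccontr)
    define U where "U = {u \<in> A. \<forall>i. le (y i) u}"
    assume "\<not> (\<exists>i. lt z (y i))"
    then have "z \<in> U" using not_lt[OF z(1) yA] z(1) unfolding U_def by blast
    moreover have "U \<subseteq> A" unfolding U_def by blast
    ultimately obtain u where u: "u \<in> U" "\<And>v. v \<in> U \<Longrightarrow> u \<noteq> v \<Longrightarrow> lt u v" using w(3)[of U] by blast
    have uA: "u \<in> A" and yu: "\<And>i. le (y i) u" using u(1) U_def by auto
    have yu': "lt (y i) u" for i using lt_le[OF yA yA uA yl yu] .
    have "le N u" unfolding N_def
    proof (rule nx_least[OF x uA])
      show "lt x u" using yu'[of 0] y0 by simp
      fix v assume v: "v \<in> A" "le x v" "lt v u"
      then have "v \<notin> U" using u(2) w(1,5) uA by metis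
      then obtain i where "\<not> le (y i) v" using v(1) U_def by blast
      then have "le v (y i)" using not_le[OF yA v(1)] by blast
      then have "le (nx k v) (y (Suc i))" unfolding yS by (rule nx_mono[OF v(1) yA])
      then show "lt (nx k v) u" using le_lt[OF nx_A[OF v(1)] yA uA] yu' by blast
    qed
    moreover have "le u z" using u(2) \<open>z \<in> U\<close> by blast
    ultimately have "le N z" using le_le[OF N(1) uA z(1)] by blast
    then show False using z(2) w(5)[OF z(1) N(1)] w(1)[OF z(1)] by blast
  qed
  have "lt z N \<longleftrightarrow> (\<exists>i. lt z (y i))" if "z \<in> A" for z
    using ex[OF that] w(2)[OF that yA N(1)] yN by blast
  then show "iv x (nx (Suc k) x) = upto (\<lambda>i. (nx k ^^ i) x)"
    unfolding iv_def upto_def N_def[symmetric] y_def[symmetric] y0 by blast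
  show "(nx k ^^ i) x \<in> A" "le ((nx k ^^ i) x) ((nx k ^^ Suc i) x)"
    using yA yle unfolding y_def by auto
qed

definition col :: "('a \<Rightarrow> nat) \<Rightarrow> bool" where "col c \<longleftrightarrow> (\<forall>z. c z < n)"

lemma colD: "col c \<Longrightarrow> c ` X \<subseteq> {..<n}" unfolding col_def by auto

lemma tp_T: "X \<subseteq> A \<Longrightarrow> col c \<Longrightarrow> tp m lt X c \<in> types n m"
  using tp_types[OF wo_sub[OF wo]] colD by blast

lemma om_upto:
  assumes y: "\<And>i. y i \<in> A" "\<And>i. le (y i) (y (Suc i))" and c: "col c"
  shows "tp m lt (upto y) c = om n m (\<lambda>i. tp m lt (iv (y i) (y (Suc i))) c)"
  unfolding pieces(1)[where y = y, OF y]
  by (rule tp_om[OF pieces(2)[where y = y, OF y] colD[OF c] tp_T[OF iv_sub(1) c]])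

lemma om_glue:
  assumes y: "\<And>i. y i \<in> A" "\<And>i. le (y i) (y (Suc i))"
    and c: "\<And>i. \<exists>c. col c \<and> tp m lt (iv (y i) (y (Suc i))) c = t i"
  shows "\<exists>c. col c \<and> tp m lt (upto y) c = om n m t"
proof -
  from c obtain C where C: "\<And>i. col (C i)" "\<And>i. tp m lt (iv (y i) (y (Suc i))) (C i) = t i" by metis
  define p where "p z = (LEAST i. lt z (y (Suc i)))" for z
  have p: "p z = i" if "z \<in> iv (y i) (y (Suc i))" for z i
    unfolding p_def
  proof (rule Least_equality)
    show "lt z (y (Suc i))" using that iv_def by blast
    fix j assume j: "lt z (y (Suc j))"
    show "i \<le> j"
    proof (rule ccontr)
      assume "\<not> i \<le> j"
      then have "le (y (Suc j)) (y i)" by (intro mono_seq[where y = y, OF y]) simp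
      moreover have z: "z \<in> A" "le (y i) z" using that iv_def by auto
      ultimately have "le (y (Suc j)) z" using le_le[OF y(1) y(1) z(1)] by blast
      then show False using j w(5)[OF z(1) y(1)] w(1)[OF z(1)] by blast
    qed
  qed
  define c where "c z = C (p z) z" for z
  have cc: "col c" using C(1) unfolding col_def c_def by blast
  have "tp m lt (iv (y i) (y (Suc i))) c = t i" for i
    unfolding C(2)[symmetric] by (rule tp_cong) (simp add: c_def p)
  then have "tp m lt (upto y) c = om n m t" unfolding om_upto[where y = y, OF y cc] by simp
  then show ?thesis using cc by blast
qed

lemma mul_glue:
  assumes b: "before lt X Y" "X \<subseteq> A" "Y \<subseteq> A"
    and c: "\<exists>c. col c \<and> tp m lt X c = s" "\<exists>c. col c \<and> tp m lt Y c = t"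
  shows "\<exists>c. col c \<and> tp m lt (X \<union> Y) c = mul n m s t"
proof -
  obtain c1 c2 where c: "col c1" "tp m lt X c1 = s" "col c2" "tp m lt Y c2 = t" using c by blast
  define c where "c z = (if z \<in> X then c1 z else c2 z)" for z
  have cc: "col c" using c unfolding col_def c_def by auto
  have "X \<inter> Y = {}" using b w(1) unfolding before_def by blast
  then have "tp m lt Y c = tp m lt Y c2" by (intro tp_cong) (auto simp: c_def)
  moreover have "tp m lt X c = tp m lt X c1" by (intro tp_cong) (auto simp: c_def)
  ultimately have "tp m lt (X \<union> Y) c = mul n m s t"
    using tp_mul[OF b(1) colD[OF cc] tp_T[OF b(2) cc] tp_T[OF b(3) cc]] c by simp
  then show ?thesis using cc by blast
qed

lemma S_src: "x \<in> A \<Longrightarrow> col c \<Longrightarrow> tp m lt (iv x (nx k x)) c \<in> W.S k"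
proof (induction k arbitrary: x)
  case 0
  have "iv x (nx 0 x) = {x}"
    using nx_0[of x] 0 w(1,5) nx_A[of x 0] lt_nx[of x 0] unfolding iv_def by blast
  then show ?case using tp_single(2)[of lt x c n m] w(1) 0 unfolding col_def by simp
next
  case (Suc k)
  note u = nx_upto[OF Suc.prems(1), where k = k]
  show ?case unfolding u(1) om_upto[where y = "\<lambda>i. (nx k ^^ i) x", OF u(2,3) Suc.prems(2)] W.S.simps mem_Collect_eq
  proof (intro exI[of _ "\<lambda>i. tp m lt (iv ((nx k ^^ i) x) ((nx k ^^ Suc i) x)) c"] conjI allI refl)
    fix i
    show "tp m lt (iv ((nx k ^^ i) x) ((nx k ^^ Suc i) x)) c \<in> W.S k"
      using Suc.IH[OF u(2) Suc.prems(2), of i] by simp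
  qed
qed

text \<open>An interval \<open>[x, x + \<omega>\<^sup>k)\<close> is a copy of \<open>\<omega>\<^sup>k\<close>, so it carries exactly the types in \<open>S k\<close>.\<close>

lemma S_real: "t \<in> W.S k \<Longrightarrow> x \<in> A \<Longrightarrow> \<exists>c. col c \<and> tp m lt (iv x (nx k x)) c = t"
proof (induction k arbitrary: x t)
  case 0
  have "iv x (nx 0 x) = {x}"
    using nx_0[of x] 0 w(1,5) nx_A[of x 0] lt_nx[of x 0] unfolding iv_def by blast
  moreover have "t \<in> letters n m" using 0 by simp
  then obtain a where "a < n" "t = tp m lx {[]} (\<lambda>_. a)" unfolding letters_def by blast
  ultimately show ?case using tp_single(1)[of lt x "\<lambda>_. a" n m] w(1) 0
    by (intro exI[of _ "\<lambda>_. a"]) (simp add: col_def)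
next
  case (Suc k)
  then obtain f where f: "t = om n m f" "\<And>i. f i \<in> W.S k" by auto
  note u = nx_upto[OF Suc.prems(2), where k = k]
  show ?case unfolding u(1) f(1)
  proof (rule om_glue[where y = "\<lambda>i. (nx k ^^ i) x", OF u(2,3)])
    fix i
    show "\<exists>c. col c \<and> tp m lt (iv ((nx k ^^ i) x) ((nx k ^^ Suc i) x)) c = f i"
      using Suc.IH[OF f(2) u(2), of i i] by simp
  qed
qed

text \<open>A product of two types of rank \<open>k\<close> needs at most \<open>\<omega>\<^sup>k \<cdot> 2\<close> points and an \<open>\<omega>\<close>-product at most
\<open>\<omega>\<^bsup>k+1\<^esup>\<close>.\<close>

lemma gen_real:
  "W.gen k t \<Longrightarrow> x \<in> A \<Longrightarrow> \<exists>y\<in>A. le x y \<and> le y (nx k x) \<and> (\<exists>c. col c \<and> tp m lt (iv x y) c = t)"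
proof (induction arbitrary: x rule: W.gen.induct)
  case gen_unit
  have "iv x x = {}" using w(1,5) gen_unit unfolding iv_def by blast
  then show ?case using n gen_unit by (intro bexI[of _ x]) (auto simp: col_def)
next
  case (gen_letter a)
  then have "\<exists>c. col c \<and> tp m lt (iv x (nx 0 x)) c = a" by (intro S_real) auto
  then show ?case using gen_letter by (intro bexI[of _ "nx 0 x"]) auto
next
  case (gen_mul k s t)
  obtain y where y: "y \<in> A" "le x y" "le y (nx k x)" "\<exists>c. col c \<and> tp m lt (iv x y) c = s"
    using gen_mul by blast
  obtain z where z: "z \<in> A" "le y z" "le z (nx k y)" "\<exists>c. col c \<and> tp m lt (iv y z) c = t"
    using gen_mul.IH(2)[OF y(1)] by blast
  have xA: "nx k x \<in> A" "nx k y \<in> A" "nx k (nx k x) \<in> A" "nx (Suc k) x \<in> A" using gen_mul.prems y(1) by auto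
  have "le (nx k y) (nx k (nx k x))" using nx_mono y xA by blast
  then have "le z (nx k (nx k x))" using le_le[OF z(1) xA(2) xA(3)] z(3) by blast
  then have "lt z (nx (Suc k) x)" using le_lt[OF z(1) xA(3) xA(4)] nx_nx(2)[OF gen_mul.prems] by blast
  moreover have "le x z" using le_le[OF gen_mul.prems y(1) z(1) y(2) z(2)] .
  moreover have "\<exists>c. col c \<and> tp m lt (iv x z) c = mul n m s t"
    unfolding iv_split(1)[OF gen_mul.prems y(1,2) z(1,2)]
    by (rule mul_glue[OF iv_split(3)[OF gen_mul.prems y(1,2)] iv_sub(1) iv_sub(1) y(4) z(4)])
  ultimately show ?case using z(1) by blast
next
  case (gen_om k t)
  define P where "P i x v \<longleftrightarrow> v \<in> A \<and> le x v \<and> le v (nx k x) \<and>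
    (\<exists>c. col c \<and> tp m lt (iv x v) c = t i)" for i x v
  define f where "f i x = (SOME v. P i x v)" for i x
  have ex: "\<exists>v. P i x v" if "x \<in> A" for i x
    using gen_om.IH[OF that, of i] unfolding P_def Bex_def .
  have "P i x (f i x)" if "x \<in> A" for i x unfolding f_def by (rule someI_ex[OF ex[OF that]])
  then have f: "\<And>i x. x \<in> A \<Longrightarrow> f i x \<in> A" "\<And>i x. x \<in> A \<Longrightarrow> le x (f i x)"
    "\<And>i x. x \<in> A \<Longrightarrow> le (f i x) (nx k x)" "\<And>i x. x \<in> A \<Longrightarrow> \<exists>c. col c \<and> tp m lt (iv x (f i x)) c = t i"
    unfolding P_def by simp_all
  define y where "y = rec_nat x f"
  have y0: "y 0 = x" and yS: "y (Suc i) = f i (y i)" for i by (auto simp: y_def)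
  have yA: "y i \<in> A" for i by (induction i) (auto simp: y0 yS f gen_om.prems)
  have yle: "le (y i) (y (Suc i))" for i unfolding yS using f(2) yA by blast
  define N where "N = nx (Suc k) x"
  have N: "N \<in> A" "lt x N" using gen_om.prems by (auto simp: N_def)
  have yx: "le x (y i)" for i using mono_seq[where y = y, OF yA yle, of 0 i] y0 by simp
  have yN: "lt (y i) N" for i
  proof (induction i)
    case (Suc i)
    then have "lt (nx k (y i)) N" unfolding N_def by (rule nx_closed[OF gen_om.prems yA yx])
    then show ?case unfolding yS using le_lt[OF f(1)[OF yA] nx_A[OF yA] N(1)] f(3)[OF yA] by blast
  qed (use N y0 in simp)
  (* The interval ends at the supremum u of the end points y i. *)
  define U where "U = {u \<in> A. \<forall>i. le (y i) u}"
  have "N \<in> U" using yN N U_def by blast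
  moreover have "U \<subseteq> A" unfolding U_def by blast
  ultimately obtain u where u: "u \<in> U" "\<And>v. v \<in> U \<Longrightarrow> u \<noteq> v \<Longrightarrow> lt u v" using w(3)[of U] by blast
  have uA: "u \<in> A" "\<And>i. le (y i) u" using u(1) U_def by auto
  have "lt z u \<longleftrightarrow> (\<exists>i. lt z (y i))" if z: "z \<in> A" for z
  proof
    assume zu: "lt z u"
    then have "z \<notin> U" using u(2)[of z] w(5)[OF z uA(1)] w(1)[OF z] by blast
    then obtain i where "\<not> le (y i) z" using z U_def by blast
    then show "\<exists>i. lt z (y i)" using not_le[OF yA z] by blast
  next
    assume "\<exists>i. lt z (y i)"
    then obtain i where "lt z (y i)" by blast
    then show "lt z u" using lt_le[OF z yA uA(1)] uA(2) by blast
  qed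
  then have "iv x u = upto y" unfolding iv_def upto_def y0 by blast
  moreover have "\<exists>c. col c \<and> tp m lt (upto y) c = om n m t"
    by (rule om_glue[where y = y, OF yA yle]) (use f(4) yA yS in simp)
  moreover have "le x u" using uA(2)[of 0] y0 by simp
  moreover have "le u N" using u(2) \<open>N \<in> U\<close> by blast
  ultimately show ?case using uA(1) unfolding N_def by (intro bexI[of _ u]) simp_all
next
  case (gen_Suc k t)
  obtain y where y: "y \<in> A" "le x y" "le y (nx k x)" "\<exists>c. col c \<and> tp m lt (iv x y) c = t"
    using gen_Suc by blast
  have "le y (nx (Suc k) x)"
    by (rule le_le[OF y(1) nx_A[OF gen_Suc.prems] nx_A[OF gen_Suc.prems] y(3) disjI2[OF nx_nx(1)[OF gen_Suc.prems]]])
  then show ?case using y by blast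
qed

lemma G_real: "W.G t \<Longrightarrow> x \<in> A \<Longrightarrow> \<exists>y\<in>A. le x y \<and> (\<exists>c. col c \<and> tp m lt (iv x y) c = t)"
  unfolding W.G_def using gen_real by blast

text \<open>The type \<open>e\<close> can be stretched beyond any \<open>v\<close>: an interval that ends at some \<open>v' + \<omega>\<^sup>j\<close> is a sum of
copies of \<open>\<omega>\<^sup>j\<close>, each of which can be given the type \<open>e\<close>, and then the sum has type \<open>e\<close>.\<close>

lemma power_real:
  assumes e: "mul n m e e = e" "W.pw e = e" "e \<in> W.S j" and x: "x \<in> A" and v: "v \<in> A"
  shows "\<exists>y\<in>A. le x y \<and> lt v y \<and> (\<exists>c. col c \<and> tp m lt (iv x y) c = e)"
proof -
  define v' where "v' = (if lt x v then v else x)"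
  have v': "v' \<in> A" "le x v'" "le v v'" using x v not_lt[OF x v] by (auto simp: v'_def)
  define y where "y = nx j v'"
  have y: "y \<in> A" "lt v' y" using v' by (auto simp: y_def)
  have xy: "lt x y" "lt v y" using le_lt[OF x v'(1) y(1) v'(2) y(2)] le_lt[OF v v'(1) y(1) v'(3) y(2)] by auto
  define X where "X = iv x y"
  (* The points with the same nx j form a copy of omega^j, because of absorption. *)
  define I where "I = nx j ` X"
  have XA: "X \<subseteq> A" unfolding X_def by (rule iv_sub)
  have IA: "I \<subseteq> A" using XA I_def by auto
  have nxy: "le (nx j z) y" if "z \<in> X" for z
  proof (cases "le v' z")
    case True
    then have "nx j z = y" unfolding y_def using nx_absorb[OF v'(1), of z j] that XA unfolding X_def iv_def y_def by blast
    then show ?thesis by simp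
  next
    case False
    then have "le z v'" using not_le[OF v'(1), of z] that XA by blast
    then show ?thesis unfolding y_def using nx_mono that XA v'(1) by blast
  qed
  have lt_iff: "lt z z' \<longleftrightarrow> lt (nx j z) (nx j z')" if "z \<in> X" "z' \<in> X" "nx j z \<noteq> nx j z'" for z z'
  proof -
    have z: "z \<in> A" "z' \<in> A" using that XA by auto
    have "lt z z' \<Longrightarrow> lt (nx j z) (nx j z')" using nx_mono[OF z, of j] that(3) by blast
    moreover have "lt z' z \<Longrightarrow> lt (nx j z') (nx j z)" using nx_mono[OF z(2,1), of j] that(3) by metis
    ultimately show ?thesis using w(4)[OF z] w(5)[OF nx_A[OF z(1)] nx_A[OF z(2)]] that(3) by metis
  qed
  have f: "fibred lt X (nx j) lt I"
    unfolding fibred_def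
  proof (intro conjI ballI impI)
    show "nx j ` X \<subseteq> I" by (simp add: I_def)
    show "\<not> lt i i" if "i \<in> I" for i using w(1) that IA by blast
    show "\<not> lt j' i" if "i \<in> I" "j' \<in> I" "lt i j'" for i j' using w(5) that IA by blast
  qed (rule lt_iff)
  have fibre: "\<exists>d\<in>A. v = nx j d \<and> {z \<in> X. nx j z = v} = iv d (nx j d)" if "v \<in> I" for v
  proof -
    define F where "F = {z \<in> X. nx j z = v}"
    have "F \<noteq> {}" "F \<subseteq> A" using that XA unfolding F_def I_def by auto
    then obtain d where d: "d \<in> F" "\<And>z. z \<in> F \<Longrightarrow> d \<noteq> z \<Longrightarrow> lt d z" using w(3)[of F] by blast
    have dX: "d \<in> X" "nx j d = v" "d \<in> A" using d(1) XA F_def by auto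
    have "z \<in> F" if z: "z \<in> iv d (nx j d)" for z
    proof -
      have z: "z \<in> A" "le d z" "lt z (nx j d)" using z iv_def by auto
      then have "nx j z = v" using nx_absorb dX by metis
      moreover have "le x z" using le_le[OF x dX(3) z(1)] z(2) dX(1) unfolding X_def iv_def by blast
      moreover have "lt z y" using lt_le[OF z(1) nx_A[OF dX(3)] y(1) z(3)] nxy[OF dX(1)] by blast
      ultimately show ?thesis using z(1) unfolding F_def X_def iv_def by blast
    qed
    moreover have "z \<in> iv d (nx j d)" if z: "z \<in> F" for z
    proof -
      have zX: "z \<in> A" "nx j z = nx j d" using z XA dX(2) F_def by auto
      then have "lt z (nx j d)" using lt_nx by metis
      then show ?thesis using d(2)[OF z] zX(1) unfolding iv_def by blast
    qed
    ultimately have "F = iv d (nx j d)" by blast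
    then show ?thesis using dX unfolding F_def by blast
  qed
  have "\<exists>c. col c \<and> tp m lt {z \<in> X. nx j z = v} c = e" if "v \<in> I" for v
    using fibre[OF that] S_real[OF e(3)] by metis
  then obtain C where C: "\<And>v. v \<in> I \<Longrightarrow> col (C v)" "\<And>v. v \<in> I \<Longrightarrow> tp m lt {z \<in> X. nx j z = v} (C v) = e" by metis
  define c where "c z = (if z \<in> X then C (nx j z) z else 0)" for z
  have cc: "col c" using C(1) n unfolding col_def c_def I_def by auto
  have "tp m lt X c = e"
  proof (rule tp_power[OF f wo_sub[OF wo IA] colD[OF cc] _ e(1,2)])
    have "x \<in> X" using x xy unfolding X_def iv_def by blast
    then show "I \<noteq> {}" unfolding I_def by blast
    fix v assume v: "v \<in> I"
    have "tp m lt {z \<in> X. nx j z = v} c = tp m lt {z \<in> X. nx j z = v} (C v)"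
      by (rule tp_cong) (simp add: c_def)
    then show "tp m lt {z \<in> X. nx j z = v} c = e" using C(2)[OF v] by simp
  qed
  then show ?thesis using cc xy y(1) unfolding X_def by blast
qed

text \<open>A type with a factor that can be stretched. The stretchable factor has to be one that is realised on copies of
some \<open>\<omega>\<^sup>j\<close>.\<close>

definition flex :: "nat \<Rightarrow> bool" where
  "flex g \<longleftrightarrow> (\<exists>a e b j. g = mul n m a (mul n m e b) \<and> W.G a \<and> W.G b \<and> e \<in> W.S j \<and>
     mul n m e e = e \<and> W.pw e = e)"

lemma flex_real:
  assumes "flex g" "x \<in> A" "v \<in> A"
  shows "\<exists>y\<in>A. le x y \<and> lt v y \<and> (\<exists>c. col c \<and> tp m lt (iv x y) c = g)"
proof -
  obtain a e b j where g: "g = mul n m a (mul n m e b)" "W.G a" "W.G b" and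
    e: "mul n m e e = e" "W.pw e = e" "e \<in> W.S j" using assms(1) flex_def by blast
  obtain p where p: "p \<in> A" "le x p" "\<exists>c. col c \<and> tp m lt (iv x p) c = a" using G_real[OF g(2) assms(2)] by blast
  obtain q where q: "q \<in> A" "le p q" "lt v q" "\<exists>c. col c \<and> tp m lt (iv p q) c = e"
    using power_real[OF e p(1) assms(3)] by blast
  obtain y where y: "y \<in> A" "le q y" "\<exists>c. col c \<and> tp m lt (iv q y) c = b" using G_real[OF g(3) q(1)] by blast
  have py: "le p y" using le_le[OF p(1) q(1) y(1) q(2) y(2)] .
  have "\<exists>c. col c \<and> tp m lt (iv p y) c = mul n m e b"
    unfolding iv_split(1)[OF p(1) q(1,2) y(1,2)]
    by (rule mul_glue[OF iv_split(3)[OF p(1) q(1,2)] iv_sub(1) iv_sub(1) q(4) y(3)])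
  then have "\<exists>c. col c \<and> tp m lt (iv x y) c = g"
    unfolding iv_split(1)[OF assms(2) p(1,2) y(1) py] g(1)
    by (rule mul_glue[OF iv_split(3)[OF assms(2) p(1,2)] iv_sub(1) iv_sub(1) p(3)])
  moreover have "le x y" using le_le[OF assms(2) p(1) y(1) p(2) py] .
  moreover have "lt v y" using lt_le[OF assms(3) q(1) y(1) q(3) y(2)] .
  ultimately show ?thesis using y(1) by blast
qed

lemma cofinal_seq: "\<exists>s :: nat \<Rightarrow> 'a. (\<forall>i. s i \<in> A) \<and> (\<forall>a\<in>A. \<exists>i. le a (s i))"
  using cofinal by (simp add: image_subset_iff)

text \<open>The tail is divided by a cofinal sequence with steps of at least \<open>\<omega>\<^sup>K\<close>. By Ramsey's theorem its type is
\<open>z \<cdot> g\<^sup>\<omega>\<close>, where \<open>g\<close> contains the type of a word of length \<open>\<omega>\<^sup>K\<close>, so that \<open>pump\<close> applies.\<close>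

lemma tail_src:
  assumes x: "x \<in> A" and c: "col c"
  obtains z g where "tp m lt (tail x) c = mul n m z (W.pw g)" "W.G z" "flex g"
proof -
  from cofinal_seq obtain s :: "nat \<Rightarrow> 'a" where
    s0: "(\<forall>i. s i \<in> A) \<and> (\<forall>a\<in>A. \<exists>i. le a (s i))" by (rule exE)
  have s: "s i \<in> A" "a \<in> A \<Longrightarrow> \<exists>i. le a (s i)" for i a
    by (rule spec[OF conjunct1[OF s0]], rule bspec[OF conjunct2[OF s0]])
  define K where "K = Suc (card (types n m))"
  (* At least omega^K above the previous term and at least s i, hence cofinal. *)
  define y where "y = rec_nat x (\<lambda>i v. if lt (nx K v) (s i) then s i else nx K v)"
  have y0: "y 0 = x" and yS: "y (Suc i) = (if lt (nx K (y i)) (s i) then s i else nx K (y i))" for i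
    by (auto simp: y_def)
  have yA: "y i \<in> A" for i by (induction i) (auto simp: y0 yS x s)
  have yn: "le (nx K (y i)) (y (Suc i))" and ys: "le (s i) (y (Suc i))" for i
    unfolding yS using not_lt[OF nx_A[OF yA] s(1)] by auto
  have yl: "lt (y i) (y (Suc i))" for i using lt_le[OF yA nx_A[OF yA] yA lt_nx[OF yA] yn] .
  then have yle: "le (y i) (y (Suc i))" for i by blast
  have "\<exists>i. lt z (y i)" if z: "z \<in> A" for z
  proof -
    obtain i where "le z (s i)" using s(2)[OF z] by blast
    then have "le z (y (Suc i))" using le_le[OF z s(1) yA] ys by blast
    then show ?thesis using le_lt[OF z yA yA] yl by blast
  qed
  then have tl: "tail x = upto y" unfolding tail_def upto_def y0 by blast
  define t where "t i = tp m lt (iv (y i) (y (Suc i))) c" for i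
  have tT: "t i \<in> types n m" for i unfolding t_def by (rule tp_T[OF iv_sub(1) c])
  have tG: "W.G (t i)" for i unfolding t_def by (rule G_tp[OF iv_wo(1) colD[OF c]])
  have tf: "\<exists>u v. t i = mul n m u v \<and> u \<in> W.S K \<and> W.G v" for i
  proof (intro exI conjI)
    show "t i = mul n m (tp m lt (iv (y i) (nx K (y i))) c) (tp m lt (iv (nx K (y i)) (y (Suc i))) c)"
      unfolding t_def iv_split(1)[OF yA nx_A[OF yA] disjI2[OF lt_nx[OF yA]] yA yn]
      by (rule tp_mul[OF iv_split(3)[OF yA nx_A[OF yA] disjI2[OF lt_nx[OF yA]]] colD[OF c] tp_T[OF iv_sub(1) c] tp_T[OF iv_sub(1) c]])
    show "tp m lt (iv (y i) (nx K (y i))) c \<in> W.S K" by (rule S_src[OF yA c])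
    show "W.G (tp m lt (iv (nx K (y i)) (y (Suc i))) c)" by (rule G_tp[OF iv_wo(1) colD[OF c]])
  qed
  obtain l l' g where g: "om n m t = mul n m (seg (mul n m) t 0 l) (W.pw g)" "g = seg (mul n m) t (Suc l) l'"
    using W.om_ramsey[of t] tT by metis
  obtain v where v: "g = mul n m (t (Suc l)) v" "W.G v"
  proof (cases l')
    case 0
    have "W.G 0" unfolding W.G_def using W.gen_unit by blast
    moreover have "g = mul n m (t (Suc l)) 0" using g(2) 0 mul_zero(1) norm_id[OF tT] by simp
    ultimately show ?thesis using that by blast
  next
    case (Suc k)
    have "W.G (seg (mul n m) t (Suc (Suc l)) k)" by (rule W.G_seg[OF tG])
    moreover have "g = mul n m (t (Suc l)) (seg (mul n m) t (Suc (Suc l)) k)"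
      using g(2) unfolding Suc W.seg_Cons .
    ultimately show ?thesis using that by blast
  qed
  obtain u v' where u: "t (Suc l) = mul n m u v'" "u \<in> W.S K" "W.G v'" using tf by blast
  obtain a e b j where e: "u = mul n m a (mul n m e b)" "mul n m e e = e" "W.pw e = e" "e \<in> W.S j" "W.G a" "W.G b"
    using W.pump[OF u(2)[unfolded K_def]] by metis
  have "g = mul n m a (mul n m e (mul n m (mul n m b v') v))"
    using v(1) u(1) e(1) by (simp add: mul_assoc)
  then have "flex g" unfolding flex_def using e u(3) v(2) W.G_mul by blast
  moreover have "W.G (seg (mul n m) t 0 l)" by (rule W.G_seg[OF tG])
  moreover have "tp m lt (tail x) c = mul n m (seg (mul n m) t 0 l) (W.pw g)"
    using om_upto[where y = y, OF yA yle c] g(1) unfolding tl t_def by simp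
  ultimately show ?thesis using that by blast
qed

text \<open>Each block \<open>g\<close> is stretched past the next term of a cofinal sequence, so that the \<open>\<omega>\<close> blocks fill
the tail.\<close>

lemma tail_real:
  assumes x: "x \<in> A" and z: "W.G z" and g: "flex g"
  shows "\<exists>c. col c \<and> tp m lt (tail x) c = mul n m z (W.pw g)"
proof -
  from cofinal_seq obtain s :: "nat \<Rightarrow> 'a" where
    s0: "(\<forall>i. s i \<in> A) \<and> (\<forall>a\<in>A. \<exists>i. le a (s i))" by (rule exE)
  have s: "s i \<in> A" "a \<in> A \<Longrightarrow> \<exists>i. le a (s i)" for i a
    by (rule spec[OF conjunct1[OF s0]], rule bspec[OF conjunct2[OF s0]])
  obtain p where p: "p \<in> A" "le x p" "\<exists>c. col c \<and> tp m lt (iv x p) c = z" using G_real[OF z x] by blast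
  define P where "P x v u \<longleftrightarrow> u \<in> A \<and> le x u \<and> lt v u \<and> (\<exists>c. col c \<and> tp m lt (iv x u) c = g)" for x v u
  define f where "f x v = (SOME u. P x v u)" for x v
  have ex: "\<exists>u. P x v u" if "x \<in> A" "v \<in> A" for x v
    using flex_real[OF g that] unfolding P_def Bex_def .
  have "P x v (f x v)" if "x \<in> A" "v \<in> A" for x v unfolding f_def by (rule someI_ex[OF ex[OF that]])
  then have f: "\<And>x v. x \<in> A \<Longrightarrow> v \<in> A \<Longrightarrow> f x v \<in> A"
    "\<And>x v. x \<in> A \<Longrightarrow> v \<in> A \<Longrightarrow> le x (f x v)" "\<And>x v. x \<in> A \<Longrightarrow> v \<in> A \<Longrightarrow> lt v (f x v)"
    "\<And>x v. x \<in> A \<Longrightarrow> v \<in> A \<Longrightarrow> \<exists>c. col c \<and> tp m lt (iv x (f x v)) c = g"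
    unfolding P_def by simp_all
  define y where "y = rec_nat p (\<lambda>i v. f v (s i))"
  have y0: "y 0 = p" and yS: "y (Suc i) = f (y i) (s i)" for i by (auto simp: y_def)
  have yA: "y i \<in> A" for i by (induction i) (auto simp: y0 yS p f s)
  have yle: "le (y i) (y (Suc i))" for i unfolding yS using f(2) yA s(1) by blast
  have "\<exists>i. lt z (y i)" if z: "z \<in> A" for z
  proof -
    obtain i where "le z (s i)" using s(2)[OF z] by blast
    then show ?thesis using le_lt[OF z s(1) yA] f(3)[OF yA s(1)] yS by metis
  qed
  then have tl: "tail p = upto y" unfolding tail_def upto_def y0 by blast
  have "\<exists>c. col c \<and> tp m lt (tail p) c = W.pw g"
    unfolding tl by (rule om_glue[where y = y, OF yA yle]) (use f(4) yA yS s(1) in simp)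
  then show ?thesis
    unfolding iv_split(2)[OF x p(1,2)]
    by (rule mul_glue[OF iv_split(4)[OF x p(1,2)] iv_sub p(3)])
qed

lemma short_real:
  assumes "wo R X" "c ` X \<subseteq> {..<n}" "x \<in> A"
  shows "\<exists>y\<in>A. le x y \<and> (\<exists>d. col d \<and> eqv m R X c lt (iv x y) d)"
proof -
  obtain y d where "y \<in> A" "le x y" "col d" "tp m lt (iv x y) d = tp m R X c"
    using G_real[OF G_tp[OF assms(1,2)] assms(3)] by blast
  then show ?thesis using tp_eq_iff[OF assms(2) colD] by metis
qed

end

lemma tail_equiv:
  assumes "ladder n lt A" "ladder n lt' A'" "x \<in> A" "x' \<in> A'" "\<And>z. c z < n"
  shows "\<exists>d. (\<forall>z. d z < n) \<and> eqv m lt {z \<in> A. x = z \<or> lt x z} c lt' {z \<in> A'. x' = z \<or> lt' x' z} d"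
proof -
  interpret a: ladder n m lt A by fact
  interpret b: ladder n m lt' A' by fact
  have c: "a.col c" using assms(5) a.col_def by blast
  obtain z g where 1: "tp m lt (a.tail x) c = mul n m z (om n m (\<lambda>_. g))" "a.W.G z" "a.flex g"
    using a.tail_src[OF assms(3) c] by blast
  obtain d where d: "b.col d" "tp m lt' (b.tail x') d = mul n m z (om n m (\<lambda>_. g))"
    using b.tail_real[OF assms(4) 1(2)] 1(3) unfolding a.flex_def b.flex_def by blast
  then have "eqv m lt (a.tail x) c lt' (b.tail x') d"
    using 1(1) tp_eq_iff[OF a.colD[OF c] b.colD[OF d(1)]] by metis
  then show ?thesis using d(1) unfolding b.col_def a.tail_def b.tail_def by blast
qed

section \<open>Nodes of a tree as coloured words\<close>

definition str :: "'a rel \<Rightarrow> 'a \<Rightarrow> 'a \<Rightarrow> bool" where "str r a b \<longleftrightarrow> (a, b) \<in> r \<and> a \<noteq> b"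

lemma wo_str: assumes "Well_order r" shows "wo (str r) (Field r)"
  unfolding wo_def
proof (intro conjI ballI allI impI)
  note w = Well_orderD[OF assms]
  show "\<not> str r x x" for x unfolding str_def by simp
  show "str r x z" if "str r x y" "str r y z" for x y z
    using that w(2,3) unfolding str_def by blast
  fix K assume K: "K \<subseteq> Field r" "K \<noteq> {}"
  then obtain q where "q \<in> K" by blast
  then obtain x where x: "x \<in> K" "\<And>y. (y, x) \<in> r - Id \<Longrightarrow> y \<notin> K" by (rule wfE_min[OF w(1)]) blast
  have "str r x y" if "y \<in> K" "x \<noteq> y" for y
    using w(5)[of x y] x that K(1) unfolding str_def by blast
  then show "\<exists>x\<in>K. \<forall>y\<in>K. x \<noteq> y \<longrightarrow> str r x y" using x(1) by blast
qed

definition down :: "'a rel \<Rightarrow> 'a \<Rightarrow> 'a set" where "down r b = {a. (a, b) \<in> r}"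

definition level :: "'a rel \<Rightarrow> ('a \<rightharpoonup> nat) \<Rightarrow> 'a" where
  "level r s = (THE b. b \<in> Field r \<and> dom s = underS r b)"

text \<open>The comparison includes the position \<open>c\<close> itself; so the first disagreement is seen at the position where it
occurs.\<close>

definition agree :: "'a rel \<Rightarrow> ('a \<rightharpoonup> nat) \<Rightarrow> ('a \<rightharpoonup> nat) \<Rightarrow> 'a \<Rightarrow> bool" where
  "agree r s t c \<longleftrightarrow> (\<forall>d. (d, c) \<in> r \<longrightarrow> s d = t d)"

definition colour :: "'a rel \<Rightarrow> ('a \<Rightarrow> 'd option) \<Rightarrow> (nat \<Rightarrow> 'a \<rightharpoonup> nat) \<Rightarrow> nat \<Rightarrow> 'a \<Rightarrow>
    nat option \<times> nat set \<times> 'd option" where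
  "colour r pos x i c = (x i c, {j. agree r (x i) (x j) c}, pos c)"

text \<open>\<open>y\<close> follows \<open>x i\<close> below \<open>u\<close> and has left every member of the family at \<open>u\<close> or before. At \<open>u\<close> the node
\<open>x i\<close> may already have ended.\<close>

definition branch :: "'a rel \<Rightarrow> (nat \<Rightarrow> 'a \<rightharpoonup> nat) \<Rightarrow> nat \<Rightarrow> ('a \<rightharpoonup> nat) \<Rightarrow> 'a \<Rightarrow> bool" where
  "branch r x i y u \<longleftrightarrow> (u, level r (x i)) \<in> r \<and> (\<forall>d. str r d u \<longrightarrow> y d = x i d) \<and>
     (\<forall>j. \<exists>d. (d, u) \<in> r \<and> y d \<noteq> x j d)"

locale tree_order =
  fixes r :: "'a rel" and n :: nat
  assumes W: "Well_order r" and lim: "nonzero_limit r"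
begin

lemmas wr = Well_orderD[OF W]

lemma F: "(a, b) \<in> r \<Longrightarrow> a \<in> Field r" "(a, b) \<in> r \<Longrightarrow> b \<in> Field r"
  by (auto simp: Field_def)

lemma str_r: "str r a b \<Longrightarrow> (a, b) \<in> r" "str r a b \<Longrightarrow> a \<noteq> b"
  by (auto simp: str_def)

lemma cmp: "a \<in> Field r \<Longrightarrow> b \<in> Field r \<Longrightarrow> (a, b) \<in> r \<or> str r b a"
  using wr(4,5) unfolding str_def by blast

lemma str_le: "str r a b \<Longrightarrow> (b, c) \<in> r \<Longrightarrow> str r a c" "(a, b) \<in> r \<Longrightarrow> str r b c \<Longrightarrow> str r a c"
  using wr(2,3) unfolding str_def by blast+

lemma str_irr: "\<not> (str r a b \<and> (b, a) \<in> r)"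
  using wr(3) unfolding str_def by blast

lemma underS_str: "underS r b = {a. str r a b}"
  unfolding underS_def str_def by auto

lemma level_eq: "b \<in> Field r \<Longrightarrow> dom s = underS r b \<Longrightarrow> level r s = b"
  unfolding level_def using underS_inj[OF W] by (intro the_equality) auto

lemma nodeD:
  assumes "s \<in> tree_nodes n r"
  shows "level r s \<in> Field r" "s d \<noteq> None \<longleftrightarrow> str r d (level r s)" "s d = Some a \<Longrightarrow> a < n"
proof -
  obtain b where b: "b \<in> Field r" "dom s = underS r b" "ran s \<subseteq> {..<n}"
    using assms unfolding tree_nodes_def by blast
  have l: "level r s = b" by (rule level_eq[OF b(1,2)])
  show "level r s \<in> Field r" using l b by simp
  show "s d \<noteq> None \<longleftrightarrow> str r d (level r s)" using b(2) l unfolding underS_str by blast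
  show "s d = Some a \<Longrightarrow> a < n" using b(3) by (auto simp: ran_def)
qed

lemma nodeI:
  assumes "b \<in> Field r" "\<And>d. s d \<noteq> None \<longleftrightarrow> str r d b" "\<And>d a. s d = Some a \<Longrightarrow> a < n"
  shows "s \<in> tree_nodes n r" "level r s = b"
proof -
  have "dom s = underS r b" unfolding underS_str using assms(2) by blast
  moreover have "ran s \<subseteq> {..<n}" using assms(3) by (auto simp: ran_def)
  ultimately show "s \<in> tree_nodes n r" "level r s = b"
    using assms(1) level_eq unfolding tree_nodes_def by blast+
qed

lemma diff_le_level:
  assumes s: "s \<in> tree_nodes n r" and t: "t \<in> tree_nodes n r"
    and d: "s d \<noteq> t d" "\<And>e. str r e d \<Longrightarrow> s e = t e"
  shows "(d, level r s) \<in> r"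
proof -
  have dF: "d \<in> Field r"
  proof (cases "s d")
    case None
    then have "t d \<noteq> None" using d(1) by simp
    then show ?thesis using nodeD(2)[OF t] str_r F by blast
  next
    case (Some a)
    then have "s d \<noteq> None" by simp
    then show ?thesis using nodeD(2)[OF s] str_r F by blast
  qed
  show ?thesis
  proof (rule ccontr)
    assume "(d, level r s) \<notin> r"
    then have lt: "str r (level r s) d" using cmp[OF dF nodeD(1)[OF s]] by blast
    then have "\<not> str r d (level r s)" using str_irr str_r by blast
    then have "s d = None" using nodeD(2)[OF s, of d] by blast
    then have "t d \<noteq> None" using d(1) by simp
    then have "str r d (level r t)" using nodeD(2)[OF t] by blast
    then have "str r (level r s) (level r t)" using lt str_le(2) str_r by blast
    then have "t (level r s) \<noteq> None" using nodeD(2)[OF t] by blast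
    moreover have "s (level r s) = None" using nodeD(2)[OF s, of "level r s"] str_r(2) by blast
    ultimately show False using d(2)[OF lt] by simp
  qed
qed

lemma first_diff:
  assumes s: "s \<in> tree_nodes n r" and t: "t \<in> tree_nodes n r" and "s \<noteq> t"
  obtains d where "d \<in> Field r" "s d \<noteq> t d" "\<And>e. str r e d \<Longrightarrow> s e = t e"
proof -
  define D where "D = {d \<in> Field r. s d \<noteq> t d}"
  obtain d where d: "s d \<noteq> t d" using assms(3) by blast
  then have "s d \<noteq> None \<or> t d \<noteq> None" by metis
  then have "d \<in> Field r" using nodeD(2)[OF s] nodeD(2)[OF t] str_r F by blast
  then have "D \<noteq> {}" "D \<subseteq> Field r" using d D_def by auto
  then obtain d where d: "d \<in> D" "\<And>e. e \<in> D \<Longrightarrow> d \<noteq> e \<Longrightarrow> str r d e"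
    using woD(3)[OF wo_str[OF W], of D] by blast
  have "s e = t e" if e: "str r e d" for e
  proof (rule ccontr)
    assume "s e \<noteq> t e"
    then have "e \<in> D" using e str_r F D_def by blast
    then have "str r d e" using d(2) e str_r(2) by blast
    then show False using e str_irr str_r(1) by blast
  qed
  then show ?thesis using that[of d] d(1) D_def by blast
qed

lemma agree_below: "(\<forall>c. str r c u \<longrightarrow> agree r s t c) \<longleftrightarrow> (\<forall>c. str r c u \<longrightarrow> s c = t c)"
  unfolding agree_def using wr(4) F str_le(2) str_r(1) by blast

lemma agree_down: "agree r s t c \<Longrightarrow> (d, c) \<in> r \<Longrightarrow> agree r s t d"
  unfolding agree_def using wr(2) by blast

lemma agree_self: "agree r s t c \<Longrightarrow> c \<in> Field r \<Longrightarrow> s c = t c"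
  unfolding agree_def using wr(4) by blast

lemma agree_step: "(\<And>d. str r d c \<Longrightarrow> s d = t d) \<Longrightarrow> s c = t c \<Longrightarrow> agree r s t c"
  unfolding agree_def str_def by metis

lemma agree_cong: "agree r s t c \<Longrightarrow> agree r s v c = agree r t v c"
  unfolding agree_def by metis

lemma max_exists:
  "finite K \<Longrightarrow> K \<noteq> {} \<Longrightarrow> K \<subseteq> Field r \<Longrightarrow> \<exists>k\<in>K. \<forall>j\<in>K. (j, k) \<in> r"
proof (induction K rule: finite_ne_induct)
  case (singleton x) then show ?case using wr(4) by auto
next
  case (insert x K)
  then obtain k where k: "k \<in> K" "\<forall>j\<in>K. (j, k) \<in> r" by auto
  have xk: "x \<in> Field r" "k \<in> Field r" using insert.prems k by auto
  show ?case
  proof (cases "(x, k) \<in> r")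
    case True then show ?thesis using k by blast
  next
    case False
    then have "(k, x) \<in> r" using wr(5)[OF xk] by blast
    then have "\<forall>j\<in>insert x K. (j, x) \<in> r" using k(2) wr(2) wr(4)[OF xk(1)] by blast
    then show ?thesis by blast
  qed
qed

end

text \<open>An ordinal \<open>r\<close> in the form front part plus \<open>\<theta>\<close>: \<open>pos\<close> is \<open>None\<close> on the front part, and behind it \<open>pos\<close> is
the isomorphism to \<open>\<theta>\<close>. Two ordinals with the same \<open>\<theta>\<close> are compared through the colours \<open>pos\<close>.\<close>

locale side = tree_order r n for r :: "'a rel" and n :: nat +
  fixes \<theta> :: "'d rel" and pos :: "'a \<Rightarrow> 'd option"
  assumes pos_None: "(a, b) \<in> r \<Longrightarrow> pos b = None \<Longrightarrow> pos a = None"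
    and pos_Some: "a \<in> Field r \<Longrightarrow> b \<in> Field r \<Longrightarrow> pos a = Some p \<Longrightarrow> pos b = Some q \<Longrightarrow>
       (a, b) \<in> r \<longleftrightarrow> (p, q) \<in> \<theta>"
    and pos_onto: "p \<in> Field \<theta> \<Longrightarrow> \<exists>a\<in>Field r. pos a = Some p"
    and pos_range: "a \<in> Field r \<Longrightarrow> pos a = Some p \<Longrightarrow> p \<in> Field \<theta>"
    and antisym_\<theta>: "(p, q) \<in> \<theta> \<Longrightarrow> (q, p) \<in> \<theta> \<Longrightarrow> p = q"
    and lad: "ladder n (str r) {a \<in> Field r. pos a = None}"
    and start: "\<exists>a\<in>Field r. pos a = None"
begin

text \<open>Among the first points of difference between \<open>y\<close> and the finitely many members of the family, \<open>u\<close> is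
the last.\<close>

lemma branch_exists:
  assumes x: "\<And>i. x i \<in> tree_nodes n r" and fin: "finite (range x)" and y: "y \<in> tree_nodes n r" "y \<notin> range x"
  obtains i u where "branch r x i y u"
proof -
  have "\<exists>d. d \<in> Field r \<and> y d \<noteq> s d \<and> (\<forall>e. str r e d \<longrightarrow> y e = s e)" if "s \<in> range x" for s
  proof -
    have "s \<in> tree_nodes n r" "y \<noteq> s" using that x y(2) by auto
    from first_diff[OF y(1) this] show ?thesis by metis
  qed
  then obtain B where B: "\<And>s. s \<in> range x \<Longrightarrow> B s \<in> Field r \<and> y (B s) \<noteq> s (B s) \<and> (\<forall>e. str r e (B s) \<longrightarrow> y e = s e)"
    by metis
  have "finite (B ` range x)" "B ` range x \<noteq> {}" "B ` range x \<subseteq> Field r" using fin B by auto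
  from max_exists[OF this] obtain i where i: "\<forall>j. (B (x j), B (x i)) \<in> r" by auto
  have Bi: "y (B (x i)) \<noteq> x i (B (x i))" "\<And>e. str r e (B (x i)) \<Longrightarrow> y e = x i e" using B by blast+
  have "(B (x i), level r (x i)) \<in> r"
    by (rule diff_le_level[OF x y(1)]) (use Bi in auto)
  moreover have "\<exists>d. (d, B (x i)) \<in> r \<and> y d \<noteq> x j d" for j using i B by blast
  ultimately have "branch r x i y (B (x i))" unfolding branch_def using Bi(2) by blast
  then show ?thesis by (rule that)
qed

definition fam :: "(nat \<Rightarrow> 'a \<rightharpoonup> nat) \<Rightarrow> ('a \<rightharpoonup> nat) \<Rightarrow> nat \<Rightarrow> 'a \<rightharpoonup> nat" where
  "fam x y = case_nat y x"

lemma fam_simps [simp]: "fam x y 0 = y" "fam x y (Suc j) = x j"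
  by (simp_all add: fam_def)

definition same :: "(nat \<Rightarrow> 'a \<rightharpoonup> nat) \<Rightarrow> nat \<Rightarrow> nat \<Rightarrow> 'a \<Rightarrow> bool" where
  "same x i j u \<longleftrightarrow> (\<forall>c. str r c u \<longrightarrow> x i c = x j c)"

abbreviation col0 :: "nat option \<times> nat set \<times> 'd option \<Rightarrow> nat option \<times> nat set \<times> 'd option" where
  "col0 \<equiv> \<lambda>(a, J, p). (a, insert 0 (Suc ` J), p)"
abbreviation col1 :: "nat option \<times> nat set \<times> 'd option \<Rightarrow> nat option \<times> nat set \<times> 'd option" where
  "col1 \<equiv> \<lambda>(a, J, p). (a, Suc ` J, p)"

lemma set_fam: "{k. P (fam x y k)} = (if P y then insert 0 (Suc ` {k. P (x k)}) else Suc ` {k. P (x k)})"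
proof -
  have "k \<in> {k. P (fam x y k)} \<longleftrightarrow> k \<in> (if P y then insert 0 (Suc ` {k. P (x k)}) else Suc ` {k. P (x k)})" for k
    by (cases k) auto
  then show ?thesis by blast
qed

lemma colour_fam:
  "colour r pos (fam x y) (Suc j) c = (if agree r (x j) y c then col0 (colour r pos x j c) else col1 (colour r pos x j c))"
  unfolding colour_def fam_simps set_fam[of "\<lambda>v. agree r (x j) v c"] by simp

context
  fixes x i y u
  assumes x: "\<And>i. x i \<in> tree_nodes n r" and y: "y \<in> tree_nodes n r" and br: "branch r x i y u"
begin

lemma br1: "(u, level r (x i)) \<in> r" "str r d u \<Longrightarrow> y d = x i d" "\<exists>d. (d, u) \<in> r \<and> y d \<noteq> x j d"
  using br unfolding branch_def by blast+

lemma br_same: assumes "same x i j u"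
  shows "y u \<noteq> x j u" "str r d u \<Longrightarrow> x j d = y d" "(u, level r (x j)) \<in> r"
proof -
  show 2: "str r d u \<Longrightarrow> x j d = y d" for d using assms br1(2) unfolding same_def by simp
  show 1: "y u \<noteq> x j u" using br1(3)[of j] 2 unfolding str_def by metis
  show "(u, level r (x j)) \<in> r" by (rule diff_le_level[OF x y]) (use 1 2 in auto)
qed

lemma br_y: "(u, level r y) \<in> r"
proof -
  have "same x i i u" unfolding same_def by simp
  then show ?thesis using br_same by (intro diff_le_level[OF y x, of u i]) auto
qed

lemma br_uF: "u \<in> Field r" using br1(1) F by blast

lemma br_disagree: "(u, c) \<in> r \<Longrightarrow> \<not> agree r (x j) y c"
  using br1(3)[of j] wr(2) unfolding agree_def by metis

lemma br_agree: assumes "same x i j u" "c \<in> Field r"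
  shows "agree r (x j) y c \<longleftrightarrow> str r c u"
proof
  assume "agree r (x j) y c"
  then show "str r c u" using br_disagree cmp[OF br_uF assms(2)] by blast
next
  assume "str r c u"
  then show "agree r (x j) y c" unfolding agree_def using br_same(2)[OF assms(1)] str_le(2) by blast
qed

lemma br_notsame: assumes "\<not> same x i j u" "c \<in> Field r"
  shows "agree r (x j) y c \<longleftrightarrow> agree r (x j) (x i) c"
proof -
  obtain d where d: "str r d u" "x i d \<noteq> x j d" using assms(1) same_def by blast
  show ?thesis
  proof (cases "str r c u")
    case True
    then show ?thesis unfolding agree_def using br1(2) str_le(2) by (metis (no_types))
  next
    case False
    then have "(u, c) \<in> r" using cmp[OF br_uF assms(2)] by blast
    then have "(d, c) \<in> r" using d str_r(1) wr(2) by blast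
    then have "\<not> agree r (x j) (x i) c" using d(2) unfolding agree_def by metis
    then show ?thesis using br_disagree[OF \<open>(u, c) \<in> r\<close>] by blast
  qed
qed

lemma colour_notsame:
  assumes "\<not> same x i j u" "c \<in> down r (level r (x j))"
  shows "colour r pos (fam x y) (Suc j) c =
     (\<lambda>(a, J, p). if i \<in> J then col0 (a, J, p) else col1 (a, J, p)) (colour r pos x j c)"
proof -
  have "c \<in> Field r" using assms(2) F(1) unfolding down_def by blast
  then have e: "agree r (x j) y c = agree r (x j) (x i) c" by (rule br_notsame[OF assms(1)])
  show ?thesis unfolding colour_fam e by (simp add: colour_def)
qed

lemma down_split: "(u, b) \<in> r \<Longrightarrow> down r b = {c \<in> down r b. str r c u} \<union> {c \<in> down r b. (u, c) \<in> r}"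
  "before (str r) {c \<in> down r b. str r c u} {c \<in> down r b. (u, c) \<in> r}"
proof -
  show "(u, b) \<in> r \<Longrightarrow> down r b = {c \<in> down r b. str r c u} \<union> {c \<in> down r b. (u, c) \<in> r}"
    unfolding down_def using cmp F by blast
  show "before (str r) {c \<in> down r b. str r c u} {c \<in> down r b. (u, c) \<in> r}"
    unfolding before_def using str_le str_irr str_r(1) by blast
qed

lemma colour_y_below:
  assumes "str r c u" shows "colour r pos (fam x y) 0 c = col0 (colour r pos x i c)"
proof -
  have "agree r y (x i) c" unfolding agree_def using br1(2) str_le(2) assms by blast
  then have ag: "agree r y v c = agree r (x i) v c" for v by (rule agree_cong)
  have "agree r (x i) y c" using ag[of y] by (simp add: agree_def)
  moreover have "y c = x i c" using br1(2) assms by blast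
  ultimately show ?thesis
    unfolding colour_def fam_simps ag set_fam[of "\<lambda>v. agree r (x i) v c"] by simp
qed

lemma colour_y_above:
  assumes "(u, c) \<in> r" shows "colour r pos (fam x y) 0 c = (y c, {0}, pos c)"
proof -
  have "\<not> agree r y (x j) c" for j using br_disagree[OF assms, of j] unfolding agree_def by metis
  then have "{j. agree r y (x j) c} = {}" by blast
  moreover have "agree r y y c" unfolding agree_def by simp
  ultimately have "{j. agree r y (fam x y j) c} = {0}"
    unfolding set_fam[of "\<lambda>v. agree r y v c"] by simp
  then show ?thesis unfolding colour_def fam_simps by simp
qed

text \<open>If \<open>x j\<close> agrees with \<open>x i\<close> below \<open>u\<close>, its word falls into three consecutive parts: below \<open>u\<close>, where it
agrees with the new node as well; from \<open>u\<close> on as long as it agrees with \<open>x i\<close>; and the part where it no longer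
does. On each part the new colour is a function of an old colour of \<open>x i\<close> or \<open>x j\<close>.\<close>

lemma split_same:
  assumes "same x i j u"
  defines "U0 \<equiv> {c. str r c u}"
    and "U1 \<equiv> {c \<in> {c \<in> down r (level r (x i)). (u, c) \<in> r}. j \<in> fst (snd (colour r pos x i c))}"
    and "U2 \<equiv> {c \<in> down r (level r (x j)). i \<notin> fst (snd (colour r pos x j c))}"
  shows "down r (level r (x j)) = (U0 \<union> U1) \<union> U2" "before (str r) U0 U1" "before (str r) (U0 \<union> U1) U2"
    "c \<in> U0 \<Longrightarrow> colour r pos (fam x y) (Suc j) c = col0 (colour r pos x i c)"
    "c \<in> U1 \<Longrightarrow> colour r pos (fam x y) (Suc j) c = col1 (colour r pos x i c)"
    "c \<in> U2 \<Longrightarrow> colour r pos (fam x y) (Suc j) c = col1 (colour r pos x j c)"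
proof -
  have U0: "c \<in> U0 \<longleftrightarrow> str r c u" for c unfolding U0_def by simp
  have U1: "c \<in> U1 \<longleftrightarrow> (c, level r (x i)) \<in> r \<and> (u, c) \<in> r \<and> agree r (x i) (x j) c" for c
    unfolding U1_def colour_def down_def by auto
  have U2: "c \<in> U2 \<longleftrightarrow> (c, level r (x j)) \<in> r \<and> \<not> agree r (x j) (x i) c" for c
    unfolding U2_def colour_def down_def by auto
  have sym: "agree r s t c \<longleftrightarrow> agree r t s c" for s t c unfolding agree_def by metis
  have below: "agree r (x i) (x j) c" if "str r c u" for c
    using assms(1) that str_le(2) unfolding same_def agree_def by blast
  have lev: "(c, level r t) \<in> r" if "s \<in> tree_nodes n r" "t \<in> tree_nodes n r" "(c, level r s) \<in> r" "agree r s t c" for s t c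
  proof (rule ccontr)
    assume "(c, level r t) \<notin> r"
    then have l: "str r (level r t) c" using cmp[OF F(1)[OF that(3)] nodeD(1)[OF that(2)]] by blast
    then have "str r (level r t) (level r s)" using str_le(1) that(3) by blast
    then have "s (level r t) \<noteq> None" using nodeD(2)[OF that(1)] by blast
    moreover have "t (level r t) = None" using nodeD(2)[OF that(2), of "level r t"] str_r(2) by blast
    moreover have "s (level r t) = t (level r t)" using that(4) str_r(1)[OF l] unfolding agree_def by blast
    ultimately show False by simp
  qed
  show "down r (level r (x j)) = (U0 \<union> U1) \<union> U2"
  proof -
    have "c \<in> down r (level r (x j)) \<longleftrightarrow> c \<in> (U0 \<union> U1) \<union> U2" for c
    proof
      assume "c \<in> down r (level r (x j))"
      then have c: "(c, level r (x j)) \<in> r" by (simp add: down_def)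
      show "c \<in> (U0 \<union> U1) \<union> U2"
      proof (cases "str r c u \<or> \<not> agree r (x j) (x i) c")
        case True then show ?thesis using c U2 U0 by blast
      next
        case False
        then have "(u, c) \<in> r" using cmp[OF br_uF F(1)[OF c(1)]] by blast
        then show ?thesis using False lev[OF x x c(1)] U1 sym by blast
      qed
    next
      assume "c \<in> (U0 \<union> U1) \<union> U2"
      then consider "str r c u" | "c \<in> U1" | "c \<in> U2" using U0 by blast
      then show "c \<in> down r (level r (x j))"
      proof cases
        case 1 then show ?thesis using br_same(3)[OF assms(1)] str_r(1) wr(2) unfolding down_def by blast
      next
        case 2 then show ?thesis using lev[OF x x] U1 unfolding down_def by blast
      next
        case 3 then show ?thesis using U2 unfolding down_def by blast
      qed
    qed
    then show ?thesis by blast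
  qed
  show "before (str r) U0 U1" unfolding before_def using U0 U1 str_le(1) str_irr str_r(1) by blast
  show "before (str r) (U0 \<union> U1) U2" unfolding before_def
  proof (intro ballI)
    fix a b assume a: "a \<in> U0 \<union> U1" and b: "b \<in> U2"
    have "agree r (x i) (x j) a" "a \<in> Field r" using a below U1 U0 str_r(1) F by blast+
    then have "\<not> (b, a) \<in> r" using agree_down b U2 sym by blast
    moreover have "b \<in> Field r" using b U2 F by blast
    ultimately show "str r a b \<and> \<not> str r b a" using cmp[of b a] \<open>a \<in> Field r\<close> str_r(1) by blast
  qed
  have ce: "colour r pos x j c = colour r pos x i c" if "agree r (x i) (x j) c" "c \<in> Field r" for c
    unfolding colour_def using agree_cong[OF that(1)] agree_self[OF that] by simp
  show "colour r pos (fam x y) (Suc j) c = col0 (colour r pos x i c)" if c: "c \<in> U0"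
  proof -
    have cu: "str r c u" "c \<in> Field r" using c str_r(1) F U0 by blast+
    have "agree r (x j) y c" using br_agree[OF assms(1) cu(2)] cu(1) by blast
    then show ?thesis unfolding colour_fam ce[OF below[OF cu(1)] cu(2)] by simp
  qed
  show "colour r pos (fam x y) (Suc j) c = col1 (colour r pos x i c)" if c: "c \<in> U1"
  proof -
    have cu: "(u, c) \<in> r" "agree r (x i) (x j) c" "c \<in> Field r" using c U1 F by blast+
    have "\<not> agree r (x j) y c" by (rule br_disagree[OF cu(1)])
    then show ?thesis unfolding colour_fam ce[OF cu(2,3)] by simp
  qed
  show "colour r pos (fam x y) (Suc j) c = col1 (colour r pos x j c)" if c: "c \<in> U2"
  proof -
    have cF: "c \<in> Field r" using c U2 F by blast
    have "\<not> str r c u" using below c U2 sym by blast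
    then show ?thesis unfolding colour_fam using br_agree[OF assms(1) cF] by simp
  qed
qed

end

end

section \<open>Copying the rest of a new node\<close>

lemma eqv_recolor':
  assumes "eqv m R X c S Y d" "\<And>x. x \<in> X \<Longrightarrow> c' x = g (c x)" "\<And>y. y \<in> Y \<Longrightarrow> d' y = g (d y)"
  shows "eqv m R X c' S Y d'"
proof -
  have "eqv m R X c' R X (\<lambda>x. g (c x))" by (rule eqv_cong) (rule assms(2))
  moreover have "eqv m S Y (\<lambda>y. g (d y)) S Y d'" by (rule eqv_cong) (simp add: assms(3))
  ultimately show ?thesis by (rule eqv_trans[OF _ eqv_trans[OF eqv_recolor[OF assms(1)]]])
qed

lemma eqv_ball:
  assumes "eqv (Suc k) R X c S Y d" shows "(\<forall>x\<in>X. P (c x)) \<longleftrightarrow> (\<forall>y\<in>Y. P (d y))"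
proof -
  have "\<forall>y\<in>Y. P (d y)" if "\<forall>x\<in>X. P (c x)"
  proof
    fix y assume "y \<in> Y"
    then obtain x where "x \<in> X" "reply k R X c S Y d x y" using assms unfolding eqv_Suc_iff by blast
    then show "P (d y)" using that replyD(1) by metis
  qed
  moreover have "\<forall>x\<in>X. P (c x)" if "\<forall>y\<in>Y. P (d y)"
  proof
    fix x assume "x \<in> X"
    then obtain y where "y \<in> Y" "reply k R X c S Y d x y" using assms unfolding eqv_Suc_iff by blast
    then show "P (c x)" using that replyD(1) by metis
  qed
  ultimately show ?thesis by blast
qed

text \<open>A property of the form: some point, all points to its left and all points to its right have given colours.
Two rounds preserve it.\<close>

lemma eqv_split_point:
  assumes "eqv (Suc (Suc k)) R X c S Y d"
    and "x \<in> X" "P (c x)" "\<forall>z\<in>{z \<in> X. R z x}. Q (c z)" "\<forall>z\<in>{z \<in> X. R x z}. T (c z)"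
  shows "\<exists>y\<in>Y. P (d y) \<and> (\<forall>z\<in>{z \<in> Y. S z y}. Q (d z)) \<and> (\<forall>z\<in>{z \<in> Y. S y z}. T (d z))"
proof -
  obtain y where y: "y \<in> Y" "reply (Suc k) R X c S Y d x y"
    using assms(1,2) unfolding eqv_Suc_iff[of "Suc k"] by blast
  have "P (d y)" using replyD(1)[OF y(2)] assms(3) by simp
  moreover have "\<forall>z\<in>{z \<in> Y. S z y}. Q (d z)" using eqv_ball[OF replyD(2)[OF y(2)], of Q] assms(4) by blast
  moreover have "\<forall>z\<in>{z \<in> Y. S y z}. T (d z)" using eqv_ball[OF replyD(3)[OF y(2)], of T] assms(5) by blast
  ultimately show ?thesis using y(1) by blast
qed

context ladder begin

lemma above_iff: assumes "x \<in> A" "z \<in> A" shows "le (nx 0 x) z \<longleftrightarrow> lt x z"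
  using nx_0[OF assms] lt_le[OF assms(1) nx_A[OF assms(1)] assms(2) lt_nx[OF assms(1)]] by blast

end

text \<open>The invariant of the game. An infinite sequence with finitely many values is a finite family and an
assignment of variables at the same time.\<close>

definition position :: "nat \<Rightarrow> nat \<Rightarrow> 'a rel \<Rightarrow> ('a \<Rightarrow> 'd option) \<Rightarrow> (nat \<Rightarrow> 'a \<rightharpoonup> nat) \<Rightarrow>
    'b rel \<Rightarrow> ('b \<Rightarrow> 'd option) \<Rightarrow> (nat \<Rightarrow> 'b \<rightharpoonup> nat) \<Rightarrow> bool" where
  "position m n r pos x s pos' x' \<longleftrightarrow> finite (range x) \<and> finite (range x') \<and>
     (\<forall>i. x i \<in> tree_nodes n r \<and> x' i \<in> tree_nodes n s \<and>
       eqv m (str r) (down r (level r (x i))) (colour r pos x i)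
             (str s) (down s (level s (x' i))) (colour s pos' x' i))"

lemma positionD:
  assumes "position m n r pos x s pos' x'"
  shows "finite (range x)" "finite (range x')" "x i \<in> tree_nodes n r" "x' i \<in> tree_nodes n s"
    "eqv m (str r) (down r (level r (x i))) (colour r pos x i)
             (str s) (down s (level s (x' i))) (colour s pos' x' i)"
  using assms unfolding position_def by blast+

lemma position_sym: "position m n r pos x s pos' x' \<Longrightarrow> position m n s pos' x' r pos x"
  unfolding position_def using eqv_sym by blast

lemma position_le: "k \<le> m \<Longrightarrow> position m n r pos x s pos' x' \<Longrightarrow> position k n r pos x s pos' x'"
  unfolding position_def using eqv_le by blast

lemma position_reindex:
  assumes "position m n r pos x s pos' x'"
  shows "position m n r pos (\<lambda>i. x (h i)) s pos' (\<lambda>i. x' (h i))"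
proof -
  have "finite (range (\<lambda>i. x (h i)))" "finite (range (\<lambda>i. x' (h i)))"
    by (rule finite_subset[OF _ positionD(1)[OF assms]], blast,
        rule finite_subset[OF _ positionD(2)[OF assms]], blast)
  moreover have "eqv m (str r) (down r (level r (x (h i)))) (colour r pos (\<lambda>i. x (h i)) i)
             (str s) (down s (level s (x' (h i)))) (colour s pos' (\<lambda>i. x' (h i)) i)" for i
    by (rule eqv_recolor'[OF positionD(5)[OF assms, of "h i"], where g = "\<lambda>(a, J, p). (a, h -` J, p)"])
      (simp_all add: colour_def vimage_def)
  ultimately show ?thesis unfolding position_def using positionD(3,4)[OF assms] by blast
qed

locale two_sides = a: side r n \<theta> pos + b: side s n \<theta> pos'
  for r :: "'a rel" and s :: "'b rel" and n and \<theta> :: "'d rel" and pos pos'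
begin

text \<open>On the part that lies in \<open>\<theta>\<close> the two sides are isomorphic.\<close>

lemma pos_copy:
  assumes "Q \<subseteq> Field \<theta>"
  obtains f where "bij_betw f {c \<in> Field r. \<exists>q\<in>Q. pos c = Some q} {c \<in> Field s. \<exists>q\<in>Q. pos' c = Some q}"
    "\<And>c. c \<in> Field r \<Longrightarrow> \<exists>q\<in>Q. pos c = Some q \<Longrightarrow> pos' (f c) = pos c"
    "\<And>c d. c \<in> Field r \<Longrightarrow> \<exists>q\<in>Q. pos c = Some q \<Longrightarrow> d \<in> Field r \<Longrightarrow> \<exists>q\<in>Q. pos d = Some q \<Longrightarrow>
       str s (f c) (f d) \<longleftrightarrow> str r c d"
proof -
  have injr: "c = d" if "c \<in> Field r" "d \<in> Field r" "pos c = Some q" "pos d = Some q" for c d q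
    using a.pos_Some[OF that(1,2) that(3,4)] a.pos_Some[OF that(2,1) that(4,3)] a.wr(3,5) that by blast
  have injs: "c = d" if "c \<in> Field s" "d \<in> Field s" "pos' c = Some q" "pos' d = Some q" for c d q
    using b.pos_Some[OF that(1,2) that(3,4)] b.pos_Some[OF that(2,1) that(4,3)] b.wr(3,5) that by blast
  define f where "f c = (SOME d. d \<in> Field s \<and> pos' d = pos c)" for c
  have f: "f c \<in> Field s \<and> pos' (f c) = pos c" if "c \<in> Field r" "pos c = Some q" for c q
  proof -
    have "\<exists>d. d \<in> Field s \<and> pos' d = pos c" using b.pos_onto[OF a.pos_range[OF that]] that(2) by auto
    then show ?thesis unfolding f_def by (rule someI_ex)
  qed
  have st: "str s (f c) (f d) \<longleftrightarrow> str r c d" if "c \<in> Field r" "d \<in> Field r" "pos c = Some p" "pos d = Some q" for c d p q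
  proof -
    have "(f c, f d) \<in> s \<longleftrightarrow> (c, d) \<in> r" "f c = f d \<longleftrightarrow> c = d"
      using a.pos_Some[OF that] b.pos_Some[of "f c" "f d" p q] f[OF that(1,3)] f[OF that(2,4)] that injr by auto
    then show ?thesis unfolding str_def by simp
  qed
  have "bij_betw f {c \<in> Field r. \<exists>q\<in>Q. pos c = Some q} {c \<in> Field s. \<exists>q\<in>Q. pos' c = Some q}"
    unfolding bij_betw_def
  proof
    show "inj_on f {c \<in> Field r. \<exists>q\<in>Q. pos c = Some q}"
    proof (rule inj_onI)
      fix c d assume c: "c \<in> {c \<in> Field r. \<exists>q\<in>Q. pos c = Some q}" "d \<in> {c \<in> Field r. \<exists>q\<in>Q. pos c = Some q}"
        and fe: "f c = f d"
      then obtain p q where pq: "c \<in> Field r" "d \<in> Field r" "pos c = Some p" "pos d = Some q" by blast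
      then have "p = q" using f[OF pq(1,3)] f[OF pq(2,4)] fe by simp
      then show "c = d" using injr pq by blast
    qed
    show "f ` {c \<in> Field r. \<exists>q\<in>Q. pos c = Some q} = {c \<in> Field s. \<exists>q\<in>Q. pos' c = Some q}"
    proof (intro subset_antisym subsetI)
      fix e assume "e \<in> f ` {c \<in> Field r. \<exists>q\<in>Q. pos c = Some q}"
      then show "e \<in> {c \<in> Field s. \<exists>q\<in>Q. pos' c = Some q}" using f by auto
    next
      fix e assume "e \<in> {c \<in> Field s. \<exists>q\<in>Q. pos' c = Some q}"
      then obtain q where q: "e \<in> Field s" "q \<in> Q" "pos' e = Some q" by blast
      then obtain c where c: "c \<in> Field r" "pos c = Some q" using a.pos_onto assms by blast
      then have "f c = e" using f[OF c] injs[of "f c" e q] q by simp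
      then show "e \<in> f ` {c \<in> Field r. \<exists>q\<in>Q. pos c = Some q}" using c q by blast
    qed
  qed
  then show ?thesis using that[of f] f st by blast
qed

text \<open>The word of \<open>y\<close> on \<open>[u, b]\<close> has the equivalent copy \<open>v\<close> on \<open>[u', b']\<close>. The new node is at its end point
\<open>b\<close> undefined, and from the branching point on it agrees with itself only, hence the constant second component.\<close>

definition stretch :: "nat \<Rightarrow> 'a \<Rightarrow> 'a \<Rightarrow> ('a \<Rightarrow> nat option) \<Rightarrow> 'b \<Rightarrow> 'b \<Rightarrow> ('b \<Rightarrow> nat option) \<Rightarrow> bool" where
  "stretch m u b y u' b' v \<longleftrightarrow> (u', b') \<in> s \<and> v u' = y u \<and> v b' = None \<and>
     (\<forall>c. str s c b' \<longrightarrow> (u', c) \<in> s \<longrightarrow> (\<exists>a<n. v c = Some a)) \<and>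
     eqv m (str r) {c. (u, c) \<in> r \<and> (c, b) \<in> r} (\<lambda>c. (y c, {0::nat}, pos c))
           (str s) {c. (u', c) \<in> s \<and> (c, b') \<in> s} (\<lambda>c. (v c, {0}, pos' c))"

lemma stretch_Some:
  assumes ub: "(u, b) \<in> r" and u': "u' \<in> Field s" "pos u = pos' u'" and p: "pos u = Some p"
    and y: "\<And>c. str r c b \<Longrightarrow> (u, c) \<in> r \<Longrightarrow> \<exists>a<n. y c = Some a" "y b = None"
  shows "\<exists>b' v. stretch m u b y u' b' v"
proof -
  have F: "u \<in> Field r" "b \<in> Field r" using ub a.F by auto
  obtain q where q: "pos b = Some q" using a.pos_None[OF ub] p by (cases "pos b") auto
  define Q where "Q = {e \<in> Field \<theta>. (p, e) \<in> \<theta> \<and> (e, q) \<in> \<theta>}"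
  have X: "{c. (u, c) \<in> r \<and> (c, b) \<in> r} = {c \<in> Field r. \<exists>e\<in>Q. pos c = Some e}"
  proof (intro subset_antisym subsetI)
    fix c assume "c \<in> {c. (u, c) \<in> r \<and> (c, b) \<in> r}"
    then have c: "(u, c) \<in> r" "(c, b) \<in> r" "c \<in> Field r" using a.F by auto
    obtain e where e: "pos c = Some e" using a.pos_None[OF c(1)] p by (cases "pos c") auto
    then have "e \<in> Q" unfolding Q_def
      using a.pos_Some[OF F(1) c(3) p e] a.pos_Some[OF c(3) F(2) e q] c a.pos_range[OF c(3) e] by simp
    then show "c \<in> {c \<in> Field r. \<exists>e\<in>Q. pos c = Some e}" using c(3) e by blast
  next
    fix c assume "c \<in> {c \<in> Field r. \<exists>e\<in>Q. pos c = Some e}"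
    then obtain e where e: "c \<in> Field r" "e \<in> Q" "pos c = Some e" by blast
    then show "c \<in> {c. (u, c) \<in> r \<and> (c, b) \<in> r}"
      using a.pos_Some[OF F(1) e(1) p e(3)] a.pos_Some[OF e(1) F(2) e(3) q] unfolding Q_def by simp
  qed
  have p': "pos' u' = Some p" using u' p by simp
  obtain f where f: "bij_betw f {c \<in> Field r. \<exists>q\<in>Q. pos c = Some q} {c \<in> Field s. \<exists>q\<in>Q. pos' c = Some q}"
    "\<And>c. c \<in> Field r \<Longrightarrow> \<exists>q\<in>Q. pos c = Some q \<Longrightarrow> pos' (f c) = pos c"
    "\<And>c d. c \<in> Field r \<Longrightarrow> \<exists>q\<in>Q. pos c = Some q \<Longrightarrow> d \<in> Field r \<Longrightarrow> \<exists>q\<in>Q. pos d = Some q \<Longrightarrow>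
       str s (f c) (f d) \<longleftrightarrow> str r c d"
    using pos_copy[of Q] Q_def by blast
  define X0 where "X0 = {c \<in> Field r. \<exists>q\<in>Q. pos c = Some q}"
  have uX: "u \<in> X0" "b \<in> X0" unfolding X0_def X[symmetric] using ub a.wr(4) F by auto
  have fX: "c \<in> X0 \<Longrightarrow> f c \<in> Field s \<and> pos' (f c) = pos c" for c
    using f(1,2) unfolding X0_def bij_betw_def by blast
  have fle: "c \<in> X0 \<Longrightarrow> d \<in> X0 \<Longrightarrow> (f c, f d) \<in> s \<longleftrightarrow> (c, d) \<in> r" for c d
    using a.pos_Some[of c d] b.pos_Some[of "f c" "f d"] fX[of c] fX[of d] unfolding X0_def by auto
  have fu: "f u = u'"
  proof -
    have "(f u, u') \<in> s \<longleftrightarrow> (p, p) \<in> \<theta>" "(u', f u) \<in> s \<longleftrightarrow> (p, p) \<in> \<theta>"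
      using b.pos_Some[of "f u" u' p p] b.pos_Some[of u' "f u" p p] fX[OF uX(1)] p p' u'(1) by auto
    then show ?thesis using b.wr(3,5) fX[OF uX(1)] u'(1) by blast
  qed
  have qb: "pos' (f b) = Some q" using fX[OF uX(2)] q by simp
  have X': "{c. (u', c) \<in> s \<and> (c, f b) \<in> s} = {c \<in> Field s. \<exists>e\<in>Q. pos' c = Some e}"
  proof (intro subset_antisym subsetI)
    fix c assume "c \<in> {c. (u', c) \<in> s \<and> (c, f b) \<in> s}"
    then have c: "(u', c) \<in> s" "(c, f b) \<in> s" "c \<in> Field s" using b.F by auto
    obtain e where e: "pos' c = Some e" using b.pos_None[OF c(1)] p' by (cases "pos' c") auto
    then have "e \<in> Q" unfolding Q_def
      using b.pos_Some[OF u'(1) c(3) p' e] b.pos_Some[OF c(3) _ e qb] fX[OF uX(2)] c b.pos_range[OF c(3) e] by simp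
    then show "c \<in> {c \<in> Field s. \<exists>e\<in>Q. pos' c = Some e}" using c(3) e by blast
  next
    fix c assume "c \<in> {c \<in> Field s. \<exists>e\<in>Q. pos' c = Some e}"
    then obtain e where e: "c \<in> Field s" "e \<in> Q" "pos' c = Some e" by blast
    then show "c \<in> {c. (u', c) \<in> s \<and> (c, f b) \<in> s}"
      using b.pos_Some[OF u'(1) e(1) p' e(3)] b.pos_Some[OF e(1) _ e(3) qb] fX[OF uX(2)] unfolding Q_def by simp
  qed
  define v where "v c = y (inv_into X0 f c)" for c
  have vf: "v (f c) = y c" if "c \<in> X0" for c
    unfolding v_def using f(1) that unfolding X0_def[symmetric] bij_betw_def by simp
  have "\<exists>a<n. v c = Some a" if c: "str s c (f b)" "(u', c) \<in> s" for c
  proof -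
    have "c \<in> {c \<in> Field s. \<exists>e\<in>Q. pos' c = Some e}" unfolding X'[symmetric] using c b.str_r(1) by blast
    then obtain d where d: "d \<in> X0" "c = f d" using f(1) unfolding X0_def[symmetric] bij_betw_def by blast
    have "str r d b" "(u, d) \<in> r"
      using c d fle[OF d(1) uX(2)] fle[OF uX(1) d(1)] fu unfolding str_def by auto
    then show ?thesis using y(1) vf d by metis
  qed
  moreover have "eqv m (str r) X0 (\<lambda>c. (y c, {0::nat}, pos c))
           (str s) {c \<in> Field s. \<exists>e\<in>Q. pos' c = Some e} (\<lambda>c. (v c, {0}, pos' c))"
    by (rule eqv_iso[of f]) (use f(1,3) vf fX in \<open>auto simp: X0_def\<close>)
  ultimately have "stretch m u b y u' (f b) v" unfolding stretch_def X X' X0_def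
    using fle[OF uX] ub fu vf[OF uX(1)] vf[OF uX(2)] y(2) by simp
  then show ?thesis by blast
qed

text \<open>If \<open>b\<close> is in the front part, the word strictly between \<open>u\<close> and \<open>b\<close> is realised on a suitable interval above
\<open>u'\<close>. Otherwise the word on the whole tail of the front part above \<open>u\<close> is transferred to the tail above \<open>u'\<close>, and
the part in \<open>\<theta>\<close> is copied.\<close>

lemma stretch_None:
  assumes ub: "str r u b" and u': "u' \<in> Field s" "pos' u' = None" and p: "pos u = None"
    and y: "\<And>c. str r c b \<Longrightarrow> (u, c) \<in> r \<Longrightarrow> \<exists>a<n. y c = Some a" "y b = None"
  shows "\<exists>b' v. stretch m u b y u' b' v"
proof -
  define A where "A = {c \<in> Field r. pos c = None}"
  define B where "B = {c \<in> Field s. pos' c = None}"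
  interpret la: ladder n m "str r" A unfolding A_def by (rule a.lad)
  interpret lb: ladder n m "str s" B unfolding B_def by (rule b.lad)
  have F: "u \<in> Field r" "b \<in> Field r" "(u, b) \<in> r" using ub a.str_r a.F by blast+
  have uA: "u \<in> A" "u' \<in> B" using F u' p by (auto simp: A_def B_def)
  define cz where "cz c = (case y c of None \<Rightarrow> 0 | Some a \<Rightarrow> if a < n then a else 0)" for c
  have cz: "cz c < n" for c unfolding cz_def using la.n by (auto split: option.split)
  have czy: "y c = Some (cz c)" if "str r c b" "(u, c) \<in> r" for c
    using y(1)[OF that] unfolding cz_def by auto
  have taila: "{z \<in> A. la.nx 0 u = z \<or> str r (la.nx 0 u) z} = {c \<in> A. str r u c}"
    using la.above_iff[OF uA(1)] by blast
  have tailb: "{z \<in> B. lb.nx 0 u' = z \<or> str s (lb.nx 0 u') z} = {c \<in> B. str s u' c}"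
    using lb.above_iff[OF uA(2)] by blast
  show ?thesis
  proof (cases "pos b")
    case None
    define M where "M = {c. str r u c \<and> str r c b}"
    have "M \<subseteq> A" unfolding M_def A_def using a.pos_None[OF _ None] a.str_r(1) a.F by blast
    from lb.short_real[OF wo_sub[OF la.wo this], of cz "lb.nx 0 u'"] cz uA
    obtain b' d where b': "b' \<in> B" "lb.nx 0 u' = b' \<or> str s (lb.nx 0 u') b'" "lb.col d"
      "eqv m (str r) M cz (str s) (lb.iv (lb.nx 0 u') b') d" by auto
    have ub': "str s u' b'" using b'(1,2) lb.above_iff[OF uA(2) b'(1)] by blast
    have b'N: "pos' b' = None" "b' \<in> Field s" using b'(1) B_def by auto
    have N: "lb.iv (lb.nx 0 u') b' = {c. str s u' c \<and> str s c b'}" (is "_ = ?N")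
    proof -
      have "?N \<subseteq> B" unfolding B_def using b.pos_None[OF _ b'N(1)] b.str_r(1) b.F by blast
      then show ?thesis unfolding lb.iv_def using tailb by blast
    qed
    define v where "v c = (if c = u' then y u else if c = b' then None else Some (d c))" for c
    have dn: "d c < n" for c using b'(3) lb.col_def by blast
    have eM: "eqv m (str r) M (\<lambda>c. (y c, {0}, pos c)) (str s) ?N (\<lambda>c. (v c, {0}, pos' c))"
    proof (rule eqv_recolor'[OF b'(4)[unfolded N], where g = "\<lambda>a. (Some a, {0}, None)"])
      show "(y c, {0}, pos c) = (Some (cz c), {0}, None)" if "c \<in> M" for c
        using that czy a.str_r(1) \<open>M \<subseteq> A\<close> unfolding M_def A_def by auto
      show "(v c, {0}, pos' c) = (Some (d c), {0}, None)" if c: "c \<in> ?N" for c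
      proof -
        have "c \<noteq> u'" "c \<noteq> b'" using c by (auto simp: str_def)
        moreover have "pos' c = None" using c by (intro b.pos_None[OF _ b'N(1)]) (simp add: str_def)
        ultimately show ?thesis by (simp add: v_def)
      qed
    qed
    have "eqv m (str r) ({u} \<union> (M \<union> {b})) (\<lambda>c. (y c, {0::nat}, pos c))
             (str s) ({u'} \<union> (?N \<union> {b'})) (\<lambda>c. (v c, {0}, pos' c))"
    proof (intro eqv_union eM eqv_single)
      show "before (str r) {u} (M \<union> {b})" unfolding before_def M_def
        using ub a.str_irr a.str_r(1) by blast
      show "before (str r) M {b}" unfolding before_def M_def using a.str_irr a.str_r(1) by blast
      show "before (str s) {u'} (?N \<union> {b'})" unfolding before_def
        using ub' b.str_irr b.str_r(1) by blast
      show "before (str s) ?N {b'}" unfolding before_def using b.str_irr b.str_r(1) by blast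
      show "(y u, {0::nat}, pos u) = (v u', {0}, pos' u')" using u' p by (simp add: v_def)
      show "(y b, {0::nat}, pos b) = (v b', {0}, pos' b')"
        using y(2) None b'N b.str_r(2)[OF ub'] by (simp add: v_def)
    qed (simp_all add: str_def)
    moreover have "{u} \<union> (M \<union> {b}) = {c. (u, c) \<in> r \<and> (c, b) \<in> r}"
      unfolding M_def using F a.wr(4) unfolding str_def by blast
    moreover have "{u'} \<union> (?N \<union> {b'}) = {c. (u', c) \<in> s \<and> (c, b') \<in> s}"
      using b'N(2) u'(1) b.wr(4) ub' unfolding str_def by blast
    moreover have "\<exists>a<n. v c = Some a" if "str s c b'" "(u', c) \<in> s" for c
      using that dn y(1)[OF ub] F a.wr(4) b.str_r(2) unfolding v_def by auto
    ultimately have "stretch m u b y u' b' v"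
      unfolding stretch_def using b.str_r(1)[OF ub'] b.str_r(2)[OF ub'] by (simp add: v_def)
    then show ?thesis by blast
  next
    case (Some q)
    define Q where "Q = {e \<in> Field \<theta>. (e, q) \<in> \<theta>}"
    define M where "M = {c \<in> A. str r u c}"
    define N where "N = {c \<in> B. str s u' c}"
    define Z where "Z = {c \<in> Field r. \<exists>e\<in>Q. pos c = Some e}"
    define Y where "Y = {c \<in> Field s. \<exists>e\<in>Q. pos' c = Some e}"
    from tail_equiv[OF la.ladder_axioms lb.ladder_axioms la.nx_A[OF uA(1), of 0] lb.nx_A[OF uA(2), of 0],
        where c = cz and m = m, OF cz, unfolded taila tailb, folded M_def N_def]
    obtain d where d0: "(\<forall>z. d z < n) \<and> eqv m (str r) M cz (str s) N d" by (rule exE)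
    then have d: "\<And>z. d z < n" "eqv m (str r) M cz (str s) N d" by blast+
    have qF: "q \<in> Field \<theta>" using a.pos_range[OF F(2) Some] .
    obtain b' where b': "b' \<in> Field s" "pos' b' = Some q" using b.pos_onto[OF qF] by blast
    obtain f where f: "bij_betw f Z Y"
      "\<And>c. c \<in> Field r \<Longrightarrow> \<exists>q\<in>Q. pos c = Some q \<Longrightarrow> pos' (f c) = pos c"
      "\<And>c d. c \<in> Field r \<Longrightarrow> \<exists>q\<in>Q. pos c = Some q \<Longrightarrow> d \<in> Field r \<Longrightarrow> \<exists>q\<in>Q. pos d = Some q \<Longrightarrow>
         str s (f c) (f d) \<longleftrightarrow> str r c d"
      using pos_copy[of Q] Q_def unfolding Z_def Y_def by blast
    define v where "v c = (if c = u' then y u else if pos' c = None then Some (d c) else y (inv_into Z f c))" for c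
    have qq: "(q, q) \<in> \<theta>" using a.pos_Some[OF F(2) F(2) Some Some] a.wr(4)[OF F(2)] by blast
    have bZ: "b \<in> Z" "b' \<in> Y" using F b' Some qF qq unfolding Z_def Y_def Q_def by auto
    have fb: "f b = b'"
    proof -
      have "f b \<in> Field s" "pos' (f b) = Some q"
        using f(1) bZ f(2)[of b] Some unfolding bij_betw_def Z_def Y_def by auto
      then have "(f b, b') \<in> s" "(b', f b) \<in> s"
        using b.pos_Some[of "f b" b' q q] b.pos_Some[of b' "f b" q q] b' qq by auto
      then show ?thesis by (rule b.wr(3))
    qed
    have vZ: "v (f c) = y c" if "c \<in> Z" for c
    proof -
      have "f c \<in> Y" using f(1) that unfolding bij_betw_def by blast
      then have "pos' (f c) \<noteq> None" "f c \<noteq> u'" using u' unfolding Y_def by auto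
      then have "v (f c) = y (inv_into Z f (f c))" unfolding v_def by auto
      then show ?thesis using f(1) that unfolding bij_betw_def by simp
    qed
    have eM: "eqv m (str r) M (\<lambda>c. (y c, {0}, pos c)) (str s) N (\<lambda>c. (v c, {0}, pos' c))"
    proof (rule eqv_recolor'[OF d(2), where g = "\<lambda>a. (Some a, {0}, None)"])
      fix c assume c: "c \<in> M"
      then have cc: "c \<in> Field r" "pos c = None" "(u, c) \<in> r" using a.str_r(1) unfolding M_def A_def by auto
      have "(b, c) \<notin> r" using a.pos_None[of b c] cc(2) Some by auto
      then have "str r c b" using a.cmp[OF F(2) cc(1)] by blast
      then show "(y c, {0}, pos c) = (Some (cz c), {0}, None)" using czy cc by simp
    next
      show "(v c, {0}, pos' c) = (Some (d c), {0}, None)" if c: "c \<in> N" for c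
      proof -
        have "c \<noteq> u'" "pos' c = None" using c by (auto simp: str_def N_def B_def)
        then show ?thesis by (simp add: v_def)
      qed
    qed
    have eZ: "eqv m (str r) Z (\<lambda>c. (y c, {0}, pos c)) (str s) Y (\<lambda>c. (v c, {0::nat}, pos' c))"
      by (rule eqv_iso[OF f(1)]) (use f(2,3) vZ in \<open>auto simp: Z_def\<close>)
    have bNS: "before (str r) X Z'" if "\<And>c. c \<in> X \<Longrightarrow> c \<in> Field r \<and> pos c = None" "\<And>c. c \<in> Z' \<Longrightarrow> c \<in> Field r \<and> pos c \<noteq> None" for X Z'
      unfolding before_def
    proof (intro ballI)
      fix c e assume "c \<in> X" "e \<in> Z'"
      then have ce: "c \<in> Field r" "pos c = None" "e \<in> Field r" "pos e \<noteq> None" using that by blast+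
      have "(e, c) \<notin> r" using a.pos_None[of e c] ce by blast
      then show "str r c e \<and> \<not> str r e c" using a.cmp[OF ce(3,1)] a.str_r(1) by blast
    qed
    have bNS': "before (str s) X Z'" if "\<And>c. c \<in> X \<Longrightarrow> c \<in> Field s \<and> pos' c = None" "\<And>c. c \<in> Z' \<Longrightarrow> c \<in> Field s \<and> pos' c \<noteq> None" for X Z'
      unfolding before_def
    proof (intro ballI)
      fix c e assume "c \<in> X" "e \<in> Z'"
      then have ce: "c \<in> Field s" "pos' c = None" "e \<in> Field s" "pos' e \<noteq> None" using that by blast+
      have "(e, c) \<notin> s" using b.pos_None[of e c] ce by blast
      then show "str s c e \<and> \<not> str s e c" using b.cmp[OF ce(3,1)] b.str_r(1) by blast
    qed
    have "eqv m (str r) (({u} \<union> M) \<union> Z) (\<lambda>c. (y c, {0::nat}, pos c))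
             (str s) (({u'} \<union> N) \<union> Y) (\<lambda>c. (v c, {0}, pos' c))"
    proof (intro eqv_union eM eZ eqv_single)
      show "before (str r) {u} M" unfolding before_def M_def using a.str_irr a.str_r(1) by blast
      show "before (str s) {u'} N" unfolding before_def N_def using b.str_irr b.str_r(1) by blast
      show "before (str r) ({u} \<union> M) Z" by (rule bNS) (use F p in \<open>auto simp: M_def A_def Z_def\<close>)
      show "before (str s) ({u'} \<union> N) Y" by (rule bNS') (use u' in \<open>auto simp: N_def B_def Y_def\<close>)
      show "(y u, {0::nat}, pos u) = (v u', {0}, pos' u')" using u' p by (simp add: v_def)
    qed (simp_all add: str_def)
    moreover have "({u} \<union> M) \<union> Z = {c. (u, c) \<in> r \<and> (c, b) \<in> r}"
    proof (intro subset_antisym subsetI)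
      fix c assume c: "c \<in> ({u} \<union> M) \<union> Z"
      then have cF: "c \<in> Field r" using F unfolding M_def A_def Z_def by auto
      have "(u, c) \<in> r"
      proof (cases "pos c")
        case None then show ?thesis using c F a.wr(4) a.str_r(1) unfolding M_def Z_def by auto
      next
        case (Some e)
        then show ?thesis using bNS[of "{u}" "{c}"] F p cF a.str_r(1) unfolding before_def by simp
      qed
      moreover have "(c, b) \<in> r"
      proof (cases "pos c")
        case None
        then show ?thesis using bNS[of "{c}" "{b}"] F Some cF a.str_r(1) unfolding before_def by simp
      next
        case S: (Some e)
        then have "(e, q) \<in> \<theta>" using c p unfolding M_def A_def Z_def Q_def by auto
        then show ?thesis using a.pos_Some[OF cF F(2) S Some] by blast
      qed
      ultimately show "c \<in> {c. (u, c) \<in> r \<and> (c, b) \<in> r}" by blast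
    next
      fix c assume "c \<in> {c. (u, c) \<in> r \<and> (c, b) \<in> r}"
      then have c: "(u, c) \<in> r" "(c, b) \<in> r" "c \<in> Field r" using a.F by auto
      show "c \<in> ({u} \<union> M) \<union> Z"
      proof (cases "pos c")
        case None then show ?thesis using c unfolding M_def A_def str_def by auto
      next
        case S: (Some e)
        then have "e \<in> Q" unfolding Q_def using a.pos_Some[OF c(3) F(2) S Some] c a.pos_range[OF c(3) S] by blast
        then show ?thesis using S c(3) Z_def by blast
      qed
    qed
    moreover have Y': "({u'} \<union> N) \<union> Y = {c. (u', c) \<in> s \<and> (c, b') \<in> s}"
    proof (intro subset_antisym subsetI)
      fix c assume c: "c \<in> ({u'} \<union> N) \<union> Y"
      then have cF: "c \<in> Field s" using u' unfolding N_def B_def Y_def by auto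
      have "(u', c) \<in> s"
      proof (cases "pos' c")
        case None then show ?thesis using c u' b.wr(4) b.str_r(1) unfolding N_def Y_def by auto
      next
        case (Some e)
        then show ?thesis using bNS'[of "{u'}" "{c}"] u' cF b.str_r(1) unfolding before_def by simp
      qed
      moreover have "(c, b') \<in> s"
      proof (cases "pos' c")
        case None
        then show ?thesis using bNS'[of "{c}" "{b'}"] b' cF b.str_r(1) unfolding before_def by simp
      next
        case S: (Some e)
        then have "(e, q) \<in> \<theta>" using c u' unfolding N_def B_def Y_def Q_def by auto
        then show ?thesis using b.pos_Some[OF cF b'(1) S b'(2)] by blast
      qed
      ultimately show "c \<in> {c. (u', c) \<in> s \<and> (c, b') \<in> s}" by blast
    next
      fix c assume "c \<in> {c. (u', c) \<in> s \<and> (c, b') \<in> s}"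
      then have c: "(u', c) \<in> s" "(c, b') \<in> s" "c \<in> Field s" using b.F by auto
      show "c \<in> ({u'} \<union> N) \<union> Y"
      proof (cases "pos' c")
        case None then show ?thesis using c unfolding N_def B_def str_def by auto
      next
        case S: (Some e)
        then have "e \<in> Q" unfolding Q_def using b.pos_Some[OF c(3) b'(1) S b'(2)] c b.pos_range[OF c(3) S] by blast
        then show ?thesis using S c(3) Y_def by blast
      qed
    qed
    moreover have "\<exists>a<n. v c = Some a" if c: "str s c b'" "(u', c) \<in> s" for c
    proof -
      have "c \<in> ({u'} \<union> N) \<union> Y" unfolding Y' using c b.str_r(1) by blast
      then consider "c = u'" | "c \<in> N" | "c \<in> Y" by blast
      then show ?thesis
      proof cases
        case 1 then show ?thesis using y(1)[OF ub a.wr(4)[OF F(1)]] by (simp add: v_def)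
      next
        case 2 then show ?thesis using d(1) b.str_r(2) unfolding N_def B_def v_def by auto
      next
        case 3
        then obtain e where e: "e \<in> Z" "c = f e" using f(1) unfolding bij_betw_def by blast
        have "str r e b" using f(3)[of e b] e c(1) bZ(1) fb unfolding Z_def by auto
        moreover have "(u, e) \<in> r" using bNS[of "{u}" "{e}"] e(1) F p a.str_r(1) unfolding before_def Z_def by auto
        ultimately show ?thesis using y(1) vZ[OF e(1)] e(2) by metis
      qed
    qed
    moreover have "(u', b') \<in> s" "v b' = None" using Y' bZ(2) vZ[OF bZ(1)] fb y(2) by auto
    ultimately have "stretch m u b y u' b' v"
      unfolding stretch_def by (simp add: v_def)
    then show ?thesis by blast
  qed
qed

lemma stretch_exists:
  assumes ub: "(u, b) \<in> r" and u': "u' \<in> Field s" "pos u = pos' u'"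
    and y: "\<And>c. str r c b \<Longrightarrow> (u, c) \<in> r \<Longrightarrow> \<exists>a<n. y c = Some a" "y b = None"
  shows "\<exists>b' v. stretch m u b y u' b' v"
proof (cases "pos u")
  case (Some p) then show ?thesis by (rule stretch_Some[where y = y, OF ub u' _ y])
next
  case None
  show ?thesis
  proof (cases "u = b")
    case False
    then have "str r u b" using ub str_def by metis
    moreover have "pos' u' = None" using None u'(2) by simp
    ultimately show ?thesis by (rule stretch_None[where y = y, OF _ u'(1) _ None y])
  next
    case True
    have uF: "u \<in> Field r" using ub a.F by blast
    have "{c. (u, c) \<in> r \<and> (c, u) \<in> r} = {u}" "{c. (u', c) \<in> s \<and> (c, u') \<in> s} = {u'}"
      using a.wr(3) a.wr(4)[OF uF] b.wr(3) b.wr(4)[OF u'(1)] by blast+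
    moreover have "eqv m (str r) {u} (\<lambda>c. (y c, {0::nat}, pos c)) (str s) {u'} (\<lambda>c. (None, {0}, pos' c))"
      by (rule eqv_single) (use u'(2) y(2) True in \<open>simp_all add: str_def\<close>)
    moreover have "\<not> (str s c u' \<and> (u', c) \<in> s)" for c by (rule b.str_irr)
    ultimately have "stretch m u b y u' u' (\<lambda>_. None)"
      unfolding stretch_def True[symmetric] using y(2) True b.wr(4)[OF u'(1)] by simp
    then show ?thesis by blast
  qed
qed

end

section \<open>The game on two trees\<close>

lemma eqv_on_unions:
  assumes "X = (A \<union> B) \<union> C" "before R A B" "before R (A \<union> B) C"
    and "Y = (A' \<union> B') \<union> C'" "before S A' B'" "before S (A' \<union> B') C'"
    and "eqv m R A c S A' d" "eqv m R B c S B' d" "eqv m R C c S C' d"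
  shows "eqv m R X c S Y d"
  unfolding assms(1,4) by (intro eqv_union assms)

context two_sides begin

text \<open>A move in the tree costs one round: it supplies the reply to the branching point. All words of the new position
are then composed of pieces of old words with changed colours and of the stretched rest of the new node.\<close>

lemma step:
  assumes P: "position (Suc (Suc k)) n r pos x s pos' x'" and y: "y \<in> tree_nodes n r"
  shows "\<exists>y'. position (Suc k) n r pos (case_nat y x) s pos' (case_nat y' x')"
proof (cases "y \<in> range x")
  case True
  then obtain i where i: "y = x i" by blast
  have "case_nat (x i) x = (\<lambda>j. x (case_nat i id j))" "case_nat (x' i) x' = (\<lambda>j. x' (case_nat i id j))"
    by (auto split: nat.splits)
  then have "position (Suc (Suc k)) n r pos (case_nat y x) s pos' (case_nat (x' i) x')"
    unfolding i using position_reindex[OF P, of "case_nat i id"] by simp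
  then have "position (Suc k) n r pos (case_nat y x) s pos' (case_nat (x' i) x')"
    by (rule position_le[rotated]) simp
  then show ?thesis by (intro exI[of _ "x' i"])
next
  case False
  note x = positionD(3)[OF P] and x' = positionD(4)[OF P]
  define m where "m = Suc k"
  have E: "eqv (Suc m) (str r) (down r (level r (x j))) (colour r pos x j)
             (str s) (down s (level s (x' j))) (colour s pos' x' j)" for j
    using positionD(5)[OF P] unfolding m_def .
  (* The reply u' is sought in the word of x i, the node that y follows longest. *)
  obtain i u where br: "branch r x i y u" using a.branch_exists[OF x positionD(1)[OF P] y False] by blast
  have br1: "(u, level r (x i)) \<in> r" "\<And>d. str r d u \<Longrightarrow> y d = x i d" using br unfolding branch_def by auto
  then have "u \<in> down r (level r (x i))" unfolding down_def by simp
  then obtain u' where u': "u' \<in> down s (level s (x' i))"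
    and re: "reply m (str r) (down r (level r (x i))) (colour r pos x i)
             (str s) (down s (level s (x' i))) (colour s pos' x' i) u u'"
    using E[of i] unfolding eqv_Suc_iff by blast
  have u'l: "(u', level s (x' i)) \<in> s" using u' unfolding down_def by simp
  have u'F: "u' \<in> Field s" using u'l b.F by blast
  have col: "x i u = x' i u'" "pos u = pos' u'" "agree r (x i) (x j) u \<longleftrightarrow> agree s (x' i) (x' j) u'" for j
    using replyD(1)[OF re] unfolding colour_def by auto
  have dr: "{z \<in> down r b. str r z u} = {c. str r c u}" if "(u, b) \<in> r" for b
    using that a.str_r(1) a.wr(2) unfolding down_def by blast
  have ds: "{z \<in> down s b. str s z u'} = {c. str s c u'}" if "(u', b) \<in> s" for b
    using that b.str_r(1) b.wr(2) unfolding down_def by blast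
  have E0: "eqv m (str r) {c. str r c u} (colour r pos x i) (str s) {c. str s c u'} (colour s pos' x' i)"
    using replyD(2)[OF re] unfolding dr[OF br1(1)] ds[OF u'l] .
  have same: "a.same x i j u \<longleftrightarrow> b.same x' i j u'" for j
  proof -
    have "(\<forall>c. str r c u \<longrightarrow> agree r (x i) (x j) c) \<longleftrightarrow> (\<forall>c. str s c u' \<longrightarrow> agree s (x' i) (x' j) c)"
      using eqv_ball[OF E0[unfolded m_def], of "\<lambda>(a, J, p). j \<in> J"] unfolding colour_def by simp
    then show ?thesis unfolding a.agree_below b.agree_below a.same_def b.same_def .
  qed
  (* The colours record the letter of x i at u only. If x j differs from x i at u, its letter there is
     found by a second reply, which must again be u' because both mark the first disagreement. *)
  have val: "x j u = x' j u'" if sj: "a.same x i j u" for j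
  proof (cases "agree r (x i) (x j) u")
    case True
    then have "x i u = x j u" "x' i u' = x' j u'"
      using a.agree_self a.br_uF[OF x y br] b.agree_self u'F col(3) by blast+
    then show ?thesis using col(1) by simp
  next
    case nag: False
    have "u \<in> down r (level r (x j))" using a.br_same(3)[OF x y br sj] unfolding down_def by simp
    then obtain v where v: "v \<in> down s (level s (x' j))"
      and re': "reply m (str r) (down r (level r (x j))) (colour r pos x j)
             (str s) (down s (level s (x' j))) (colour s pos' x' j) u v"
      using E[of j] unfolding eqv_Suc_iff by blast
    have vl: "(v, level s (x' j)) \<in> s" and vF: "v \<in> Field s" using v b.F unfolding down_def by auto
    have colv: "x j u = x' j v" "agree r (x j) (x i) u \<longleftrightarrow> agree s (x' j) (x' i) v"
      using replyD(1)[OF re'] unfolding colour_def by auto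
    have symr: "agree r (x j) (x i) c \<longleftrightarrow> agree r (x i) (x j) c" for c unfolding agree_def by metis
    have syms: "agree s (x' j) (x' i) c \<longleftrightarrow> agree s (x' i) (x' j) c" for c unfolding agree_def by metis
    have dsv: "{z \<in> down s (level s (x' j)). str s z v} = {c. str s c v}"
      using vl b.str_r(1) b.wr(2) unfolding down_def by blast
    have "(\<forall>c. str r c u \<longrightarrow> agree r (x j) (x i) c) \<longleftrightarrow> (\<forall>c. str s c v \<longrightarrow> agree s (x' j) (x' i) c)"
      using eqv_ball[OF replyD(2)[OF re', unfolded m_def], of "\<lambda>(a, J, p). i \<in> J"]
      unfolding dsv dr[OF a.br_same(3)[OF x y br sj]] colour_def by simp
    then have sv: "str s c v \<Longrightarrow> x' i c = x' j c" for c
      using sj unfolding symr syms a.agree_below b.agree_below a.same_def by blast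
    have su: "str s c u' \<Longrightarrow> x' i c = x' j c" for c using sj same unfolding b.same_def by blast
    have "\<not> agree s (x' i) (x' j) v" "\<not> agree s (x' i) (x' j) u'" using nag colv(2) col(3) symr syms by auto
    then have "x' i v \<noteq> x' j v" "x' i u' \<noteq> x' j u'" using b.agree_step sv su by blast+
    then have "\<not> str s v u'" "\<not> str s u' v" using sv su by blast+
    then have "v = u'" using b.cmp[OF vF u'F] b.cmp[OF u'F vF] b.wr(3) by blast
    then show ?thesis using colv(1) by simp
  qed
  define b0 where "b0 = level r y"
  have ub: "(u, b0) \<in> r" unfolding b0_def by (rule a.br_y[OF x y br])
  have yb: "y c \<noteq> None \<longleftrightarrow> str r c b0" for c unfolding b0_def by (rule a.nodeD(2)[OF y])
  have ya: "\<exists>a<n. y c = Some a" if c: "str r c b0" for c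
  proof -
    obtain a where "y c = Some a" using yb[of c] c by auto
    then show ?thesis using a.nodeD(3)[OF y] by blast
  qed
  have "y b0 = None" using yb[of b0] unfolding str_def by blast
  with stretch_exists[OF ub u'F col(2), of y m] ya obtain b' v where "stretch m u b0 y u' b' v" by blast
  then have v: "(u', b') \<in> s" "v u' = y u" "v b' = None"
     "\<And>c. str s c b' \<Longrightarrow> (u', c) \<in> s \<Longrightarrow> \<exists>a<n. v c = Some a"
     "eqv m (str r) {c. (u, c) \<in> r \<and> (c, b0) \<in> r} (\<lambda>c. (y c, {0::nat}, pos c))
           (str s) {c. (u', c) \<in> s \<and> (c, b') \<in> s} (\<lambda>c. (v c, {0}, pos' c))"
    unfolding stretch_def by blast+
  define y' where "y' c = (if str s c u' then x' i c else if (u', c) \<in> s \<and> str s c b' then v c else None)" for c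
  have b'F: "b' \<in> Field s" using v(1) b.F by blast
  have y'1: "y' c = x' i c" if "str s c u'" for c using that by (simp add: y'_def)
  have y'2: "y' c = v c" if "(u', c) \<in> s" "(c, b') \<in> s" for c
    using that v(3) b.str_irr[of c u'] by (cases "c = b'") (auto simp: y'_def str_def)
  have y'N: "y' c \<noteq> None \<longleftrightarrow> str s c b'" for c
  proof (cases "str s c u'")
    case True
    then have "str s c (level s (x' i))" "str s c b'" using b.str_le(1) u'l v(1) by blast+
    then show ?thesis using y'1[OF True] b.nodeD(2)[OF x'[of i], of c] by simp
  next
    case F1: False
    show ?thesis
    proof (cases "str s c b'")
      case True
      have "c \<in> Field s" using True b.str_r(1) b.F by blast
      then have "(u', c) \<in> s" using b.cmp[OF u'F] F1 by blast
      then show ?thesis using v(4)[OF True] True F1 by (auto simp: y'_def)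
    qed (use F1 in \<open>simp add: y'_def\<close>)
  qed
  have y'n: "a < n" if "y' c = Some a" for c a
  proof (cases "str s c u'")
    case True then show ?thesis using that y'1 b.nodeD(3)[OF x'[of i]] by simp
  next
    case False
    then have "(u', c) \<in> s \<and> str s c b'" "v c = Some a" using that unfolding y'_def by (auto split: if_splits)
    then show ?thesis using v(4)[of c] by auto
  qed
  have y'T: "y' \<in> tree_nodes n s" and y'l: "level s y' = b'"
    by (rule b.nodeI[of b' y', OF b'F y'N]; erule y'n)+
  have br': "branch s x' i y' u'"
    unfolding branch_def
  proof (intro conjI allI impI)
    show "(u', level s (x' i)) \<in> s" by (rule u'l)
    show "str s d u' \<Longrightarrow> y' d = x' i d" for d by (rule y'1)
    fix j
    show "\<exists>d. (d, u') \<in> s \<and> y' d \<noteq> x' j d"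
    proof (cases "a.same x i j u")
      case True
      have "y' u' = y u" using y'2[of u'] v(1,2) b.wr(4)[OF u'F] by simp
      then have "y' u' \<noteq> x' j u'" using a.br_same(1)[OF x y br True] val[OF True] by simp
      then show ?thesis using b.wr(4)[OF u'F] by blast
    next
      case False
      then obtain d where "str s d u'" "x' i d \<noteq> x' j d" unfolding same b.same_def by blast
      then show ?thesis using y'1 b.str_r(1) by metis
    qed
  qed
  note xs = x y br and xs' = x' y'T br'
  have key: "eqv m (str r) (down r (level r (a.fam x y j))) (colour r pos (a.fam x y) j)
     (str s) (down s (level s (b.fam x' y' j))) (colour s pos' (b.fam x' y') j)" for j
  proof (cases j)
    case 0
    have 1: "down r b0 = {c. str r c u} \<union> {c. (u, c) \<in> r \<and> (c, b0) \<in> r}"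
      using a.down_split(1)[OF xs ub] dr[OF ub] unfolding down_def by blast
    have 2: "down s b' = {c. str s c u'} \<union> {c. (u', c) \<in> s \<and> (c, b') \<in> s}"
      using b.down_split(1)[OF xs' v(1)] ds[OF v(1)] unfolding down_def by blast
    have "eqv m (str r) (down r b0) (colour r pos (a.fam x y) 0) (str s) (down s b') (colour s pos' (b.fam x' y') 0)"
      unfolding 1 2
    proof (rule eqv_union)
      show "before (str r) {c. str r c u} {c. (u, c) \<in> r \<and> (c, b0) \<in> r}"
        unfolding before_def using a.str_le(1) a.str_irr a.str_r(1) by blast
      show "before (str s) {c. str s c u'} {c. (u', c) \<in> s \<and> (c, b') \<in> s}"
        unfolding before_def using b.str_le(1) b.str_irr b.str_r(1) by blast
      show "eqv m (str r) {c. str r c u} (colour r pos (a.fam x y) 0) (str s) {c. str s c u'} (colour s pos' (b.fam x' y') 0)"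
        by (rule eqv_recolor'[OF E0, where g = "\<lambda>(a, J, p). (a, insert 0 (Suc ` J), p)"])
          (simp_all add: a.colour_y_below[OF xs] b.colour_y_below[OF xs'])
      show "eqv m (str r) {c. (u, c) \<in> r \<and> (c, b0) \<in> r} (colour r pos (a.fam x y) 0)
         (str s) {c. (u', c) \<in> s \<and> (c, b') \<in> s} (colour s pos' (b.fam x' y') 0)"
        by (rule eqv_recolor'[OF v(5), where g = "\<lambda>c. c"])
          (simp_all add: a.colour_y_above[OF xs] b.colour_y_above[OF xs'] y'2)
    qed
    then show ?thesis unfolding 0 a.fam_simps b.fam_simps y'l b0_def .
  next
    case (Suc l)
    show ?thesis
    proof (cases "a.same x i l u")
      case False
      then have F': "\<not> b.same x' i l u'" using same by blast
      show ?thesis unfolding Suc a.fam_simps b.fam_simps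
        by (rule eqv_recolor'[OF eqv_Suc[OF E[of l]], where g = "\<lambda>(a, J, p). if i \<in> J then (a, insert 0 (Suc ` J), p) else (a, Suc ` J, p)"])
          (simp_all add: a.colour_notsame[OF xs False] b.colour_notsame[OF xs' F'] split: prod.splits)
    next
      case True
      then have T': "b.same x' i l u'" using same by blast
      note A = a.split_same[OF xs True] and B = b.split_same[OF xs' T']
      have ge: "{c \<in> down r (level r (x i)). (u, c) \<in> r} = {u} \<union> {c \<in> down r (level r (x i)). str r u c}"
        using br1(1) a.wr(4)[OF a.br_uF[OF xs]] unfolding down_def str_def by blast
      have ge': "{c \<in> down s (level s (x' i)). (u', c) \<in> s} = {u'} \<union> {c \<in> down s (level s (x' i)). str s u' c}"
        using u'l b.wr(4)[OF u'F] unfolding down_def str_def by blast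
      have E1: "eqv m (str r) {c \<in> down r (level r (x i)). (u, c) \<in> r} (colour r pos x i)
          (str s) {c \<in> down s (level s (x' i)). (u', c) \<in> s} (colour s pos' x' i)"
        unfolding ge ge'
      proof (rule eqv_union[OF _ _ eqv_single replyD(3)[OF re]])
        show "before (str r) {u} {c \<in> down r (level r (x i)). str r u c}"
          unfolding before_def using a.str_irr a.str_r(1) by blast
        show "before (str s) {u'} {c \<in> down s (level s (x' i)). str s u' c}"
          unfolding before_def using b.str_irr b.str_r(1) by blast
      qed (simp_all add: replyD(1)[OF re] str_def)
      show ?thesis unfolding Suc a.fam_simps b.fam_simps
      proof (rule eqv_on_unions[OF A(1-3) B(1-3)])
        show "eqv m (str r) {c. str r c u} (colour r pos (a.fam x y) (Suc l)) (str s) {c. str s c u'}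
            (colour s pos' (b.fam x' y') (Suc l))"
          by (rule eqv_recolor'[OF E0, where g = "\<lambda>(a, J, p). (a, insert 0 (Suc ` J), p)"]; rule A(4) B(4))
        show "eqv m (str r) {c \<in> {c \<in> down r (level r (x i)). (u, c) \<in> r}. l \<in> fst (snd (colour r pos x i c))}
            (colour r pos (a.fam x y) (Suc l))
            (str s) {c \<in> {c \<in> down s (level s (x' i)). (u', c) \<in> s}. l \<in> fst (snd (colour s pos' x' i c))}
            (colour s pos' (b.fam x' y') (Suc l))"
          by (rule eqv_recolor'[OF eqv_restrict[OF E1, where P = "\<lambda>p. l \<in> fst (snd p)"],
                where g = "\<lambda>(a, J, p). (a, Suc ` J, p)"]; rule A(5) B(5))
        show "eqv m (str r) {c \<in> down r (level r (x l)). i \<notin> fst (snd (colour r pos x l c))}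
            (colour r pos (a.fam x y) (Suc l))
            (str s) {c \<in> down s (level s (x' l)). i \<notin> fst (snd (colour s pos' x' l c))}
            (colour s pos' (b.fam x' y') (Suc l))"
          by (rule eqv_recolor'[OF eqv_restrict[OF eqv_Suc[OF E[of l]], where P = "\<lambda>p. i \<notin> fst (snd p)"],
                where g = "\<lambda>(a, J, p). (a, Suc ` J, p)"]; rule A(6) B(6))
      qed
    qed
  qed
  have fin: "finite (range (a.fam x y))" "finite (range (b.fam x' y'))"
  proof -
    have "range (a.fam x y) \<subseteq> insert y (range x)" "range (b.fam x' y') \<subseteq> insert y' (range x')"
      unfolding a.fam_def b.fam_def by (auto split: nat.splits)
    then show "finite (range (a.fam x y))" "finite (range (b.fam x' y'))"
      using positionD(1,2)[OF P] finite_subset by blast+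
  qed
  have "a.fam x y j \<in> tree_nodes n r" "b.fam x' y' j \<in> tree_nodes n s" for j
    using x y x' y'T by (cases j; simp)+
  then have "position m n r pos (a.fam x y) s pos' (b.fam x' y')"
    unfolding position_def using fin key by blast
  then show ?thesis unfolding m_def a.fam_def b.fam_def by blast
qed

end

lemma two_sides_sym: "two_sides r s n \<theta> pos pos' \<Longrightarrow> two_sides s r n \<theta> pos' pos"
  unfolding two_sides_def by blast

lemma (in side) down_level:
  assumes "t \<in> tree_nodes n r"
  shows "level r t \<in> down r (level r t)" "c \<in> down r (level r t) \<Longrightarrow> t c \<noteq> None \<longleftrightarrow> c \<noteq> level r t"
    "c \<in> Field r \<Longrightarrow> c \<notin> down r (level r t) \<Longrightarrow> t c = None" "t c \<noteq> None \<Longrightarrow> c \<in> down r (level r t)"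
  using wr(4)[OF nodeD(1)[OF assms]] nodeD(2)[OF assms, of c] unfolding down_def str_def by blast+

lemma (in side) eq_iff:
  assumes "\<And>i. x i \<in> tree_nodes n r"
  shows "x i = x j \<longleftrightarrow> (\<forall>c\<in>down r (level r (x i)). j \<in> fst (snd (colour r pos x i c)))"
proof
  assume R: "\<forall>c\<in>down r (level r (x i)). j \<in> fst (snd (colour r pos x i c))"
  show "x i = x j"
  proof (rule ccontr)
    assume "x i \<noteq> x j"
    from first_diff[OF assms assms this] obtain d where d: "d \<in> Field r" "x i d \<noteq> x j d" "\<And>e. str r e d \<Longrightarrow> x i e = x j e" by blast
    have "(d, level r (x i)) \<in> r" by (rule diff_le_level[OF assms assms d(2)]) (rule d(3))
    then have "agree r (x i) (x j) d" using R unfolding down_def colour_def by simp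
    then show False using agree_self d(1,2) by blast
  qed
qed (simp add: colour_def agree_def)

lemma (in side) le_iff:
  assumes "\<And>i. x i \<in> tree_nodes n r"
  shows "x i \<subseteq>\<^sub>m x j \<longleftrightarrow> (\<forall>c\<in>down r (level r (x i)).
    fst (colour r pos x i c) = None \<or> j \<in> fst (snd (colour r pos x i c)))"
proof
  assume L: "x i \<subseteq>\<^sub>m x j"
  show "\<forall>c\<in>down r (level r (x i)). fst (colour r pos x i c) = None \<or> j \<in> fst (snd (colour r pos x i c))"
  proof
    fix c assume c: "c \<in> down r (level r (x i))"
    have "agree r (x i) (x j) c" if "x i c \<noteq> None"
      unfolding agree_def
    proof (intro allI impI)
      fix d assume d: "(d, c) \<in> r"
      have "str r c (level r (x i))" using that nodeD(2)[OF assms] by blast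
      then have "x i d \<noteq> None" using d str_le(2) nodeD(2)[OF assms] by blast
      then show "x i d = x j d" using L unfolding map_le_def by blast
    qed
    then show "fst (colour r pos x i c) = None \<or> j \<in> fst (snd (colour r pos x i c))"
      unfolding colour_def by (cases "x i c") auto
  qed
next
  assume R: "\<forall>c\<in>down r (level r (x i)). fst (colour r pos x i c) = None \<or> j \<in> fst (snd (colour r pos x i c))"
  show "x i \<subseteq>\<^sub>m x j" unfolding map_le_def
  proof
    fix c assume "c \<in> dom (x i)"
    then have c: "x i c \<noteq> None" by blast
    have cd: "c \<in> down r (level r (x i))" by (rule down_level(4)[OF assms c])
    then have "agree r (x i) (x j) c" using R c unfolding colour_def by fastforce
    moreover have "c \<in> Field r" using cd F unfolding down_def by blast
    ultimately show "x i c = x j c" by (rule agree_self)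
  qed
qed

lemma (in tree_order) succ_eq:
  assumes "t \<in> tree_nodes n r" shows "tree_succ r a t = t(level r t \<mapsto> a)"
proof (rule tree_succ_eq[OF W nodeD(1)[OF assms]])
  show "dom t = underS r (level r t)" using nodeD(2)[OF assms] unfolding underS_str by blast
qed

text \<open>A pattern in the word of \<open>x i\<close>: the letter \<open>a\<close> at \<open>c\<close>, agreement with \<open>x j\<close> exactly before \<open>c\<close>, and the end
of the word directly after \<open>c\<close>. It characterises \<open>x i = S\<^sub>a (x j)\<close>.\<close>

definition succ_pt :: "nat \<Rightarrow> nat \<Rightarrow> 'x \<Rightarrow> ('x \<Rightarrow> 'x \<Rightarrow> bool) \<Rightarrow> 'x set \<Rightarrow> ('x \<Rightarrow> nat option \<times> nat set \<times> 'd) \<Rightarrow> bool" where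
  "succ_pt a j c R X col \<longleftrightarrow> c \<in> X \<and> (fst (col c) = Some a \<and> j \<notin> fst (snd (col c))) \<and>
     (\<forall>z\<in>{z \<in> X. R z c}. j \<in> fst (snd (col z))) \<and> (\<forall>z\<in>{z \<in> X. R c z}. fst (col z) = None)"

lemma (in side) succ_iff:
  assumes x: "\<And>i. x i \<in> tree_nodes n r"
  shows "x i = tree_succ r a (x j) \<longleftrightarrow> x j \<subseteq>\<^sub>m x i \<and>
     (\<exists>c. succ_pt a j c (str r) (down r (level r (x i))) (colour r pos x i))"
proof
  assume e: "x i = tree_succ r a (x j)"
  define l where "l = level r (x j)"
  have xi: "x i = (x j)(l \<mapsto> a)" using e succ_eq[OF x] l_def by simp
  have xjl: "x j l = None" using nodeD(2)[OF x, of j l] unfolding l_def str_def by blast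
  have lF: "l \<in> Field r" using nodeD(1)[OF x] l_def by simp
  have "x j \<subseteq>\<^sub>m x i" unfolding xi map_le_def using xjl by auto
  moreover have "succ_pt a j l (str r) (down r (level r (x i))) (colour r pos x i)"
    unfolding succ_pt_def
  proof (intro conjI ballI)
    show "l \<in> down r (level r (x i))" by (rule down_level(4)[OF x]) (simp add: xi)
    show "fst (colour r pos x i l) = Some a" by (simp add: colour_def xi)
    have "x i l \<noteq> x j l" using xi xjl by simp
    then show "j \<notin> fst (snd (colour r pos x i l))" using agree_self lF unfolding colour_def by auto
    fix z assume z: "z \<in> {z \<in> down r (level r (x i)). str r z l}"
    have "agree r (x i) (x j) z" unfolding agree_def
    proof (intro allI impI)
      fix d assume "(d, z) \<in> r"
      then have "d \<noteq> l" using z str_le(2) str_r(2) by blast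
      then show "x i d = x j d" using xi by simp
    qed
    then show "j \<in> fst (snd (colour r pos x i z))" by (simp add: colour_def)
  next
    fix z assume z: "z \<in> {z \<in> down r (level r (x i)). str r l z}"
    then have "z \<noteq> l" "\<not> str r z l" using str_r str_irr by blast+
    then have "x j z = None" using nodeD(2)[OF x, of j z] l_def by blast
    then show "fst (colour r pos x i z) = None" using xi \<open>z \<noteq> l\<close> by (simp add: colour_def)
  qed
  ultimately show "x j \<subseteq>\<^sub>m x i \<and> (\<exists>c. succ_pt a j c (str r) (down r (level r (x i))) (colour r pos x i))" by blast
next
  assume "x j \<subseteq>\<^sub>m x i \<and> (\<exists>c. succ_pt a j c (str r) (down r (level r (x i))) (colour r pos x i))"
  then obtain c where L: "x j \<subseteq>\<^sub>m x i" and c: "(c, level r (x i)) \<in> r" "x i c = Some a" "\<not> agree r (x i) (x j) c"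
    "\<And>z. (z, level r (x i)) \<in> r \<Longrightarrow> str r z c \<Longrightarrow> agree r (x i) (x j) z"
    "\<And>z. (z, level r (x i)) \<in> r \<Longrightarrow> str r c z \<Longrightarrow> x i z = None"
    unfolding succ_pt_def colour_def down_def by auto
  define l where "l = level r (x j)"
  have lF: "l \<in> Field r" "c \<in> Field r" using nodeD(1)[OF x] l_def F c(1) by auto
  have below: "x i z = x j z" if "str r z c" for z
  proof -
    have "(z, level r (x i)) \<in> r" "z \<in> Field r" using that str_r(1) c(1) wr(2) F by blast+
    then show ?thesis using c(4) that agree_self by blast
  qed
  have "x i c \<noteq> x j c" using agree_step[of c "x i" "x j"] below c(3) by blast
  then have xjc: "x j c = None" using L c(2) unfolding map_le_def by (metis domIff)
  have cl: "(l, c) \<in> r" using nodeD(2)[OF x, of j c] xjc cmp[OF lF] l_def by blast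
  have "l = c"
  proof (rule ccontr)
    assume "l \<noteq> c"
    then have lc: "str r l c" using cl str_def by metis
    have "x j l = None" using nodeD(2)[OF x, of j l] unfolding l_def str_def by blast
    moreover have "x i l \<noteq> None" using nodeD(2)[OF x, of i l] str_le(1)[OF lc c(1)] by blast
    ultimately show False using below[OF lc] by simp
  qed
  have "x i z = ((x j)(c \<mapsto> a)) z" for z
  proof -
    consider "z = c" | "str r z c" | "x i z = None" "z \<noteq> c" | "x i z \<noteq> None" "z \<noteq> c" "\<not> str r z c" by blast
    then show ?thesis
    proof cases
      case 3
      then have "x j z = None" using L unfolding map_le_def by (metis domIff)
      then show ?thesis using 3 by simp
    next
      case 4
      then have z: "str r z (level r (x i))" using nodeD(2)[OF x] by blast
      then have "z \<in> Field r" using str_r F by blast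
      then have "str r c z" using cmp[OF lF(2), of z] 4 unfolding str_def by blast
      then show ?thesis using c(5)[of z] str_r(1)[OF z] 4 by blast
    qed (use c(2) below str_r(2) in auto)
  qed
  then show "x i = tree_succ r a (x j)" using succ_eq[OF x, of a j] \<open>l = c\<close> l_def by auto
qed

context two_sides begin

lemma position_eq:
  assumes P: "position 1 n r pos x s pos' x'" shows "x i = x j \<longleftrightarrow> x' i = x' j"
proof -
  have "eqv (Suc 0) (str r) (down r (level r (x i))) (colour r pos x i)
      (str s) (down s (level s (x' i))) (colour s pos' x' i)" using positionD(5)[OF P] by simp
  from eqv_ball[OF this, of "\<lambda>c. j \<in> fst (snd c)"] show ?thesis
    unfolding a.eq_iff[where x = x, OF positionD(3)[OF P]] b.eq_iff[where x = x', OF positionD(4)[OF P]] .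
qed

lemma position_le_map:
  assumes P: "position 1 n r pos x s pos' x'" shows "x i \<subseteq>\<^sub>m x j \<longleftrightarrow> x' i \<subseteq>\<^sub>m x' j"
proof -
  have "eqv (Suc 0) (str r) (down r (level r (x i))) (colour r pos x i)
      (str s) (down s (level s (x' i))) (colour s pos' x' i)" using positionD(5)[OF P] by simp
  from eqv_ball[OF this, of "\<lambda>c. fst c = None \<or> j \<in> fst (snd c)"] show ?thesis
    unfolding a.le_iff[where x = x, OF positionD(3)[OF P]] b.le_iff[where x = x', OF positionD(4)[OF P]] .
qed

lemma position_succ:
  assumes P: "position 2 n r pos x s pos' x'"
  shows "x i = tree_succ r a (x j) \<longleftrightarrow> x' i = tree_succ s a (x' j)"
proof -
  have "x j \<subseteq>\<^sub>m x i \<longleftrightarrow> x' j \<subseteq>\<^sub>m x' i" by (rule position_le_map[OF position_le[OF _ P]]) simp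
  moreover have imp: "\<exists>c. succ_pt a j c S Y d"
    if ex: "\<exists>c. succ_pt a j c R X col" and eq: "eqv 2 R X col S Y d" for R S X Y col d
  proof -
    obtain c where c: "succ_pt a j c R X col" using ex by blast
    have "eqv (Suc (Suc 0)) R X col S Y d" using eq by (simp add: numeral_2_eq_2)
    from eqv_split_point[OF this, of c "\<lambda>p. fst p = Some a \<and> j \<notin> fst (snd p)" "\<lambda>p. j \<in> fst (snd p)" "\<lambda>p. fst p = None"]
    show ?thesis using c unfolding succ_pt_def by blast
  qed
  ultimately show ?thesis
    unfolding a.succ_iff[where x = x, OF positionD(3)[OF P]] b.succ_iff[where x = x', OF positionD(4)[OF P]]
    using imp[OF _ positionD(5)[OF P]] imp[OF _ eqv_sym[OF positionD(5)[OF P]]] by blast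
qed

end

primrec depth :: "fo_term \<Rightarrow> nat" where
  "depth (TVar v) = 0"
| "depth (TFun a t) = Suc (depth t)"

text \<open>Every nested function symbol is evaluated by one more move of the game, and two rounds remain for recognising
the patterns of equality, inclusion and successor.\<close>

primrec rank :: "fo_form \<Rightarrow> nat" where
  "rank (FEq t u) = depth t + depth u + 2"
| "rank (FRel t u) = depth t + depth u + 2"
| "rank (FNeg \<phi>) = rank \<phi>"
| "rank (FConj \<phi> \<psi>) = max (rank \<phi>) (rank \<psi>)"
| "rank (FEx v \<phi>) = Suc (rank \<phi>)"

lemma rank_ge: "rank \<phi> \<ge> 2" by (induction \<phi>) auto

context two_sides begin

text \<open>The value of a subterm is added to the family by a move; \<open>position_succ\<close> forces the reply to be the
corresponding value.\<close>

lemma term_step: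
  assumes "position (depth t + Suc (Suc k)) n r pos x s pos' x'" "term_funs t \<subseteq> {..<n}"
  shows "position (Suc (Suc k)) n r pos (case_nat (term_val (tree_struct n r) (\<lambda>v. x (h v)) t) x)
    s pos' (case_nat (term_val (tree_struct n s) (\<lambda>v. x' (h v)) t) x')"
  using assms
proof (induction t arbitrary: k)
  case (TVar v)
  have 1: "case_nat (x (h v)) x = (\<lambda>j. x (case_nat (h v) id j))"
    "case_nat (x' (h v)) x' = (\<lambda>j. x' (case_nat (h v) id j))"
    by (auto split: nat.splits)
  have "position (Suc (Suc k)) n r pos x s pos' x'" using TVar(1) by simp
  then show ?case unfolding term_val.simps 1 by (rule position_reindex)
next
  case (TFun a t)
  define V where "V = term_val (tree_struct n r) (\<lambda>v. x (h v)) t"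
  define V' where "V' = term_val (tree_struct n s) (\<lambda>v. x' (h v)) t"
  have IH: "position (Suc (Suc (Suc k))) n r pos (case_nat V x) s pos' (case_nat V' x')"
    unfolding V_def V'_def by (rule TFun.IH) (use TFun.prems in simp_all)
  have "V \<in> tree_nodes n r" using positionD(3)[OF IH, of 0] by simp
  then have "tree_succ r a V \<in> tree_nodes n r" using tree_succ_in_nodes[OF a.lim] TFun.prems(2) by simp
  from step[OF IH this] obtain y' where
    y': "position (Suc (Suc k)) n r pos (case_nat (tree_succ r a V) (case_nat V x)) s pos' (case_nat y' (case_nat V' x'))" by blast
  have "position 2 n r pos (case_nat (tree_succ r a V) (case_nat V x)) s pos' (case_nat y' (case_nat V' x'))"
    by (rule position_le[OF _ y']) simp
  from position_succ[OF this, of 0 a 1] have e: "y' = tree_succ s a V'" by simp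
  define g where "g = case_nat (0::nat) (\<lambda>j. Suc (Suc j))"
  have sh: "(\<lambda>j. case_nat y (case_nat z x) (g j)) = case_nat y x" for y z and x :: "nat \<Rightarrow> 'z"
    unfolding g_def by (auto split: nat.splits)
  have "position (Suc (Suc k)) n r pos (case_nat (tree_succ r a V) x) s pos' (case_nat y' x')"
    using position_reindex[OF y', of g] unfolding sh .
  moreover have "ufun (tree_struct n r) = tree_succ r" "ufun (tree_struct n s) = tree_succ s"
    by (simp_all add: tree_struct_def)
  ultimately show ?case unfolding term_val.simps V_def[symmetric] V'_def[symmetric] e by (simp only:)
qed

lemma atom_step:
  assumes P: "position (depth t + depth u + 2) n r pos x s pos' x'"
    and f: "term_funs t \<subseteq> {..<n}" "term_funs u \<subseteq> {..<n}"
  shows "position 1 n r pos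
      (case_nat (term_val (tree_struct n r) x u) (case_nat (term_val (tree_struct n r) x t) x))
    s pos' (case_nat (term_val (tree_struct n s) x' u) (case_nat (term_val (tree_struct n s) x' t) x'))"
proof -
  have "position (Suc (Suc (depth u))) n r pos (case_nat (term_val (tree_struct n r) x t) x)
    s pos' (case_nat (term_val (tree_struct n s) x' t) x')"
    using term_step[OF _ f(1), of "depth u" x x' "\<lambda>v. v"] P by simp
  then have "position (depth u + Suc (Suc 0)) n r pos (case_nat (term_val (tree_struct n r) x t) x)
    s pos' (case_nat (term_val (tree_struct n s) x' t) x')" by simp
  from term_step[OF this f(2), of Suc]
  have "position (Suc (Suc 0)) n r pos
      (case_nat (term_val (tree_struct n r) x u) (case_nat (term_val (tree_struct n r) x t) x))
    s pos' (case_nat (term_val (tree_struct n s) x' u) (case_nat (term_val (tree_struct n s) x' t) x'))"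
    by simp
  then show ?thesis by (rule position_le[rotated]) simp
qed

end

lemma case_nat_upd: "(\<lambda>u. case_nat y x (if u = v then 0 else Suc u)) = x(v := y)"
  by auto

lemma sat_position:
  assumes "two_sides r s n \<theta> pos pos'" "position m n r pos x s pos' x'" "rank \<phi> \<le> m" "form_funs \<phi> \<subseteq> {..<n}"
  shows "sat (tree_struct n r) x \<phi> \<longleftrightarrow> sat (tree_struct n s) x' \<phi>"
  using assms(2-4)
proof (induction \<phi> arbitrary: m x x')
  case (FEq t u)
  interpret two_sides r s n \<theta> pos pos' by (rule assms(1))
  have "position (depth t + depth u + 2) n r pos x s pos' x'"
    by (rule position_le[OF _ FEq(1)]) (use FEq(2) in simp)
  from position_eq[OF atom_step[OF this], of 1 0] show ?case using FEq(3) by simp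
next
  case (FRel t u)
  interpret two_sides r s n \<theta> pos pos' by (rule assms(1))
  have "position (depth t + depth u + 2) n r pos x s pos' x'"
    by (rule position_le[OF _ FRel(1)]) (use FRel(2) in simp)
  from position_le_map[OF atom_step[OF this], of 1 0] show ?case
    using FRel(3) by (simp add: tree_struct_def)
next
  case (FNeg \<phi>)
  show ?case using FNeg.IH[OF FNeg.prems(1)] FNeg.prems(2,3) by simp
next
  case (FConj \<phi> \<psi>)
  show ?case using FConj.IH(1)[OF FConj.prems(1)] FConj.IH(2)[OF FConj.prems(1)] FConj.prems(2,3) by simp
next
  case (FEx v \<phi>)
  define k where "k = m - 2"
  have m: "m = Suc (Suc k)" and rk: "rank \<phi> \<le> Suc k" using FEx.prems(2) rank_ge[of \<phi>] unfolding k_def by auto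
  have ff: "form_funs \<phi> \<subseteq> {..<n}" using FEx.prems(3) by simp
  have sub: "sat (tree_struct n r) (x(v := y)) \<phi> \<longleftrightarrow> sat (tree_struct n s) (x'(v := y')) \<phi>"
    if "position (Suc k) n r pos (case_nat y x) s pos' (case_nat y' x')" for y y'
    using FEx.IH[OF position_reindex[OF that, of "\<lambda>u. if u = v then 0 else Suc u"] rk ff]
    unfolding case_nat_upd .
  have T: "univ (tree_struct n r) = tree_nodes n r" "univ (tree_struct n s) = tree_nodes n s"
    by (simp_all add: tree_struct_def)
  have nodes: "y \<in> tree_nodes n r" "y' \<in> tree_nodes n s"
    if "position (Suc k) n r pos (case_nat y x) s pos' (case_nat y' x')" for y y'
    using positionD(3,4)[OF that, of 0] by simp_all
  show ?case unfolding sat.simps T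
  proof
    assume "\<exists>y\<in>tree_nodes n r. sat (tree_struct n r) (x(v := y)) \<phi>"
    then obtain y where y: "y \<in> tree_nodes n r" "sat (tree_struct n r) (x(v := y)) \<phi>" by blast
    obtain y' where y': "position (Suc k) n r pos (case_nat y x) s pos' (case_nat y' x')"
      using two_sides.step[OF assms(1) FEx.prems(1)[unfolded m] y(1)] by blast
    show "\<exists>y\<in>tree_nodes n s. sat (tree_struct n s) (x'(v := y)) \<phi>"
      using sub[OF y'] y(2) nodes(2)[OF y'] by blast
  next
    assume "\<exists>y\<in>tree_nodes n s. sat (tree_struct n s) (x'(v := y)) \<phi>"
    then obtain y' where y': "y' \<in> tree_nodes n s" "sat (tree_struct n s) (x'(v := y')) \<phi>" by blast
    obtain y where "position (Suc k) n s pos' (case_nat y' x') r pos (case_nat y x)"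
      using two_sides.step[OF two_sides_sym[OF assms(1)] position_sym[OF FEx.prems(1)[unfolded m]] y'(1)] by blast
    then have y: "position (Suc k) n r pos (case_nat y x) s pos' (case_nat y' x')" by (rule position_sym)
    show "\<exists>y\<in>tree_nodes n r. sat (tree_struct n r) (x(v := y)) \<phi>"
      using sub[OF y] y'(2) nodes(1)[OF y] by blast
  qed
qed

lemma (in side) root:
  obtains b where "b \<in> Field r" "pos b = None" "down r b = {b}" "Map.empty \<in> tree_nodes n r" "level r Map.empty = b"
proof -
  obtain c where c: "c \<in> Field r" "pos c = None" using start by blast
  then obtain b where b: "b \<in> Field r" "\<And>y. y \<in> Field r \<Longrightarrow> b \<noteq> y \<Longrightarrow> str r b y"
    using woD(3)[OF wo_str[OF W], of "Field r"] by blast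
  have "(b, c) \<in> r" using b c(1) wr(4) str_r(1) by blast
  then have "pos b = None" using pos_None c(2) by blast
  moreover have no: "\<not> str r d b" for d
  proof
    assume d: "str r d b"
    then have "str r b d" using b(2)[of d] str_r F by metis
    then show False using d str_irr str_r(1) by blast
  qed
  then have "down r b = {b}" unfolding down_def str_def using wr(4)[OF b(1)] by blast
  moreover have "Map.empty \<in> tree_nodes n r" "level r Map.empty = b"
    by (rule nodeI[OF b(1)]; use no in simp)+
  ultimately show ?thesis using that b(1) by blast
qed

text \<open>The game starts with the constant family of empty nodes.\<close>

theorem tree_equiv:
  assumes "two_sides r s n \<theta> pos pos'"
  shows "elem_equiv n (tree_struct n r) (tree_struct n s)"
  unfolding elem_equiv_def
proof (intro allI impI)
  fix \<phi> assume \<phi>: "fo_sentence n \<phi>"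
  interpret two_sides r s n \<theta> pos pos' by (rule assms)
  obtain b where b: "b \<in> Field r" "pos b = None" "down r b = {b}" "Map.empty \<in> tree_nodes n r" "level r Map.empty = b"
    by (rule a.root)
  obtain c where c: "c \<in> Field s" "pos' c = None" "down s c = {c}" "Map.empty \<in> tree_nodes n s" "level s Map.empty = c"
    by (rule b.root)
  have "position (rank \<phi>) n r pos (\<lambda>_. Map.empty) s pos' (\<lambda>_. Map.empty)"
    unfolding position_def b(3,5) c(3,5)
    using b(2,4) c(2,4) by (auto intro!: eqv_single simp: colour_def agree_def str_def)
  then have "sat (tree_struct n r) (\<lambda>_. Map.empty) \<phi> \<longleftrightarrow> sat (tree_struct n s) (\<lambda>_. Map.empty) \<phi>"
    using sat_position[OF assms _ order_refl] \<phi> unfolding fo_sentence_def by blast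
  then show "models (tree_struct n r) \<phi> \<longleftrightarrow> models (tree_struct n s) \<phi>"
    unfolding models_sentence[OF \<phi>, of _ "\<lambda>_. Map.empty"] .
qed

section \<open>Ordinals below \<open>\<omega>\<^sup>\<omega>\<close> described by climbs\<close>

text \<open>Embeddings onto convex suborders. Intervals between points of the image are the same inside and outside, and
therefore climbs between such points are preserved.\<close>

definition convex_emb :: "('a \<Rightarrow> 'a \<Rightarrow> bool) \<Rightarrow> 'a set \<Rightarrow> ('b \<Rightarrow> 'b \<Rightarrow> bool) \<Rightarrow> 'b set \<Rightarrow> ('a \<Rightarrow> 'b) \<Rightarrow> bool" where
  "convex_emb R A S B f \<longleftrightarrow> f ` A \<subseteq> B \<and> inj_on f A \<and> (\<forall>x\<in>A. \<forall>y\<in>A. S (f x) (f y) \<longleftrightarrow> R x y) \<and>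
     (\<forall>x\<in>A. \<forall>y\<in>A. \<forall>b\<in>B. S (f x) b \<longrightarrow> S b (f y) \<longrightarrow> b \<in> f ` A)"

lemma convex_embD:
  assumes "convex_emb R A S B f"
  shows "x \<in> A \<Longrightarrow> f x \<in> B" "x \<in> A \<Longrightarrow> y \<in> A \<Longrightarrow> f x = f y \<longleftrightarrow> x = y"
    "x \<in> A \<Longrightarrow> y \<in> A \<Longrightarrow> S (f x) (f y) \<longleftrightarrow> R x y"
    "x \<in> A \<Longrightarrow> y \<in> A \<Longrightarrow> b \<in> B \<Longrightarrow> S (f x) b \<Longrightarrow> S b (f y) \<Longrightarrow> \<exists>a\<in>A. b = f a"
  using assms unfolding convex_emb_def inj_on_def by blast+

lemma convex_between:
  assumes e: "convex_emb R A S B f" and "x \<in> A" "y \<in> A"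
  shows "(\<exists>z\<in>B. S (f x) z \<and> S z (f y) \<and> P z) \<longleftrightarrow> (\<exists>z\<in>A. R x z \<and> R z y \<and> P (f z))"
proof
  assume "\<exists>z\<in>B. S (f x) z \<and> S z (f y) \<and> P z"
  then obtain z where z: "z \<in> B" "S (f x) z" "S z (f y)" "P z" by blast
  then obtain a where "a \<in> A" "z = f a" using convex_embD(4)[OF e assms(2,3)] by blast
  then show "\<exists>z\<in>A. R x z \<and> R z y \<and> P (f z)" using z convex_embD(3)[OF e] assms by blast
next
  assume "\<exists>z\<in>A. R x z \<and> R z y \<and> P (f z)"
  then show "\<exists>z\<in>B. S (f x) z \<and> S z (f y) \<and> P z"
    using convex_embD(1,3)[OF e] assms by blast
qed

definition closed_under :: "('a \<Rightarrow> 'a \<Rightarrow> bool) \<Rightarrow> ('a \<Rightarrow> 'a \<Rightarrow> bool) \<Rightarrow> 'a set \<Rightarrow> 'a \<Rightarrow> 'a \<Rightarrow> bool" where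
  "closed_under C R A x y \<longleftrightarrow> (\<forall>z\<in>A. (z = x \<or> R x z) \<and> R z y \<longrightarrow> (\<exists>w\<in>A. R w y \<and> C z w))"

lemma climb_Suc: "climb (Suc k) R A x y \<longleftrightarrow> x \<in> A \<and> y \<in> A \<and> R x y \<and> closed_under (climb k R A) R A x y \<and>
   \<not> (\<exists>z\<in>A. R x z \<and> R z y \<and> closed_under (climb k R A) R A x z)"
  unfolding climb.simps(2) closed_under_def ..

lemma closed_emb:
  assumes e: "convex_emb R A S B f" and IH: "\<And>x y. x \<in> A \<Longrightarrow> y \<in> A \<Longrightarrow> climb k S B (f x) (f y) \<longleftrightarrow> climb k R A x y"
    and xy: "x \<in> A" "y \<in> A" "R x y"
  shows "closed_under (climb k S B) S B (f x) (f y) \<longleftrightarrow> closed_under (climb k R A) R A x y"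
proof -
  have inner: "(\<exists>w\<in>B. S w (f y) \<and> climb k S B (f z) w) \<longleftrightarrow> (\<exists>w\<in>A. R w y \<and> climb k R A z w)" if z: "z \<in> A" for z
  proof -
    have "(\<exists>w\<in>B. S w (f y) \<and> climb k S B (f z) w) \<longleftrightarrow> (\<exists>w\<in>B. S (f z) w \<and> S w (f y) \<and> climb k S B (f z) w)"
      using climbD(3)[of k S B "f z"] by blast
    also have "\<dots> \<longleftrightarrow> (\<exists>w\<in>A. R z w \<and> R w y \<and> climb k S B (f z) (f w))"
      by (rule convex_between[OF e z xy(2)])
    also have "\<dots> \<longleftrightarrow> (\<exists>w\<in>A. R w y \<and> climb k R A z w)" using IH[OF z] climbD(3)[of k R A z] by blast
    finally show ?thesis .
  qed
  have "closed_under (climb k S B) S B (f x) (f y) \<longleftrightarrow>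
     (S (f x) (f y) \<longrightarrow> (\<exists>w\<in>B. S w (f y) \<and> climb k S B (f x) w)) \<and>
     \<not> (\<exists>z\<in>B. S (f x) z \<and> S z (f y) \<and> \<not> (\<exists>w\<in>B. S w (f y) \<and> climb k S B z w))"
    unfolding closed_under_def using convex_embD(1)[OF e xy(1)] by blast
  also have "\<dots> \<longleftrightarrow> (R x y \<longrightarrow> (\<exists>w\<in>A. R w y \<and> climb k R A x w)) \<and>
     \<not> (\<exists>z\<in>A. R x z \<and> R z y \<and> \<not> (\<exists>w\<in>A. R w y \<and> climb k R A z w))"
    unfolding convex_between[OF e xy(1,2)] convex_embD(3)[OF e xy(1,2)] inner[OF xy(1)] using inner by blast
  also have "\<dots> \<longleftrightarrow> closed_under (climb k R A) R A x y" unfolding closed_under_def using xy(1) by blast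
  finally show ?thesis .
qed

lemma climb_emb:
  assumes e: "convex_emb R A S B f"
  shows "x \<in> A \<Longrightarrow> y \<in> A \<Longrightarrow> climb k S B (f x) (f y) \<longleftrightarrow> climb k R A x y"
proof (induction k arbitrary: x y)
  case 0
  have "(\<exists>z\<in>B. S (f x) z \<and> S z (f y)) \<longleftrightarrow> (\<exists>z\<in>A. R x z \<and> R z y)"
    using convex_between[OF e 0, of "\<lambda>_. True"] by simp
  then show ?case using convex_embD(1,3)[OF e] 0 by simp
next
  case (Suc k)
  have "(\<exists>z\<in>B. S (f x) z \<and> S z (f y) \<and> closed_under (climb k S B) S B (f x) z) \<longleftrightarrow>
        (\<exists>z\<in>A. R x z \<and> R z y \<and> closed_under (climb k S B) S B (f x) (f z))"
    by (rule convex_between[OF e Suc.prems])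
  also have "\<dots> \<longleftrightarrow> (\<exists>z\<in>A. R x z \<and> R z y \<and> closed_under (climb k R A) R A x z)"
    using closed_emb[OF e Suc.IH Suc.prems(1)] by blast
  finally show ?case unfolding climb_Suc
    using closed_emb[OF e Suc.IH Suc.prems] convex_embD(1,3)[OF e] Suc.prems by blast
qed

text \<open>\<open>y = x + \<omega>\<^bsup>k\<^sub>1\<^esup> + \<dots> + \<omega>\<^bsup>k\<^sub>l\<^esup>\<close> for \<open>ks = [k\<^sub>1, \<dots>, k\<^sub>l]\<close>.\<close>

primrec path :: "nat list \<Rightarrow> ('a \<Rightarrow> 'a \<Rightarrow> bool) \<Rightarrow> 'a set \<Rightarrow> 'a \<Rightarrow> 'a \<Rightarrow> bool" where
  "path [] R A x y \<longleftrightarrow> x = y"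
| "path (k # ks) R A x y \<longleftrightarrow> (\<exists>z\<in>A. climb k R A x z \<and> path ks R A z y)"

lemma path_le: assumes w: "wo R A" shows "path ks R A x y \<Longrightarrow> x \<in> A \<Longrightarrow> y \<in> A \<Longrightarrow> x = y \<or> R x y"
proof (induction ks arbitrary: x)
  case (Cons k ks)
  from Cons.prems(1) obtain z where z: "z \<in> A" "climb k R A x z" "path ks R A z y" by auto
  have "R x z" "z = y \<or> R z y" using Cons.IH[OF z(3,1) Cons.prems(3)] climbD(3)[OF z(2)] by blast+
  then show ?case using woD(2)[OF w Cons.prems(2) z(1) Cons.prems(3)] by blast
qed simp

lemma path_unique: assumes w: "wo R A" shows "path ks R A x y \<Longrightarrow> path ks R A x y' \<Longrightarrow> y = y'"
proof (induction ks arbitrary: x)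
  case (Cons k ks)
  then show ?case using climb_unique[OF w] by (metis path.simps(2))
qed simp

lemma path_append: "path (ks @ ls) R A x y \<longleftrightarrow> (\<exists>z. path ks R A x z \<and> path ls R A z y)"
  by (induction ks arbitrary: x) auto

lemma path_emb:
  assumes e: "convex_emb R A S B f" and w: "wo S B"
  shows "x \<in> A \<Longrightarrow> y \<in> A \<Longrightarrow> path ks S B (f x) (f y) \<longleftrightarrow> path ks R A x y"
proof (induction ks arbitrary: x)
  case Nil then show ?case using convex_embD(2)[OF e] by simp
next
  case (Cons k ks)
  show ?case
  proof
    assume "path (k # ks) S B (f x) (f y)"
    then obtain z where z: "z \<in> B" "climb k S B (f x) z" "path ks S B z (f y)" by auto
    have "z = f y \<or> S z (f y)" using path_le[OF w z(3) z(1)] convex_embD(1)[OF e] Cons.prems by blast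
    then obtain a where "a \<in> A" "z = f a"
      using convex_embD(4)[OF e Cons.prems z(1) climbD(3)[OF z(2)]] Cons.prems(2) by blast
    then show "path (k # ks) R A x y" using z(2,3) Cons climb_emb[OF e] by auto
  next
    assume "path (k # ks) R A x y"
    then obtain z where "z \<in> A" "climb k R A x z" "path ks R A z y" by auto
    then have "f z \<in> B" "climb k S B (f x) (f z)" "path ks S B (f z) (f y)"
      using Cons.IH Cons.prems climb_emb[OF e] convex_embD(1)[OF e] by blast+
    then show "path (k # ks) S B (f x) (f y)" by auto
  qed
qed

text \<open>The order type is \<open>\<omega>\<^bsup>k\<^sub>1\<^esup> + \<dots> + \<omega>\<^bsup>k\<^sub>l\<^esup> + \<omega>\<^bsup>j+1\<^esup>\<close>: behind \<open>p\<close> the order is closed under adding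
\<open>\<omega>\<^sup>j\<close>, but does not reach \<open>p + \<omega>\<^bsup>j+1\<^esup>\<close>.\<close>

definition ends :: "nat list \<Rightarrow> nat \<Rightarrow> ('a \<Rightarrow> 'a \<Rightarrow> bool) \<Rightarrow> 'a set \<Rightarrow> bool" where
  "ends ks j R A \<longleftrightarrow> (\<exists>x\<in>A. \<not> (\<exists>z\<in>A. R z x) \<and> (\<exists>p\<in>A. path ks R A x p \<and>
     \<not> (\<exists>z\<in>A. (z = p \<or> R p z) \<and> \<not> (\<exists>w\<in>A. climb j R A z w)) \<and> \<not> (\<exists>y\<in>A. climb (Suc j) R A p y)))"

lemma climb_exists:
  assumes w: "wo R A" and "p \<in> A" "b \<in> A" "R p b" "closed_under (climb j R A) R A p b"
  shows "\<exists>y\<in>A. climb (Suc j) R A p y"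
proof -
  define K where "K = {y \<in> A. R p y \<and> closed_under (climb j R A) R A p y}"
  have "K \<subseteq> A" "K \<noteq> {}" using assms unfolding K_def by auto
  then obtain y where y: "y \<in> K" "\<And>z. z \<in> K \<Longrightarrow> y \<noteq> z \<Longrightarrow> R y z" using woD(3)[OF w, of K] by blast
  have "\<not> R z y" if "z \<in> K" for z
    using y(2)[OF that] woD(1,5)[OF w] y(1) that \<open>K \<subseteq> A\<close> by blast
  then have "climb (Suc j) R A p y" unfolding climb_Suc using y(1) assms(2) unfolding K_def by blast
  then show ?thesis using y(1) K_def by blast
qed

text \<open>If the larger order were properly longer, the first point outside the image would show that
\<open>p + \<omega>\<^bsup>j+1\<^esup>\<close> exists in it.\<close>

lemma ends_no_proper:
  assumes A: "wo R A" "ends ks j R A" and B: "wo S B" "ends ks j S B"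
    and f: "convex_emb R A S B f" "b \<in> B" "\<And>z. z \<in> B \<Longrightarrow> S z b \<longleftrightarrow> z \<in> f ` A"
  shows False
proof -
  obtain x p where x: "x \<in> A" "\<not> (\<exists>z\<in>A. R z x)" "p \<in> A" "path ks R A x p"
    "\<not> (\<exists>z\<in>A. (z = p \<or> R p z) \<and> \<not> (\<exists>w\<in>A. climb j R A z w))"
    using A(2) unfolding ends_def by blast
  obtain x' p' where x': "x' \<in> B" "\<not> (\<exists>z\<in>B. S z x')" "p' \<in> B" "path ks S B x' p'"
    "\<not> (\<exists>y\<in>B. climb (Suc j) S B p' y)"
    using B(2) unfolding ends_def by blast
  note e = convex_embD[OF f(1)]
  have fb: "S (f a) b" if "a \<in> A" for a using f(3) that e(1) by blast
  have "x' = f x"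
  proof (rule ccontr)
    assume "x' \<noteq> f x"
    then have "S x' (f x)" using woD(4)[OF B(1) x'(1) e(1)[OF x(1)]] x'(2) e(1)[OF x(1)] by blast
    then have "S x' b" using woD(2)[OF B(1) x'(1) e(1)[OF x(1)] f(2)] fb[OF x(1)] by blast
    then obtain a where "a \<in> A" "x' = f a" using f(3) x'(1) by blast
    then show False using \<open>S x' (f x)\<close> e(3) x(1,2) by blast
  qed
  then have "path ks S B x' (f p)" using path_emb[OF f(1) B(1) x(1,3)] x(4) by simp
  then have p': "p' = f p" using path_unique[OF B(1)] x'(4) by blast
  have "closed_under (climb j S B) S B p' b"
    unfolding closed_under_def
  proof (intro ballI impI)
    fix z assume z: "z \<in> B" "(z = p' \<or> S p' z) \<and> S z b"
    then obtain a where a: "a \<in> A" "z = f a" using f(3) by blast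
    then have "a = p \<or> R p a" using z(2) e(2,3) x(3) unfolding p' by blast
    then obtain w where "w \<in> A" "climb j R A a w" using x(5) a(1) by blast
    then show "\<exists>w\<in>B. S w b \<and> climb j S B z w" using climb_emb[OF f(1) a(1)] fb e(1) a(2) by blast
  qed
  moreover have "S p' b" using fb x(3) unfolding p' .
  ultimately show False using climb_exists[OF B(1) x'(3) f(2)] x'(5) by blast
qed

lemma ordLess_emb:
  assumes "r <o r'"
  obtains f b where "convex_emb (str r) (Field r) (str r') (Field r') f" "b \<in> Field r'"
    "\<And>z. z \<in> Field r' \<Longrightarrow> str r' z b \<longleftrightarrow> z \<in> f ` Field r"
proof -
  from assms obtain f where f: "Well_order r" "Well_order r'" "embedS r r' f" unfolding ordLess_def by blast
  then have em: "embed r r' f" and nb: "\<not> bij_betw f (Field r) (Field r')" unfolding embedS_def by auto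
  have inj: "inj_on f (Field r)" by (rule embed_inj_on[OF f(1) em])
  have sub: "f ` Field r \<subseteq> Field r'" by (rule embed_Field[OF em])
  have of: "wo_rel.ofilter r' (f ` Field r)" by (rule embed_Field_ofilter[OF f(1,2) em])
  interpret w: wo_rel r' by unfold_locales (rule f(2))
  have "f ` Field r \<noteq> Field r'" using nb inj unfolding bij_betw_def by blast
  then obtain b where b: "b \<in> Field r'" "f ` Field r = underS r' b"
    using w.ofilter_underS_Field of by auto
  have iff: "str r' z b \<longleftrightarrow> z \<in> f ` Field r" for z unfolding b(2) underS_def str_def by auto
  have "str r' (f x) (f y) \<longleftrightarrow> str r x y" if "x \<in> Field r" "y \<in> Field r" for x y
  proof -
    have c: "compat r r' f" by (rule embed_compat[OF em])
    have "str r x y \<Longrightarrow> str r' (f x) (f y)" if "x \<in> Field r" "y \<in> Field r" for x y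
      using c inj that unfolding compat_def str_def inj_on_def by blast
    then show ?thesis using that woD(4,5)[OF wo_str[OF f(1)]] woD(1,5)[OF wo_str[OF f(2)]] sub
      by (metis image_subset_iff)
  qed
  moreover have "z \<in> f ` Field r" if "y \<in> Field r" "z \<in> Field r'" "str r' z (f y)" for y z
  proof -
    have "str r' (f y) b" using iff that(1) by blast
    then have "str r' z b" using woD(2)[OF wo_str[OF f(2)] that(2) _ b(1) that(3)] sub that(1) by blast
    then show ?thesis using iff by blast
  qed
  ultimately have "convex_emb (str r) (Field r) (str r') (Field r') f"
    unfolding convex_emb_def using inj sub by blast
  then show ?thesis using that[of f b] b(1) iff by blast
qed

lemma ends_iso:
  assumes "Well_order r" "Well_order r'" "ends ks j (str r) (Field r)" "ends ks j (str r') (Field r')"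
  shows "r =o r'"
proof -
  have "\<not> r <o r'" if "Well_order r" "Well_order r'" "ends ks j (str r) (Field r)" "ends ks j (str r') (Field r')"
    for r :: "'x rel" and r' :: "'y rel"
  proof
    assume "r <o r'"
    from ordLess_emb[OF this] ends_no_proper[OF wo_str[OF that(1)] that(3) wo_str[OF that(2)] that(4)]
    show False by metis
  qed
  then show ?thesis using assms ordLess_or_ordLeq ordLeq_iff_ordLess_or_ordIso ordIso_symmetric by metis
qed

lemma ends_emb:
  assumes e: "convex_emb R A S B f" and w: "wo S B" and s: "f ` A = B" and "ends ks j R A"
  shows "ends ks j S B"
proof -
  obtain x p where x: "x \<in> A" "\<not> (\<exists>z\<in>A. R z x)" "p \<in> A" "path ks R A x p"
    "\<not> (\<exists>z\<in>A. (z = p \<or> R p z) \<and> \<not> (\<exists>w\<in>A. climb j R A z w))" "\<not> (\<exists>y\<in>A. climb (Suc j) R A p y)"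
    using assms(4) unfolding ends_def by blast
  note d = convex_embD[OF e]
  have "\<not> (\<exists>z\<in>B. S z (f x))" using x(1,2) d(3) s by blast
  moreover have "path ks S B (f x) (f p)" using path_emb[OF e w x(1,3)] x(4) by blast
  moreover have "\<not> (\<exists>z\<in>B. (z = f p \<or> S (f p) z) \<and> \<not> (\<exists>w\<in>B. climb j S B z w))"
  proof
    assume "\<exists>z\<in>B. (z = f p \<or> S (f p) z) \<and> \<not> (\<exists>w\<in>B. climb j S B z w)"
    then obtain z where z: "z \<in> B" "z = f p \<or> S (f p) z" "\<not> (\<exists>w\<in>B. climb j S B z w)" by blast
    then obtain a where "a \<in> A" "z = f a" using s by auto
    then have a: "a \<in> A" "f a = f p \<or> S (f p) (f a)" "\<not> (\<exists>w\<in>B. climb j S B (f a) w)" using z by auto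
    then have "a = p \<or> R p a" using d(2,3) x(3) by blast
    then obtain w where "w \<in> A" "climb j R A a w" using x(5) a(1) by blast
    then show False using a(1,3) climb_emb[OF e] d(1) by blast
  qed
  moreover have "\<not> (\<exists>y\<in>B. climb (Suc j) S B (f p) y)" using x(3,6) climb_emb[OF e] s by blast
  ultimately show ?thesis unfolding ends_def using d(1) x(1,3) by blast
qed

abbreviation oo :: "(nat \<Rightarrow> nat) \<Rightarrow> (nat \<Rightarrow> nat) \<Rightarrow> bool" where "oo \<equiv> str omega_omega"

lemma oo_iff: "oo f g \<longleftrightarrow> f \<in> Field omega_omega \<and> g \<in> Field omega_omega \<and> (\<exists>z. f z < g z \<and> (\<forall>x>z. f x = g x))"
  unfolding str_def omega_omega_iff Field_omega_omega by auto

text \<open>The ordinal \<open>f + \<omega>\<^sup>k\<close>: the coefficient at \<open>k\<close> grows by one and the smaller ones are swallowed.\<close>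

definition onx :: "nat \<Rightarrow> (nat \<Rightarrow> nat) \<Rightarrow> nat \<Rightarrow> nat" where
  "onx k f i = (if i < k then 0 else if i = k then Suc (f k) else f i)"

lemma onx_Field: "f \<in> Field omega_omega \<Longrightarrow> onx k f \<in> Field omega_omega"
proof -
  assume "f \<in> Field omega_omega"
  then have "finite (insert k {i. f i \<noteq> 0})" unfolding Field_omega_omega by simp
  moreover have "{i. onx k f i \<noteq> 0} \<subseteq> insert k {i. f i \<noteq> 0}" unfolding onx_def by (auto split: if_splits)
  ultimately show ?thesis unfolding Field_omega_omega using finite_subset by blast
qed

lemmas ow = woD[OF wo_str[OF Well_order_omega_omega]]

lemma oo_onx: "f \<in> Field omega_omega \<Longrightarrow> oo f (onx k f)"
  unfolding oo_iff using onx_Field by (auto simp: onx_def intro!: exI[of _ k])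

lemma oo_between:
  assumes "f \<in> Field omega_omega" "oo z (onx k f)" "z = f \<or> oo f z" "i \<ge> k"
  shows "z i = f i"
proof (cases "z = f")
  case False
  then obtain p where p: "f p < z p" "\<forall>x>p. f x = z x" using assms(3) unfolding oo_iff by blast
  obtain q where q: "z q < onx k f q" "\<forall>x>q. z x = onx k f x" using assms(2) unfolding oo_iff by blast
  have "p < k"
  proof (rule ccontr)
    assume "\<not> p < k"
    have "q \<ge> k" using q(1) unfolding onx_def by (auto split: if_splits)
    consider "q > p" | "q = p" | "q < p" by linarith
    then show False
    proof cases
      case 1
      then have "z q = f q" using p(2) by simp
      then show False using q(1) 1 \<open>\<not> p < k\<close> unfolding onx_def by simp
    next
      case 2
      then show False using p(1) q(1) \<open>\<not> p < k\<close> unfolding onx_def by (auto split: if_splits)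
    next
      case 3
      then have "z p = f p" using q(2) \<open>q \<ge> k\<close> unfolding onx_def by simp
      then show False using p(1) by simp
    qed
  qed
  then show ?thesis using p(2) assms(4) by simp
qed simp

lemma oo_climb: "f \<in> Field omega_omega \<Longrightarrow> climb k oo (Field omega_omega) f (onx k f)"
proof (induction k arbitrary: f)
  case 0
  have "\<not> (\<exists>z\<in>Field omega_omega. oo f z \<and> oo z (onx 0 f))"
  proof
    assume "\<exists>z\<in>Field omega_omega. oo f z \<and> oo z (onx 0 f)"
    then obtain z where z: "z \<in> Field omega_omega" "oo f z" "oo z (onx 0 f)" by blast
    then have "z = f" using oo_between[OF 0 z(3)] by auto
    then show False using z(2) str_def by metis
  qed
  then show ?case using 0 onx_Field oo_onx by simp
next
  case (Suc k)
  have fF: "f \<in> Field omega_omega" by (rule Suc.prems)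
  have cl: "closed_under (climb k oo (Field omega_omega)) oo (Field omega_omega) f (onx (Suc k) f)"
    unfolding closed_under_def
  proof (intro ballI impI)
    fix z assume z: "z \<in> Field omega_omega" "(z = f \<or> oo f z) \<and> oo z (onx (Suc k) f)"
    then have eq: "i \<ge> Suc k \<Longrightarrow> z i = f i" for i using oo_between[OF Suc.prems] by blast
    have "oo (onx k z) (onx (Suc k) f)" unfolding oo_iff
      using onx_Field[OF z(1)] onx_Field[OF Suc.prems] eq
      by (auto simp: onx_def intro!: exI[of _ "Suc k"])
    then show "\<exists>w\<in>Field omega_omega. oo w (onx (Suc k) f) \<and> climb k oo (Field omega_omega) z w"
      using Suc.IH[OF z(1)] onx_Field[OF z(1)] by blast
  qed
  have "False" if y: "y \<in> Field omega_omega" "oo f y" "oo y (onx (Suc k) f)"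
     "closed_under (climb k oo (Field omega_omega)) oo (Field omega_omega) f y" for y
  proof -
    have yf: "i \<ge> Suc k \<Longrightarrow> y i = f i" for i using oo_between[OF Suc.prems y(3)] y(2) by blast
    have nxt: "oo (onx k z) y" if z: "z \<in> Field omega_omega" "z = f \<or> oo f z" "oo z y" for z
    proof -
      obtain w where "oo w y" "climb k oo (Field omega_omega) z w" using y(4) z unfolding closed_under_def by blast
      then show ?thesis
        using climb_unique[OF wo_str[OF Well_order_omega_omega] _ Suc.IH[OF z(1)]] by blast
    qed
    have "\<exists>z. z \<in> Field omega_omega \<and> (z = f \<or> oo f z) \<and> oo z y \<and> z k \<ge> i \<and> (\<forall>l>k. z l = f l)" for i
    proof (induction i)
      case 0 then show ?case using fF y(2) by (intro exI[of _ f]) simp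
    next
      case (Suc i)
      then obtain z where z: "z \<in> Field omega_omega" "z = f \<or> oo f z" "oo z y" "z k \<ge> i" "\<forall>l>k. z l = f l" by blast
      have "oo f (onx k z)"
        using z(2) oo_onx[OF z(1), of k] ow(2)[OF fF z(1) onx_Field[OF z(1)]] by blast
      moreover have "onx k z k = Suc (z k)" "\<forall>l>k. onx k z l = z l" by (simp_all add: onx_def)
      ultimately show ?case using nxt[OF z(1-3)] onx_Field[OF z(1), of k] z(4,5)
        by (intro exI[of _ "onx k z"]) simp
    qed
    then obtain z where z: "oo z y" "z k \<ge> Suc (y k)" "\<forall>l>k. z l = f l" by blast
    obtain p where p: "z p < y p" "\<forall>x>p. z x = y x" using z(1) unfolding oo_iff by blast
    show False
    proof (cases "p < k")
      case True then show False using p(2) z(2) by auto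
    next
      case False
      then show False using p(1) z(2,3) yf by (cases "p = k") auto
    qed
  qed
  then show ?case unfolding climb_Suc using Suc.prems onx_Field oo_onx cl by blast
qed

lemma oo_zero: "(\<lambda>_. 0) \<in> Field omega_omega" "\<not> oo z (\<lambda>_. 0)"
  unfolding Field_omega_omega oo_iff by auto

text \<open>In the least counterexample, lowering by one the smallest nonzero coefficient gives a smaller ordinal from
which one climb leads back.\<close>

lemma oo_path: "f \<in> Field omega_omega \<Longrightarrow> \<exists>ks. path ks oo (Field omega_omega) (\<lambda>_. 0) f"
proof (rule ccontr)
  assume "f \<in> Field omega_omega" "\<nexists>ks. path ks oo (Field omega_omega) (\<lambda>_. 0) f"
  define K where "K = {f \<in> Field omega_omega. \<nexists>ks. path ks oo (Field omega_omega) (\<lambda>_. 0) f}"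
  have "K \<subseteq> Field omega_omega" "K \<noteq> {}" using \<open>f \<in> _\<close> \<open>\<nexists>ks. _\<close> K_def by auto
  then obtain g where g: "g \<in> K" "\<And>h. h \<in> K \<Longrightarrow> g \<noteq> h \<Longrightarrow> oo g h" using ow(3)[of K] by blast
  have gF: "g \<in> Field omega_omega" using g(1) K_def by blast
  have "g \<noteq> (\<lambda>_. 0)"
  proof
    assume "g = (\<lambda>_. 0)"
    then have "path [] oo (Field omega_omega) (\<lambda>_. 0) g" by simp
    then show False using g(1) K_def by blast
  qed
  then have ex: "\<exists>k. g k \<noteq> 0" by auto
  define k where "k = (LEAST k. g k \<noteq> 0)"
  have k: "g k \<noteq> 0" "\<And>i. i < k \<Longrightarrow> g i = 0" unfolding k_def using LeastI_ex[OF ex] not_less_Least by blast+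
  define h where "h = g(k := g k - 1)"
  have "{i. h i \<noteq> 0} \<subseteq> {i. g i \<noteq> 0}" by (auto simp: h_def)
  then have hF: "h \<in> Field omega_omega" using gF unfolding Field_omega_omega using finite_subset by blast
  have gh: "g = onx k h" using k unfolding onx_def h_def by auto
  have "oo h g" unfolding gh by (rule oo_onx[OF hF])
  then have "h \<notin> K" using g(2)[of h] ow(5)[OF hF gF] ow(1)[OF gF] by blast
  then obtain ks where "path ks oo (Field omega_omega) (\<lambda>_. 0) h" using hF K_def by blast
  moreover have "path [k] oo (Field omega_omega) h g" using oo_climb[OF hF, of k] gF gh by simp
  ultimately have "path (ks @ [k]) oo (Field omega_omega) (\<lambda>_. 0) g" unfolding path_append by blast
  then show False using g(1) K_def by blast
qed

section \<open>Sums of ordinals, and formulas about climbs\<close>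

text \<open>The front part inherits the total climbs and the cofinal sequence of \<open>R0\<close>, because the isomorphism carries it
onto an initial segment.\<close>

lemma side_of_sum:
  assumes f: "iso r (R0 +ord \<theta>) f" and W: "Well_order r" "Well_order R0" "Well_order \<theta>" and lim: "nonzero_limit r"
    and climbs: "\<And>k x. x \<in> Field R0 \<Longrightarrow> \<exists>y. climb k (str R0) (Field R0) x y"
    and cof: "\<exists>t :: nat \<Rightarrow> 'c. range t \<subseteq> Field R0 \<and> (\<forall>a\<in>Field R0. \<exists>i. (a, t i) \<in> R0)"
    and ne: "Field R0 \<noteq> {}" and n: "n > 0"
  shows "side r n \<theta> (\<lambda>c. case f c of Inl _ \<Rightarrow> None | Inr d \<Rightarrow> Some d)"
proof -
  define pos where "pos c = (case f c of Inl _ \<Rightarrow> None | Inr d \<Rightarrow> Some d)" for c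
  have bij: "bij_betw f (Field r) (Inl ` Field R0 \<union> Inr ` Field \<theta>)"
    and ord: "\<And>a b. a \<in> Field r \<Longrightarrow> b \<in> Field r \<Longrightarrow> (a, b) \<in> r \<longleftrightarrow> (f a, f b) \<in> R0 +ord \<theta>"
    using f unfolding iso_iff2[of r "R0 +ord \<theta>" f] Field_ord_sum by auto
  have Fr: "(a, b) \<in> r \<Longrightarrow> a \<in> Field r" "(a, b) \<in> r \<Longrightarrow> b \<in> Field r" for a b by (auto simp: Field_def)
  have pN: "pos c = None \<longleftrightarrow> (\<exists>x. f c = Inl x)" and pS: "pos c = Some d \<longleftrightarrow> f c = Inr d" for c d
    unfolding pos_def by (auto split: sum.splits)
  have fc: "f c \<in> Inl ` Field R0 \<union> Inr ` Field \<theta>" if "c \<in> Field r" for c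
    using bij that unfolding bij_betw_def by blast
  have onto: "\<exists>c\<in>Field r. f c = z" if "z \<in> Inl ` Field R0 \<union> Inr ` Field \<theta>" for z
  proof -
    have "z \<in> f ` Field r" using bij that unfolding bij_betw_def by simp
    then show ?thesis by auto
  qed
  have inj: "inj_on f (Field r)" using bij unfolding bij_betw_def by blast
  define A where "A = {a \<in> Field r. pos a = None}"
  obtain g where g: "\<And>x. x \<in> Field R0 \<Longrightarrow> g x \<in> Field r \<and> f (g x) = Inl x"
  proof -
    have "\<forall>x. \<exists>c. x \<in> Field R0 \<longrightarrow> c \<in> Field r \<and> f c = Inl x"
    proof
      fix x
      show "\<exists>c. x \<in> Field R0 \<longrightarrow> c \<in> Field r \<and> f c = Inl x" using onto[of "Inl x"] by blast
    qed
    from choice[OF this] show ?thesis using that by blast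
  qed
  have gA: "g ` Field R0 = A"
  proof (intro subset_antisym subsetI)
    fix a assume "a \<in> g ` Field R0" then show "a \<in> A" using g pN unfolding A_def by auto
  next
    fix a assume a: "a \<in> A"
    then obtain x where x: "a \<in> Field r" "f a = Inl x" using pN unfolding A_def by blast
    then have "x \<in> Field R0" using fc[OF x(1)] by auto
    then have "g x = a" using g[of x] x inj_onD[OF inj, of "g x" a] by simp
    then show "a \<in> g ` Field R0" using \<open>x \<in> Field R0\<close> by blast
  qed
  have gle: "(g x, g y) \<in> r \<longleftrightarrow> (x, y) \<in> R0" if "x \<in> Field R0" "y \<in> Field R0" for x y
    using ord[of "g x" "g y"] g that by simp
  have ginj: "g x = g y \<longleftrightarrow> x = y" if "x \<in> Field R0" "y \<in> Field R0" for x y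
  proof
    assume "g x = g y"
    then have "f (g x) = f (g y)" by (rule arg_cong)
    then show "x = y" using g[OF that(1)] g[OF that(2)] by simp
  qed (rule arg_cong)
  have emb: "convex_emb (str R0) (Field R0) (str r) A g"
    unfolding convex_emb_def
  proof (intro conjI ballI impI)
    show "g ` Field R0 \<subseteq> A" using gA by simp
    show "inj_on g (Field R0)" using ginj by (intro inj_onI) simp
    show "str r (g x) (g y) \<longleftrightarrow> str R0 x y" if "x \<in> Field R0" "y \<in> Field R0" for x y
      unfolding str_def gle[OF that] ginj[OF that] ..
    show "b \<in> g ` Field R0" if "b \<in> A" for b using that gA by simp
  qed
  have lad: "ladder n (str r) A"
  proof
    show "wo (str r) A" by (rule wo_sub[OF wo_str[OF W(1)]]) (auto simp: A_def)
    show "\<exists>y. climb k (str r) A x y" if xA: "x \<in> A" for k x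
    proof -
      obtain x0 where x0: "x0 \<in> Field R0" "x = g x0" using xA gA by blast
      obtain y0 where "climb k (str R0) (Field R0) x0 y0" using climbs[OF x0(1)] by blast
      then show ?thesis using climb_emb[OF emb x0(1) climbD(2)] x0(2) by blast
    qed
    obtain t :: "nat \<Rightarrow> _" where t: "range t \<subseteq> Field R0" "\<And>a. a \<in> Field R0 \<Longrightarrow> \<exists>i. (a, t i) \<in> R0" using cof by blast
    have "\<exists>i. a = g (t i) \<or> str r a (g (t i))" if a: "a \<in> A" for a
    proof -
      obtain x where x: "x \<in> Field R0" "a = g x" using a gA by blast
      obtain i where i: "(x, t i) \<in> R0" using t(2)[OF x(1)] by blast
      have "t i \<in> Field R0" using t(1) by blast
      then have "(a, g (t i)) \<in> r" using gle[OF x(1)] i x(2) by blast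
      then show ?thesis unfolding str_def by blast
    qed
    moreover have "range (\<lambda>i. g (t i)) \<subseteq> A" using t(1) gA by blast
    ultimately show "\<exists>s :: nat \<Rightarrow> _. range s \<subseteq> A \<and> (\<forall>a\<in>A. \<exists>i. a = s i \<or> str r a (s i))"
      by (intro exI[of _ "\<lambda>i. g (t i)"]) blast
  qed (rule n)
  show ?thesis unfolding pos_def[symmetric]
  proof (intro side.intro side_axioms.intro tree_order.intro)
    show "Well_order r" "nonzero_limit r" by fact+
    show "pos a = None" if ab: "(a, b) \<in> r" and b: "pos b = None" for a b
    proof -
      obtain y where y: "f b = Inl y" using b pN by blast
      have "(f a, Inl y) \<in> R0 +ord \<theta>" using ord[OF Fr[OF ab]] ab y by simp
      then show ?thesis using pN by (cases "f a") auto
    qed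
    show "(a, b) \<in> r \<longleftrightarrow> (p, q) \<in> \<theta>" if "a \<in> Field r" "b \<in> Field r" "pos a = Some p" "pos b = Some q" for a b p q
      using ord[OF that(1,2)] that(3,4) unfolding pS by simp
    show "\<exists>a\<in>Field r. pos a = Some p" if "p \<in> Field \<theta>" for p using onto[of "Inr p"] that pS by auto
    show "p \<in> Field \<theta>" if "a \<in> Field r" "pos a = Some p" for a p using fc[OF that(1)] that(2) pS by auto
    show "p = q" if "(p, q) \<in> \<theta>" "(q, p) \<in> \<theta>" for p q using Well_orderD(3)[OF W(3) that] .
    show "ladder n (str r) {a \<in> Field r. pos a = None}" using lad unfolding A_def .
    show "\<exists>a\<in>Field r. pos a = None" using ne gA unfolding A_def by blast
  qed
qed

definition FLt :: "nat \<Rightarrow> nat \<Rightarrow> fo_form" where "FLt v w = FRel (TVar v) (TVar w)"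
definition FLe :: "nat \<Rightarrow> nat \<Rightarrow> fo_form" where
  "FLe v w = FNeg (FConj (FNeg (FEq (TVar w) (TVar v))) (FNeg (FLt v w)))"
definition FAll :: "nat \<Rightarrow> fo_form \<Rightarrow> fo_form" where "FAll v \<phi> = FNeg (FEx v (FNeg \<phi>))"
definition FImp :: "fo_form \<Rightarrow> fo_form \<Rightarrow> fo_form" where "FImp \<phi> \<psi> = FNeg (FConj \<phi> (FNeg \<psi>))"

lemma sat_FAll [simp]: "sat M e (FAll v \<phi>) \<longleftrightarrow> (\<forall>a\<in>univ M. sat M (e(v := a)) \<phi>)" by (simp add: FAll_def)
lemma sat_FImp [simp]: "sat M e (FImp \<phi> \<psi>) \<longleftrightarrow> (sat M e \<phi> \<longrightarrow> sat M e \<psi>)" by (simp add: FImp_def)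
lemma sat_FLt [simp]: "sat (order_struct r) e (FLt v w) \<longleftrightarrow> str r (e v) (e w)"
  by (simp add: FLt_def order_struct_def str_def)
lemma sat_FLe [simp]: "sat (order_struct r) e (FLe v w) \<longleftrightarrow> e w = e v \<or> str r (e v) (e w)"
  by (simp add: FLe_def)
lemma univ_order [simp]: "univ (order_struct r) = Field r" by (simp add: order_struct_def)

lemma syn_simps [simp]:
  "free_vars (FLt v w) = {v, w}" "free_vars (FLe v w) = {v, w}"
  "free_vars (FAll v \<phi>) = free_vars \<phi> - {v}" "free_vars (FImp \<phi> \<psi>) = free_vars \<phi> \<union> free_vars \<psi>"
  "form_funs (FLt v w) = {}" "form_funs (FLe v w) = {}"
  "form_funs (FAll v \<phi>) = form_funs \<phi>" "form_funs (FImp \<phi> \<psi>) = form_funs \<phi> \<union> form_funs \<psi>"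
  by (auto simp: FLt_def FLe_def FAll_def FImp_def)

abbreviation fresh :: "nat \<Rightarrow> nat \<Rightarrow> nat" where "fresh v w \<equiv> Suc (max v w)"

definition closed_form :: "(nat \<Rightarrow> nat \<Rightarrow> fo_form) \<Rightarrow> nat \<Rightarrow> nat \<Rightarrow> fo_form" where
  "closed_form C v w = (let b = fresh v w in FAll b (FImp (FConj (FLe v b) (FLt b w))
     (FEx (Suc b) (FConj (FLt (Suc b) w) (C b (Suc b))))))"

text \<open>The bound variables are chosen above \<open>v\<close> and \<open>w\<close>, so that no capture occurs.\<close>

primrec climb_form :: "nat \<Rightarrow> nat \<Rightarrow> nat \<Rightarrow> fo_form" where
  "climb_form 0 = (\<lambda>v w. FConj (FLt v w) (FNeg (FEx (fresh v w) (FConj (FLt v (fresh v w)) (FLt (fresh v w) w)))))"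
| "climb_form (Suc k) = (\<lambda>v w. FConj (FLt v w) (FConj (closed_form (climb_form k) v w)
     (FNeg (FEx (fresh v w) (FConj (FLt v (fresh v w)) (FConj (FLt (fresh v w) w)
        (closed_form (climb_form k) v (fresh v w))))))))"

lemma free_closed_form:
  "(\<And>v w. free_vars (C v w) \<subseteq> {v, w}) \<Longrightarrow> free_vars (closed_form C v w) \<subseteq> {v, w}"
  unfolding closed_form_def Let_def by (fastforce simp: subset_iff)

lemma free_climb_form: "free_vars (climb_form k v w) \<subseteq> {v, w}"
proof (induction k arbitrary: v w)
  case (Suc k)
  have "free_vars (closed_form (climb_form k) a b) \<subseteq> {a, b}" for a b by (rule free_closed_form) (rule Suc)
  from this[of v w] this[of v "fresh v w"] show ?case by auto
qed auto

lemma funs_climb_form: "form_funs (climb_form k v w) = {}"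
  by (induction k arbitrary: v w) (auto simp: closed_form_def Let_def)

lemma sat_closed_form:
  assumes C: "\<And>e v w. e v \<in> Field r \<Longrightarrow> e w \<in> Field r \<Longrightarrow> sat (order_struct r) e (C v w) \<longleftrightarrow> Q (e v) (e w)"
    and e: "e v \<in> Field r" "e w \<in> Field r"
  shows "sat (order_struct r) e (closed_form C v w) \<longleftrightarrow> closed_under Q (str r) (Field r) (e v) (e w)"
proof -
  define b where "b = fresh v w"
  have b: "v \<noteq> b" "w \<noteq> b" "v \<noteq> Suc b" "w \<noteq> Suc b" unfolding b_def by auto
  have 1: "sat (order_struct r) (e(b := z, Suc b := y)) (C b (Suc b)) \<longleftrightarrow> Q z y"
    if "z \<in> Field r" "y \<in> Field r" for z y
    using C[of "e(b := z, Suc b := y)" b "Suc b"] that by simp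
  show ?thesis
    unfolding closed_form_def Let_def b_def[symmetric] closed_under_def using b 1 by auto
qed

lemma sat_climb_form:
  "e v \<in> Field r \<Longrightarrow> e w \<in> Field r \<Longrightarrow>
   sat (order_struct r) e (climb_form k v w) \<longleftrightarrow> climb k (str r) (Field r) (e v) (e w)"
proof (induction k arbitrary: e v w)
  case (Suc k)
  define b where "b = fresh v w"
  have b: "v \<noteq> b" "w \<noteq> b" unfolding b_def by auto
  have cl: "sat (order_struct r) e (closed_form (climb_form k) v w) \<longleftrightarrow>
      closed_under (climb k (str r) (Field r)) (str r) (Field r) (e v) (e w)"
    if "e v \<in> Field r" "e w \<in> Field r" for e v w
    by (rule sat_closed_form[where Q = "climb k (str r) (Field r)", OF Suc.IH that])
  have "sat (order_struct r) (e(b := z)) (closed_form (climb_form k) v b) \<longleftrightarrow>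
      closed_under (climb k (str r) (Field r)) (str r) (Field r) (e v) z" if "z \<in> Field r" for z
    using cl[of "e(b := z)" v b] that Suc.prems b by simp
  then show ?case unfolding climb_Suc climb_form.simps b_def[symmetric] using cl[OF Suc.prems] Suc.prems b by auto
qed auto

primrec path_form :: "nat list \<Rightarrow> nat \<Rightarrow> nat \<Rightarrow> fo_form" where
  "path_form [] = (\<lambda>v w. FEq (TVar v) (TVar w))"
| "path_form (k # ks) = (\<lambda>v w. FEx (fresh v w) (FConj (climb_form k v (fresh v w)) (path_form ks (fresh v w) w)))"

lemma free_path_form: "free_vars (path_form ks v w) \<subseteq> {v, w}"
proof (induction ks arbitrary: v)
  case (Cons k ks)
  from Cons[of "fresh v w"] free_climb_form[of k v "fresh v w"] show ?case by auto
qed auto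

lemma funs_path_form: "form_funs (path_form ks v w) = {}"
  by (induction ks arbitrary: v) (auto simp: funs_climb_form)

lemma sat_path_form:
  "e v \<in> Field r \<Longrightarrow> e w \<in> Field r \<Longrightarrow>
   sat (order_struct r) e (path_form ks v w) \<longleftrightarrow> path ks (str r) (Field r) (e v) (e w)"
proof (induction ks arbitrary: e v)
  case (Cons k ks)
  define b where "b = fresh v w"
  have b: "v \<noteq> b" "w \<noteq> b" unfolding b_def by auto
  have "sat (order_struct r) (e(b := z)) (climb_form k v b) \<longleftrightarrow> climb k (str r) (Field r) (e v) z"
    "sat (order_struct r) (e(b := z)) (path_form ks b w) \<longleftrightarrow> path ks (str r) (Field r) z (e w)" if z: "z \<in> Field r" for z
  proof -
    have u: "(e(b := z)) v = e v" "(e(b := z)) w = e w" "(e(b := z)) b = z" using b by auto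
    show "sat (order_struct r) (e(b := z)) (climb_form k v b) \<longleftrightarrow> climb k (str r) (Field r) (e v) z"
      using sat_climb_form[of "e(b := z)" v r b k] Cons.prems z unfolding u by blast
    show "sat (order_struct r) (e(b := z)) (path_form ks b w) \<longleftrightarrow> path ks (str r) (Field r) z (e w)"
      using Cons.IH[of "e(b := z)" b] Cons.prems z unfolding u by blast
  qed
  then show ?case unfolding path_form.simps path.simps b_def[symmetric] by simp
qed simp

definition ends_form :: "nat list \<Rightarrow> nat \<Rightarrow> fo_form" where
  "ends_form ks j = FEx 0 (FConj (FNeg (FEx 1 (FLt 1 0))) (FEx 1 (FConj (path_form ks 0 1)
     (FConj (FNeg (FEx 2 (FConj (FLe 1 2) (FNeg (FEx 3 (climb_form j 2 3))))))
            (FNeg (FEx 2 (climb_form (Suc j) 1 2)))))))"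

lemma ends_form_sentence: "free_vars (ends_form ks j) = {}" "form_funs (ends_form ks j) = {}"
  using free_path_form[of ks 0 1] free_climb_form[of j 2 3] free_climb_form[of "Suc j" 1 2]
    funs_path_form funs_climb_form
  unfolding ends_form_def by (auto simp del: climb_form.simps)

lemma sat_ends_form: "sat (order_struct r) e (ends_form ks j) \<longleftrightarrow> ends ks j (str r) (Field r)"
proof -
  have 1: "sat (order_struct r) (e(0 := x, 1 := p)) (path_form ks 0 1) \<longleftrightarrow> path ks (str r) (Field r) x p"
    if "x \<in> Field r" "p \<in> Field r" for x p
    using sat_path_form[of "e(0 := x, 1 := p)" 0 r 1 ks] that by simp
  have 2: "sat (order_struct r) (e(0 := x, 1 := p, 2 := z, 3 := y)) (climb_form j 2 3) \<longleftrightarrow> climb j (str r) (Field r) z y"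
    if "z \<in> Field r" "y \<in> Field r" for x p z y
    using sat_climb_form[of "e(0 := x, 1 := p, 2 := z, 3 := y)" 2 r 3 j] that by simp
  have 3: "sat (order_struct r) (e(0 := x, 1 := p, 2 := y)) (climb_form (Suc j) 1 2) \<longleftrightarrow> climb (Suc j) (str r) (Field r) p y"
    if "p \<in> Field r" "y \<in> Field r" for x p y
    using sat_climb_form[of "e(0 := x, 1 := p, 2 := y)" 1 r 2 "Suc j"] that by simp
  show ?thesis unfolding ends_form_def ends_def sat.simps univ_order using 1 2 3
    by (simp del: climb_form.simps climb.simps add: One_nat_def[symmetric] del: One_nat_def)
qed

lemma order_iso_sat:
  assumes f: "convex_emb (str r) (Field r) (str s) (Field s) f" "f ` Field r = Field s"
  shows "form_funs \<phi> = {} \<Longrightarrow> \<forall>v\<in>free_vars \<phi>. e v \<in> Field r \<and> e' v = f (e v) \<Longrightarrow>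
    sat (order_struct r) e \<phi> \<longleftrightarrow> sat (order_struct s) e' \<phi>"
proof (induction \<phi> arbitrary: e e')
  case (FEq t u)
  obtain a b where "t = TVar a" "u = TVar b" using FEq(1) by (cases t; cases u) auto
  then show ?case using FEq(2) convex_embD(2)[OF f(1)] by auto
next
  case (FRel t u)
  obtain a b where "t = TVar a" "u = TVar b" using FRel(1) by (cases t; cases u) auto
  then show ?case using FRel(2) convex_embD(3)[OF f(1), of "e a" "e b"] by (auto simp: order_struct_def str_def)
next
  case (FNeg \<phi>)
  show ?case using FNeg.IH[of e e'] FNeg.prems by simp
next
  case (FConj \<phi> \<psi>)
  show ?case using FConj.IH(1)[of e e'] FConj.IH(2)[of e e'] FConj.prems by simp
next
  case (FEx v \<phi>)
  have "sat (order_struct r) (e(v := a)) \<phi> \<longleftrightarrow> sat (order_struct s) (e'(v := f a)) \<phi>" if "a \<in> Field r" for a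
    by (rule FEx.IH) (use FEx.prems that in auto)
  then show ?case unfolding sat.simps univ_order f(2)[symmetric] by simp
qed

lemma order_iso_equiv:
  assumes "convex_emb (str r) (Field r) (str s) (Field s) f" "f ` Field r = Field s" "fo_sentence 0 \<phi>"
  shows "models (order_struct r) \<phi> \<longleftrightarrow> models (order_struct s) \<phi>"
proof -
  have \<phi>: "free_vars \<phi> = {}" "form_funs \<phi> = {}" using assms(3) unfolding fo_sentence_def by auto
  show ?thesis unfolding models_sentence[OF assms(3), of "order_struct r" undefined] models_sentence[OF assms(3), of "order_struct s" undefined]
    by (rule order_iso_sat[OF assms(1,2) \<phi>(2)]) (simp add: \<phi>(1))
qed

primrec tvar :: "fo_term \<Rightarrow> nat" where
  "tvar (TVar v) = v" | "tvar (TFun i t) = tvar t"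

text \<open>A sentence about orders is interpreted in a structure whose order relation is \<open>brel\<close> on the elements that
satisfy the guard \<open>G\<close>. Variables are shifted by \<open>3\<close>: the small ones are left for the parameter of the guard and
its bound variables. The strict order of \<open>order_struct\<close> becomes the irreflexive part of \<open>brel\<close>.\<close>

primrec relativise :: "(nat \<Rightarrow> fo_form) \<Rightarrow> fo_form \<Rightarrow> fo_form" where
  "relativise G (FEq t u) = FEq (TVar (tvar t + 3)) (TVar (tvar u + 3))"
| "relativise G (FRel t u) = FConj (FRel (TVar (tvar t + 3)) (TVar (tvar u + 3)))
     (FNeg (FEq (TVar (tvar t + 3)) (TVar (tvar u + 3))))"
| "relativise G (FNeg \<phi>) = FNeg (relativise G \<phi>)"
| "relativise G (FConj \<phi> \<psi>) = FConj (relativise G \<phi>) (relativise G \<psi>)"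
| "relativise G (FEx v \<phi>) = FEx (v + 3) (FConj (G (v + 3)) (relativise G \<phi>))"

lemma sat_relativise:
  assumes p: "p < 3" and h: "h ` Field R = {t \<in> univ M. g t}"
    and G: "\<And>e v. v \<ge> 3 \<Longrightarrow> e p = s \<Longrightarrow> e v \<in> univ M \<Longrightarrow> sat M e (G v) \<longleftrightarrow> g (e v)"
    and ord: "\<And>x y. x \<in> Field R \<Longrightarrow> y \<in> Field R \<Longrightarrow> h x = h y \<longleftrightarrow> x = y"
      "\<And>x y. x \<in> Field R \<Longrightarrow> y \<in> Field R \<Longrightarrow> brel M (h x) (h y) \<longleftrightarrow> (x, y) \<in> R"
  shows "form_funs \<phi> = {} \<Longrightarrow> e' p = s \<Longrightarrow> \<forall>v\<in>free_vars \<phi>. e v \<in> Field R \<and> e' (v + 3) = h (e v) \<Longrightarrow>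
    sat M e' (relativise G \<phi>) \<longleftrightarrow> sat (order_struct R) e \<phi>"
proof (induction \<phi> arbitrary: e e')
  case (FEq t u)
  obtain a b where "t = TVar a" "u = TVar b" using FEq(1) by (cases t; cases u) auto
  then show ?case using FEq(3) ord(1) by auto
next
  case (FRel t u)
  obtain a b where "t = TVar a" "u = TVar b" using FRel(1) by (cases t; cases u) auto
  then show ?case using FRel(3) ord by (auto simp: order_struct_def)
next
  case (FNeg \<phi>)
  show ?case using FNeg.IH[of e' e] FNeg.prems by simp
next
  case (FConj \<phi> \<psi>)
  show ?case using FConj.IH(1)[of e' e] FConj.IH(2)[of e' e] FConj.prems by simp
next
  case (FEx v \<phi>)
  have 1: "sat M (e'(v + 3 := h a)) (relativise G \<phi>) \<longleftrightarrow> sat (order_struct R) (e(v := a)) \<phi>" if "a \<in> Field R" for a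
    by (rule FEx.IH) (use FEx.prems that p in auto)
  have 2: "sat M (e'(v + 3 := t)) (G (v + 3)) \<longleftrightarrow> g t" if "t \<in> univ M" for t
    using G[of "v + 3" "e'(v + 3 := t)"] FEx.prems(2) p that by simp
  have "(\<exists>t\<in>univ M. sat M (e'(v + 3 := t)) (FConj (G (v + 3)) (relativise G \<phi>))) \<longleftrightarrow>
      (\<exists>t\<in>{t \<in> univ M. g t}. sat M (e'(v + 3 := t)) (relativise G \<phi>))" using 2 by auto
  also have "\<dots> \<longleftrightarrow> (\<exists>a\<in>Field R. sat (order_struct R) (e(v := a)) \<phi>)" unfolding h[symmetric] using 1 by auto
  finally show ?case by simp
qed

lemma free_relativise:
  assumes "\<And>v. free_vars (G v) \<subseteq> {p, v}" and "form_funs \<phi> = {}"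
  shows "free_vars (relativise G \<phi>) \<subseteq> insert p ((\<lambda>v. v + 3) ` free_vars \<phi>)"
  using assms(2)
proof (induction \<phi>)
  case (FEq t u)
  obtain a b where "t = TVar a" "u = TVar b" using FEq by (cases t; cases u) auto
  then show ?case by simp
next
  case (FRel t u)
  obtain a b where "t = TVar a" "u = TVar b" using FRel by (cases t; cases u) auto
  then show ?case by simp
next
  case (FEx v \<phi>)
  have "free_vars (relativise G (FEx v \<phi>)) \<subseteq> ({p, v + 3} \<union> insert p ((\<lambda>v. v + 3) ` free_vars \<phi>)) - {v + 3}"
    using FEx assms(1)[of "v + 3"] by auto
  then show ?case by auto
qed auto

lemma funs_relativise: "(\<And>v. form_funs (G v) \<subseteq> N) \<Longrightarrow> form_funs (relativise G \<phi>) \<subseteq> N"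
  by (induction \<phi>) auto

section \<open>Reading the order in the tree\<close>

lemma Field_Restr: assumes "Well_order r" "A \<subseteq> Field r" shows "Field (Restr r A) = A"
  using Well_orderD(4)[OF assms(1)] assms(2) unfolding Field_def by blast

lemma str_Restr: "str (Restr r A) x y \<longleftrightarrow> x \<in> A \<and> y \<in> A \<and> str r x y"
  unfolding str_def by blast

definition up :: "'a rel \<Rightarrow> 'a \<Rightarrow> 'a set" where "up r b = {c. (b, c) \<in> r}"

definition end_point :: "nat list \<Rightarrow> nat \<Rightarrow> 'a rel \<Rightarrow> 'a \<Rightarrow> bool" where
  "end_point ks j r b \<longleftrightarrow> ends ks j (str (Restr r (up r b))) (Field (Restr r (up r b)))"

text \<open>The definable place at which the last summand \<open>\<theta>\<close> begins.\<close>

definition least_end :: "nat list \<Rightarrow> nat \<Rightarrow> 'a rel \<Rightarrow> 'a \<Rightarrow> bool" where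
  "least_end ks j r b \<longleftrightarrow> b \<in> Field r \<and> end_point ks j r b \<and> (\<forall>c. str r c b \<longrightarrow> \<not> end_point ks j r c)"

text \<open>\<open>w\<close> extends the node \<open>p\<close> by zeros only. These extensions form a chain that is isomorphic to the ordinals from
the length of \<open>p\<close> on.\<close>

definition tail_guard :: "nat \<Rightarrow> nat \<Rightarrow> fo_form" where
  "tail_guard p w = FConj (FRel (TVar p) (TVar w)) (FAll 2 (FImp
     (FConj (FRel (TVar p) (TVar 2)) (FConj (FRel (TVar 2) (TVar w)) (FNeg (FEq (TVar 2) (TVar w)))))
     (FRel (TFun 0 (TVar 2)) (TVar w))))"

definition below_guard :: "nat \<Rightarrow> fo_form" where
  "below_guard w = FConj (FRel (TVar w) (TVar 0)) (FNeg (FEq (TVar w) (TVar 0)))"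

definition tail_form :: "nat list \<Rightarrow> nat \<Rightarrow> nat \<Rightarrow> fo_form" where
  "tail_form ks j p = relativise (tail_guard p) (ends_form ks j)"

definition least_form :: "nat list \<Rightarrow> nat \<Rightarrow> fo_form" where
  "least_form ks j = FConj (tail_form ks j 0) (FAll 1 (FImp (below_guard 1) (FNeg (tail_form ks j 1))))"

definition below_form :: "nat list \<Rightarrow> nat \<Rightarrow> fo_form \<Rightarrow> fo_form" where
  "below_form ks j \<phi> = FEx 0 (FConj (least_form ks j) (relativise below_guard \<phi>))"

text \<open>The position \<open>w\<close>, given as a proper initial segment of the node \<open>0\<close>, carries the letter \<open>1\<close>.\<close>

definition mark :: "nat \<Rightarrow> fo_form" where
  "mark w = FConj (below_guard w) (FRel (TFun 1 (TVar w)) (TVar 0))"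

definition marking_form :: fo_form where
  "marking_form = FConj
     (FAll 1 (FImp (below_guard 1) (FEx 2 (FConj (FRel (TVar 1) (TVar 2)) (mark 2)))))
     (FAll 1 (FImp (FConj (below_guard 1) (FEx 2 (FConj (mark 2) (FConj (FRel (TVar 2) (TVar 1)) (FNeg (FEq (TVar 2) (TVar 1)))))))
        (FEx 2 (FConj (FConj (mark 2) (FConj (FRel (TVar 2) (TVar 1)) (FNeg (FEq (TVar 2) (TVar 1)))))
           (FAll 3 (FImp (FConj (mark 3) (FConj (FRel (TVar 3) (TVar 1)) (FNeg (FEq (TVar 3) (TVar 1)))))
              (FRel (TVar 3) (TVar 2))))))))"

definition cof_form :: "nat list \<Rightarrow> nat \<Rightarrow> fo_form" where
  "cof_form ks j = FEx 0 (FConj (least_form ks j) marking_form)"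

lemma free_tail_form: "free_vars (tail_form ks j p) \<subseteq> {p}"
  using free_relativise[of "tail_guard p" p "ends_form ks j"] ends_form_sentence[of ks j]
  unfolding tail_form_def by (auto simp: tail_guard_def)

lemma free_least_form: "free_vars (least_form ks j) \<subseteq> {0}"
  using free_tail_form[of ks j 0] free_tail_form[of ks j 1] unfolding least_form_def by (auto simp: below_guard_def)

lemma funs_tail_form: "form_funs (tail_form ks j p) \<subseteq> {0}"
  unfolding tail_form_def by (rule funs_relativise) (simp add: tail_guard_def)

lemma funs_least_form: "form_funs (least_form ks j) \<subseteq> {0}"
  using funs_tail_form[of ks j] unfolding least_form_def by (auto simp: below_guard_def)

lemma below_form_sentence:
  assumes "fo_sentence 0 \<phi>" "n \<ge> 2" shows "fo_sentence n (below_form ks j \<phi>)"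
proof -
  have \<phi>: "free_vars \<phi> = {}" "form_funs \<phi> = {}" using assms(1) unfolding fo_sentence_def by auto
  have "free_vars (relativise below_guard \<phi>) \<subseteq> {0}"
    using free_relativise[of below_guard 0 \<phi>] \<phi> by (auto simp: below_guard_def)
  moreover have "form_funs (relativise below_guard \<phi>) \<subseteq> {}" by (rule funs_relativise) (simp add: below_guard_def)
  ultimately show ?thesis
    using free_least_form[of ks j] funs_least_form[of ks j] assms(2) unfolding fo_sentence_def below_form_def by auto
qed

lemma cof_form_sentence: assumes "n \<ge> 2" shows "fo_sentence n (cof_form ks j)"
  using free_least_form[of ks j] funs_least_form[of ks j] assms
  unfolding fo_sentence_def cof_form_def marking_form_def by (auto simp: below_guard_def mark_def)

text \<open>The letters \<open>1\<close> of \<open>s\<close> are cofinal below \<open>b\<close>, and those below any \<open>c\<close> have a largest one if there are any.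
In a well-order the second condition forces order type at most \<open>\<omega>\<close>.\<close>

definition marked :: "'a rel \<Rightarrow> ('a \<rightharpoonup> nat) \<Rightarrow> 'a \<Rightarrow> bool" where
  "marked r s b \<longleftrightarrow> (\<forall>c. str r c b \<longrightarrow> (\<exists>d. (c, d) \<in> r \<and> str r d b \<and> s d = Some 1)) \<and>
     (\<forall>c. str r c b \<longrightarrow> (\<exists>d. str r d c \<and> s d = Some 1) \<longrightarrow>
        (\<exists>d. str r d c \<and> s d = Some 1 \<and> (\<forall>e. str r e c \<and> s e = Some 1 \<longrightarrow> (e, d) \<in> r)))"

context tree_order begin

abbreviation M where "M \<equiv> tree_struct n r"
abbreviation T where "T \<equiv> tree_nodes n r"

lemma M_simps [simp]: "univ M = T" "brel M = (\<subseteq>\<^sub>m)" "ufun M = tree_succ r"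
  by (simp_all add: tree_struct_def)

definition cut :: "('a \<rightharpoonup> nat) \<Rightarrow> 'a \<Rightarrow> 'a \<rightharpoonup> nat" where
  "cut s c d = (if str r d c then s d else None)"

definition zeros :: "('a \<rightharpoonup> nat) \<Rightarrow> 'a \<Rightarrow> 'a \<rightharpoonup> nat" where
  "zeros s c d = (if str r d (level r s) then s d else if str r d c then Some 0 else None)"

lemma cut_node:
  assumes s: "s \<in> T" and c: "(c, level r s) \<in> r"
  shows "cut s c \<in> T" "level r (cut s c) = c"
proof -
  have a: "cut s c d \<noteq> None \<longleftrightarrow> str r d c" for d
    using nodeD(2)[OF s, of d] str_le(1)[of d c] c unfolding cut_def by auto
  have b: "cut s c d = Some a \<Longrightarrow> a < n" for d a
    using nodeD(3)[OF s] unfolding cut_def by (auto split: if_splits)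
  show "cut s c \<in> T" "level r (cut s c) = c" by (rule nodeI[OF F(1)[OF c] a]; erule b)+
qed

lemma zeros_node:
  assumes s: "s \<in> T" and c: "(level r s, c) \<in> r" and n: "n > 0"
  shows "zeros s c \<in> T" "level r (zeros s c) = c"
proof -
  have a: "zeros s c d \<noteq> None \<longleftrightarrow> str r d c" for d
    using nodeD(2)[OF s, of d] str_le(1)[of d "level r s" c] c unfolding zeros_def by auto
  have b: "zeros s c d = Some a \<Longrightarrow> a < n" for d a
    using nodeD(3)[OF s] n unfolding zeros_def by (auto split: if_splits)
  show "zeros s c \<in> T" "level r (zeros s c) = c" by (rule nodeI[OF F(2)[OF c] a]; erule b)+
qed

lemma le_cut: assumes s: "s \<in> T" and u: "u \<in> T"
  shows "u \<subseteq>\<^sub>m s \<longleftrightarrow> (level r u, level r s) \<in> r \<and> u = cut s (level r u)"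
proof
  assume le: "u \<subseteq>\<^sub>m s"
  have "\<not> str r (level r s) (level r u)"
  proof
    assume "str r (level r s) (level r u)"
    then have "u (level r s) \<noteq> None" using nodeD(2)[OF u] by blast
    moreover have "s (level r s) = None" using nodeD(2)[OF s, of "level r s"] by (simp add: str_def)
    ultimately show False using le unfolding map_le_def by (metis domIff)
  qed
  then have "(level r u, level r s) \<in> r" using cmp[OF nodeD(1)[OF u] nodeD(1)[OF s]] by blast
  moreover have "u d = cut s (level r u) d" for d
  proof (cases "str r d (level r u)")
    case True
    then have "d \<in> dom u" using nodeD(2)[OF u] by blast
    then show ?thesis using le True unfolding cut_def map_le_def by simp
  next
    case False
    then show ?thesis using nodeD(2)[OF u, of d] unfolding cut_def by simp
  qed
  ultimately show "(level r u, level r s) \<in> r \<and> u = cut s (level r u)" by blast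
next
  assume a: "(level r u, level r s) \<in> r \<and> u = cut s (level r u)"
  have "u d = s d" if "d \<in> dom u" for d
  proof -
    have "str r d (level r u)" using that nodeD(2)[OF u] by blast
    moreover have "u d = cut s (level r u) d" using a by metis
    ultimately show ?thesis unfolding cut_def by simp
  qed
  then show "u \<subseteq>\<^sub>m s" unfolding map_le_def by blast
qed

lemma cut_level: "s \<in> T \<Longrightarrow> cut s (level r s) = s"
  using le_cut[of s s] by (simp add: map_le_refl)

lemma cut_cut: assumes "(c, d) \<in> r" shows "cut (cut s d) c = cut s c"
  using str_le(1)[OF _ assms] unfolding cut_def by auto

lemma cut_zeros:
  assumes l: "level r s \<in> Field r" and c: "(c, d) \<in> r"
  shows "cut (zeros s d) c = (if (level r s, c) \<in> r then zeros s c else cut s c)"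
proof (cases "(level r s, c) \<in> r")
  case True
  have "cut (zeros s d) c x = zeros s c x" for x
    using str_le(1)[of x c d, OF _ c] str_le(1)[of x "level r s" c, OF _ True] unfolding cut_def zeros_def by simp
  then show ?thesis using True by (simp add: fun_eq_iff)
next
  case False
  then have "str r c (level r s)" using cmp[OF l F(1)[OF c]] by blast
  then have "cut (zeros s d) c x = cut s c x" for x
    using str_le(1)[of x c "level r s", OF _ str_r(1)] unfolding cut_def zeros_def by simp
  then show ?thesis using False by (simp add: fun_eq_iff)
qed

definition in_tail :: "('a \<rightharpoonup> nat) \<Rightarrow> ('a \<rightharpoonup> nat) \<Rightarrow> bool" where
  "in_tail s u \<longleftrightarrow> s \<subseteq>\<^sub>m u \<and> (\<forall>w\<in>T. s \<subseteq>\<^sub>m w \<and> w \<subseteq>\<^sub>m u \<and> w \<noteq> u \<longrightarrow> tree_succ r 0 w \<subseteq>\<^sub>m u)"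

lemma succ_le: assumes w: "w \<in> T" and u: "u \<in> T" and wu: "w \<subseteq>\<^sub>m u"
  shows "tree_succ r a w \<subseteq>\<^sub>m u \<longleftrightarrow> u (level r w) = Some a"
  using wu unfolding succ_eq[OF w] map_le_def by auto

lemma in_tail_iff:
  assumes s: "s \<in> T" and u: "u \<in> T" and n: "n > 0"
  shows "in_tail s u \<longleftrightarrow> (\<exists>c\<in>up r (level r s). u = zeros s c)"
proof
  assume t: "in_tail s u"
  define c where "c = level r u"
  have su: "(level r s, c) \<in> r" "s = cut u (level r s)"
    using t le_cut[OF u s] unfolding in_tail_def c_def by blast+
  have "u d = zeros s c d" for d
  proof (cases "str r d (level r s)")
    case True
    then show ?thesis using fun_cong[OF su(2), of d] unfolding zeros_def cut_def by simp
  next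
    case F1: False
    show ?thesis
    proof (cases "str r d c")
      case True
      have dF: "d \<in> Field r" using True str_r F by blast
      have sd: "(level r s, d) \<in> r" using F1 cmp[OF nodeD(1)[OF s] dF] by blast
      have dc: "(d, level r u) \<in> r" using True str_r c_def by blast
      define w where "w = cut u d"
      have w: "w \<in> T" "level r w = d" unfolding w_def by (rule cut_node[OF u dc])+
      have "w \<subseteq>\<^sub>m u" using le_cut[OF u w(1)] w(2) dc w_def by simp
      moreover have "s \<subseteq>\<^sub>m w" unfolding le_cut[OF w(1) s] w(2)
        using sd su(2) cut_cut[OF sd, of u] w_def by simp
      moreover have "w \<noteq> u" using w(2) True c_def str_r(2) by blast
      ultimately have "u d = Some 0" using t w succ_le[OF w(1) u, of 0] unfolding in_tail_def by blast
      then show ?thesis using F1 True unfolding zeros_def by simp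
    next
      case False
      then show ?thesis using F1 nodeD(2)[OF u, of d] c_def unfolding zeros_def by simp
    qed
  qed
  then show "\<exists>c\<in>up r (level r s). u = zeros s c" using su(1) unfolding up_def by blast
next
  assume "\<exists>c\<in>up r (level r s). u = zeros s c"
  then obtain c where c: "(level r s, c) \<in> r" "u = zeros s c" unfolding up_def by blast
  have lu: "level r u = c" using zeros_node[OF s c(1) n] c(2) by blast
  have "s d = cut u (level r s) d" for d
    using nodeD(2)[OF s, of d] unfolding c(2) cut_def zeros_def by (cases "str r d (level r s)") auto
  then have "s \<subseteq>\<^sub>m u" unfolding le_cut[OF u s] lu using c(1) by blast
  moreover have "tree_succ r 0 w \<subseteq>\<^sub>m u" if w: "w \<in> T" "s \<subseteq>\<^sub>m w" "w \<subseteq>\<^sub>m u" "w \<noteq> u" for w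
  proof -
    have sw: "(level r s, level r w) \<in> r" using le_cut[OF w(1) s] w(2) by blast
    have wu: "(level r w, c) \<in> r" "w = cut u (level r w)" using le_cut[OF u w(1)] w(3) lu by auto
    have "level r w \<noteq> c" using wu(2) w(4) cut_level[OF u] lu by metis
    then have "str r (level r w) c" using wu(1) unfolding str_def by blast
    moreover have "\<not> str r (level r w) (level r s)" using sw str_irr by blast
    ultimately have "u (level r w) = Some 0" unfolding c(2) zeros_def by simp
    then show ?thesis using succ_le[OF w(1) u w(3)] by blast
  qed
  ultimately show "in_tail s u" unfolding in_tail_def by blast
qed

lemma up_Field: "up r b \<subseteq> Field r" unfolding up_def using F by blast

lemma sat_tail_form:
  assumes n: "n > 0" and p: "p < 2" and s: "e p \<in> T"
  shows "sat M e (tail_form ks j p) \<longleftrightarrow> end_point ks j r (level r (e p))"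
proof -
  define s where "s = e p"
  define b where "b = level r s"
  have sT: "s \<in> T" using s s_def by simp
  have FR: "Field (Restr r (up r b)) = up r b" by (rule Field_Restr[OF W up_Field])
  have z: "zeros s c \<in> T" "level r (zeros s c) = c" if "c \<in> up r b" for c
    using zeros_node[OF sT _ n] that unfolding up_def b_def by auto
  have "sat M e (relativise (tail_guard p) (ends_form ks j)) \<longleftrightarrow> sat (order_struct (Restr r (up r b))) undefined (ends_form ks j)"
  proof (rule sat_relativise[where h = "zeros s" and g = "in_tail s" and p = p and s = s])
    show "p < 3" using p by simp
    show "zeros s ` Field (Restr r (up r b)) = {t \<in> univ M. in_tail s t}"
      unfolding FR using z(1) in_tail_iff[OF sT _ n] unfolding b_def by auto
    show "sat M f (tail_guard p v) \<longleftrightarrow> in_tail s (f v)" if "v \<ge> 3" "f p = s" "f v \<in> univ M" for f v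
      using that p unfolding tail_guard_def in_tail_def by simp
    fix x y assume xy: "x \<in> Field (Restr r (up r b))" "y \<in> Field (Restr r (up r b))"
    then have xy: "x \<in> up r b" "y \<in> up r b" unfolding FR by auto
    show "zeros s x = zeros s y \<longleftrightarrow> x = y" using z(2)[OF xy(1)] z(2)[OF xy(2)] by metis
    have bx: "(level r s, x) \<in> r" "(level r s, y) \<in> r" using xy unfolding up_def b_def by auto
    have "zeros s x \<subseteq>\<^sub>m zeros s y \<longleftrightarrow> (x, y) \<in> r"
      unfolding le_cut[OF z(1)[OF xy(2)] z(1)[OF xy(1)]] z(2)[OF xy(1)] z(2)[OF xy(2)]
      using cut_zeros[OF nodeD(1)[OF sT], of x y] bx by auto
    then show "brel M (zeros s x) (zeros s y) \<longleftrightarrow> (x, y) \<in> Restr r (up r b)" using xy by simp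
  qed (simp_all add: ends_form_sentence s_def)
  then show ?thesis unfolding tail_form_def sat_ends_form end_point_def b_def s_def .
qed

lemma below_iff: assumes s: "s \<in> T"
  shows "{u \<in> T. u \<subseteq>\<^sub>m s \<and> u \<noteq> s} = cut s ` underS r (level r s)"
proof (intro subset_antisym subsetI)
  fix u assume "u \<in> {u \<in> T. u \<subseteq>\<^sub>m s \<and> u \<noteq> s}"
  then have u: "u \<in> T" "(level r u, level r s) \<in> r" "u = cut s (level r u)" "u \<noteq> s" using le_cut[OF s] by auto
  then have "level r u \<noteq> level r s" using cut_level[OF s] by metis
  then show "u \<in> cut s ` underS r (level r s)" using u unfolding underS_def by blast
next
  fix u assume "u \<in> cut s ` underS r (level r s)"
  then obtain c where c: "(c, level r s) \<in> r" "c \<noteq> level r s" "u = cut s c" unfolding underS_def by blast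
  then show "u \<in> {u \<in> T. u \<subseteq>\<^sub>m s \<and> u \<noteq> s}" using cut_node[OF s c(1)] le_cut[OF s, of u] by auto
qed

lemma sat_least_form:
  assumes n: "n > 0" and s: "e 0 \<in> T"
  shows "sat M e (least_form ks j) \<longleftrightarrow> least_end ks j r (level r (e 0))"
proof -
  have 1: "sat M (e(1 := u)) (tail_form ks j 1) \<longleftrightarrow> end_point ks j r (level r u)" if "u \<in> T" for u
    using sat_tail_form[OF n, of 1 "e(1 := u)"] that by simp
  have "sat M e (least_form ks j) \<longleftrightarrow> end_point ks j r (level r (e 0)) \<and>
     (\<forall>u\<in>{u \<in> T. u \<subseteq>\<^sub>m e 0 \<and> u \<noteq> e 0}. \<not> end_point ks j r (level r u))"
    unfolding least_form_def using sat_tail_form[OF n, of 0 e] s 1 by (auto simp: below_guard_def)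
  also have "\<dots> \<longleftrightarrow> least_end ks j r (level r (e 0))"
    unfolding below_iff[OF s] least_end_def using cut_node(2)[OF s] nodeD(1)[OF s] by (auto simp: underS_str str_r(1))
  finally show ?thesis .
qed

lemma node_exists: assumes "b \<in> Field r" "n > 0" obtains s where "s \<in> T" "level r s = b"
proof -
  define s where "s d = (if str r d b then Some (0::nat) else None)" for d
  have "s \<in> T" "level r s = b" by (rule nodeI[OF assms(1)]; use assms(2) in \<open>auto simp: s_def split: if_splits\<close>)+
  then show ?thesis by (rule that)
qed

lemma sat_below:
  assumes s: "e 0 \<in> T" and \<phi>: "fo_sentence 0 \<phi>"
  shows "sat M e (relativise below_guard \<phi>) \<longleftrightarrow> models (order_struct (Restr r (underS r (level r (e 0))))) \<phi>"
proof -
  define s where "s = e 0"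
  define b where "b = level r s"
  have sT: "s \<in> T" using s s_def by simp
  have U: "underS r b \<subseteq> Field r" unfolding underS_def using F by blast
  have FR: "Field (Restr r (underS r b)) = underS r b" by (rule Field_Restr[OF W U])
  have z: "cut s c \<in> T" "level r (cut s c) = c" "(c, level r s) \<in> r" if "c \<in> underS r b" for c
    using cut_node[OF sT] that unfolding underS_def b_def by auto
  have "sat M e (relativise below_guard \<phi>) \<longleftrightarrow> sat (order_struct (Restr r (underS r b))) undefined \<phi>"
  proof (rule sat_relativise[where h = "cut s" and g = "\<lambda>u. u \<subseteq>\<^sub>m s \<and> u \<noteq> s" and p = 0 and s = s])
    show "cut s ` Field (Restr r (underS r b)) = {t \<in> univ M. t \<subseteq>\<^sub>m s \<and> t \<noteq> s}"
      unfolding FR unfolding M_simps below_iff[OF sT] b_def ..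
    show "sat M f (below_guard v) \<longleftrightarrow> f v \<subseteq>\<^sub>m s \<and> f v \<noteq> s" if "v \<ge> 3" "f 0 = s" "f v \<in> univ M" for f v
      using that unfolding below_guard_def by simp
    fix x y assume xy: "x \<in> Field (Restr r (underS r b))" "y \<in> Field (Restr r (underS r b))"
    then have xy: "x \<in> underS r b" "y \<in> underS r b" unfolding FR by auto
    show "cut s x = cut s y \<longleftrightarrow> x = y" using z(2)[OF xy(1)] z(2)[OF xy(2)] by metis
    have "cut s x \<subseteq>\<^sub>m cut s y \<longleftrightarrow> (x, y) \<in> r"
      unfolding le_cut[OF z(1)[OF xy(2)] z(1)[OF xy(1)]] z(2)[OF xy(1)] z(2)[OF xy(2)]
      using cut_cut[of x y s] by auto
    then show "brel M (cut s x) (cut s y) \<longleftrightarrow> (x, y) \<in> Restr r (underS r b)" using xy by simp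
  qed (use \<phi> in \<open>simp_all add: fo_sentence_def s_def\<close>)
  then show ?thesis unfolding models_sentence[OF \<phi>, of _ undefined] b_def s_def .
qed

text \<open>The tree knows every first-order property of the ordinal in front of the point \<open>least_end\<close>.\<close>

lemma models_below_form:
  assumes n: "n \<ge> 2" and \<phi>: "fo_sentence 0 \<phi>"
  shows "models M (below_form ks j \<phi>) \<longleftrightarrow>
    (\<exists>b. least_end ks j r b \<and> models (order_struct (Restr r (underS r b))) \<phi>)"
proof -
  have n0: "n > 0" using n by simp
  have 1: "sat M (e(0 := s)) (FConj (least_form ks j) (relativise below_guard \<phi>)) \<longleftrightarrow>
      least_end ks j r (level r s) \<and> models (order_struct (Restr r (underS r (level r s)))) \<phi>" if "s \<in> T" for s e
    using sat_least_form[OF n0, of "e(0 := s)"] sat_below[of "e(0 := s)", OF _ \<phi>] that by simp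
  have 2: "models M (below_form ks j \<phi>) \<longleftrightarrow> sat M undefined (below_form ks j \<phi>)"
    by (rule models_sentence[OF below_form_sentence[OF \<phi> n]])
  have "models M (below_form ks j \<phi>) \<longleftrightarrow> (\<exists>s\<in>T. least_end ks j r (level r s) \<and> models (order_struct (Restr r (underS r (level r s)))) \<phi>)"
    unfolding 2 unfolding below_form_def sat.simps(5) M_simps using 1 by blast
  also have "\<dots> \<longleftrightarrow> (\<exists>b. least_end ks j r b \<and> models (order_struct (Restr r (underS r b))) \<phi>)"
    using node_exists[OF _ n0] unfolding least_end_def by metis
  finally show ?thesis .
qed

lemma cut_less: assumes s: "s \<in> T" and "(c, level r s) \<in> r" "(d, level r s) \<in> r"
  shows "cut s c \<subseteq>\<^sub>m cut s d \<longleftrightarrow> (c, d) \<in> r" "cut s c = cut s d \<longleftrightarrow> c = d"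
proof -
  note z = cut_node[OF s assms(2)] and z' = cut_node[OF s assms(3)]
  show "cut s c = cut s d \<longleftrightarrow> c = d" using z(2) z'(2) by metis
  show "cut s c \<subseteq>\<^sub>m cut s d \<longleftrightarrow> (c, d) \<in> r"
    unfolding le_cut[OF z'(1) z(1)] z(2) z'(2) using cut_cut[of c d s] by auto
qed

lemma sat_cof:
  assumes s: "s \<in> T" and e: "e 0 = s"
  shows "sat M e marking_form
   \<longleftrightarrow> marked r s (level r s)"
proof -
  define b where "b = level r s"
  define B where "B = {u \<in> T. u \<subseteq>\<^sub>m s \<and> u \<noteq> s}"
  define Z where "Z = {c. str r c b}"
  have B: "B = cut s ` {c. str r c b}" unfolding B_def below_iff[OF s] underS_str b_def ..
  have BT: "u \<in> T \<and> u \<subseteq>\<^sub>m s \<and> u \<noteq> s \<longleftrightarrow> u \<in> B" for u unfolding B_def by blast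
  define K where "K u \<longleftrightarrow> u \<in> B \<and> tree_succ r 1 u \<subseteq>\<^sub>m s" for u
  have Kc: "K (cut s c) \<longleftrightarrow> s c = Some 1" if "c \<in> Z" for c
  proof -
    have that: "str r c b" using that Z_def by blast
    have cl: "(c, level r s) \<in> r" using that str_r b_def by blast
    have "cut s c \<in> B" unfolding B using that by blast
    then show ?thesis unfolding K_def using succ_le[OF cut_node(1)[OF s cl] s, of 1] cut_node(2)[OF s cl] B_def by simp
  qed
  have KB: "K u \<Longrightarrow> u \<in> B" for u unfolding K_def by blast
  have le: "cut s c \<subseteq>\<^sub>m cut s d \<longleftrightarrow> (c, d) \<in> r" "cut s c = cut s d \<longleftrightarrow> c = d" if "c \<in> Z" "d \<in> Z" for c d
    using cut_less[OF s] that str_r(1) unfolding b_def Z_def by blast+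
  have "sat M e marking_form
   \<longleftrightarrow> (\<forall>u\<in>B. \<exists>w\<in>B. u \<subseteq>\<^sub>m w \<and> K w) \<and>
     (\<forall>u\<in>B. (\<exists>w\<in>B. K w \<and> w \<subseteq>\<^sub>m u \<and> w \<noteq> u) \<longrightarrow>
        (\<exists>w\<in>B. K w \<and> w \<subseteq>\<^sub>m u \<and> w \<noteq> u \<and> (\<forall>v\<in>B. K v \<and> v \<subseteq>\<^sub>m u \<and> v \<noteq> u \<longrightarrow> v \<subseteq>\<^sub>m w)))"
    proof -
    have bg: "sat M f (below_guard w) \<longleftrightarrow> f w \<in> B" if "f 0 = s" "f w \<in> T" for f w
      using that BT[of "f w"] by (simp add: below_guard_def)
    have mk: "sat M f (mark w) \<longleftrightarrow> K (f w)" if "f 0 = s" "f w \<in> T" for f w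
      using that bg[of f w] by (simp add: mark_def K_def)
    have bx: "(\<exists>w\<in>T. P w) \<longleftrightarrow> (\<exists>w\<in>B. P w)" if "\<And>w. P w \<Longrightarrow> w \<in> B" for P
      using that B_def by blast
    have "sat M e marking_form \<longleftrightarrow> (\<forall>u\<in>T. u \<in> B \<longrightarrow> (\<exists>w\<in>T. u \<subseteq>\<^sub>m w \<and> K w)) \<and>
     (\<forall>u\<in>T. u \<in> B \<and> (\<exists>w\<in>T. K w \<and> w \<subseteq>\<^sub>m u \<and> w \<noteq> u) \<longrightarrow>
        (\<exists>w\<in>T. (K w \<and> w \<subseteq>\<^sub>m u \<and> w \<noteq> u) \<and> (\<forall>v\<in>T. K v \<and> v \<subseteq>\<^sub>m u \<and> v \<noteq> u \<longrightarrow> v \<subseteq>\<^sub>m w)))"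
      unfolding marking_form_def by (simp add: bg mk e)
    also have "\<dots> \<longleftrightarrow> (\<forall>u\<in>B. \<exists>w\<in>B. u \<subseteq>\<^sub>m w \<and> K w) \<and>
     (\<forall>u\<in>B. (\<exists>w\<in>B. K w \<and> w \<subseteq>\<^sub>m u \<and> w \<noteq> u) \<longrightarrow>
        (\<exists>w\<in>B. K w \<and> w \<subseteq>\<^sub>m u \<and> w \<noteq> u \<and> (\<forall>v\<in>B. K v \<and> v \<subseteq>\<^sub>m u \<and> v \<noteq> u \<longrightarrow> v \<subseteq>\<^sub>m w)))"
    proof -
      have 1: "(\<forall>u\<in>T. u \<in> B \<longrightarrow> P u) \<longleftrightarrow> (\<forall>u\<in>B. P u)" "(\<forall>u\<in>T. u \<in> B \<and> Q u \<longrightarrow> P u) \<longleftrightarrow> (\<forall>u\<in>B. Q u \<longrightarrow> P u)"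
        "(\<forall>v\<in>T. K v \<and> Q v \<longrightarrow> P v) \<longleftrightarrow> (\<forall>v\<in>B. K v \<and> Q v \<longrightarrow> P v)"
        "(\<exists>w\<in>T. K w \<and> P w) \<longleftrightarrow> (\<exists>w\<in>B. K w \<and> P w)" "(\<exists>w\<in>T. Q w \<and> K w) \<longleftrightarrow> (\<exists>w\<in>B. Q w \<and> K w)" for P Q
        using KB B_def by blast+
      show ?thesis unfolding conj_assoc 1 ..
    qed
    finally show ?thesis .
  qed
  also have "\<dots> \<longleftrightarrow> (\<forall>c\<in>Z. \<exists>d\<in>Z. (c, d) \<in> r \<and> s d = Some 1) \<and>
     (\<forall>c\<in>Z. (\<exists>d\<in>Z. s d = Some 1 \<and> (d, c) \<in> r \<and> d \<noteq> c) \<longrightarrow>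
        (\<exists>d\<in>Z. s d = Some 1 \<and> (d, c) \<in> r \<and> d \<noteq> c \<and> (\<forall>x\<in>Z. s x = Some 1 \<and> (x, c) \<in> r \<and> x \<noteq> c \<longrightarrow> (x, d) \<in> r)))"
    unfolding B Z_def[symmetric] by (simp add: Kc le)
  also have "\<dots> \<longleftrightarrow> marked r s b"
  proof -
    have st: "(d, c) \<in> r \<and> d \<noteq> c \<longleftrightarrow> str r d c" for d c unfolding str_def by blast
    have bex: "(\<exists>d\<in>Z. P d \<and> str r d c) \<longleftrightarrow> (\<exists>d. P d \<and> str r d c)" if "c \<in> Z" for c P
      using str_le(1)[OF _ str_r(1)] that unfolding Z_def by blast
    have ball: "(\<forall>x\<in>Z. s x = Some 1 \<and> str r x c \<longrightarrow> (x, d) \<in> r) \<longleftrightarrow> (\<forall>x. str r x c \<and> s x = Some 1 \<longrightarrow> (x, d) \<in> r)" if "c \<in> Z" for c d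
      using str_le(1)[OF _ str_r(1)] that unfolding Z_def by blast
    have ex: "(\<exists>d\<in>Z. s d = Some 1 \<and> str r d c \<and> Q d) \<longleftrightarrow> (\<exists>d. str r d c \<and> s d = Some 1 \<and> Q d)" if "c \<in> Z" for c Q
      using str_le(1)[OF _ str_r(1)] that unfolding Z_def by blast
    have Z: "(\<forall>c\<in>Z. P c) \<longleftrightarrow> (\<forall>c. str r c b \<longrightarrow> P c)" "(\<exists>d\<in>Z. (c, d) \<in> r \<and> s d = Some 1) \<longleftrightarrow> (\<exists>d. (c, d) \<in> r \<and> str r d b \<and> s d = Some 1)" for P c
      unfolding Z_def by blast+
    have st': "(d, c) \<in> r \<and> d \<noteq> c \<and> X \<longleftrightarrow> str r d c \<and> X" for d c X unfolding str_def by blast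
    have 1: "((\<exists>d\<in>Z. s d = Some 1 \<and> str r d c) \<longrightarrow>
        (\<exists>d\<in>Z. s d = Some 1 \<and> str r d c \<and> (\<forall>x\<in>Z. s x = Some 1 \<and> str r x c \<longrightarrow> (x, d) \<in> r))) \<longleftrightarrow>
      ((\<exists>d. str r d c \<and> s d = Some 1) \<longrightarrow>
        (\<exists>d. str r d c \<and> s d = Some 1 \<and> (\<forall>e. str r e c \<and> s e = Some 1 \<longrightarrow> (e, d) \<in> r)))" if "c \<in> Z" for c
      unfolding ball[OF that] ex[OF that] bex[OF that] by (simp only: conj_commute)
    show ?thesis unfolding st st' marked_def Z(2) Z(1)[symmetric] by (simp only: 1 cong: ball_cong)
  qed
  finally show ?thesis unfolding b_def .
qed

lemma models_cof_form:
  assumes n: "n \<ge> 2"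
  shows "models M (cof_form ks j) \<longleftrightarrow> (\<exists>b s. least_end ks j r b \<and> s \<in> T \<and> level r s = b \<and> marked r s b)"
proof -
  have n0: "n > 0" using n by simp
  have 1: "sat M (e(0 := s)) (FConj (least_form ks j) marking_form) \<longleftrightarrow>
      least_end ks j r (level r s) \<and> marked r s (level r s)" if "s \<in> T" for s e
    using sat_least_form[OF n0, of "e(0 := s)"] sat_cof[OF that, of "e(0 := s)"] that by simp
  have 2: "models M (cof_form ks j) \<longleftrightarrow> sat M undefined (cof_form ks j)"
    by (rule models_sentence[OF cof_form_sentence[OF n]])
  show ?thesis unfolding 2 unfolding cof_form_def sat.simps(5) M_simps using 1 by blast
qed

end

section \<open>The two directions\<close>

lemma oo_cofinal: "\<exists>t :: nat \<Rightarrow> nat \<Rightarrow> nat. range t \<subseteq> Field omega_omega \<and> (\<forall>f\<in>Field omega_omega. \<exists>i. (f, t i) \<in> omega_omega)"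
proof -
  define t where "t i j = (if j = i then 1 else 0 :: nat)" for i j :: nat
  have t: "finite {k. t i k \<noteq> 0}" for i unfolding t_def by simp
  have "\<exists>i. (f, t i) \<in> omega_omega" if f: "finite {k. f k \<noteq> 0}" for f
  proof -
    obtain i where i: "\<And>k. f k \<noteq> 0 \<Longrightarrow> k < i" using f unfolding finite_nat_set_iff_bounded by blast
    then have "f i = 0" by blast
    moreover have "\<forall>x>i. f x = t i x" using i t_def by (metis less_asym less_irrefl)
    ultimately have "(f, t i) \<in> omega_omega" unfolding omega_omega_iff using f t by (auto simp: t_def)
    then show ?thesis by blast
  qed
  then show ?thesis using t unfolding Field_omega_omega by blast
qed

text \<open>Totality of \<open>climb k\<close> is a first-order sentence for each \<open>k\<close>.\<close>

lemma total_transfer: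
  assumes e: "elem_equiv 0 (order_struct R) (order_struct omega_omega)"
  shows "Field R \<noteq> {}" "x \<in> Field R \<Longrightarrow> \<exists>y. climb k (str R) (Field R) x y"
proof -
  define \<phi> where "\<phi> = FAll 0 (FEx 1 (climb_form k 0 1))"
  have s\<phi>: "fo_sentence 0 \<phi>"
    unfolding fo_sentence_def \<phi>_def using free_climb_form[of k 0 1] funs_climb_form[of k 0 1] by auto
  have m: "models (order_struct S) \<phi> \<longleftrightarrow> (\<forall>x\<in>Field S. \<exists>y\<in>Field S. climb k (str S) (Field S) x y)" for S :: "'x rel"
  proof -
    have 1: "sat (order_struct S) (e(0 := x, 1 := y)) (climb_form k 0 1) \<longleftrightarrow> climb k (str S) (Field S) x y"
      if "x \<in> Field S" "y \<in> Field S" for x y and e :: "nat \<Rightarrow> 'x"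
      using sat_climb_form[of "e(0 := x, 1 := y)" 0 S 1 k] that by simp
    have "models (order_struct S) \<phi> \<longleftrightarrow> sat (order_struct S) undefined \<phi>" by (rule models_sentence[OF s\<phi>])
    also have "\<dots> \<longleftrightarrow> (\<forall>x\<in>Field S. \<exists>y\<in>Field S. climb k (str S) (Field S) x y)"
      unfolding \<phi>_def sat_FAll sat.simps univ_order using 1 by blast
    finally show ?thesis .
  qed
  have "models (order_struct omega_omega) \<phi>" unfolding m using oo_climb onx_Field by blast
  then have "models (order_struct R) \<phi>" using e s\<phi> unfolding elem_equiv_def by blast
  then show "x \<in> Field R \<Longrightarrow> \<exists>y. climb k (str R) (Field R) x y" unfolding m by blast
  define \<psi> where "\<psi> = FEx 0 (FEq (TVar 0) (TVar 0))"
  have s\<psi>: "fo_sentence 0 \<psi>" unfolding fo_sentence_def \<psi>_def by simp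
  have m\<psi>: "models (order_struct S) \<psi> \<longleftrightarrow> Field S \<noteq> {}" for S :: "'x rel"
    unfolding models_def \<psi>_def by auto
  have "models (order_struct omega_omega) \<psi>" unfolding m\<psi> using oo_zero(1) by blast
  then show "Field R \<noteq> {}" using e s\<psi> unfolding elem_equiv_def m\<psi>[symmetric] by blast
qed

lemma cofinal_sequence:
  assumes W: "Well_order R" and c: "has_cofinality R natLeq"
  shows "\<exists>t :: nat \<Rightarrow> 'a. range t \<subseteq> Field R \<and> (\<forall>a\<in>Field R. \<exists>i. (a, t i) \<in> (R :: 'a rel))"
proof -
  obtain K where K: "K \<subseteq> Field R" "\<And>a. a \<in> Field R \<Longrightarrow> \<exists>b\<in>K. (a, b) \<in> R" "Restr R K =o natLeq"
    using c unfolding has_cofinality_def cofinal_subset_def by blast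
  obtain f where "iso (Restr R K) natLeq f" using K(3) unfolding ordIso_def by blast
  then have "bij_betw f K UNIV" unfolding iso_iff2 Field_Restr[OF W K(1)] Field_natLeq by blast
  then have f: "inj_on f K" "f ` K = UNIV" unfolding bij_betw_def by auto
  have "range (inv_into K f) \<subseteq> Field R" using K(1) inv_into_into[of _ f K] f(2) by blast
  moreover have "\<exists>i. (a, inv_into K f i) \<in> R" if a: "a \<in> Field R" for a
  proof -
    obtain b where "b \<in> K" "(a, b) \<in> R" using K(2)[OF a] by blast
    then show ?thesis using inv_into_f_f[OF f(1), of b] by metis
  qed
  ultimately show ?thesis by blast
qed

lemma nonzero_limit_sum: assumes "Well_order R" "nonzero_limit \<theta>" shows "nonzero_limit (R +ord \<theta>)"
proof -
  have \<theta>: "Well_order \<theta>" "Field \<theta> \<noteq> {}" "\<And>a. a \<in> Field \<theta> \<Longrightarrow> \<exists>b\<in>Field \<theta>. a \<noteq> b \<and> (a, b) \<in> \<theta>"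
    using assms(2) unfolding nonzero_limit_def by auto
  have "\<exists>b\<in>Field (R +ord \<theta>). a \<noteq> b \<and> (a, b) \<in> R +ord \<theta>" if "a \<in> Field (R +ord \<theta>)" for a
  proof (cases a)
    case (Inl x)
    then have "x \<in> Field R" using that unfolding Field_ord_sum by auto
    moreover obtain d where "d \<in> Field \<theta>" using \<theta>(2) by blast
    ultimately show ?thesis unfolding Inl Field_ord_sum by (intro bexI[of _ "Inr d"]) auto
  next
    case (Inr d)
    then have "d \<in> Field \<theta>" using that unfolding Field_ord_sum by auto
    then obtain d' where "d' \<in> Field \<theta>" "d \<noteq> d'" "(d, d') \<in> \<theta>" using \<theta>(3) by blast
    then show ?thesis unfolding Inr Field_ord_sum by (intro bexI[of _ "Inr d'"]) auto
  qed
  then show ?thesis unfolding nonzero_limit_def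
    using Well_order_ord_sum[OF assms(1) \<theta>(1)] \<theta>(2) by (simp add: Field_ord_sum)
qed

lemma tree_equiv_sum:
  fixes \<alpha> :: "'a rel" and \<alpha>0 :: "'c rel" and \<theta> :: "'b rel"
  assumes n: "n > 0" and \<theta>: "nonzero_limit \<theta>" and \<alpha>: "nonzero_limit \<alpha>" and W: "Well_order \<alpha>0"
    and sum: "\<alpha> =o \<alpha>0 +ord \<theta>" and e: "elem_equiv 0 (order_struct \<alpha>0) (order_struct omega_omega)"
    and c: "has_cofinality \<alpha>0 natLeq"
  shows "elem_equiv n (tree_struct n \<alpha>) (tree_struct n (omega_omega +ord \<theta>))"
proof -
  have W\<theta>: "Well_order \<theta>" and W\<alpha>: "Well_order \<alpha>" using \<theta> \<alpha> unfolding nonzero_limit_def by auto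
  obtain f where f: "iso \<alpha> (\<alpha>0 +ord \<theta>) f" using sum unfolding ordIso_def by blast
  have 1: "side \<alpha> n \<theta> (\<lambda>c. case f c of Inl _ \<Rightarrow> None | Inr d \<Rightarrow> Some d)"
    by (rule side_of_sum[OF f W\<alpha> W W\<theta> \<alpha> total_transfer(2)[OF e] cofinal_sequence[OF W c] total_transfer(1)[OF e] n])
  have i: "iso (omega_omega +ord \<theta>) (omega_omega +ord \<theta>) id" by (rule id_iso)
  have ne: "Field omega_omega \<noteq> {}" using oo_zero(1) by blast
  have 2: "side (omega_omega +ord \<theta>) n \<theta> (\<lambda>c. case id c of Inl _ \<Rightarrow> None | Inr d \<Rightarrow> Some d)"
    by (rule side_of_sum[OF i Well_order_ord_sum[OF Well_order_omega_omega W\<theta>] Well_order_omega_omega W\<theta>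
        nonzero_limit_sum[OF Well_order_omega_omega \<theta>] _ oo_cofinal ne n]) (use oo_climb in blast)
  show ?thesis by (rule tree_equiv[OF two_sides.intro[OF 1 2]])
qed

lemma convex_emb_id:
  assumes "A \<subseteq> B" "\<And>x y b. x \<in> A \<Longrightarrow> y \<in> A \<Longrightarrow> b \<in> B \<Longrightarrow> S x b \<Longrightarrow> S b y \<Longrightarrow> b \<in> A"
  shows "convex_emb S A S B id"
proof -
  have "id ` A \<subseteq> B" "inj_on id A" "\<forall>x\<in>A. \<forall>y\<in>A. S (id x) (id y) \<longleftrightarrow> S x y"
    using assms(1) by simp_all
  moreover have "\<forall>x\<in>A. \<forall>y\<in>A. \<forall>b\<in>B. S (id x) b \<longrightarrow> S b (id y) \<longrightarrow> b \<in> id ` A"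
    using assms(2) unfolding image_id id_apply by blast
  ultimately show ?thesis unfolding convex_emb_def by (intro conjI)
qed

text \<open>\<open>\<theta>\<close> is the set of predecessors of some \<open>b < \<omega>\<^sup>\<omega>\<close>. The last term of the Cantor normal form of \<open>b\<close> is some
\<open>\<omega>\<^sup>k\<close>, and \<open>k > 0\<close> because \<open>\<theta>\<close> has no maximum.\<close>

lemma ends_limit:
  fixes \<theta> :: "'b rel"
  assumes \<theta>: "nonzero_limit \<theta>" and less: "\<theta> <o omega_omega"
  shows "\<exists>ks j. ends ks j (str \<theta>) (Field \<theta>)"
proof -
  let ?O = "Field omega_omega"
  have W: "Well_order \<theta>" and ne: "Field \<theta> \<noteq> {}" and nx: "\<And>a. a \<in> Field \<theta> \<Longrightarrow> \<exists>b\<in>Field \<theta>. str \<theta> a b"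
    using \<theta> unfolding nonzero_limit_def str_def by auto
  obtain f b where f: "convex_emb (str \<theta>) (Field \<theta>) oo ?O f" and b: "b \<in> ?O"
    and im: "\<And>z. z \<in> ?O \<Longrightarrow> oo z b \<longleftrightarrow> z \<in> f ` Field \<theta>"
    using ordLess_emb[OF less] by metis
  define B where "B = {z \<in> ?O. oo z b}"
  note d = convex_embD[OF f]
  have fB: "f ` Field \<theta> = B" unfolding B_def using im d(1) by blast
  have inj: "inj_on f (Field \<theta>)" using f unfolding convex_emb_def by blast
  define g where "g = inv_into (Field \<theta>) f"
  have gf: "g (f x) = x" if "x \<in> Field \<theta>" for x unfolding g_def using inv_into_f_f[OF inj that] .
  have gB: "g ` B = Field \<theta>" unfolding fB[symmetric] image_image using gf by simp
  have "inj_on g B" unfolding fB[symmetric] using gf by (auto simp: inj_on_def)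
  moreover have "str \<theta> (g x) (g y) \<longleftrightarrow> oo x y" if "x \<in> B" "y \<in> B" for x y
    using that gf d(3) unfolding fB[symmetric] by auto
  ultimately have g: "convex_emb oo B (str \<theta>) (Field \<theta>) g" unfolding convex_emb_def using gB by blast
  have BO: "B \<subseteq> ?O" unfolding B_def by blast
  have down: "z \<in> B" if "z \<in> ?O" "y \<in> B" "oo z y" for z y
    using ow(2)[OF that(1) _ b that(3)] that unfolding B_def by blast
  have idB: "convex_emb oo B oo ?O id" by (rule convex_emb_id[OF BO]) (use down in blast)
  have climbB: "climb k oo B x y \<longleftrightarrow> climb k oo ?O x y" if "x \<in> B" "y \<in> B" for k x y
    using climb_emb[OF idB that, of k] by simp
  have pathB: "path ks oo B x y \<longleftrightarrow> path ks oo ?O x y" if "x \<in> B" "y \<in> B" for ks x y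
    using path_emb[OF idB wo_str[OF Well_order_omega_omega] that, of ks] by simp
  have Bne: "B \<noteq> {}" using fB ne by blast
  have Bnx: "\<exists>z\<in>B. oo y z" if y: "y \<in> B" for y
  proof -
    obtain x where "x \<in> Field \<theta>" "y = f x" using y fB by blast
    moreover then obtain x' where "x' \<in> Field \<theta>" "str \<theta> x x'" using nx by blast
    ultimately show ?thesis using d(3) fB by blast
  qed
  have "\<exists>k. b k \<noteq> 0"
  proof (rule ccontr)
    assume "\<nexists>k. b k \<noteq> 0"
    then have "b = (\<lambda>_. 0)" by auto
    then show False using Bne oo_zero(2) unfolding B_def by blast
  qed
  then obtain k where k: "b k \<noteq> 0" "\<And>i. i < k \<Longrightarrow> b i = 0" using exists_least_iff[of "\<lambda>k. b k \<noteq> 0"] by auto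
  (* b = p + omega^k *)
  define p where "p i = (if i < k then 0 else if i = k then b k - 1 else b i)" for i
  have bp: "b = onx k p" unfolding onx_def p_def using k by (auto simp: fun_eq_iff)
  have "{i. p i \<noteq> 0} \<subseteq> {i. b i \<noteq> 0}" unfolding p_def using k(1) by auto
  then have p: "p \<in> ?O" using b finite_subset unfolding Field_omega_omega by blast
  have pb: "oo p b" using oo_onx[OF p] bp by metis
  then have pB: "p \<in> B" using p B_def by blast
  have zp: "z i = p i" if "z \<in> B" "z = p \<or> oo p z" "i \<ge> k" for z i
    using oo_between[OF p _ that(2,3)] that(1) bp unfolding B_def by auto
  have "k \<noteq> 0"
  proof
    assume "k = 0"
    obtain z where z: "z \<in> B" "oo p z" using Bnx[OF pB] by blast
    then have "z = p" using zp[OF z(1)] \<open>k = 0\<close> by auto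
    then show False using z(2) str_def by metis
  qed
  then obtain j where j: "k = Suc j" by (cases k) auto
  obtain ks where ks: "path ks oo ?O (\<lambda>_. 0) p" using oo_path[OF p] by blast
  have zB: "(\<lambda>_. 0) \<in> B"
  proof (cases "p = (\<lambda>_. 0)")
    case False
    then have "oo (\<lambda>_. 0) p" using ow(4)[OF oo_zero(1) p] oo_zero(2) by metis
    then show ?thesis using down[OF oo_zero(1) pB] by blast
  qed (use pB in simp)
  have "\<not> (\<exists>z\<in>B. (z = p \<or> oo p z) \<and> \<not> (\<exists>w\<in>B. climb j oo B z w))"
    proof
      assume "\<exists>z\<in>B. (z = p \<or> oo p z) \<and> \<not> (\<exists>w\<in>B. climb j oo B z w)"
      then obtain z where z: "z \<in> B" "z = p \<or> oo p z" "\<not> (\<exists>w\<in>B. climb j oo B z w)" by blast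
      have zO: "z \<in> ?O" using z(1) BO by blast
      have "oo (onx j z) b" unfolding oo_iff bp
        using onx_Field[OF zO] onx_Field[OF p] zp[OF z(1,2)] j by (auto simp: onx_def intro!: exI[of _ k])
      then have "onx j z \<in> B" unfolding B_def using onx_Field[OF zO] by blast
      then show False using z(3) climbB[OF z(1)] oo_climb[OF zO] by blast
    qed
  moreover have "\<not> (\<exists>y\<in>B. climb (Suc j) oo B p y)"
    proof
      assume "\<exists>y\<in>B. climb (Suc j) oo B p y"
      then obtain y where y: "y \<in> B" "climb k oo ?O p y" using climbB[OF pB] j by blast
      have "y = b" using climb_unique[OF wo_str[OF Well_order_omega_omega] y(2) oo_climb[OF p]] bp by simp
      then show False using y(1) str_def B_def by (metis (no_types, lifting) mem_Collect_eq)
    qed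
  moreover have "path ks oo B (\<lambda>_. 0) p" using pathB[OF zB pB] ks by blast
  ultimately have "ends ks j oo B" unfolding ends_def using zB pB oo_zero(2) by blast
  then show ?thesis using ends_emb[OF g wo_str[OF W] gB] by blast
qed

lemma path_exists:
  assumes "\<And>k x. x \<in> A \<Longrightarrow> \<exists>y\<in>A. climb k R A x y"
  shows "x \<in> A \<Longrightarrow> \<exists>y\<in>A. path ks R A x y"
proof (induction ks arbitrary: x)
  case (Cons k ks)
  obtain z where "z \<in> A" "climb k R A x z" using assms[OF Cons.prems] by blast
  moreover then obtain y where "y \<in> A" "path ks R A z y" using Cons.IH by blast
  ultimately show ?case by auto
qed simp

text \<open>From a point of \<open>\<omega>\<^sup>\<omega>\<close> the path \<open>ks\<close> ends inside \<open>\<omega>\<^sup>\<omega>\<close>, where a further climb of height \<open>j + 1\<close>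
is possible.\<close>

lemma no_end_in_front:
  assumes \<theta>: "Well_order \<theta>" and a: "a \<in> Field omega_omega"
  shows "\<not> end_point ks j (omega_omega +ord \<theta>) (Inl a)"
proof
  let ?\<beta> = "omega_omega +ord \<theta>" and ?O = "Field omega_omega"
  define U where "U = up ?\<beta> (Inl a)"
  define S where "S = Restr ?\<beta> U"
  define C where "C = {c. (a, c) \<in> omega_omega}"
  note wo = Well_orderD[OF Well_order_omega_omega]
  have W: "Well_order ?\<beta>" by (rule Well_order_ord_sum[OF Well_order_omega_omega \<theta>])
  have UF: "U \<subseteq> Field ?\<beta>" unfolding U_def up_def Field_def by blast
  have SF: "Field S = U" unfolding S_def by (rule Field_Restr[OF W UF])
  have wS: "wo (str S) U" using wo_str[OF Well_order_Restr[OF W, of U]] SF unfolding S_def by simp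
  have strS: "str S x y \<longleftrightarrow> x \<in> U \<and> y \<in> U \<and> str ?\<beta> x y" for x y unfolding S_def by (rule str_Restr)
  have CO: "C \<subseteq> ?O" unfolding C_def Field_def by blast
  have aC: "a \<in> C" unfolding C_def using wo(4)[OF a] by blast
  have upC: "y \<in> C" if "x \<in> C" "oo x y" for x y using that wo(2) unfolding C_def str_def by blast
  have idC: "convex_emb oo C oo ?O id" by (rule convex_emb_id[OF CO]) (use upC in blast)
  have cl: "\<exists>y\<in>C. climb k oo C x y" if x: "x \<in> C" for k x
  proof -
    have xO: "x \<in> ?O" using x CO by blast
    have "onx k x \<in> C" using upC[OF x oo_onx[OF xO]] .
    then show ?thesis using climb_emb[OF idC x, of "onx k x" k] oo_climb[OF xO] by auto
  qed
  have CU: "Inl c \<in> U \<longleftrightarrow> c \<in> C" for c unfolding U_def C_def up_def by simp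
  have emb: "convex_emb oo C (str S) U Inl" unfolding convex_emb_def strS
  proof (intro conjI ballI impI)
    show "Inl ` C \<subseteq> U" using CU by blast
    show "inj_on Inl C" by simp
    show "(Inl x \<in> U \<and> Inl y \<in> U \<and> str ?\<beta> (Inl x) (Inl y)) \<longleftrightarrow> oo x y" if "x \<in> C" "y \<in> C" for x y
      using that CU by (simp add: str_def)
    fix x y z assume "z \<in> U" "Inl x \<in> U \<and> z \<in> U \<and> str ?\<beta> (Inl x) z" "z \<in> U \<and> Inl y \<in> U \<and> str ?\<beta> z (Inl y)"
    then show "z \<in> Inl ` C" using CU by (cases z) (auto simp: str_def)
  qed
  assume "end_point ks j ?\<beta> (Inl a)"
  then have "ends ks j (str S) U" unfolding end_point_def U_def[symmetric] S_def[symmetric] SF .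
  then obtain x q where x: "x \<in> U" "\<not> (\<exists>z\<in>U. str S z x)" "q \<in> U" "path ks (str S) U x q"
    "\<not> (\<exists>y\<in>U. climb (Suc j) (str S) U q y)" unfolding ends_def by blast
  have aU: "Inl a \<in> U" using CU aC by blast
  have "(Inl a, x) \<in> ?\<beta>" using x(1) unfolding U_def up_def by blast
  moreover have "\<not> str ?\<beta> (Inl a) x" using x(2) aU x(1) strS by blast
  ultimately have xa: "x = Inl a" unfolding str_def by blast
  obtain y where y: "y \<in> C" "path ks oo C a y" using path_exists[OF cl aC] by blast
  have "path ks (str S) U (Inl a) (Inl y)" using path_emb[OF emb wS aC y(1)] y(2) by blast
  then have q: "q = Inl y" using path_unique[OF wS x(4)] xa by blast
  obtain z where "z \<in> C" "climb (Suc j) oo C y z" using cl[OF y(1)] by blast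
  then have "climb (Suc j) (str S) U q (Inl z)" "Inl z \<in> U" using climb_emb[OF emb y(1)] q CU by blast+
  then show False using x(5) by blast
qed

lemma least_end_sum:
  fixes \<theta> :: "'b rel"
  assumes \<theta>: "Well_order \<theta>" and e: "ends ks j (str \<theta>) (Field \<theta>)"
    and m: "m \<in> Field \<theta>" "\<And>d. d \<in> Field \<theta> \<Longrightarrow> (m, d) \<in> \<theta>"
  shows "least_end ks j (omega_omega +ord \<theta>) b \<longleftrightarrow> b = Inr m"
proof -
  let ?\<beta> = "omega_omega +ord \<theta>"
  have W: "Well_order ?\<beta>" by (rule Well_order_ord_sum[OF Well_order_omega_omega \<theta>])
  have U: "up ?\<beta> (Inr m) = Inr ` Field \<theta>"
  proof (intro subset_antisym subsetI)
    fix x assume x: "x \<in> up ?\<beta> (Inr m)"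
    then show "x \<in> Inr ` Field \<theta>" unfolding up_def by (cases x) (auto simp: Field_def)
  next
    fix x :: "(nat \<Rightarrow> nat) + 'b" assume "x \<in> Inr ` Field \<theta>"
    then show "x \<in> up ?\<beta> (Inr m)" unfolding up_def using m(2) by auto
  qed
  define S where "S = Restr ?\<beta> (Inr ` Field \<theta>)"
  have SF: "Field S = Inr ` Field \<theta>" unfolding S_def by (rule Field_Restr[OF W]) (auto simp: Field_ord_sum)
  have strS: "str S x y \<longleftrightarrow> x \<in> Inr ` Field \<theta> \<and> y \<in> Inr ` Field \<theta> \<and> str ?\<beta> x y" for x y
    unfolding S_def by (rule str_Restr)
  have wS: "wo (str S) (Field S)" using wo_str[OF Well_order_Restr[OF W]] unfolding S_def .
  have "convex_emb (str \<theta>) (Field \<theta>) (str S) (Field S) Inr"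
    unfolding convex_emb_def strS SF by (auto simp: str_def)
  then have "ends ks j (str S) (Field S)" using ends_emb[OF _ wS _ e] SF by blast
  then have me: "end_point ks j ?\<beta> (Inr m)" unfolding end_point_def U S_def .
  have low: "\<exists>a. c = Inl a \<and> a \<in> Field omega_omega" if "str ?\<beta> c (Inr m)" for c
  proof (cases c)
    case (Inr d)
    then have "(d, m) \<in> \<theta>" "d \<noteq> m" using that unfolding str_def by auto
    moreover then have "(m, d) \<in> \<theta>" using m(2) by (auto simp: Field_def)
    ultimately show ?thesis using Well_orderD(3)[OF \<theta>] by blast
  qed (use that in \<open>auto simp: str_def\<close>)
  show ?thesis
  proof
    assume l: "least_end ks j ?\<beta> b"
    then have b: "b \<in> Field ?\<beta>" "end_point ks j ?\<beta> b" "\<And>c. str ?\<beta> c b \<Longrightarrow> \<not> end_point ks j ?\<beta> c"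
      unfolding least_end_def by blast+
    show "b = Inr m"
    proof (cases b)
      case (Inl a)
      then show ?thesis using b(1,2) no_end_in_front[OF \<theta>, of a] unfolding Field_ord_sum by blast
    next
      case (Inr d)
      then have "d \<in> Field \<theta>" using b(1) unfolding Field_ord_sum by auto
      then have "(Inr m, b) \<in> ?\<beta>" using m(2) Inr by simp
      then show ?thesis using b(3)[of "Inr m"] me unfolding str_def by blast
    qed
  next
    assume b: "b = Inr m"
    show "least_end ks j ?\<beta> b" unfolding least_end_def b
      using me low no_end_in_front[OF \<theta>] m(1) unfolding Field_ord_sum by blast
  qed
qed

lemma underS_sum:
  fixes R :: "'a rel" and \<theta> :: "'b rel"
  assumes \<theta>: "Well_order \<theta>" and m: "m \<in> Field \<theta>" "\<And>d. d \<in> Field \<theta> \<Longrightarrow> (m, d) \<in> \<theta>"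
  shows "underS (R +ord \<theta>) (Inr m) = Inl ` Field R"
proof (intro subset_antisym subsetI)
  fix x :: "'a + 'b" assume "x \<in> underS (R +ord \<theta>) (Inr m)"
  then have x: "(x, Inr m) \<in> R +ord \<theta>" "x \<noteq> Inr m" unfolding underS_def by auto
  show "x \<in> Inl ` Field R"
  proof (cases x)
    case (Inr d)
    then have "(d, m) \<in> \<theta>" "d \<noteq> m" using x by auto
    moreover then have "(m, d) \<in> \<theta>" using m(2) by (auto simp: Field_def)
    ultimately show ?thesis using Well_orderD(3)[OF \<theta>] by blast
  qed (use x in auto)
next
  fix x :: "'a + 'b" assume "x \<in> Inl ` Field R"
  then show "x \<in> underS (R +ord \<theta>) (Inr m)" unfolding underS_def using m(1) by auto
qed

lemma front_models:
  fixes R :: "'a rel" and \<theta> :: "'b rel"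
  assumes \<theta>: "Well_order \<theta>" and R: "Well_order R" and m: "m \<in> Field \<theta>" "\<And>d. d \<in> Field \<theta> \<Longrightarrow> (m, d) \<in> \<theta>" and \<phi>: "fo_sentence 0 \<phi>"
  shows "models (order_struct (Restr (R +ord \<theta>) (underS (R +ord \<theta>) (Inr m)))) \<phi> \<longleftrightarrow> models (order_struct R) \<phi>"
proof -
  define S where "S = Restr (R +ord \<theta>) (Inl ` Field R)"
  have SF: "Field S = Inl ` Field R" unfolding S_def
    by (rule Field_Restr[OF Well_order_ord_sum[OF R \<theta>]]) (auto simp: Field_ord_sum)
  have strS: "str S x y \<longleftrightarrow> x \<in> Inl ` Field R \<and> y \<in> Inl ` Field R \<and> str (R +ord \<theta>) x y" for x y
    unfolding S_def by (rule str_Restr)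
  have "convex_emb (str R) (Field R) (str S) (Field S) Inl"
    unfolding convex_emb_def strS SF by (auto simp: str_def)
  then have "models (order_struct R) \<phi> \<longleftrightarrow> models (order_struct S) \<phi>"
    by (rule order_iso_equiv) (simp_all add: SF \<phi>)
  then show ?thesis using underS_sum[OF \<theta> m, of R] S_def by metis
qed

lemma cofinal_infinite:
  assumes W: "Well_order R" and ne: "Field R \<noteq> {}" and nx: "\<And>c. c \<in> Field R \<Longrightarrow> \<exists>d. str R c d"
    and K: "cofinal_subset R K"
  shows "infinite K"
proof
  note w = Well_orderD[OF W]
  have KF: "K \<subseteq> Field R" and cof: "\<And>a. a \<in> Field R \<Longrightarrow> \<exists>b\<in>K. (a, b) \<in> R" using K unfolding cofinal_subset_def by auto
  have "\<exists>m\<in>Field R. \<forall>k\<in>K'. (k, m) \<in> R" if "finite K'" "K' \<subseteq> Field R" for K'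
    using that
  proof (induction K' rule: finite_induct)
    case (insert x K')
    then obtain m where m: "m \<in> Field R" "\<forall>k\<in>K'. (k, m) \<in> R" by blast
    have x: "x \<in> Field R" using insert by blast
    from w(5)[OF m(1) x] show ?case
    proof
      assume "(m, x) \<in> R"
      then show ?thesis using m x w(4)[OF x] w(2) by blast
    next
      assume "(x, m) \<in> R"
      then show ?thesis using m by blast
    qed
  qed (use ne in blast)
  moreover assume "finite K"
  ultimately obtain m where m: "m \<in> Field R" "\<forall>k\<in>K. (k, m) \<in> R" using KF by blast
  obtain d where d: "str R m d" using nx[OF m(1)] by blast
  then have dF: "d \<in> Field R" unfolding str_def Field_def by blast
  obtain k where "k \<in> K" "(d, k) \<in> R" using cof[OF dF] by blast
  then have "(d, m) \<in> R" using m(2) w(2) by blast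
  then show False using d w(3) unfolding str_def by blast
qed

text \<open>\<open>K\<close> is infinite. If its order type were larger than \<open>\<omega>\<close>, then below the element of rank \<open>\<omega>\<close> there would
be no largest element of \<open>K\<close>.\<close>

lemma has_cofinality_omegaI:
  assumes W: "Well_order R" and ne: "Field R \<noteq> {}" and nx: "\<And>c. c \<in> Field R \<Longrightarrow> \<exists>d. str R c d"
    and K: "cofinal_subset R K"
    and max: "\<And>c. c \<in> Field R \<Longrightarrow> \<exists>d\<in>K. str R d c \<Longrightarrow> \<exists>d\<in>K. str R d c \<and> (\<forall>e\<in>K. str R e c \<longrightarrow> (e, d) \<in> R)"
  shows "has_cofinality R natLeq"
proof -
  note w = Well_orderD[OF W]
  have le: "natLeq \<le>o Restr R K'" if "cofinal_subset R K'" for K'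
  proof -
    have "natLeq \<le>o |K'|" using cofinal_infinite[OF W ne nx that] infinite_iff_natLeq_ordLeq by blast
    moreover have "K' \<subseteq> Field R" using that unfolding cofinal_subset_def by blast
    then have "well_order_on K' (Restr R K')"
      using Well_order_Restr[OF W, of K'] Field_Restr[OF W, of K'] by simp
    ultimately show ?thesis using card_of_least ordLeq_transitive by blast
  qed
  have KF: "K \<subseteq> Field R" using K unfolding cofinal_subset_def by blast
  have "\<not> natLeq <o Restr R K"
  proof
    assume l: "natLeq <o Restr R K"
    obtain f b where f: "convex_emb (str natLeq) (Field natLeq) (str (Restr R K)) (Field (Restr R K)) f"
      and b: "b \<in> Field (Restr R K)"
      and im: "\<And>z. z \<in> Field (Restr R K) \<Longrightarrow> str (Restr R K) z b \<longleftrightarrow> z \<in> f ` Field natLeq"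
      using ordLess_emb[OF l] by metis
    note F = Field_Restr[OF W KF]
    have fK: "f i \<in> K" for i using convex_embD(1)[OF f, of i] unfolding F Field_natLeq by blast
    have up: "str R (f i) (f (Suc i))" for i
      using convex_embD(3)[OF f, of i "Suc i"] unfolding Field_natLeq str_Restr by (simp add: str_def natLeq_def)
    have im: "str R z b \<longleftrightarrow> z \<in> range f" if "z \<in> K" for z
      using im[of z] b that unfolding F str_Restr Field_natLeq by blast
    have bK: "b \<in> Field R" using b KF unfolding F by blast
    have "\<exists>d\<in>K. str R d b" using im[OF fK] fK by blast
    then obtain d where d: "d \<in> K" "str R d b" "\<And>e. e \<in> K \<Longrightarrow> str R e b \<Longrightarrow> (e, d) \<in> R" using max[OF bK] by blast
    then obtain i where "d = f i" using im by blast
    moreover have "(f (Suc i), d) \<in> R" using d(3)[OF fK] im[OF fK] by blast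
    ultimately show False using up[of i] w(3) unfolding str_def by blast
  qed
  then have "Restr R K =o natLeq"
    using le[OF K] ordLeq_iff_ordLess_or_ordIso ordIso_symmetric by blast
  then show ?thesis unfolding has_cofinality_def using K le by blast
qed

lemma sum_of_cut:
  fixes r :: "'a rel" and \<theta> :: "'b rel"
  assumes W: "Well_order r" and \<theta>: "Well_order \<theta>" and b: "b \<in> Field r" and tail: "Restr r (up r b) =o \<theta>"
  shows "r =o Restr r (underS r b) +ord \<theta>"
proof -
  note w = Well_orderD[OF W]
  have UF: "up r b \<subseteq> Field r" "underS r b \<subseteq> Field r" unfolding up_def underS_def Field_def by auto
  note FU = Field_Restr[OF W UF(1)] and FS = Field_Restr[OF W UF(2)]
  obtain g where "iso (Restr r (up r b)) \<theta> g" using tail unfolding ordIso_def by blast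
  then have g: "bij_betw g (up r b) (Field \<theta>)"
    "\<And>x y. x \<in> up r b \<Longrightarrow> y \<in> up r b \<Longrightarrow> (x, y) \<in> r \<longleftrightarrow> (g x, g y) \<in> \<theta>"
    unfolding iso_iff2 FU by auto
  have gF: "g x \<in> Field \<theta>" if "x \<in> up r b" for x using g(1) that unfolding bij_betw_def by blast
  define h where "h c = (if c \<in> underS r b then Inl c else Inr (g c))" for c
  have split: "c \<in> underS r b \<or> c \<in> up r b" if "c \<in> Field r" for c
    using w(5)[OF that b] w(4)[OF b] unfolding underS_def up_def by blast
  have disj: "c \<notin> underS r b" if "c \<in> up r b" for c using that w(3) unfolding underS_def up_def by blast
  have hu: "h c = Inr (g c)" if "c \<in> up r b" for c unfolding h_def using disj[OF that] by simp
  have hs: "h c = Inl c" if "c \<in> underS r b" for c unfolding h_def using that by simp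
  have Fr: "Field r = underS r b \<union> up r b" using split UF by blast
  have "bij_betw h (underS r b \<union> up r b) (Inl ` underS r b \<union> Inr ` Field \<theta>)"
  proof (rule bij_betw_combine)
    show "bij_betw h (underS r b) (Inl ` underS r b)" using hs by (auto simp: bij_betw_def inj_on_def image_iff)
    have "bij_betw (Inr \<circ> g) (up r b) (Inr ` Field \<theta>)"
      by (rule bij_betw_trans[OF g(1)]) (auto simp: bij_betw_def)
    then show "bij_betw h (up r b) (Inr ` Field \<theta>)" using bij_betw_cong[of "up r b" h "Inr \<circ> g"] hu by simp
  qed auto
  moreover have "(x, y) \<in> r \<longleftrightarrow> (h x, h y) \<in> Restr r (underS r b) +ord \<theta>" if "x \<in> Field r" "y \<in> Field r" for x y
  proof -
    from split[OF that(1)] split[OF that(2)] consider "x \<in> underS r b" "y \<in> underS r b" | "x \<in> underS r b" "y \<in> up r b"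
      | "x \<in> up r b" "y \<in> underS r b" | "x \<in> up r b" "y \<in> up r b" by blast
    then show ?thesis
    proof cases
      case 2
      then have "(x, y) \<in> r" using w(2) unfolding underS_def up_def by blast
      then show ?thesis using 2 hs hu FS gF by simp
    next
      case 3
      have "(x, y) \<notin> r" using 3 w(2,3) unfolding underS_def up_def by blast
      then show ?thesis using 3 hs hu by simp
    qed (use hs hu g(2) in auto)
  qed
  ultimately have "iso r (Restr r (underS r b) +ord \<theta>) h"
    unfolding iso_iff2 Field_ord_sum FS unfolding Fr by blast
  then show ?thesis unfolding ordIso_def using W Well_order_ord_sum[OF Well_order_Restr[OF W] \<theta>] by blast
qed

text \<open>The powers \<open>\<omega>\<^sup>i\<close> are cofinal in \<open>\<omega>\<^sup>\<omega>\<close> and have order type \<open>\<omega>\<close>; the node is their characteristic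
function.\<close>

lemma unit_marking:
  fixes \<theta> :: "'b rel"
  assumes n: "n \<ge> 2" and \<theta>: "nonzero_limit \<theta>" and m: "m \<in> Field \<theta>" "\<And>d. d \<in> Field \<theta> \<Longrightarrow> (m, d) \<in> \<theta>"
  shows "\<exists>s\<in>tree_nodes n (omega_omega +ord \<theta>). level (omega_omega +ord \<theta>) s = Inr m \<and> marked (omega_omega +ord \<theta>) s (Inr m)"
proof -
  let ?\<beta> = "omega_omega +ord \<theta>" and ?O = "Field omega_omega"
  have W\<theta>: "Well_order \<theta>" using \<theta> unfolding nonzero_limit_def by blast
  interpret tree_order ?\<beta> n
    by unfold_locales (rule Well_order_ord_sum[OF Well_order_omega_omega W\<theta>], rule nonzero_limit_sum[OF Well_order_omega_omega \<theta>])
  define u where "u i j = (if j = i then 1 else 0 :: nat)" for i j :: nat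
  have uO: "u i \<in> ?O" for i unfolding Field_omega_omega u_def by simp
  have uu: "(u i, u j) \<in> omega_omega \<longleftrightarrow> i \<le> j" for i j
  proof (cases i j rule: linorder_cases)
    case less
    then have "\<exists>z. u i z < u j z \<and> (\<forall>x>z. u i x = u j x)" by (intro exI[of _ j]) (auto simp: u_def)
    then show ?thesis unfolding omega_omega_iff using uO less unfolding Field_omega_omega by auto
  next
    case greater
    then have "oo (u j) (u i)" unfolding oo_iff using uO by (auto intro!: exI[of _ i] simp: u_def)
    then show ?thesis using greater Well_orderD(3)[OF Well_order_omega_omega] unfolding str_def by auto
  next
    case equal
    then show ?thesis using Well_orderD(4)[OF Well_order_omega_omega uO] by simp
  qed
  have ub: "\<exists>i. oo f (u i)" if "f \<in> ?O" for f
  proof -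
    have "finite {k. f k \<noteq> 0}" using that unfolding Field_omega_omega by blast
    then obtain i where i: "\<And>k. f k \<noteq> 0 \<Longrightarrow> k < i" unfolding finite_nat_set_iff_bounded by blast
    have "f i < u i i" "\<forall>x>i. f x = u i x" using i u_def by (metis less_irrefl zero_less_one neq0_conv, metis less_asym less_irrefl)
    then have "oo f (u i)" unfolding oo_iff using that uO by blast
    then show ?thesis by blast
  qed
  define s where "s x = (case x of Inl f \<Rightarrow> if f \<in> ?O then Some (if f \<in> range u then 1 else 0 :: nat) else None | Inr (d :: 'b) \<Rightarrow> None)" for x
  have below: "str ?\<beta> x (Inr m) \<longleftrightarrow> (\<exists>f\<in>?O. x = Inl f)" for x
    using underS_sum[OF W\<theta> m, of omega_omega] unfolding underS_str by blast
  have mF: "Inr m \<in> Field ?\<beta>" using m(1) unfolding Field_ord_sum by blast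
  have dom: "s d \<noteq> None \<longleftrightarrow> str ?\<beta> d (Inr m)" for d unfolding below s_def by (cases d) auto
  have val: "s d = Some a \<Longrightarrow> a < n" for d a using n unfolding s_def by (auto split: sum.splits if_splits)
  have node: "s \<in> tree_nodes n ?\<beta>" "level ?\<beta> s = Inr m" by (rule nodeI[OF mF dom]; erule val)+
  have one: "s x = Some 1 \<longleftrightarrow> (\<exists>i. x = Inl (u i))" for x
    unfolding s_def using uO by (cases x) auto
  have sb: "str ?\<beta> (Inl f) (Inl g) \<longleftrightarrow> oo f g" for f g by (simp add: str_def)
  have "\<exists>d. (c, d) \<in> ?\<beta> \<and> str ?\<beta> d (Inr m) \<and> s d = Some 1" if c: "str ?\<beta> c (Inr m)" for c
  proof -
    obtain f where f: "f \<in> ?O" "c = Inl f" using c below by blast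
    obtain i where "oo f (u i)" using ub[OF f(1)] by blast
    then have "(c, Inl (u i)) \<in> ?\<beta>" using f(2) unfolding str_def by simp
    then show ?thesis using below one uO by blast
  qed
  moreover have "\<exists>d. str ?\<beta> d c \<and> s d = Some 1 \<and> (\<forall>e. str ?\<beta> e c \<and> s e = Some 1 \<longrightarrow> (e, d) \<in> ?\<beta>)"
    if c: "str ?\<beta> c (Inr m)" and d: "\<exists>d. str ?\<beta> d c \<and> s d = Some 1" for c
  proof -
    obtain f where f: "f \<in> ?O" "c = Inl f" using c below by blast
    define I where "I = {i. oo (u i) f}"
    obtain N where N: "oo f (u N)" using ub[OF f(1)] by blast
    have "i \<le> N" if "i \<in> I" for i
    proof -
      have "oo (u i) (u N)" using ow(2)[OF uO f(1) uO _ N] that unfolding I_def by blast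
      then show ?thesis using uu str_def by metis
    qed
    then have fin: "finite I" using finite_nat_set_iff_bounded_le by blast
    have "I \<noteq> {}" using d one unfolding f(2) I_def sb[symmetric] by auto
    then have M: "Max I \<in> I" "\<And>i. i \<in> I \<Longrightarrow> i \<le> Max I" using fin by auto
    show ?thesis
    proof (intro exI[of _ "Inl (u (Max I))"] conjI allI impI)
      show "str ?\<beta> (Inl (u (Max I))) c" using M(1) unfolding f(2) sb I_def by blast
      show "s (Inl (u (Max I))) = Some 1" using one by blast
      fix e assume e: "str ?\<beta> e c \<and> s e = Some 1"
      then obtain i where i: "e = Inl (u i)" using one by blast
      then have "i \<in> I" using e unfolding f(2) I_def by (simp add: sb)
      then show "(e, Inl (u (Max I))) \<in> ?\<beta>" using M(2) uu i by simp
    qed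
  qed
  ultimately have "marked ?\<beta> s (Inr m)" unfolding marked_def by blast
  then show ?thesis using node by blast
qed

lemma least_end_unique:
  assumes W: "Well_order r" and "least_end ks j r b" "least_end ks j r b'" shows "b = b'"
proof (rule ccontr)
  assume "b \<noteq> b'"
  moreover have "b \<in> Field r" "b' \<in> Field r" using assms(2,3) unfolding least_end_def by auto
  ultimately have "str r b b' \<or> str r b' b" using Well_orderD(5)[OF W, of b b'] unfolding str_def by auto
  then show False using assms(2,3) unfolding least_end_def by blast
qed

text \<open>All sentences \<open>below_form\<close> and \<open>cof_form\<close> are evaluated in the tree of \<open>\<omega>\<^sup>\<omega> + \<theta>\<close>, where the front part
is \<open>\<omega>\<^sup>\<omega>\<close>, and carried over to the tree of \<open>\<alpha>\<close>.\<close>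

lemma decomposition_of_equiv:
  fixes \<alpha> :: "'a rel" and \<theta> :: "'b rel"
  assumes n: "n \<ge> 2" and \<theta>: "nonzero_limit \<theta>" and less: "\<theta> <o omega_omega" and \<alpha>: "nonzero_limit \<alpha>"
    and eq: "elem_equiv n (tree_struct n \<alpha>) (tree_struct n (omega_omega +ord \<theta>))"
  shows "\<exists>\<alpha>0 :: 'a rel. Well_order \<alpha>0 \<and> \<alpha> =o \<alpha>0 +ord \<theta> \<and>
       elem_equiv 0 (order_struct \<alpha>0) (order_struct omega_omega) \<and> has_cofinality \<alpha>0 natLeq"
proof -
  let ?\<beta> = "omega_omega +ord \<theta>"
  have W\<theta>: "Well_order \<theta>" and ne: "Field \<theta> \<noteq> {}" and W\<alpha>: "Well_order \<alpha>" using \<theta> \<alpha> unfolding nonzero_limit_def by auto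
  note W\<beta> = Well_order_ord_sum[OF Well_order_omega_omega W\<theta>]
  interpret A: tree_order \<alpha> n by unfold_locales (rule W\<alpha> \<alpha>)+
  interpret B: tree_order ?\<beta> n
    by unfold_locales (rule W\<beta>, rule nonzero_limit_sum[OF Well_order_omega_omega \<theta>])
  obtain ks j where e: "ends ks j (str \<theta>) (Field \<theta>)" using ends_limit[OF \<theta> less] by blast
  obtain m where m: "m \<in> Field \<theta>" "\<And>d. d \<in> Field \<theta> \<Longrightarrow> m \<noteq> d \<Longrightarrow> str \<theta> m d"
    using woD(3)[OF wo_str[OF W\<theta>] subset_refl ne] by blast
  have ml: "(m, d) \<in> \<theta>" if "d \<in> Field \<theta>" for d
    using m(2)[OF that] Well_orderD(4)[OF W\<theta> that] unfolding str_def by (cases "m = d") auto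
  have lb: "least_end ks j ?\<beta> c \<longleftrightarrow> c = Inr m" for c by (rule least_end_sum[OF W\<theta> e m(1)]) (rule ml)
  have front: "(\<exists>b. least_end ks j \<alpha> b \<and> models (order_struct (Restr \<alpha> (underS \<alpha> b))) \<phi>) \<longleftrightarrow> models (order_struct omega_omega) \<phi>"
    if \<phi>: "fo_sentence 0 \<phi>" for \<phi>
  proof -
    have "models A.M (below_form ks j \<phi>) \<longleftrightarrow> models B.M (below_form ks j \<phi>)"
      using eq below_form_sentence[OF \<phi> n] unfolding elem_equiv_def by blast
    moreover have "models (order_struct (Restr ?\<beta> (underS ?\<beta> (Inr m)))) \<phi> \<longleftrightarrow> models (order_struct omega_omega) \<phi>"
      by (rule front_models[OF W\<theta> Well_order_omega_omega m(1) _ \<phi>]) (rule ml)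
    ultimately show ?thesis unfolding A.models_below_form[OF n \<phi>] B.models_below_form[OF n \<phi>] lb by simp
  qed
  have "fo_sentence 0 (FEx 0 (FEq (TVar 0) (TVar 0)))" unfolding fo_sentence_def by simp
  moreover have "models (order_struct omega_omega) (FEx 0 (FEq (TVar 0) (TVar 0)))"
    unfolding models_def using oo_zero(1) by auto
  ultimately obtain b where b: "least_end ks j \<alpha> b" using front by blast
  have bF: "b \<in> Field \<alpha>" and be: "end_point ks j \<alpha> b" using b unfolding least_end_def by auto
  have uniq: "least_end ks j \<alpha> c \<longleftrightarrow> c = b" for c using b least_end_unique[OF W\<alpha> _ b] by blast
  define \<alpha>0 where "\<alpha>0 = Restr \<alpha> (underS \<alpha> b)"
  have W0: "Well_order \<alpha>0" unfolding \<alpha>0_def by (rule Well_order_Restr[OF W\<alpha>])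
  have UF: "underS \<alpha> b \<subseteq> Field \<alpha>" unfolding underS_def Field_def by auto
  have F0: "Field \<alpha>0 = underS \<alpha> b" unfolding \<alpha>0_def by (rule Field_Restr[OF W\<alpha> UF])
  have "Restr \<alpha> (up \<alpha> b) =o \<theta>"
    by (rule ends_iso[OF Well_order_Restr[OF W\<alpha>] W\<theta> be[unfolded end_point_def] e])
  then have sum: "\<alpha> =o \<alpha>0 +ord \<theta>" unfolding \<alpha>0_def by (rule sum_of_cut[OF W\<alpha> W\<theta> bF])
  have eq0: "elem_equiv 0 (order_struct \<alpha>0) (order_struct omega_omega)"
    unfolding elem_equiv_def using front unfolding uniq \<alpha>0_def by blast
  have "models B.M (cof_form ks j)" unfolding B.models_cof_form[OF n] lb
    using unit_marking[where m = m, OF n \<theta> m(1)] ml by blast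
  then have "models A.M (cof_form ks j)" using eq cof_form_sentence[OF n] unfolding elem_equiv_def by blast
  then obtain s where s: "marked \<alpha> s b" unfolding A.models_cof_form[OF n] uniq by blast
  define K where "K = {c. str \<alpha> c b \<and> s c = Some 1}"
  have str0: "str \<alpha>0 x y \<longleftrightarrow> str \<alpha> x b \<and> str \<alpha> y b \<and> str \<alpha> x y" for x y
    unfolding \<alpha>0_def str_Restr A.underS_str by blast
  have in0: "(x, y) \<in> \<alpha>0 \<longleftrightarrow> str \<alpha> x b \<and> str \<alpha> y b \<and> (x, y) \<in> \<alpha>" for x y
    unfolding \<alpha>0_def A.underS_str by blast
  have below: "str \<alpha> d b" if "str \<alpha> c b" "str \<alpha> d c" for c d using A.str_le(1)[OF that(2) A.str_r(1)[OF that(1)]] .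
  have "has_cofinality \<alpha>0 natLeq"
  proof (rule has_cofinality_omegaI[OF W0 total_transfer(1)[OF eq0]])
    show "\<exists>d. str \<alpha>0 c d" if "c \<in> Field \<alpha>0" for c
      using total_transfer(2)[OF eq0 that, of 0] by auto
    show "cofinal_subset \<alpha>0 K" unfolding cofinal_subset_def F0 A.underS_str in0
      using s unfolding marked_def K_def by blast
    fix c assume c: "c \<in> Field \<alpha>0" "\<exists>d\<in>K. str \<alpha>0 d c"
    have cb: "str \<alpha> c b" using c(1) unfolding F0 A.underS_str by blast
    have "\<exists>d. str \<alpha> d c \<and> s d = Some 1" using c(2) unfolding str0 K_def by blast
    then obtain d where d: "str \<alpha> d c" "s d = Some 1" "\<And>x. str \<alpha> x c \<Longrightarrow> s x = Some 1 \<Longrightarrow> (x, d) \<in> \<alpha>"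
      using s cb unfolding marked_def by blast
    have db: "str \<alpha> d b" using below[OF cb d(1)] .
    then show "\<exists>d\<in>K. str \<alpha>0 d c \<and> (\<forall>e\<in>K. str \<alpha>0 e c \<longrightarrow> (e, d) \<in> \<alpha>0)"
      using d cb unfolding K_def str0 in0 by (intro bexI[of _ d]) auto
  qed
  then show ?thesis using W0 sum eq0 by blast
qed

theorem theorem22:
  fixes n :: nat and \<theta> :: "'b rel" and \<alpha> :: "'a rel"
  assumes "n \<ge> 2"
    and "nonzero_limit \<theta>" and "\<theta> <o omega_omega"
    and "nonzero_limit \<alpha>"
  shows "elem_equiv n (tree_struct n \<alpha>) (tree_struct n (omega_omega +ord \<theta>)) \<longleftrightarrow>
    (\<exists>\<alpha>0 :: 'a rel. Well_order \<alpha>0 \<and> \<alpha> =o \<alpha>0 +ord \<theta> \<and>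
       elem_equiv 0 (order_struct \<alpha>0) (order_struct omega_omega) \<and>
       has_cofinality \<alpha>0 natLeq)"
proof
  assume "elem_equiv n (tree_struct n \<alpha>) (tree_struct n (omega_omega +ord \<theta>))"
  then show "\<exists>\<alpha>0 :: 'a rel. Well_order \<alpha>0 \<and> \<alpha> =o \<alpha>0 +ord \<theta> \<and>
       elem_equiv 0 (order_struct \<alpha>0) (order_struct omega_omega) \<and> has_cofinality \<alpha>0 natLeq"
    by (rule decomposition_of_equiv[OF assms])
next
  have "n > 0" using assms(1) by simp
  moreover assume "\<exists>\<alpha>0 :: 'a rel. Well_order \<alpha>0 \<and> \<alpha> =o \<alpha>0 +ord \<theta> \<and>
       elem_equiv 0 (order_struct \<alpha>0) (order_struct omega_omega) \<and> has_cofinality \<alpha>0 natLeq"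
  ultimately show "elem_equiv n (tree_struct n \<alpha>) (tree_struct n (omega_omega +ord \<theta>))"
    using tree_equiv_sum[OF _ assms(2,4)] by blast
qed

end
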